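(* Let $\phi\colon X\to\mathbb R$ be acceptable and satisfy $P(\phi)<\infty$. Suppose there exists an induced system $(\Sigma,\tau|_\Sigma)$ for which the induced potentials $\Phi_\gamma$, $\gamma\in\mathbb R$, associated with $\phi$ are locally H\"older continuous, and there exists $\gamma_0\in\mathbb R$ such that $P(\Phi_{\gamma_0})=0$. Then the sequence $\{\tilde\mu_n\}_{n=1}^\infty$ of Borel probability measures on $\mathcal M(X)$ given by $$\tilde\mu_n=\frac{1}{Z_n(\phi)}\sum_{x\in E_n}\exp(S_n\phi(x))\,\delta_{V_n(x)}$$ is exponentially tight and satisfies the Large Deviation Principle with the good rate function $I_\phi$.
   Context: Full shift. $\mathbb N=\{1,2,\dots\}$ is discrete and $X=\mathbb N^{\mathbb N}$ has the product topology, with metric $d_X(x,y)=\exp(-\inf\{n\ge1: x_n\ne y_n\})$ ($\exp(-\infty)=0$). For $p_1\cdots p_n\in\mathbb N^n$, $[p_1\cdots p_n]=\{x\in X: x_k=p_k,\ 1\le k\le n\}$. $\sigma\colon X\to X$ is the left shift. For $\phi\colon X\to\mathbb R$, $S_n\phi=\sum_{k=0}^{n-1}\phi\circ\sigma^k$. $\phi$ is acceptable if it is uniformly continuous and $\sup_{p\in\mathbb N}(\sup_{[p]}\phi-\inf_{[p]}\phi)<\infty$. $\phi$ is locally H\"older continuous if there are $C>0$, $\alpha\in(0,1]$ such that $|\phi(x)-\phi(y)|\le C d_X(x,y)^\alpha$ for all $p\in\mathbb N$ and $x,y\in[p]$. The pressure is $P(\phi)=\lim_{n\to\infty}\frac1n\log\sum_{p_1\cdots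 p_n\in\mathbb N^n}\sup_{[p_1\cdots p_n]}\exp S_n\phi$. The same definitions are used for the full shift over any countably infinite alphabet. Induced systems. Fix an integer $p^*\ge2$ and put $\mathbb N^*=\mathbb N\cap[p^*,\infty)$, $\mathbb N_*=\mathbb N\cap[1,p^* )$, $X^*=X\setminus\bigcup_{p\in\mathbb N_*}[p]$. Let $R\colon X^*\to\mathbb N\cup\{\infty\}$, $R(x)=\inf\{n\ge1:\sigma^nx\in X^*\}$; $\tau(x)=\sigma^{R(x)}x$ on $\{R<\infty\}=\bigcup_{k\geq 1}\{R=k\}$; $\Sigma=\bigcap_{n=0}^\infty\tau^{-n}(\bigcup_{k=1}^\infty\{R=k\})$. The pair $(\Sigma,\tau|_\Sigma)$ is called an induced system (one for each choice of $p^*$). The induced potentials are $\Phi_\gamma\colon\Sigma\to\mathbb R$, $\Phi_\gamma(x)=S_{R(x)}\phi(x)-\gamma R(x)$, $\gamma\in\mathbb R$. Let $W_0(\mathbb N_* )$ be the set of finite words (including the empty one) over $\mathbb N_*$ and let $\mathbb A=\{\bigcup_{q\in\mathbb N^*}[p\omega q]: p\in\mathbb N^*,\ \omega\in W_0(\mathbb N_* )\}$, a countably infinite alphabet. Let $\mathbb A^{\mathbb N}$ be the full shift over $\mathbb A$ with left shift $\theta$. The map $\Pi\colon\mathbb A^{\mathbb N}\to\Sigma$ sending $(z_n)_n$, $z_n=\bigcup_{q\in\mathbb N^*}[p_n\omega^{(n)}q]$, to the infinite concatenation $p_1\omega^{(1)}p_2\omega^{(2)}\cdots$ is a homeomorphism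 with $\Pi\circ\theta=\tau|_\Sigma\circ\Pi$. $\Phi_\gamma$ is called locally H\"older continuous if $\Phi_\gamma\circ\Pi$ is so on the full shift $\mathbb A^{\mathbb N}$, and $P(\Phi_\gamma)$ is the pressure of $\Phi_\gamma\circ\Pi$ on $(\mathbb A^{\mathbb N},\theta)$. Large deviations. $\mathcal M(X)$ is the space of Borel probability measures on $X$ with the weak* topology (tested against bounded continuous functions). $V_n(x)=\frac1n\sum_{k=0}^{n-1}\delta_{\sigma^kx}$; $E_n=\{x\in X:\sigma^nx=x\}$; $Z_n(\phi)=\sum_{x\in E_n}\exp S_n\phi(x)$; $\delta_{V_n(x)}$ is the unit point mass at $V_n(x)\in\mathcal M(X)$. A sequence $\{\tilde\mu_n\}$ of Borel probability measures on a topological space $\mathcal X$ is exponentially tight if for any $L>0$ there is a compact $\mathcal K\subset\mathcal X$ with $\limsup_n\frac1n\log\tilde\mu_n(\mathcal X\setminus\mathcal K)\le-L$. It satisfies the Large Deviation Principle with rate function $I$ if $I\colon\mathcal X\to[0,\infty]$ is lower semicontinuous, $\liminf_n\frac1n\log\tilde\mu_n(\mathcal G)\ge-\inf_{\mathcal G}I$ for every open $\mathcal G\subset\mathcal X$, and $\limsup_n\frac1n\log\tilde\mu_n(\mathcal C)\le-\inf_{\mathcal C}I$ for every closed $\mathcal C\subset\mathcal X$ ($\inf\emptyset=\infty$, $\log0=-\infty$). $I$ is good if $\{I\le\alpha\}$ is compact for every $\alpha>0$. Rate function. $\mathcal M(X,\sigma)$ is the set of $\sigma$-invariant elements of $\mathcal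 M(X)$, $\mathcal M_\phi(X,\sigma)=\{\mu\in\mathcal M(X,\sigma):\int\phi\,d\mu>-\infty\}$, and $h(\mu)$ is the measure-theoretic entropy of $\mu$ with respect to $\sigma$. Put $F_\phi(\mu)=h(\mu)+\int\phi\,d\mu-P(\phi)$ if $\mu\in\mathcal M_\phi(X,\sigma)$ and $F_\phi(\mu)=-\infty$ otherwise, and $I_\phi(\mu)=-\inf_{\mathcal G\ni\mu}\sup_{\mathcal G}F_\phi$, the infimum being over all open $\mathcal G\subset\mathcal M(X)$ containing $\mu$. *)

theory Defs
  imports "HOL-Probability.Probability"
begin

section \<open>The full shift over a countable alphabet\<close>

text \<open>Sequences are functions on \<^typ>\<open>nat\<close>, so the entry $x_n$, $n\ge 1$, of the usual one-based notation
  is \<open>x (n - 1)\<close>. The alphabet is a set \<open>A\<close>, so that the same definitions apply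
  to \<open>{1..}\<close> and to the alphabet of an induced system. All notions below only look at points of
  \<open>full_shift A\<close>; values of a potential elsewhere are irrelevant.\<close>

definition full_shift :: "'a set \<Rightarrow> (nat \<Rightarrow> 'a) set" where
  "full_shift A = {x. \<forall>n. x n \<in> A}"

definition left_shift :: "(nat \<Rightarrow> 'a) \<Rightarrow> nat \<Rightarrow> 'a" where
  "left_shift x = (\<lambda>n. x (Suc n))"

definition cylinder :: "'a set \<Rightarrow> 'a list \<Rightarrow> (nat \<Rightarrow> 'a) set" where
  "cylinder A w = {x \<in> full_shift A. \<forall>k<length w. x k = w ! k}"

definition words :: "'a set \<Rightarrow> nat \<Rightarrow> 'a list set" where
  "words A n = {w. length w = n \<and> set w \<subseteq> A}"

definition seq_dist :: "(nat \<Rightarrow> 'a) \<Rightarrow> (nat \<Rightarrow> 'a) \<Rightarrow> real" where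
  "seq_dist x y = (if x = y then 0 else exp (- real (Suc (LEAST k. x k \<noteq> y k))))"

definition birkhoff_sum :: "((nat \<Rightarrow> 'a) \<Rightarrow> real) \<Rightarrow> nat \<Rightarrow> (nat \<Rightarrow> 'a) \<Rightarrow> real" where
  "birkhoff_sum \<phi> n x = (\<Sum>k<n. \<phi> ((left_shift ^^ k) x))"

definition acceptable :: "'a set \<Rightarrow> ((nat \<Rightarrow> 'a) \<Rightarrow> real) \<Rightarrow> bool" where
  "acceptable A \<phi> \<longleftrightarrow>
    (\<forall>\<epsilon>>0. \<exists>\<delta>>0. \<forall>x\<in>full_shift A. \<forall>y\<in>full_shift A.
       seq_dist x y < \<delta> \<longrightarrow> \<bar>\<phi> x - \<phi> y\<bar> < \<epsilon>) \<and>
    (SUP p\<in>A. (SUP x\<in>cylinder A [p]. ereal (\<phi> x)) - (INF x\<in>cylinder A [p]. ereal (\<phi> x))) < \<infinity>"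

definition locally_hoelder :: "'a set \<Rightarrow> ((nat \<Rightarrow> 'a) \<Rightarrow> real) \<Rightarrow> bool" where
  "locally_hoelder A \<phi> \<longleftrightarrow>
    (\<exists>C>0. \<exists>\<alpha>. 0 < \<alpha> \<and> \<alpha> \<le> 1 \<and>
      (\<forall>p\<in>A. \<forall>x\<in>cylinder A [p]. \<forall>y\<in>cylinder A [p].
         \<bar>\<phi> x - \<phi> y\<bar> \<le> C * seq_dist x y powr \<alpha>))"

definition elog :: "ennreal \<Rightarrow> ereal" where
  "elog t = (if t = 0 then - \<infinity> else if t = \<infinity> then \<infinity> else ereal (ln (enn2real t)))"

text \<open>Sums of \<^typ>\<open>ennreal\<close>-valued families are integrals with respect to counting measure.\<close>

definition pressure :: "'a set \<Rightarrow> ((nat \<Rightarrow> 'a) \<Rightarrow> real) \<Rightarrow> ereal" where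
  "pressure A \<phi> =
    lim (\<lambda>n. elog (\<integral>\<^sup>+ w. (SUP x\<in>cylinder A w. ennreal (exp (birkhoff_sum \<phi> n x)))
                      \<partial>count_space (words A n)) / ereal (real n))"

abbreviation Xfull :: "(nat \<Rightarrow> nat) set" where
  "Xfull \<equiv> full_shift {1..}"


section \<open>Induced systems\<close>

definition Xstar :: "nat \<Rightarrow> (nat \<Rightarrow> nat) set" where
  "Xstar pstar = Xfull - (\<Union>p\<in>{1..<pstar}. cylinder {1..} [p])"

definition return_time :: "nat \<Rightarrow> (nat \<Rightarrow> nat) \<Rightarrow> enat" where
  "return_time pstar x = Inf (enat ` {n. 1 \<le> n \<and> (left_shift ^^ n) x \<in> Xstar pstar})"

definition return_map :: "nat \<Rightarrow> (nat \<Rightarrow> nat) \<Rightarrow> nat \<Rightarrow> nat" where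
  "return_map pstar x = (left_shift ^^ the_enat (return_time pstar x)) x"

text \<open>\<^const>\<open>return_map\<close> is total, with junk values outside the set of points of \<^const>\<open>Xstar\<close>
  that return; as that set is required to contain the whole orbit (including the \<open>n = 0\<close> term), these
  values play no role in the following definition.\<close>

definition induced_space :: "nat \<Rightarrow> (nat \<Rightarrow> nat) set" where
  "induced_space pstar =
    (\<Inter>n. (return_map pstar ^^ n) -` (\<Union>k\<in>{1..}. {x \<in> Xstar pstar. return_time pstar x = enat k}))"

definition induced_potential ::
    "((nat \<Rightarrow> nat) \<Rightarrow> real) \<Rightarrow> nat \<Rightarrow> real \<Rightarrow> (nat \<Rightarrow> nat) \<Rightarrow> real" where
  "induced_potential \<phi> pstar \<gamma> = (\<lambda>x\<in>induced_space pstar.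
     birkhoff_sum \<phi> (the_enat (return_time pstar x)) x - \<gamma> * real (the_enat (return_time pstar x)))"

text \<open>Letters of the induced alphabet are the sets \<open>\<Union>\<^sub>q [p\<omega>q]\<close>; they are in bijection with the words
  \<open>p\<omega>\<close> (lemma \<open>inj_on_letter\<close> below).\<close>

definition return_words :: "nat \<Rightarrow> nat list set" where
  "return_words pstar = {p # \<omega> |p \<omega>. pstar \<le> p \<and> set \<omega> \<subseteq> {1..<pstar}}"

definition letter :: "nat \<Rightarrow> nat list \<Rightarrow> (nat \<Rightarrow> nat) set" where
  "letter pstar w = (\<Union>q\<in>{pstar..}. cylinder {1..} (w @ [q]))"

definition induced_alphabet :: "nat \<Rightarrow> (nat \<Rightarrow> nat) set set" where
  "induced_alphabet pstar = letter pstar ` return_words pstar"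

text \<open>The first \<open>k + 1\<close> (nonempty) words of the concatenation determine its entry at position \<open>k\<close>.\<close>

definition inf_concat :: "(nat \<Rightarrow> 'a list) \<Rightarrow> nat \<Rightarrow> 'a" where
  "inf_concat u k = concat (map u [0..<Suc k]) ! k"

definition coding :: "nat \<Rightarrow> (nat \<Rightarrow> (nat \<Rightarrow> nat) set) \<Rightarrow> nat \<Rightarrow> nat" where
  "coding pstar z = inf_concat (\<lambda>n. inv_into (return_words pstar) (letter pstar) (z n))"


section \<open>Measures, entropy and the rate function\<close>

definition prob_measures :: "'a::topological_space set \<Rightarrow> 'a measure set" where
  "prob_measures S = {\<mu>. sets \<mu> = sets (restrict_space borel S) \<and> prob_space \<mu>}"

text \<open>The coarsest topology for which \<open>\<mu> \<mapsto> \<integral>f d\<mu>\<close> is continuous for all bounded continuous \<open>f\<close>.\<close>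

definition weak_star :: "'a::topological_space set \<Rightarrow> 'a measure topology" where
  "weak_star S = topology_generated_by
     {{\<mu> \<in> prob_measures S. (\<integral>x. f x \<partial>\<mu>) \<in> U} |(f :: 'a \<Rightarrow> real) U.
        continuous_on S f \<and> bounded (f ` S) \<and> open U}"

definition borel_on :: "'a topology \<Rightarrow> 'a measure" where
  "borel_on T = sigma (topspace T) {U. openin T U}"

text \<open>The measure \<open>\<Sum>\<^sub>i\<^sub>\<in>\<^sub>I w\<^sub>i \<delta>\<^bsub>f i\<^esub>\<close> on the measurable space \<open>M\<close>; see \<open>emeasure_atomic_measure\<close>.\<close>

definition atomic_measure :: "'b measure \<Rightarrow> 'i set \<Rightarrow> ('i \<Rightarrow> ennreal) \<Rightarrow> ('i \<Rightarrow> 'b) \<Rightarrow> 'b measure" where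
  "atomic_measure M I w f = distr (density (count_space I) w) M f"

definition invariant_measures :: "(nat \<Rightarrow> nat) measure set" where
  "invariant_measures = {\<mu> \<in> prob_measures Xfull.
     \<forall>B\<in>sets \<mu>. emeasure \<mu> (left_shift -` B \<inter> space \<mu>) = emeasure \<mu> B}"

text \<open>With the convention \<open>\<infinity> - \<infinity> = \<infinity>\<close> of \<^typ>\<open>ereal\<close>; potentials that are acceptable and have finite
  pressure are bounded above, so that the integral of the positive part is finite.\<close>

definition ext_integral :: "'a measure \<Rightarrow> ('a \<Rightarrow> real) \<Rightarrow> ereal" where
  "ext_integral \<mu> \<phi> =
     enn2ereal (\<integral>\<^sup>+ x. ennreal (\<phi> x) \<partial>\<mu>) - enn2ereal (\<integral>\<^sup>+ x. ennreal (- \<phi> x) \<partial>\<mu>)"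

definition finite_partitions :: "'a measure \<Rightarrow> 'a set set set" where
  "finite_partitions M = {\<C>. finite \<C> \<and> \<C> \<subseteq> sets M \<and> partition_on (space M) \<C>}"

definition iterated_join :: "'a measure \<Rightarrow> ('a \<Rightarrow> 'a) \<Rightarrow> 'a set set \<Rightarrow> nat \<Rightarrow> 'a set set" where
  "iterated_join M T \<C> n =
     {{x \<in> space M. \<forall>k<n. (T ^^ k) x \<in> f k} |f. \<forall>k<n. f k \<in> \<C>} - {{}}"

definition partition_entropy :: "'a measure \<Rightarrow> 'a set set \<Rightarrow> real" where
  "partition_entropy M \<C> = - (\<Sum>B\<in>\<C>. measure M B * ln (measure M B))"

definition ks_entropy :: "'a measure \<Rightarrow> ('a \<Rightarrow> 'a) \<Rightarrow> ereal" where
  "ks_entropy M T = (SUP \<C>\<in>finite_partitions M.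
     ereal (lim (\<lambda>n. partition_entropy M (iterated_join M T \<C> n) / real n)))"

definition free_energy :: "((nat \<Rightarrow> nat) \<Rightarrow> real) \<Rightarrow> (nat \<Rightarrow> nat) measure \<Rightarrow> ereal" where
  "free_energy \<phi> \<mu> =
    (if \<mu> \<in> invariant_measures \<and> ext_integral \<mu> \<phi> > - \<infinity>
     then ks_entropy \<mu> left_shift + ext_integral \<mu> \<phi> - pressure {1..} \<phi> else - \<infinity>)"

definition rate_function :: "((nat \<Rightarrow> nat) \<Rightarrow> real) \<Rightarrow> (nat \<Rightarrow> nat) measure \<Rightarrow> ereal" where
  "rate_function \<phi> \<mu> =
     - (INF G\<in>{G. openin (weak_star Xfull) G \<and> \<mu> \<in> G}. SUP \<nu>\<in>G. free_energy \<phi> \<nu>)"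


section \<open>Large deviations\<close>

definition borel_prob_on :: "'a topology \<Rightarrow> 'a measure \<Rightarrow> bool" where
  "borel_prob_on T M \<longleftrightarrow> sets M = sets (borel_on T) \<and> prob_space M"

text \<open>Compact sets need not be Borel in a general topological space; the measurability of \<open>K\<close>
  prevents \<^const>\<open>emeasure\<close> from being evaluated at a non-measurable set, where it is \<open>0\<close>.\<close>

definition exponentially_tight :: "'a topology \<Rightarrow> (nat \<Rightarrow> 'a measure) \<Rightarrow> bool" where
  "exponentially_tight T \<mu> \<longleftrightarrow>
    (\<forall>L::real. L > 0 \<longrightarrow> (\<exists>K. compactin T K \<and> K \<in> sets (borel_on T) \<and>
       limsup (\<lambda>n. elog (emeasure (\<mu> n) (topspace T - K)) / ereal (real n)) \<le> ereal (- L)))"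

definition ldp :: "'a topology \<Rightarrow> (nat \<Rightarrow> 'a measure) \<Rightarrow> ('a \<Rightarrow> ereal) \<Rightarrow> bool" where
  "ldp T \<mu> I \<longleftrightarrow>
    (\<forall>x\<in>topspace T. 0 \<le> I x) \<and>
    (\<forall>a. closedin T {x \<in> topspace T. I x \<le> a}) \<and>
    (\<forall>G. openin T G \<longrightarrow>
       - (INF x\<in>G. I x) \<le> liminf (\<lambda>n. elog (emeasure (\<mu> n) G) / ereal (real n))) \<and>
    (\<forall>C. closedin T C \<longrightarrow>
       limsup (\<lambda>n. elog (emeasure (\<mu> n) C) / ereal (real n)) \<le> - (INF x\<in>C. I x))"

definition good_rate :: "'a topology \<Rightarrow> ('a \<Rightarrow> ereal) \<Rightarrow> bool" where
  "good_rate T I \<longleftrightarrow> (\<forall>\<alpha>::real. \<alpha> > 0 \<longrightarrow> compactin T {x \<in> topspace T. I x \<le> ereal \<alpha>})"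

definition periodic_points :: "nat \<Rightarrow> (nat \<Rightarrow> nat) set" where
  "periodic_points n = {x \<in> Xfull. (left_shift ^^ n) x = x}"

definition empirical_measure :: "nat \<Rightarrow> (nat \<Rightarrow> nat) \<Rightarrow> (nat \<Rightarrow> nat) measure" where
  "empirical_measure n x =
     atomic_measure (restrict_space borel Xfull) {..<n} (\<lambda>_. ennreal (1 / real n)) (\<lambda>k. (left_shift ^^ k) x)"

definition partition_function :: "((nat \<Rightarrow> nat) \<Rightarrow> real) \<Rightarrow> nat \<Rightarrow> ennreal" where
  "partition_function \<phi> n =
     (\<integral>\<^sup>+ x. ennreal (exp (birkhoff_sum \<phi> n x)) \<partial>count_space (periodic_points n))"

definition periodic_distribution ::
    "((nat \<Rightarrow> nat) \<Rightarrow> real) \<Rightarrow> nat \<Rightarrow> (nat \<Rightarrow> nat) measure measure" where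
  "periodic_distribution \<phi> n =
     atomic_measure (borel_on (weak_star Xfull)) (periodic_points n)
       (\<lambda>x. ennreal (exp (birkhoff_sum \<phi> n x)) / partition_function \<phi> n) (empirical_measure n)"


section \<open>Basic facts about the encodings\<close>

lemma emeasure_atomic_measure:
  assumes "f ` I \<subseteq> space M" "B \<in> sets M"
  shows "emeasure (atomic_measure M I w f) B = (\<integral>\<^sup>+ i. w i * indicator B (f i) \<partial>count_space I)"
proof -
  have f: "f \<in> measurable (density (count_space I) w) M"
    using assms(1) by (auto simp: measurable_def)
  have "emeasure (atomic_measure M I w f) B = emeasure (density (count_space I) w) (f -` B \<inter> I)"
    unfolding atomic_measure_def using emeasure_distr[OF f assms(2)] by simp
  also have "\<dots> = (\<integral>\<^sup>+ i. w i * indicator (f -` B \<inter> I) i \<partial>count_space I)"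
    by (intro emeasure_density) auto
  also have "\<dots> = (\<integral>\<^sup>+ i. w i * indicator B (f i) \<partial>count_space I)"
    by (intro nn_integral_cong) (auto simp: indicator_def)
  finally show ?thesis .
qed

lemma funpow_left_shift: "(left_shift ^^ n) x = (\<lambda>k. x (n + k))"
  by (induction n arbitrary: x) (auto simp: left_shift_def)

lemma topspace_weak_star: "topspace (weak_star S) = prob_measures S"
proof -
  have "prob_measures S \<in> {{\<mu> \<in> prob_measures S. (\<integral>x. f x \<partial>\<mu>) \<in> U} |(f :: 'a \<Rightarrow> real) U.
        continuous_on S f \<and> bounded (f ` S) \<and> open U}"
    by (intro CollectI exI[of _ "\<lambda>_. 0::real"] exI[of _ UNIV]) (auto simp: bounded_iff)
  then show ?thesis
    unfolding weak_star_def topology_generated_by_topspace by blast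
qed

lemma empirical_measure_in:
  assumes "1 \<le> n" "x \<in> Xfull"
  shows "empirical_measure n x \<in> prob_measures Xfull"
proof -
  have sub: "(\<lambda>k. (left_shift ^^ k) x) ` {..<n} \<subseteq> space (restrict_space borel Xfull)"
    using assms(2) by (auto simp: space_restrict_space funpow_left_shift full_shift_def)
  have sp: "space (empirical_measure n x) = space (restrict_space borel Xfull)"
    by (simp add: empirical_measure_def atomic_measure_def)
  have "emeasure (empirical_measure n x) (space (empirical_measure n x))
      = (\<integral>\<^sup>+ k. ennreal (1 / real n) *
          indicator (space (restrict_space borel Xfull)) ((left_shift ^^ k) x) \<partial>count_space {..<n})"
    unfolding sp unfolding empirical_measure_def by (rule emeasure_atomic_measure[OF sub]) simp
  also have "\<dots> = (\<integral>\<^sup>+ k. ennreal (1 / real n) \<partial>count_space {..<n})"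
    using sub by (intro nn_integral_cong) (auto simp: image_subset_iff indicator_def simp del: One_nat_def)
  also have "\<dots> = 1"
    using assms(1) by (simp add: ennreal_of_nat_eq_real_of_nat flip: ennreal_mult ennreal_1)
  finally show ?thesis
    by (auto simp: prob_measures_def empirical_measure_def atomic_measure_def intro: prob_spaceI)
qed

text \<open>Distinct words of the form \<open>p\<omega>\<close> give disjoint (nonempty) letters.\<close>

lemma letter_split:
  assumes "w \<in> return_words pstar" "x \<in> letter pstar w"
  shows "w = map x [0..<length w]" "length w = (LEAST n. 1 \<le> n \<and> pstar \<le> x n)"
proof -
  obtain q where q: "pstar \<le> q" "x \<in> cylinder {1..} (w @ [q])"
    using assms(2) by (auto simp: letter_def)
  have nth: "x k = (w @ [q]) ! k" if "k \<le> length w" for k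
    using q(2) that by (auto simp: cylinder_def)
  show "w = map x [0..<length w]"
    using nth by (intro nth_equalityI) (auto simp: nth_append)
  obtain p \<omega> where w: "w = p # \<omega>" "set \<omega> \<subseteq> {1..<pstar}"
    using assms(1) by (auto simp: return_words_def)
  have "(LEAST n. 1 \<le> n \<and> pstar \<le> x n) = length w"
  proof (rule Least_equality)
    show "1 \<le> length w \<and> pstar \<le> x (length w)"
      using w q(1) nth[of "length w"] by simp
    fix n assume n: "1 \<le> n \<and> pstar \<le> x n"
    show "length w \<le> n"
    proof (rule ccontr)
      assume "\<not> length w \<le> n"
      then have "x n = w ! n" "n < length w" using nth[of n] by (auto simp: nth_append)
      then have "x n = \<omega> ! (n - 1)" "n - 1 < length \<omega>" using n w by (auto simp: nth_Cons')
      then have "x n \<in> {1..<pstar}" using w(2) nth_mem by (metis subsetD)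
      then show False using n by simp
    qed
  qed
  then show "length w = (LEAST n. 1 \<le> n \<and> pstar \<le> x n)" by simp
qed

lemma inj_on_letter:
  assumes "2 \<le> pstar"
  shows "inj_on (letter pstar) (return_words pstar)"
proof (rule inj_onI)
  fix v w assume vw: "v \<in> return_words pstar" "w \<in> return_words pstar" "letter pstar v = letter pstar w"
  define x where "x k = (if k < length v then v ! k else pstar)" for k
  have "v ! k \<ge> 1" if "k < length v" for k
    using vw(1) assms nth_mem[OF that] by (force simp: return_words_def)
  then have "x \<in> letter pstar v"
    using assms by (auto simp: letter_def cylinder_def full_shift_def x_def nth_append intro!: bexI[of _ pstar])
  then show "v = w"
    using letter_split[OF vw(1), of x] letter_split[OF vw(2), of x] vw(3) by metis
qed

text \<open>The coding takes values in the induced space and conjugates the shift to the return map.\<close>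

lemma inf_concat_unfold:
  assumes "\<And>n. u n \<noteq> []"
  shows "inf_concat u k = (if k < length (u 0) then u 0 ! k
     else inf_concat (left_shift u) (k - length (u 0)))"
proof -
  have len: "n \<le> length (concat (map v [0..<n]))" if "\<And>n. v n \<noteq> []" for v :: "nat \<Rightarrow> 'a list" and n
  proof (induction n)
    case (Suc n)
    have "length (v n) \<ge> 1" using that[of n] by (cases "v n") auto
    with Suc show ?case by simp
  qed simp
  have pre: "concat (map v [0..<m]) ! k = concat (map v [0..<n]) ! k"
    if "m \<le> n" "k < length (concat (map v [0..<m]))" for v :: "nat \<Rightarrow> 'a list" and m n k
  proof -
    have "[0..<n] = [0..<m] @ [m..<n]" using that(1) upt_add_eq_append[of 0 m "n - m"] by simp
    then show ?thesis using that(2) by (simp only: map_append concat_append nth_append if_True)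
  qed
  have eq: "concat (map u [0..<Suc k]) = u 0 @ concat (map (left_shift u) [0..<k])"
    by (induction k) (auto simp: left_shift_def)
  show ?thesis
  proof (cases "k < length (u 0)")
    case True
    then show ?thesis unfolding inf_concat_def eq by (simp add: nth_append)
  next
    case False
    let ?j = "k - length (u 0)"
    have ne: "\<And>n. left_shift u n \<noteq> []" using assms by (simp add: left_shift_def)
    have "length (u 0) \<ge> 1" using assms[of 0] by (cases "u 0") auto
    then have "Suc ?j \<le> k" using False by simp
    moreover have "?j < length (concat (map (left_shift u) [0..<Suc ?j]))"
      using len[of "left_shift u" "Suc ?j", OF ne] by simp
    ultimately have "concat (map (left_shift u) [0..<Suc ?j]) ! ?j = concat (map (left_shift u) [0..<k]) ! ?j"
      by (rule pre)
    then show ?thesis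
      using False unfolding inf_concat_def[of u] eq inf_concat_def[of "left_shift u"] by (simp add: nth_append)
  qed
qed

lemma inf_concat_return:
  assumes p: "2 \<le> pstar" and u: "\<And>n. u n \<in> return_words pstar"
  shows "inf_concat u \<in> Xstar pstar"
    and "return_time pstar (inf_concat u) = enat (length (u 0))"
    and "return_map pstar (inf_concat u) = inf_concat (left_shift u)"
proof -
  have ne: "v n \<noteq> []" if "\<And>n. v n \<in> return_words pstar" for v :: "nat \<Rightarrow> nat list" and n
    using that[of n] by (auto simp: return_words_def)
  have pos: "1 \<le> w ! k" if "w \<in> return_words pstar" "k < length w" for w k
    using that(1) p nth_mem[OF that(2)] by (force simp: return_words_def)
  have unf: "inf_concat v k = (if k < length (v 0) then v 0 ! k
     else inf_concat (left_shift v) (k - length (v 0)))"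
    if "\<And>n. v n \<in> return_words pstar" for v k
    by (rule inf_concat_unfold) (rule ne[OF that])
  have full: "inf_concat v \<in> Xfull" if v: "\<And>n. v n \<in> return_words pstar" for v
  proof -
    have "\<forall>v. (\<forall>n. v n \<in> return_words pstar) \<longrightarrow> 1 \<le> inf_concat v k" for k
    proof (induction k rule: less_induct)
      case (less k)
      show ?case
      proof (intro allI impI)
        fix v :: "nat \<Rightarrow> nat list" assume v: "\<forall>n. v n \<in> return_words pstar"
        have "length (v 0) \<ge> 1" using ne[of v 0] v by (cases "v 0") auto
        moreover have "\<forall>n. left_shift v n \<in> return_words pstar" using v by (simp add: left_shift_def)
        ultimately show "1 \<le> inf_concat v k"
          unfolding unf[of v k, OF v[rule_format]]
          using v less.IH[of "k - length (v 0)"] pos[of "v 0" k] by (cases "k < length (v 0)") simp_all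
      qed
    qed
    then show ?thesis using v by (auto simp: full_shift_def)
  qed
  have hd: "pstar \<le> inf_concat v 0" if v: "\<And>n. v n \<in> return_words pstar" for v
    using v[of 0] unfolding unf[of v 0, OF v] by (auto simp: return_words_def)
  have star: "inf_concat v \<in> Xstar pstar" if v: "\<And>n. v n \<in> return_words pstar" for v
    using full[of v, OF v] hd[of v, OF v] by (auto simp: Xstar_def cylinder_def)
  show "inf_concat u \<in> Xstar pstar" using star u by blast
  have us: "\<And>n. left_shift u n \<in> return_words pstar" using u by (simp add: left_shift_def)
  have sh: "(left_shift ^^ length (u 0)) (inf_concat u) = inf_concat (left_shift u)"
  proof (rule ext)
    fix k
    show "(left_shift ^^ length (u 0)) (inf_concat u) k = inf_concat (left_shift u) k"
      unfolding funpow_left_shift unf[of u "length (u 0) + k", OF u] by simp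
  qed
  have one: "1 \<le> length (u 0)" using ne[of u 0, OF u] by (cases "u 0") auto
  have small: "(left_shift ^^ n) (inf_concat u) \<notin> Xstar pstar" if n: "1 \<le> n" "n < length (u 0)" for n
  proof -
    have "inf_concat u n = u 0 ! n" using n unfolding unf[of u n, OF u] by simp
    moreover obtain q \<omega> where q: "u 0 = q # \<omega>" "set \<omega> \<subseteq> {1..<pstar}"
      using u[of 0] by (auto simp: return_words_def)
    moreover have "\<omega> ! (n - 1) \<in> {1..<pstar}"
      using q n by (intro subsetD[OF q(2)] nth_mem) auto
    ultimately have "inf_concat u n \<in> {1..<pstar}" using n by (simp add: nth_Cons')
    then show ?thesis by (auto simp: Xstar_def cylinder_def funpow_left_shift)
  qed
  show R: "return_time pstar (inf_concat u) = enat (length (u 0))"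
    unfolding return_time_def
  proof (rule antisym)
    show "Inf (enat ` {n. 1 \<le> n \<and> (left_shift ^^ n) (inf_concat u) \<in> Xstar pstar}) \<le> enat (length (u 0))"
      using star[of "left_shift u", OF us] one by (intro Inf_lower imageI) (simp add: sh)
    show "enat (length (u 0)) \<le> Inf (enat ` {n. 1 \<le> n \<and> (left_shift ^^ n) (inf_concat u) \<in> Xstar pstar})"
      using small by (intro Inf_greatest) (force simp: not_less)
  qed
  show "return_map pstar (inf_concat u) = inf_concat (left_shift u)"
    by (simp add: return_map_def R sh)
qed

lemma
  assumes p: "2 \<le> pstar" and z: "z \<in> full_shift (induced_alphabet pstar)"
  shows coding_return_map: "return_map pstar (coding pstar z) = coding pstar (left_shift z)"
    and coding_in_induced_space: "coding pstar z \<in> induced_space pstar"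
proof -
  define w where "w z n = inv_into (return_words pstar) (letter pstar) (z n)" for z :: "nat \<Rightarrow> (nat \<Rightarrow> nat) set" and n :: nat
  have w: "w z n \<in> return_words pstar" if "z \<in> full_shift (induced_alphabet pstar)" for z n
    using that by (auto simp: w_def full_shift_def induced_alphabet_def intro: inv_into_into)
  have c: "coding pstar z = inf_concat (w z)" for z unfolding coding_def w_def ..
  have s: "left_shift (w z) = w (left_shift z)" for z by (rule ext) (simp add: left_shift_def w_def)
  have fs: "(left_shift ^^ n) z \<in> full_shift (induced_alphabet pstar)" for n
    using z by (simp add: full_shift_def funpow_left_shift)
  have conj: "return_map pstar (coding pstar z) = coding pstar (left_shift z)"
    if "z \<in> full_shift (induced_alphabet pstar)" for z
    using inf_concat_return(3)[of pstar "w z", OF p w[OF that]] by (simp add: c s)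
  show "return_map pstar (coding pstar z) = coding pstar (left_shift z)" using conj z by blast
  have it: "(return_map pstar ^^ n) (coding pstar z) = coding pstar ((left_shift ^^ n) z)" for n
    by (induction n) (simp_all add: conj fs)
  have "1 \<le> length (w z' 0)" if "z' \<in> full_shift (induced_alphabet pstar)" for z'
    using w[OF that, of 0] by (auto simp: return_words_def)
  moreover have "coding pstar ((left_shift ^^ n) z) \<in> Xstar pstar"
    "return_time pstar (coding pstar ((left_shift ^^ n) z)) = enat (length (w ((left_shift ^^ n) z) 0))" for n
    unfolding c using inf_concat_return(1,2)[of pstar "w ((left_shift ^^ n) z)", OF p w[OF fs]] .
  ultimately show "coding pstar z \<in> induced_space pstar"
    using fs unfolding induced_space_def by (simp add: it)
qed

end

theory Submission
  imports Defs
begin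

text \<open>In the zero-dimensional space \<open>X\<close> the weak* topology is generated by the masses
  \<open>\<mu>[w]\<close> of cylinders, so that measures may be compared through the words they see. Since \<open>\<phi>\<close> is
  acceptable, Birkhoff sums \<open>S\<^sub>n\<phi>\<close> vary by \<open>o(n)\<close> on cylinders of length \<open>n\<close>, and finite pressure
  makes the sum of \<open>sup exp \<phi>\<close> over the cylinders \<open>[p]\<close> converge; weighting the letters by a slowly growing
  function and using Chernoff's inequality gives exponential tightness. For the lower bound, an invariant measure \<open>\<nu>\<close> is
  replaced by the distribution of its words of a large length, and the weak law of large numbers for
  independent concatenations of such words yields sufficiently many periodic points; neither
  ergodicity nor the Shannon-McMillan-Breiman theorem is needed. For the upper bound, the periodic points in a convex
  neighbourhood are the blocks of a stationary process with Gibbs weights: its empirical means stay in the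
  neighbourhood, and entropy plus energy of the process equal the logarithm of the partition sum up to \<open>o(n)\<close>.\<close>

section \<open>Cylinders and Borel probability measures on the full shift\<close>

text \<open>Over an infinite alphabet neither \<open>Xfull\<close> nor the space of measures is
  compact, entropy is not upper semicontinuous, and \<phi> is unbounded below, so a limit of
  empirical measures may lose mass or free energy. The proof therefore stays at finite length. As
  \<open>rate_function\<close> is a regularisation over open neighbourhoods, the upper bound may
  ask, for each large n and each finite set of periodic points, for one invariant measure inside the
  neighbourhood, and builds it explicitly. Energy and entropy of a block distribution p enter
  together, as the mean of \<open>S n (per w) - ln (p w)\<close>. Because
  \<open>p * exp (S - ln p)\<close> is \<open>exp S\<close>, the weak law for this single function
  bounds the sum of \<open>exp S\<close> over typical concatenations from below. In the upper bound
  p is proportional to \<open>exp S\<close>, which makes \<open>S - ln p\<close> constant and equal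
  to the logarithm of the partition sum. Entropies are computed for finite-valued labels, as the
  partition into one-letter cylinders may have infinite entropy; finitely many words are reached by
  cutting off large letters, with monotone or dominated convergence paying for the cut.\<close>

declare One_nat_def [simp del]

abbreviation cyl :: "nat list \<Rightarrow> (nat \<Rightarrow> nat) set" where
  "cyl w \<equiv> cylinder {1..} w"

abbreviation BX :: "(nat \<Rightarrow> nat) measure" where
  "BX \<equiv> restrict_space borel Xfull"

lemma open_contains_prefix:
  fixes U :: "(nat \<Rightarrow> nat) set"
  assumes "open U" "x \<in> U"
  obtains n where "\<And>y. (\<And>k. k < n \<Longrightarrow> y k = x k) \<Longrightarrow> y \<in> U"
proof -
  have "openin (product_topology (\<lambda>_. euclidean) UNIV) U"
    using assms(1) by (simp add: open_fun_def)
  from product_topology_open_contains_basis[OF this assms(2)]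
  obtain V where V: "x \<in> Pi\<^sub>E UNIV V" "finite {i. V i \<noteq> topspace euclidean}" "Pi\<^sub>E UNIV V \<subseteq> U"
    by auto
  obtain n where n: "\<And>i. V i \<noteq> UNIV \<Longrightarrow> i < n"
    using finite_nat_set_iff_bounded[of "{i. V i \<noteq> UNIV}"] V(2) by auto
  show ?thesis
  proof (rule that)
    fix y assume "\<And>k. k < n \<Longrightarrow> y k = x k"
    then have "y k \<in> V k" for k
      using n[of k] V(1) by (cases "V k = UNIV") (auto simp: PiE_iff)
    then show "y \<in> U" using V(3) by (auto simp: PiE_iff)
  qed
qed

lemma cylinder_alt: "cylinder A w = full_shift A \<inter> {x. \<forall>k<length w. x k = w ! k}"
  by (auto simp: cylinder_def)

lemma open_prefix: "open {x :: nat \<Rightarrow> nat. \<forall>k<length w. x k = w ! k}"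
proof -
  have "open ((\<lambda>x :: nat \<Rightarrow> nat. x k) -` {a})" for k and a :: nat
    by (intro open_vimage[OF discrete_topology_class.open_discrete] continuous_on_product_coordinates)
  then have "open (\<Inter>k\<in>{..<length w}. (\<lambda>x. x k) -` {w ! k})"
    by (intro open_INT) auto
  also have "(\<Inter>k\<in>{..<length w}. (\<lambda>x. x k) -` {w ! k}) = {x :: nat \<Rightarrow> nat. \<forall>k<length w. x k = w ! k}"
    by auto
  finally show ?thesis .
qed

lemma cyl_in_BX [measurable, simp]: "cyl w \<in> sets BX"
  unfolding cylinder_alt sets_restrict_space using open_prefix[of w] by auto

lemma space_BX [simp]: "space BX = Xfull"
  by (simp add: space_restrict_space)

lemma cyl_Nil [simp]: "cyl [] = Xfull"
  by (simp add: cylinder_def)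

lemma cyl_subset: "cyl w \<subseteq> Xfull"
  by (auto simp: cylinder_def)

lemma cyl_eq_prefix: "x \<in> Xfull \<Longrightarrow> x \<in> cyl w \<longleftrightarrow> map x [0..<length w] = w"
proof -
  assume "x \<in> Xfull"
  have "map x [0..<length w] = w \<longleftrightarrow> (\<forall>k<length w. x k = w ! k)"
    by (subst list_eq_iff_nth_eq) simp
  then show ?thesis using \<open>x \<in> Xfull\<close> by (simp add: cylinder_def)
qed

lemma cyl_append: "cyl (v @ w) \<subseteq> cyl v"
  by (auto simp: cylinder_def nth_append)

lemma cyl_same_length_disjoint: "length v = length w \<Longrightarrow> v \<noteq> w \<Longrightarrow> cyl v \<inter> cyl w = {}"
  by (auto simp: cylinder_def list_eq_iff_nth_eq)

text \<open>0 is not a letter. Thanks to this, cylinder masses can be indexed by all lists of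
  naturals, without an alphabet condition on the word.\<close>

lemma cyl_empty: "0 \<in> set w \<Longrightarrow> cyl w = {}"
proof -
  assume "0 \<in> set w"
  then obtain k where "k < length w" "w ! k = 0" by (auto simp: in_set_conv_nth)
  then have "x \<notin> cyl w" for x
    by (auto simp: cylinder_def full_shift_def intro!: exI[of _ k])
  then show ?thesis by blast
qed

lemma cyl_Int: "cyl v \<inter> cyl w \<in> range cyl"
proof -
  have *: "cyl v \<inter> cyl w \<in> range cyl" if le: "length v \<le> length w" for v w
  proof (cases "take (length v) w = v")
    case True
    then have "cyl w \<subseteq> cyl v" using cyl_append[of v "drop (length v) w"] by (metis append_take_drop_id)
    then show ?thesis by (auto simp: Int_absorb1)
  next
    case False
    have "cyl w \<subseteq> cyl (take (length v) w)"
      using cyl_append[of "take (length v) w" "drop (length v) w"] by simp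
    moreover have "cyl v \<inter> cyl (take (length v) w) = {}"
      using le False by (intro cyl_same_length_disjoint) auto
    \<comment> \<open>Disjoint cylinders require an empty member of the generator;
      \<open>cyl [0]\<close> is one.\<close>
    ultimately have "cyl v \<inter> cyl w = cyl [0]" using cyl_empty[of "[0]"] by auto
    then show ?thesis by simp
  qed
  show ?thesis
  proof (cases "length v \<le> length w")
    case False
    then show ?thesis using *[of w v] by (simp add: Int_commute)
  qed (rule *)
qed

lemma Int_stable_cyl: "Int_stable (range cyl)"
  using cyl_Int by (auto simp: Int_stable_def)

text \<open>There are only countably many words, so an open set is a countable union of the
  cylinders that it contains. This presents the Borel sets by an intersection-stable
  generator.\<close>

lemma sets_BX: "sets BX = sigma_sets Xfull (range cyl)"
proof -
  have "sets BX = (\<inter>) Xfull ` sigma_sets UNIV {S. open S}"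
    by (simp add: sets_restrict_space sets_borel)
  also have "\<dots> = sigma_sets Xfull ((\<inter>) Xfull ` {S. open S})"
  proof -
    \<comment> \<open>\<open>sigma_sets_Int\<close> asks for the subspace itself to be Borel; it is
      even closed.\<close>
    have "Xfull = (\<Inter>n. (\<lambda>x. x n) -` {1..})" by (auto simp: full_shift_def)
    also have "closed \<dots>"
      by (intro closed_INT ballI closed_vimage closed_atLeast continuous_on_product_coordinates)
    finally have "Xfull \<in> sigma_sets UNIV {S. open S}" using borel_closed sets_borel by metis
    then show ?thesis by (intro sigma_sets_Int) auto
  qed
  also have "\<dots> = sigma_sets Xfull (range cyl)"
  proof (rule sigma_sets_eqI)
    fix a assume "a \<in> (\<inter>) Xfull ` {S. open S}"
    then obtain U where U: "open U" "a = Xfull \<inter> U" by auto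
    have "a = \<Union>(cyl ` {w. cyl w \<subseteq> U})"
    proof (intro equalityI subsetI)
      fix x assume x: "x \<in> a"
      obtain n where n: "\<And>y. (\<And>k. k < n \<Longrightarrow> y k = x k) \<Longrightarrow> y \<in> U"
        using open_contains_prefix[OF U(1), of x] x U by auto
      have "x \<in> cyl (map x [0..<n])" "cyl (map x [0..<n]) \<subseteq> U"
        using x U n by (auto simp: cylinder_def)
      then show "x \<in> \<Union>(cyl ` {w. cyl w \<subseteq> U})" by blast
    qed (use U cyl_subset in auto)
    also have "\<dots> \<in> sigma_sets Xfull (range cyl)"
      by (intro sigma_sets_UNION) auto
    finally show "a \<in> sigma_sets Xfull (range cyl)" .
  next
    fix b assume "b \<in> range cyl"
    then show "b \<in> sigma_sets Xfull ((\<inter>) Xfull ` {S. open S})"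
      unfolding cylinder_alt using open_prefix by (auto intro!: sigma_sets.Basic)
  qed
  finally show ?thesis .
qed

lemma measurable_BX:
  assumes "\<And>x. x \<in> space M \<Longrightarrow> f x \<in> Xfull"
    and "\<And>w. f -` cyl w \<inter> space M \<in> sets M"
  shows "f \<in> measurable M BX"
  using assms cyl_subset by (intro measurable_sigma_sets[OF sets_BX]) auto

lemma prob_measuresD:
  assumes "\<mu> \<in> prob_measures Xfull"
  shows "sets \<mu> = sets BX" "space \<mu> = Xfull" "prob_space \<mu>" "cyl w \<in> sets \<mu>"
proof -
  show s: "sets \<mu> = sets BX" "prob_space \<mu>" using assms by (auto simp: prob_measures_def)
  from sets_eq_imp_space_eq[OF s(1)] show "space \<mu> = Xfull" by simp
  show "cyl w \<in> sets \<mu>" by (simp add: s)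
qed

lemma measure_eqI_cyl:
  assumes "\<mu> \<in> prob_measures Xfull" "\<nu> \<in> prob_measures Xfull"
    and "\<And>w. measure \<mu> (cyl w) = measure \<nu> (cyl w)"
  shows "\<mu> = \<nu>"
proof -
  interpret m: prob_space \<mu> by (rule prob_measuresD[OF assms(1)])
  interpret n: prob_space \<nu> by (rule prob_measuresD[OF assms(2)])
  have "Xfull \<in> range cyl" using cyl_Nil by (metis rangeI)
  then show ?thesis
  proof (intro measure_eqI_generator_eq[OF Int_stable_cyl, of Xfull _ _ "\<lambda>_. cyl []"])
    show "emeasure \<mu> X = emeasure \<nu> X" if "X \<in> range cyl" for X
      using that assms(3) by (auto simp: m.emeasure_eq_measure n.emeasure_eq_measure)
  qed (use cyl_subset prob_measuresD(1)[OF assms(1)] prob_measuresD(1)[OF assms(2)] in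
       \<open>auto simp: sets_BX m.emeasure_eq_measure\<close>)
qed

lemma cyl_split: "cyl w = (\<Union>p. cyl (w @ [p]))"
proof (intro equalityI subsetI)
  fix x assume "x \<in> cyl w"
  then have "x \<in> cyl (w @ [x (length w)])" by (auto simp: cylinder_def nth_append less_Suc_eq)
  then show "x \<in> (\<Union>p. cyl (w @ [p]))" by blast
qed (use cyl_append in blast)

lemma measure_cyl_sums:
  assumes "\<mu> \<in> prob_measures Xfull"
  shows "(\<lambda>p. measure \<mu> (cyl (w @ [p]))) sums measure \<mu> (cyl w)"
proof -
  interpret m: prob_space \<mu> by (rule prob_measuresD[OF assms(1)])
  show ?thesis
    unfolding cyl_split[of w]
    by (intro m.finite_measure_UNION)
       (auto simp: disjoint_family_on_def cyl_same_length_disjoint prob_measuresD(4)[OF assms])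
qed

lemma measure_Union_cyl:
  assumes "\<mu> \<in> prob_measures Xfull" "finite F" "\<And>w. w \<in> F \<Longrightarrow> length w = n"
  shows "measure \<mu> (\<Union>w\<in>F. cyl w) = (\<Sum>w\<in>F. measure \<mu> (cyl w))"
proof -
  interpret m: prob_space \<mu> by (rule prob_measuresD[OF assms(1)])
  show ?thesis
    using assms by (intro m.finite_measure_finite_Union)
       (auto simp: disjoint_family_on_def cyl_same_length_disjoint prob_measuresD(4)[OF assms(1)])
qed

lemma finite_bounded_words: "finite {w. length w = n \<and> set w \<subseteq> {..m::nat}}"
  using finite_lists_length_eq[of "{..m}" n] by (simp add: conj_commute)

text \<open>Restricting to letters at most m leaves finitely many words of length n, and these sets
  of words increase to \<open>S\<close>; continuity from below then does what finiteness of the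
  alphabet would do.\<close>

lemma finite_cyl_approx:
  assumes mu: "\<mu> \<in> prob_measures Xfull" and S: "\<And>w. w \<in> S \<Longrightarrow> length w = n" and "0 < d"
  obtains F where "finite F" "F \<subseteq> S" "measure \<mu> (\<Union>w\<in>S. cyl w) - d < (\<Sum>w\<in>F. measure \<mu> (cyl w))"
proof -
  interpret m: prob_space \<mu> by (rule prob_measuresD[OF mu])
  define F where "F m = {w \<in> S. set w \<subseteq> {..m}}" for m
  have fin: "finite (F m)" for m
    by (rule finite_subset[OF _ finite_bounded_words[of n m]]) (auto simp: F_def S)
  have "(\<lambda>m. measure \<mu> (\<Union>w\<in>F m. cyl w)) \<longlonglongrightarrow> measure \<mu> (\<Union>m. \<Union>w\<in>F m. cyl w)"
  proof (rule m.finite_Lim_measure_incseq)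
    show "range (\<lambda>m. \<Union>w\<in>F m. cyl w) \<subseteq> sets \<mu>"
      using fin prob_measuresD(4)[OF mu] by auto
    show "incseq (\<lambda>m. \<Union>w\<in>F m. cyl w)"
      by (intro monoI UN_mono) (auto simp: F_def)
  qed
  also have "(\<Union>m. \<Union>w\<in>F m. cyl w) = (\<Union>w\<in>S. cyl w)"
  proof -
    have "\<exists>m. w \<in> F m" if "w \<in> S" for w
      using that by (intro exI[of _ "Max (set w)"]) (auto simp: F_def)
    then show ?thesis by (fastforce simp: F_def)
  qed
  finally have "\<forall>\<^sub>F m in sequentially. measure \<mu> (\<Union>w\<in>S. cyl w) - d < measure \<mu> (\<Union>w\<in>F m. cyl w)"
    using \<open>0 < d\<close> by (intro order_tendstoD(1)) auto
  then obtain m where m: "measure \<mu> (\<Union>w\<in>S. cyl w) - d < measure \<mu> (\<Union>w\<in>F m. cyl w)"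
    by (auto simp: eventually_sequentially)
  also have "measure \<mu> (\<Union>w\<in>F m. cyl w) = (\<Sum>w\<in>F m. measure \<mu> (cyl w))"
    using S by (intro measure_Union_cyl[OF mu fin]) (auto simp: F_def)
  finally show ?thesis using that[OF fin[of m]] by (auto simp: F_def)
qed

lemma sum_indicator_cyl:
  fixes c :: "nat list \<Rightarrow> real"
  assumes "finite F" "\<And>w. w \<in> F \<Longrightarrow> length w = n" "x \<in> Xfull"
  shows "(\<Sum>w\<in>F. c w * indicator (cyl w) x) = (if map x [0..<n] \<in> F then c (map x [0..<n]) else 0)"
proof -
  have "(\<Sum>w\<in>F. c w * indicator (cyl w) x) = (\<Sum>w\<in>F. if w = map x [0..<n] then c w else 0)"
    using assms by (intro sum.cong) (auto simp: indicator_def cyl_eq_prefix)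
  then show ?thesis using assms(1) by simp
qed

text \<open>On the cylinders of \<open>F\<close> replacing f by the constants costs e; off them, on
  the missing mass, it costs at most \<open>B\<close>. The bound sees \<mu> only through finitely
  many cylinder masses, so it transfers to nearby measures.\<close>

lemma integral_cyl_approx:
  assumes mu: "\<mu> \<in> prob_measures Xfull" and fin: "finite F" and F: "\<And>w. w \<in> F \<Longrightarrow> length w = n"
    and f: "f \<in> borel_measurable BX" and B: "\<And>x. x \<in> Xfull \<Longrightarrow> \<bar>f x\<bar> \<le> B"
    and c: "\<And>w x. w \<in> F \<Longrightarrow> x \<in> cyl w \<Longrightarrow> \<bar>f x - c w\<bar> \<le> e" and "0 \<le> e"
  shows "\<bar>(\<integral>x. f x \<partial>\<mu>) - (\<Sum>w\<in>F. c w * measure \<mu> (cyl w))\<bar> \<le> e + B * (1 - (\<Sum>w\<in>F. measure \<mu> (cyl w)))"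
proof -
  interpret m: prob_space \<mu> by (rule prob_measuresD[OF mu])
  note D = prob_measuresD[OF mu]
  have [measurable]: "cyl w \<in> sets \<mu>" for w by (rule D)
  have [measurable]: "f \<in> borel_measurable \<mu>" using f D(1) by (simp cong: measurable_cong_sets)
  have int_cyl [simp, intro]: "integrable \<mu> (indicat_real (cyl w))" for w
    by (rule integrable_real_indicator) (auto simp: m.emeasure_eq_measure)
  define g where "g x = (\<Sum>w\<in>F. c w * indicator (cyl w) x)" for x
  define h where "h x = e + B * (1 - (\<Sum>w\<in>F. 1 * indicator (cyl w) x))" for x
  have if': "integrable \<mu> f"
    by (rule m.integrable_const_bound[of _ B]) (use B D(2) in auto)
  have ig: "integrable \<mu> g" unfolding g_def by (intro Bochner_Integration.integrable_sum) auto
  have ih: "integrable \<mu> h" unfolding h_def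
    by (intro Bochner_Integration.integrable_add Bochner_Integration.integrable_diff
        Bochner_Integration.integrable_sum integrable_mult_right) auto
  have Ig: "(\<integral>x. g x \<partial>\<mu>) = (\<Sum>w\<in>F. c w * measure \<mu> (cyl w))"
    unfolding g_def using D(2)
    by (subst Bochner_Integration.integral_sum)
       (auto simp: cyl_subset Int_absorb2 int_cyl)
  have Ih: "(\<integral>x. h x \<partial>\<mu>) = e + B * (1 - (\<Sum>w\<in>F. measure \<mu> (cyl w)))"
  proof -
    have "(\<integral>x. h x \<partial>\<mu>) = (\<integral>x. e + B * 1 \<partial>\<mu>) - B * (\<integral>x. (\<Sum>w\<in>F. 1 * indicator (cyl w) x) \<partial>\<mu>)"
      unfolding h_def by (subst integral_mult_right_zero[symmetric], subst Bochner_Integration.integral_diff[symmetric])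
         (auto simp: algebra_simps intro!: Bochner_Integration.integral_cong)
    then show ?thesis
      using D(2) m.prob_space by (subst (asm) Bochner_Integration.integral_sum) (auto simp: cyl_subset Int_absorb2 algebra_simps)
  qed
  have pw: "\<bar>f x - g x\<bar> \<le> h x" if x: "x \<in> Xfull" for x
  proof -
    have gx: "g x = (if map x [0..<n] \<in> F then c (map x [0..<n]) else 0)"
      unfolding g_def by (rule sum_indicator_cyl[OF fin F x])
    have "(\<Sum>w\<in>F. 1 * indicator (cyl w) x) = (if map x [0..<n] \<in> F then 1 else 0 :: real)"
      by (rule sum_indicator_cyl[OF fin F x])
    then have hx: "h x = e + B * (1 - (if map x [0..<n] \<in> F then 1 else 0))"
      unfolding h_def by simp
    have "x \<in> cyl (map x [0..<n])" using x by (auto simp: cylinder_def)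
    then show ?thesis using B[OF x] \<open>0 \<le> e\<close> c[of "map x [0..<n]" x] by (simp add: gx hx)
  qed
  have "\<bar>(\<integral>x. f x \<partial>\<mu>) - (\<integral>x. g x \<partial>\<mu>)\<bar> = \<bar>\<integral>x. f x - g x \<partial>\<mu>\<bar>"
    using if' ig by simp
  also have "\<dots> \<le> (\<integral>x. \<bar>f x - g x\<bar> \<partial>\<mu>)" by (rule integral_abs_bound)
  also have "\<dots> \<le> (\<integral>x. h x \<partial>\<mu>)"
    by (intro integral_mono ih integrable_abs Bochner_Integration.integrable_diff if' ig) (use pw D(2) in auto)
  finally show ?thesis unfolding Ig Ih .
qed

lemma continuous_on_measurable_BX:
  fixes f :: "(nat \<Rightarrow> nat) \<Rightarrow> real"
  shows "continuous_on Xfull f \<Longrightarrow> f \<in> borel_measurable BX"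
  by (rule borel_measurable_continuous_on_restrict)

lemma continuous_on_Xfull_prefix:
  fixes f :: "(nat \<Rightarrow> nat) \<Rightarrow> real"
  assumes "continuous_on Xfull f" "x \<in> Xfull" "0 < e"
  obtains n where "\<And>y. y \<in> Xfull \<Longrightarrow> (\<And>k. k < n \<Longrightarrow> y k = x k) \<Longrightarrow> \<bar>f y - f x\<bar> < e"
proof -
  from assms(1) have "\<exists>A. open A \<and> A \<inter> Xfull = f -` ball (f x) e \<inter> Xfull"
    unfolding continuous_on_open_invariant by auto
  then obtain A where A: "open A" "A \<inter> Xfull = f -` ball (f x) e \<inter> Xfull" by blast
  then have "x \<in> A" using assms by auto
  then obtain n where n: "\<And>y. (\<And>k. k < n \<Longrightarrow> y k = x k) \<Longrightarrow> y \<in> A"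
    using open_contains_prefix[OF A(1)] by metis
  show ?thesis
  proof (rule that[of n])
    fix y assume "y \<in> Xfull" "\<And>k. k < n \<Longrightarrow> y k = x k"
    then have "y \<in> f -` ball (f x) e" using n[of y] A(2) by blast
    then show "\<bar>f y - f x\<bar> < e" by (simp add: dist_real_def abs_minus_commute)
  qed
qed

lemma prefix_continuous_on_Xfull:
  fixes f :: "(nat \<Rightarrow> nat) \<Rightarrow> real"
  assumes "\<And>x e. x \<in> Xfull \<Longrightarrow> 0 < e \<Longrightarrow>
    \<exists>n. \<forall>y\<in>Xfull. (\<forall>k<n. y k = x k) \<longrightarrow> \<bar>f y - f x\<bar> < e"
  shows "continuous_on Xfull f"
proof -
  have "(f \<longlongrightarrow> f x) (at x within Xfull)" if x: "x \<in> Xfull" for x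
  proof (rule tendstoI)
    fix e :: real assume "0 < e"
    then obtain n where n: "\<forall>y\<in>Xfull. (\<forall>k<n. y k = x k) \<longrightarrow> \<bar>f y - f x\<bar> < e" using assms x by blast
    have "x \<in> {y. \<forall>k<length (map x [0..<n]). y k = map x [0..<n] ! k}" by simp
    then have "eventually (\<lambda>y. y \<in> {y. \<forall>k<length (map x [0..<n]). y k = map x [0..<n] ! k}) (at x within Xfull)"
      by (rule topological_tendstoD[OF tendsto_ident_at open_prefix])
    moreover have "eventually (\<lambda>y. y \<in> Xfull) (at x within Xfull)"
      by (simp add: eventually_at_filter)
    ultimately show "eventually (\<lambda>y. dist (f y) (f x) < e) (at x within Xfull)"
      by eventually_elim (use n in \<open>auto simp: dist_real_def\<close>)
  qed
  then show ?thesis by (simp add: continuous_on_def)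
qed

section \<open>Cylinder neighbourhoods in the weak star topology\<close>

lemma continuous_on_indicator_cyl: "continuous_on Xfull (indicator (cyl w) :: _ \<Rightarrow> real)"
  by (rule prefix_continuous_on_Xfull, rule exI[of _ "length w"]) (auto simp: indicator_def cylinder_def)

lemma openin_weak_star_cyl:
  assumes "open V"
  shows "openin (weak_star Xfull) {\<mu> \<in> prob_measures Xfull. measure \<mu> (cyl w) \<in> V}"
proof -
  have "{\<mu> \<in> prob_measures Xfull. measure \<mu> (cyl w) \<in> V} =
    {\<mu> \<in> prob_measures Xfull. (\<integral>x. indicator (cyl w) x \<partial>\<mu>) \<in> V}"
    using prob_measuresD(2) by (auto simp: cyl_subset Int_absorb2)
  also have "openin (weak_star Xfull) \<dots>"
    unfolding weak_star_def
    by (rule topology_generated_by_Basis)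
       (use assms continuous_on_indicator_cyl[of w] in \<open>fastforce simp: bounded_iff indicator_def\<close>)
  finally show ?thesis .
qed

lemma openin_weak_star_nhd:
  assumes "finite F" "0 < (e::real)"
  shows "openin (weak_star Xfull) {\<mu> \<in> prob_measures Xfull. \<forall>w\<in>F. \<bar>measure \<mu> (cyl w) - c w\<bar> < e}"
  using assms(1)
proof induction
  case empty
  then show ?case using openin_topspace[of "weak_star Xfull"] by (simp add: topspace_weak_star)
next
  case (insert w F)
  have "{\<mu> \<in> prob_measures Xfull. \<forall>w\<in>insert w F. \<bar>measure \<mu> (cyl w) - c w\<bar> < e} =
    {\<mu> \<in> prob_measures Xfull. measure \<mu> (cyl w) \<in> ball (c w) e} \<inter>
    {\<mu> \<in> prob_measures Xfull. \<forall>w\<in>F. \<bar>measure \<mu> (cyl w) - c w\<bar> < e}"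
    by (auto simp: dist_real_def abs_minus_commute)
  then show ?case using insert openin_weak_star_cyl[of "ball (c w) e" w] by (auto intro!: openin_Int)
qed

text \<open>The function f need not be uniformly continuous. But the cylinders of length n on which
  f oscillates by at most \<open>d\<close> increase to the whole space, so finitely many of them
  carry almost all of \<mu>, and then also almost all of any measure with nearby masses on
  them.\<close>

lemma weak_star_subbasis_nhd:
  fixes f :: "(nat \<Rightarrow> nat) \<Rightarrow> real"
  assumes f: "continuous_on Xfull f" "bounded (f ` Xfull)" and U: "open U"
    and mu: "\<mu> \<in> prob_measures Xfull" "(\<integral>x. f x \<partial>\<mu>) \<in> U"
  obtains F e where "finite F" "0 < e"
    "\<And>\<nu>. \<nu> \<in> prob_measures Xfull \<Longrightarrow> (\<And>w. w \<in> F \<Longrightarrow> \<bar>measure \<nu> (cyl w) - measure \<mu> (cyl w)\<bar> < e) \<Longrightarrow>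
      (\<integral>x. f x \<partial>\<nu>) \<in> U"
proof -
  interpret m: prob_space \<mu> by (rule prob_measuresD[OF mu(1)])
  obtain r where r: "0 < r" "\<And>t. \<bar>t - (\<integral>x. f x \<partial>\<mu>)\<bar> < r \<Longrightarrow> t \<in> U"
    using U mu(2) unfolding open_dist dist_real_def by blast
  obtain B where B: "0 < B" "\<And>x. x \<in> Xfull \<Longrightarrow> \<bar>f x\<bar> \<le> B"
    using f(2) unfolding bounded_pos by auto
  \<comment> \<open>The errors at the end are \<open>d + 2 * B * d\<close> for \<nu>,
    \<open>d + B * d\<close> for \<mu> and \<open>B * d\<close> between the two finite sums, at most
    3/4 of \<open>r\<close> in total.\<close>
  define d where "d = r / (8 * (1 + B))"
  have d: "0 < d" "d \<le> r / 8" "B * d \<le> r / 8" "(1 + B) * d = r / 8"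
    using r(1) B(1) by (auto simp: d_def field_simps)
  define S where "S n = {w. length w = n \<and> (\<forall>x\<in>cyl w. \<forall>y\<in>cyl w. \<bar>f x - f y\<bar> \<le> d)}" for n
  have "(\<lambda>n. measure \<mu> (\<Union>w\<in>S n. cyl w)) \<longlonglongrightarrow> measure \<mu> (\<Union>n. \<Union>w\<in>S n. cyl w)"
  proof (rule m.finite_Lim_measure_incseq)
    show "range (\<lambda>n. \<Union>w\<in>S n. cyl w) \<subseteq> sets \<mu>"
      using prob_measuresD(4)[OF mu(1)] by auto
    show "incseq (\<lambda>n. \<Union>w\<in>S n. cyl w)"
    proof (intro incseq_SucI subsetI)
      fix n x assume "x \<in> (\<Union>w\<in>S n. cyl w)"
      then obtain w where w: "w \<in> S n" "x \<in> cyl w" by blast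
      then obtain p where p: "x \<in> cyl (w @ [p])" unfolding cyl_split[of w] by blast
      have "w @ [p] \<in> S (Suc n)"
        using w(1) cyl_append[of w "[p]"] by (auto simp: S_def)
      then show "x \<in> (\<Union>w\<in>S (Suc n). cyl w)" using p by blast
    qed
  qed
  also have "(\<Union>n. \<Union>w\<in>S n. cyl w) = Xfull"
  proof (intro equalityI subsetI)
    fix x assume x: "x \<in> Xfull"
    obtain n where n: "\<And>y. y \<in> Xfull \<Longrightarrow> (\<And>k. k < n \<Longrightarrow> y k = x k) \<Longrightarrow> \<bar>f y - f x\<bar> < d / 2"
      using continuous_on_Xfull_prefix[OF f(1) x, of "d / 2"] d(1) by auto
    have *: "\<bar>f y - f x\<bar> < d / 2" if "y \<in> cyl (map x [0..<n])" for y
      using that n[of y] by (auto simp: cylinder_def)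
    have "\<bar>f y - f z\<bar> \<le> d" if "y \<in> cyl (map x [0..<n])" "z \<in> cyl (map x [0..<n])" for y z
      using *[OF that(1)] *[OF that(2)] by linarith
    then have "map x [0..<n] \<in> S n" by (simp add: S_def)
    moreover have "x \<in> cyl (map x [0..<n])" using x by (auto simp: cylinder_def)
    ultimately show "x \<in> (\<Union>n. \<Union>w\<in>S n. cyl w)" by blast
  qed (use cyl_subset in blast)
  also have "measure \<mu> Xfull = 1" using m.prob_space prob_measuresD(2)[OF mu(1)] by simp
  finally have "\<forall>\<^sub>F n in sequentially. 1 - d / 2 < measure \<mu> (\<Union>w\<in>S n. cyl w)"
    using d(1) by (intro order_tendstoD(1)) auto
  then obtain n where n: "1 - d / 2 < measure \<mu> (\<Union>w\<in>S n. cyl w)"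
    by (auto simp: eventually_sequentially)
  obtain F where F: "finite F" "F \<subseteq> S n" "measure \<mu> (\<Union>w\<in>S n. cyl w) - d / 2 < (\<Sum>w\<in>F. measure \<mu> (cyl w))"
    using finite_cyl_approx[OF mu(1), of "S n" n "d / 2"] d(1) by (auto simp: S_def)
  have len: "length w = n" if "w \<in> F" for w using F(2) that by (auto simp: S_def)
  define c where "c w = f (SOME x. x \<in> cyl w)" for w
  have c: "\<bar>f x - c w\<bar> \<le> d" if "w \<in> F" "x \<in> cyl w" for w x
    using that F(2) someI[of "\<lambda>x. x \<in> cyl w" x] by (auto simp: c_def S_def)
  \<comment> \<open>An empty cylinder offers no sample point, and the value of \<open>c\<close>
    there need not be bounded by \<open>B\<close>.\<close>
  define b where "b w = (if cyl w = {} then 0 else c w)" for w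
  have b: "\<bar>f x - b w\<bar> \<le> d" if "w \<in> F" "x \<in> cyl w" for w x
    using c[OF that] that(2) by (auto simp: b_def)
  have bB: "\<bar>b w\<bar> \<le> B" for w
    using B some_in_eq[of "cyl w"] cyl_subset by (auto simp: b_def c_def)
  have appr: "\<bar>(\<integral>x. f x \<partial>\<nu>) - (\<Sum>w\<in>F. b w * measure \<nu> (cyl w))\<bar> \<le> d + B * (1 - (\<Sum>w\<in>F. measure \<nu> (cyl w)))"
    if "\<nu> \<in> prob_measures Xfull" for \<nu>
    using that F(1) len continuous_on_measurable_BX[OF f(1)] B(2) b d(1) by (intro integral_cyl_approx) auto
  define e where "e = d / (1 + real (card F))"
  have e: "0 < e" "real (card F) * e \<le> d" using d(1) by (auto simp: e_def field_simps)
  show ?thesis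
  proof (rule that[OF F(1) e(1)])
    fix \<nu> assume nu: "\<nu> \<in> prob_measures Xfull"
      and near: "\<And>w. w \<in> F \<Longrightarrow> \<bar>measure \<nu> (cyl w) - measure \<mu> (cyl w)\<bar> < e"
    have "\<bar>(\<Sum>w\<in>F. measure \<nu> (cyl w)) - (\<Sum>w\<in>F. measure \<mu> (cyl w))\<bar> \<le> (\<Sum>w\<in>F. \<bar>measure \<nu> (cyl w) - measure \<mu> (cyl w)\<bar>)"
      unfolding sum_subtractf[symmetric] by (rule sum_abs)
    also have "\<dots> \<le> (\<Sum>w\<in>F. e)" using near by (intro sum_mono) (simp add: less_imp_le)
    finally have s1: "\<bar>(\<Sum>w\<in>F. measure \<nu> (cyl w)) - (\<Sum>w\<in>F. measure \<mu> (cyl w))\<bar> \<le> d"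
      using e(2) by simp
    have "\<bar>(\<Sum>w\<in>F. b w * measure \<nu> (cyl w)) - (\<Sum>w\<in>F. b w * measure \<mu> (cyl w))\<bar>
       \<le> (\<Sum>w\<in>F. \<bar>b w * measure \<nu> (cyl w) - b w * measure \<mu> (cyl w)\<bar>)"
      unfolding sum_subtractf[symmetric] by (rule sum_abs)
    also have "\<dots> \<le> (\<Sum>w\<in>F. B * e)"
      using near bB B(1) less_imp_le[OF near]
      by (intro sum_mono) (auto simp: abs_mult simp flip: right_diff_distrib intro!: mult_mono)
    also have "\<dots> = B * (real (card F) * e)" by simp
    also have "\<dots> \<le> B * d" using e(2) B(1) by (intro mult_left_mono) auto
    finally have s2: "\<bar>(\<Sum>w\<in>F. b w * measure \<nu> (cyl w)) - (\<Sum>w\<in>F. b w * measure \<mu> (cyl w))\<bar> \<le> B * d" .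
    have s3: "1 - (\<Sum>w\<in>F. measure \<mu> (cyl w)) \<le> d" using F(3) n by simp
    then have "1 - (\<Sum>w\<in>F. measure \<nu> (cyl w)) \<le> 2 * d" using s1 by linarith
    then have "B * (1 - (\<Sum>w\<in>F. measure \<nu> (cyl w))) \<le> B * (2 * d)"
       "B * (1 - (\<Sum>w\<in>F. measure \<mu> (cyl w))) \<le> B * d"
      using s3 B(1) by (auto intro!: mult_left_mono)
    then have "\<bar>(\<integral>x. f x \<partial>\<nu>) - (\<integral>x. f x \<partial>\<mu>)\<bar> < r"
      using appr[OF nu] appr[OF mu(1)] s2 d r(1) by linarith
    then show "(\<integral>x. f x \<partial>\<nu>) \<in> U" by (rule r(2))
  qed
qed

text \<open>The property \<open>P\<close> of containing a neighbourhood given by finitely many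
  cylinder masses holds for the generating sets by \<open>weak_star_subbasis_nhd\<close> and passes
  to finite intersections and unions. Together with \<open>openin_weak_star_nhd\<close> this makes
  such neighbourhoods a base of the topology.\<close>

lemma weak_star_nhd:
  assumes "openin (weak_star Xfull) G" "\<mu> \<in> G"
  obtains F e where "finite F" "0 < e"
    "\<And>\<nu>. \<nu> \<in> prob_measures Xfull \<Longrightarrow> (\<And>w. w \<in> F \<Longrightarrow> \<bar>measure \<nu> (cyl w) - measure \<mu> (cyl w)\<bar> < e) \<Longrightarrow> \<nu> \<in> G"
proof -
  define P where "P G \<mu> \<longleftrightarrow> (\<exists>F e. finite F \<and> 0 < e \<and> (\<forall>\<nu>\<in>prob_measures Xfull.
    (\<forall>w\<in>F. \<bar>measure \<nu> (cyl w) - measure \<mu> (cyl w)\<bar> < e) \<longrightarrow> \<nu> \<in> G))"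
    for G :: "(nat \<Rightarrow> nat) measure set" and \<mu>
  have main: "P {\<mu> \<in> prob_measures Xfull. (\<integral>x. f x \<partial>\<mu>) \<in> U} \<mu>"
    if "continuous_on Xfull f" "bounded (f ` Xfull)" "open U" "\<mu> \<in> prob_measures Xfull" "(\<integral>x. f x \<partial>\<mu>) \<in> U"
    for f :: "(nat \<Rightarrow> nat) \<Rightarrow> real" and U \<mu>
  proof -
    note h = that
    obtain F e where "finite F" "0 < e"
      "\<And>\<nu>. \<nu> \<in> prob_measures Xfull \<Longrightarrow> (\<And>w. w \<in> F \<Longrightarrow> \<bar>measure \<nu> (cyl w) - measure \<mu> (cyl w)\<bar> < e) \<Longrightarrow>
        (\<integral>x. f x \<partial>\<nu>) \<in> U"
      using weak_star_subbasis_nhd[OF h] by metis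
    then show ?thesis unfolding P_def by blast
  qed
  have "generate_topology_on {{\<mu> \<in> prob_measures Xfull. (\<integral>x. f x \<partial>\<mu>) \<in> U} |(f :: (nat \<Rightarrow> nat) \<Rightarrow> real) U.
        continuous_on Xfull f \<and> bounded (f ` Xfull) \<and> open U} G"
    using assms(1) unfolding weak_star_def openin_topology_generated_by_iff .
  then have "\<forall>\<mu>\<in>G. P G \<mu>"
  proof induction
    case (Int G H)
    show ?case
    proof
      fix \<mu> assume "\<mu> \<in> G \<inter> H"
      then have "P G \<mu>" "P H \<mu>" using Int by auto
      then obtain F e F' e' where *: "finite F" "0 < e" "finite F'" "0 < e'"
        "\<forall>\<nu>\<in>prob_measures Xfull. (\<forall>w\<in>F. \<bar>measure \<nu> (cyl w) - measure \<mu> (cyl w)\<bar> < e) \<longrightarrow> \<nu> \<in> G"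
        "\<forall>\<nu>\<in>prob_measures Xfull. (\<forall>w\<in>F'. \<bar>measure \<nu> (cyl w) - measure \<mu> (cyl w)\<bar> < e') \<longrightarrow> \<nu> \<in> H"
        unfolding P_def by metis
      show "P (G \<inter> H) \<mu>"
        unfolding P_def using * by (intro exI[of _ "F \<union> F'"] exI[of _ "min e e'"]) auto
    qed
  next
    case (UN K)
    show ?case
    proof
      fix \<mu> assume "\<mu> \<in> \<Union>K"
      then obtain k where k: "k \<in> K" "\<mu> \<in> k" by blast
      then have "P k \<mu>" using UN by auto
      then show "P (\<Union>K) \<mu>" unfolding P_def using k by blast
    qed
  next
    case (Basis s)
  then show ?case
  proof (elim CollectE exE conjE)
    fix f :: "(nat \<Rightarrow> nat) \<Rightarrow> real" and U
    assume s: "s = {\<mu> \<in> prob_measures Xfull. (\<integral>x. f x \<partial>\<mu>) \<in> U}"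
      and f: "continuous_on Xfull f" "bounded (f ` Xfull)" "open U"
    show "\<forall>\<mu>\<in>s. P s \<mu>"
    proof
      fix \<mu> assume "\<mu> \<in> s"
      then show "P s \<mu>" unfolding s using main[OF f, of \<mu>] by blast
    qed
  qed
  qed simp
  then have "P G \<mu>" using assms(2) by blast
  then obtain F e where F: "finite F" "0 < e" "\<forall>\<nu>\<in>prob_measures Xfull.
    (\<forall>w\<in>F. \<bar>measure \<nu> (cyl w) - measure \<mu> (cyl w)\<bar> < e) \<longrightarrow> \<nu> \<in> G"
    unfolding P_def by (elim exE conjE)
  show ?thesis by (rule that[OF F(1,2)]) (use F(3) in blast)
qed

text \<open>The words of length \<open>n\<close> index a partition of \<open>[0,1)\<close> into the intervals
  \<open>[l w, l w + m w)\<close>, where \<open>l w\<close> is the mass of the words preceding \<open>w\<close> lexicographically;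
  reading off the intervals containing a uniformly distributed point gives the required measure.\<close>

lemma exists_measure_cyl:
  fixes m :: "nat list \<Rightarrow> real"
  assumes nonneg: "\<And>w. 0 \<le> m w" and one: "m [] = 1"
    and zero: "\<And>w. 0 \<in> set w \<Longrightarrow> m w = 0"
    and sums: "\<And>w. (\<lambda>p. m (w @ [p])) sums m w"
  obtains \<mu> where "\<mu> \<in> prob_measures Xfull" "\<And>w. measure \<mu> (cyl w) = m w"
proof -
  define l where "l w = (\<Sum>i<length w. \<Sum>q<w ! i. m (take i w @ [q]))" for w
  define J where "J w = {l w ..< l w + m w}" for w
  have l_snoc: "l (w @ [p]) = l w + (\<Sum>q<p. m (w @ [q]))" for w p
    by (simp add: l_def nth_append)
  have J_snoc: "t \<in> J (w @ [p]) \<longleftrightarrow> l w + (\<Sum>q<p. m (w @ [q])) \<le> t \<and> t < l w + (\<Sum>q<Suc p. m (w @ [q]))" for t w p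
    by (auto simp: J_def l_snoc)
  have mono: "(\<Sum>q<p. m (w @ [q])) \<le> (\<Sum>q<p'. m (w @ [q]))" if "p \<le> p'" for w p p'
    using that nonneg by (intro sum_mono2) auto
  have J_sub: "t \<in> J w" if "t \<in> J (w @ [p])" for t w p
  proof -
    have "(\<Sum>q<Suc p. m (w @ [q])) \<le> m w"
      using sum_le_suminf[of "\<lambda>p. m (w @ [p])" "{..<Suc p}"] sums[of w] nonneg
      by (auto simp: sums_iff)
    moreover have "0 \<le> (\<Sum>q<p. m (w @ [q]))" using nonneg by (simp add: sum_nonneg)
    ultimately show ?thesis using that unfolding J_snoc by (auto simp: J_def)
  qed
  have J_ex: "\<exists>p. t < l w + (\<Sum>q<Suc p. m (w @ [q]))" if "t \<in> J w" for t w
  proof -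
    have "(\<lambda>p. l w + (\<Sum>q<p. m (w @ [q]))) \<longlonglongrightarrow> l w + m w"
      using sums[of w] by (intro tendsto_intros) (simp add: sums_def)
    moreover have "t < l w + m w" using that by (simp add: J_def)
    ultimately have "\<forall>\<^sub>F p in sequentially. t < l w + (\<Sum>q<p. m (w @ [q]))"
      by (rule order_tendstoD(1))
    then obtain N where "\<And>p. N \<le> p \<Longrightarrow> t < l w + (\<Sum>q<p. m (w @ [q]))"
      by (auto simp: eventually_sequentially)
    then show ?thesis by (meson le_Suc_eq order_refl)
  qed
  define nxt where "nxt t w = (LEAST p. t < l w + (\<Sum>q<Suc p. m (w @ [q])))" for t w
  have J_nxt: "t \<in> J (w @ [p]) \<longleftrightarrow> t \<in> J w \<and> p = nxt t w" for t w p
  proof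
    assume a: "t \<in> J (w @ [p])"
    have "nxt t w = p"
      unfolding nxt_def
    proof (rule Least_equality)
      show "t < l w + (\<Sum>q<Suc p. m (w @ [q]))" using a J_snoc by blast
      fix p' assume "t < l w + (\<Sum>q<Suc p'. m (w @ [q]))"
      then have "(\<Sum>q<p. m (w @ [q])) < (\<Sum>q<Suc p'. m (w @ [q]))" using a J_snoc[of t w p] by linarith
      then show "p \<le> p'" using mono[of "Suc p'" p w] by (meson not_less_eq_eq not_le)
    qed
    then show "t \<in> J w \<and> p = nxt t w" using J_sub[OF a] by simp
  next
    assume a: "t \<in> J w \<and> p = nxt t w"
    then have up: "t < l w + (\<Sum>q<Suc p. m (w @ [q]))"
      using J_ex[of t w] unfolding nxt_def by (metis (mono_tags, lifting) LeastI)
    have "l w + (\<Sum>q<p. m (w @ [q])) \<le> t"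
    proof (cases p)
      case 0
      then show ?thesis using a by (simp add: J_def)
    next
      case (Suc p')
      then have "\<not> t < l w + (\<Sum>q<Suc p'. m (w @ [q]))"
        using a not_less_Least[of p' "\<lambda>p. t < l w + (\<Sum>q<Suc p. m (w @ [q]))"] by (auto simp: nxt_def)
      then show ?thesis using Suc by simp
    qed
    then show "t \<in> J (w @ [p])" using up J_snoc by blast
  qed
  define wd where "wd t = rec_nat [] (\<lambda>_ w. w @ [nxt t w])" for t
  have wd_0: "wd t 0 = []" and wd_Suc: "wd t (Suc n) = wd t n @ [nxt t (wd t n)]" for t n
    by (simp_all add: wd_def)
  have J_Nil: "J [] = {0..<1}" by (simp add: J_def l_def one)
  have wd_iff: "t \<in> J w \<longleftrightarrow> t \<in> {0..<1} \<and> w = wd t (length w)" for t w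
  proof (induction w rule: rev_induct)
    case Nil
    then show ?case by (simp add: J_Nil wd_0)
  next
    case (snoc p w)
    show ?case unfolding J_nxt snoc.IH by (auto simp: wd_Suc)
  qed
  have len_wd: "length (wd t n) = n" for t n by (induction n) (auto simp: wd_0 wd_Suc)
  define X where "X t k = nxt t (wd t k)" for t k
  have wd_X: "wd t n = map (X t) [0..<n]" for t n
    by (induction n) (auto simp: wd_0 wd_Suc X_def)
  have X_full: "X t \<in> Xfull" if "t \<in> {0..<1}" for t
  proof -
    \<comment> \<open>A word containing 0 has mass 0, so its half-open interval is empty and no
      point reads it.\<close>
    have "X t k \<ge> 1" for k
    proof -
      have "t \<in> J (wd t (Suc k))" using that wd_iff[of t "wd t (Suc k)"] len_wd by simp
      then have "m (wd t (Suc k)) \<noteq> 0" by (auto simp: J_def)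
      then have "0 \<notin> set (wd t (Suc k))" using zero by blast
      then show ?thesis by (auto simp: wd_X One_nat_def Suc_le_eq)
    qed
    then show ?thesis by (simp add: full_shift_def)
  qed
  have pre: "X -` cyl w \<inter> {0..<1} = J w" for w
  proof (rule set_eqI)
    fix t
    have "t \<in> {0..<1} \<Longrightarrow> X t \<in> cyl w \<longleftrightarrow> wd t (length w) = w"
      unfolding wd_X by (rule cyl_eq_prefix[OF X_full])
    then show "t \<in> X -` cyl w \<inter> {0..<1} \<longleftrightarrow> t \<in> J w"
      unfolding wd_iff[of t w] by (metis Int_iff vimage_eq)
  qed
  have J_unit: "J w \<subseteq> {0..<1}" for w
  proof
    show "t \<in> {0..<1}" if "t \<in> J w" for t using that unfolding wd_iff[of t w] by (rule conjunct1)
  qed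
  have X_meas: "X \<in> measurable (restrict_space lborel {0..<1}) BX"
  proof (rule measurable_BX)
    fix w
    show "X -` cyl w \<inter> space (restrict_space lborel {0..<1}) \<in> sets (restrict_space lborel {0..<1})"
      using J_unit[of w]
      by (simp add: space_restrict_space pre sets_restrict_space)
         (intro image_eqI[of _ _ "J w"], auto simp: J_def)
  qed (use X_full in \<open>simp add: space_restrict_space\<close>)
  define \<mu> where "\<mu> = distr (restrict_space lborel {0..<1}) BX X"
  have meas: "emeasure \<mu> (cyl w) = ennreal (m w)" for w
  proof -
    have "emeasure \<mu> (cyl w) = emeasure (restrict_space lborel {0..<1}) (J w)"
      unfolding \<mu>_def using emeasure_distr[OF X_meas cyl_in_BX, of w] by (simp add: space_restrict_space pre)
    also have "\<dots> = emeasure lborel (J w)"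
      using J_unit by (intro emeasure_restrict_space) auto
    also have "\<dots> = ennreal (m w)" using nonneg by (simp add: J_def)
    finally show ?thesis .
  qed
  show ?thesis
  proof (rule that[of \<mu>])
    have "space \<mu> = cyl []" by (simp add: \<mu>_def)
    then have "prob_space \<mu>" using meas[of "[]"] one by (intro prob_spaceI) simp
    then show "\<mu> \<in> prob_measures Xfull" by (simp add: prob_measures_def \<mu>_def)
    show "measure \<mu> (cyl w) = m w" for w
      using meas[of w] nonneg by (simp add: measure_def)
  qed
qed

section \<open>Compact sets of measures\<close>

lemma compactin_weak_star_image:
  fixes S :: "(nat list \<Rightarrow> real) set"
  assumes S: "compact S" and h: "\<And>m. m \<in> S \<Longrightarrow> h m \<in> prob_measures Xfull"
    and hm: "\<And>m w. m \<in> S \<Longrightarrow> measure (h m) (cyl w) = m w"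
  shows "compactin (weak_star Xfull) (h ` S)"
proof (rule image_compactin)
  show "compactin (top_of_set S) S"
    using S by (simp add: compactin_subtopology)
  show "continuous_map (top_of_set S) (weak_star Xfull) h"
    unfolding continuous_map_def
  proof (intro conjI allI impI)
    show "h \<in> topspace (top_of_set S) \<rightarrow> topspace (weak_star Xfull)"
      using h by (auto simp: topspace_weak_star)
    fix G assume G: "openin (weak_star Xfull) G"
    show "openin (top_of_set S) {m \<in> topspace (top_of_set S). h m \<in> G}"
    proof (subst openin_subopen, intro ballI)
      fix m assume m: "m \<in> {m \<in> topspace (top_of_set S). h m \<in> G}"
      then obtain F e where F: "finite F" "0 < e"
        "\<And>\<nu>. \<nu> \<in> prob_measures Xfull \<Longrightarrow> (\<And>w. w \<in> F \<Longrightarrow> \<bar>measure \<nu> (cyl w) - measure (h m) (cyl w)\<bar> < e) \<Longrightarrow> \<nu> \<in> G"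
        using weak_star_nhd[OF G, of "h m"] by auto
      \<comment> \<open>A basic neighbourhood of \<open>h m\<close> constrains finitely many masses,
        hence contains the image of an open set of the product topology on tables of masses.\<close>
      define T where "T = (\<Inter>w\<in>F. (\<lambda>m'. m' w) -` ball (m w) e)"
      have "open T"
        unfolding T_def using F(1)
        by (intro open_INT ballI open_vimage open_ball continuous_on_product_coordinates)
      moreover have "S \<inter> T \<subseteq> {m \<in> topspace (top_of_set S). h m \<in> G}"
      proof
        fix m' assume m': "m' \<in> S \<inter> T"
        then have "h m' \<in> G"
          using m by (intro F(3)) (auto simp: h hm T_def dist_real_def abs_minus_commute)
        then show "m' \<in> {m \<in> topspace (top_of_set S). h m \<in> G}" using m' by simp
      qed
      moreover have "m \<in> S \<inter> T" using m F(2) by (auto simp: T_def)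
      ultimately show "\<exists>T. openin (top_of_set S) T \<and> m \<in> T \<and> T \<subseteq> {m \<in> topspace (top_of_set S). h m \<in> G}"
        by (intro exI[of _ "S \<inter> T"]) (auto intro: openin_open_Int)
    qed
  qed
qed

text \<open>Every compact subset of \<open>Xfull\<close> lies in a product of finite sets
  \<open>{1..b j}\<close> whose bounds depend on the position; hence a function b in place of a
  single bound.\<close>

definition bounded_words :: "(nat \<Rightarrow> nat) \<Rightarrow> nat \<Rightarrow> nat list set" where
  "bounded_words b i = {w. length w = i \<and> (\<forall>j<i. w ! j \<in> {1..b j})}"

lemma finite_bounded_words_fun: "finite (bounded_words b i)"
proof -
  have "bounded_words b i \<subseteq> {w. length w = i \<and> set w \<subseteq> {..Max (b ` {..i})}}"
  proof
    fix w assume w: "w \<in> bounded_words b i"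
    have "w ! j \<le> Max (b ` {..i})" if "j < i" for j
    proof -
      have "w ! j \<le> b j" using w that by (auto simp: bounded_words_def)
      also have "\<dots> \<le> Max (b ` {..i})" using that by (intro Max_ge) auto
      finally show ?thesis .
    qed
    then show "w \<in> {w. length w = i \<and> set w \<subseteq> {..Max (b ` {..i})}}"
      using w by (auto simp: bounded_words_def in_set_conv_nth)
  qed
  then show ?thesis using finite_bounded_words finite_subset by blast
qed

text \<open>Only an inequality is assumed, because pointwise limits of mass tables may lose mass
  among large letters. The induction on the length groups words by all but their last
  letter.\<close>

lemma sum_words_le:
  fixes m :: "nat list \<Rightarrow> real"
  assumes nonneg: "\<And>w. 0 \<le> m w" and one: "m [] = 1"
    and le: "\<And>w Q. (\<Sum>p\<le>Q. m (w @ [p])) \<le> m w"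
  shows "finite F \<Longrightarrow> (\<And>w. w \<in> F \<Longrightarrow> length w = i) \<Longrightarrow> (\<Sum>w\<in>F. m w) \<le> 1"
proof (induction i arbitrary: F)
  case 0
  then have "F \<subseteq> {[]}" by auto
  then have "F = {} \<or> F = {[]}" by auto
  then show ?case using one by auto
next
  case (Suc i)
  have "(\<Sum>w\<in>F. m w) \<le> (\<Sum>w\<in>butlast ` F. \<Sum>p\<le>Max (last ` F). m (w @ [p]))"
  proof -
    have "(\<Sum>w\<in>F. m w) \<le> (\<Sum>w\<in>(\<lambda>(w, p). w @ [p]) ` (butlast ` F \<times> {..Max (last ` F)}). m w)"
    proof (rule sum_mono2)
      show "F \<subseteq> (\<lambda>(w, p). w @ [p]) ` (butlast ` F \<times> {..Max (last ` F)})"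
      proof
        fix w assume w: "w \<in> F"
        then have "w = butlast w @ [last w]" using Suc.prems(2)[OF w] by (cases w) auto
        moreover have "last w \<le> Max (last ` F)" using w Suc.prems(1) by simp
        ultimately show "w \<in> (\<lambda>(w, p). w @ [p]) ` (butlast ` F \<times> {..Max (last ` F)})"
          using w by (intro image_eqI[of _ _ "(butlast w, last w)"]) auto
      qed
    qed (use Suc.prems nonneg in auto)
    also have "\<dots> = (\<Sum>(w, p)\<in>butlast ` F \<times> {..Max (last ` F)}. m (w @ [p]))"
      by (subst sum.reindex) (auto simp: inj_on_def case_prod_beta)
    finally show ?thesis by (simp add: sum.cartesian_product)
  qed
  also have "\<dots> \<le> (\<Sum>w\<in>butlast ` F. m w)" using le by (intro sum_mono)
  also have "\<dots> \<le> 1" using Suc.prems by (intro Suc.IH) auto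
  finally show ?case .
qed

text \<open>Tightness gives compactness, shown on tables of cylinder masses. Countable additivity is
  not a closed condition on tables, the inequality for finite sums is; so \<open>S\<close> asks for
  the latter inside a cube, and the lower bounds on bounded words force equality afterwards.\<close>

lemma compactin_tight:
  fixes b :: "nat \<Rightarrow> nat \<Rightarrow> nat"
  shows "compactin (weak_star Xfull) {\<mu> \<in> prob_measures Xfull.
    \<forall>k i. 1 - (1/2) ^ k \<le> (\<Sum>w\<in>bounded_words (b k) i. measure \<mu> (cyl w))}"
proof -
  define S :: "(nat list \<Rightarrow> real) set" where "S = {m. (\<forall>w. m w \<in> {0..1}) \<and> m [] = 1 \<and>
     (\<forall>w. 0 \<in> set w \<longrightarrow> m w = 0) \<and> (\<forall>w Q. (\<Sum>p\<le>Q. m (w @ [p])) \<le> m w) \<and>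
     (\<forall>k i. 1 - (1/2) ^ k \<le> (\<Sum>w\<in>bounded_words (b k) i. m w))}"
  have "compact S"
  proof -
    have cube: "compact (Pi\<^sub>E UNIV (\<lambda>_. {0..1}) :: (nat list \<Rightarrow> real) set)"
    proof -
      have "compactin (product_topology (\<lambda>_. euclidean) UNIV) (Pi\<^sub>E UNIV (\<lambda>_. {0..1}) :: (nat list \<Rightarrow> real) set)"
        by (auto simp: compactin_PiE)
      then show ?thesis by (simp add: euclidean_product_topology)
    qed
    have cont: "continuous_on UNIV (\<lambda>m :: nat list \<Rightarrow> real. m w)" for w
      by (rule continuous_on_product_coordinates)
    have "closed S"
      unfolding S_def
      by (intro closed_Collect_conj closed_Collect_all closed_Collect_imp closed_Collect_le closed_Collect_eq
          continuous_intros cont open_Collect_const | simp)+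
    moreover have "S = Pi\<^sub>E UNIV (\<lambda>_. {0..1}) \<inter> S" by (auto simp: S_def PiE_iff)
    ultimately show ?thesis using compact_Int_closed[OF cube] by metis
  qed
  have sums: "(\<lambda>p. m (w @ [p])) sums m w" if m: "m \<in> S" for m w
  proof -
    have nonneg: "0 \<le> m w" for w using m by (simp add: S_def)
    have le: "(\<Sum>p\<le>Q. m (w @ [p])) \<le> m w" for w Q using m by (simp add: S_def)
    have le': "(\<Sum>p<Q. m (w @ [p])) \<le> m w" for w Q
      using le[of w "Q - 1"] nonneg by (cases Q) (auto simp: lessThan_Suc_atMost)
    have summ: "summable (\<lambda>p. m (w @ [p]))"
      using nonneg le' by (intro summableI_nonneg_bounded[of _ "m w"])
    \<comment> \<open>Bounded words one letter longer than w carry at least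
      \<open>1 - (1/2) ^ k\<close>, while the words of the length of w other than w carry at most
      \<open>1 - m w\<close>; the successors of w must make up the difference.\<close>
    have "m w - suminf (\<lambda>p. m (w @ [p])) \<le> (1/2) ^ k" for k
    proof -
      define i where "i = length w"
      \<comment> \<open>The word w is inserted because it need not respect the bounds
        itself.\<close>
      define F where "F = insert w (bounded_words (b k) i)"
      define Q where "Q = b k i"
      have fin: "finite F" and len: "\<And>v. v \<in> F \<Longrightarrow> length v = i"
        using finite_bounded_words_fun by (auto simp: F_def i_def bounded_words_def)
      have "1 - (1/2) ^ k \<le> (\<Sum>v\<in>bounded_words (b k) (Suc i). m v)" using m by (simp add: S_def)
      also have "\<dots> \<le> (\<Sum>v\<in>(\<lambda>(v, p). v @ [p]) ` (F \<times> {..Q}). m v)"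
      proof (rule sum_mono2)
        show "bounded_words (b k) (Suc i) \<subseteq> (\<lambda>(v, p). v @ [p]) ` (F \<times> {..Q})"
        proof
          fix v assume v: "v \<in> bounded_words (b k) (Suc i)"
          then have len: "length v = Suc i" by (simp add: bounded_words_def)
          then have *: "v = butlast v @ [last v]" by (cases v) auto
          have "last v = v ! i" using len by (metis diff_Suc_1 last_conv_nth length_0_conv nat.distinct(1))
          then have "last v \<le> Q" using v by (simp add: bounded_words_def Q_def)
          moreover have "butlast v \<in> F"
            using v len by (auto simp: F_def bounded_words_def nth_butlast)
          ultimately show "v \<in> (\<lambda>(v, p). v @ [p]) ` (F \<times> {..Q})"
            using * by (intro image_eqI[of _ _ "(butlast v, last v)"]) auto
        qed
      qed (use fin nonneg in auto)
      also have "\<dots> = (\<Sum>(v, p)\<in>F \<times> {..Q}. m (v @ [p]))"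
        by (subst sum.reindex) (auto simp: inj_on_def case_prod_beta)
      also have "\<dots> = (\<Sum>v\<in>F. \<Sum>p\<le>Q. m (v @ [p]))" by (simp add: sum.cartesian_product)
      also have "\<dots> = (\<Sum>p\<le>Q. m (w @ [p])) + (\<Sum>v\<in>F - {w}. \<Sum>p\<le>Q. m (v @ [p]))"
        using fin by (subst sum.remove[of F w]) (auto simp: F_def)
      also have "\<dots> \<le> suminf (\<lambda>p. m (w @ [p])) + (\<Sum>v\<in>F - {w}. m v)"
        using summ nonneg le by (intro add_mono sum_le_suminf sum_mono) auto
      also have "(\<Sum>v\<in>F - {w}. m v) = (\<Sum>v\<in>F. m v) - m w"
        using fin by (subst sum.remove[of F w]) (auto simp: F_def)
      also have "(\<Sum>v\<in>F. m v) \<le> 1"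
        using m by (intro sum_words_le[of m F i] nonneg le fin len) (auto simp: S_def)
      finally show ?thesis by simp
    qed
    moreover have "(\<lambda>k. (1/2::real) ^ k) \<longlonglongrightarrow> 0" by (rule LIMSEQ_power_zero) simp
    ultimately have "m w - suminf (\<lambda>p. m (w @ [p])) \<le> 0"
      by (intro LIMSEQ_le_const[of _ 0]) auto
    moreover have "suminf (\<lambda>p. m (w @ [p])) \<le> m w" using le' by (intro suminf_le_const summ)
    ultimately have "suminf (\<lambda>p. m (w @ [p])) = m w" by simp
    then show ?thesis using summ by (simp add: sums_iff)
  qed
  have "\<exists>\<mu>. \<mu> \<in> prob_measures Xfull \<and> (\<forall>w. measure \<mu> (cyl w) = m w)" if m: "m \<in> S" for m
  proof -
    have "\<And>w. 0 \<le> m w" "m [] = 1" "\<And>w. 0 \<in> set w \<Longrightarrow> m w = 0" using m by (auto simp: S_def)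
    from exists_measure_cyl[of m, OF this sums[OF m]] show ?thesis by metis
  qed
  then obtain h where h: "\<And>m. m \<in> S \<Longrightarrow> h m \<in> prob_measures Xfull"
    "\<And>m w. m \<in> S \<Longrightarrow> measure (h m) (cyl w) = m w" by metis
  have "h ` S = {\<mu> \<in> prob_measures Xfull. \<forall>k i. 1 - (1/2) ^ k \<le> (\<Sum>w\<in>bounded_words (b k) i. measure \<mu> (cyl w))}"
    (is "_ = ?K")
  proof (intro equalityI subsetI)
    fix \<mu> assume "\<mu> \<in> h ` S"
    then show "\<mu> \<in> ?K" using h by (auto simp: S_def)
  next
    fix \<mu> assume mu: "\<mu> \<in> ?K"
    then have mu': "\<mu> \<in> prob_measures Xfull" by blast
    interpret m: prob_space \<mu> by (rule prob_measuresD[OF mu'])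
    define m where "m w = measure \<mu> (cyl w)" for w
    have "m \<in> S"
      unfolding S_def
    proof (intro CollectI conjI allI impI)
      show "(\<Sum>p\<le>Q. m (w @ [p])) \<le> m w" for w Q
        using measure_cyl_sums[OF mu', of w] sum_le_suminf[of "\<lambda>p. m (w @ [p])" "{..Q}"]
        by (auto simp: m_def sums_iff)
      show "m [] = 1" using m.prob_space prob_measuresD(2)[OF mu'] by (simp add: m_def)
    qed (use mu in \<open>auto simp: m_def cyl_empty\<close>)
    moreover have "h m = \<mu>"
      using h[OF \<open>m \<in> S\<close>] mu' by (intro measure_eqI_cyl) (auto simp: m_def)
    ultimately show "\<mu> \<in> h ` S" by blast
  qed
  then show ?thesis using compactin_weak_star_image[OF \<open>compact S\<close> h] by simp
qed

section \<open>Acceptable potentials and their pressure\<close>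

text \<open>The limit is the infimum of \<open>u n / n\<close>, and the linear lower bound keeps it
  finite.\<close>

lemma fekete:
  fixes u :: "nat \<Rightarrow> real"
  assumes sub: "\<And>m n. 1 \<le> m \<Longrightarrow> 1 \<le> n \<Longrightarrow> u (m + n) \<le> u m + u n"
    and lb: "\<And>n. 1 \<le> n \<Longrightarrow> c * real n \<le> u n"
  obtains l where "(\<lambda>n. u n / real n) \<longlonglongrightarrow> l"
proof -
  define V where "V = (\<lambda>n. u n / real n) ` {1..}"
  define l where "l = Inf V"
  have bdd: "bdd_below V"
    using lb by (intro bdd_belowI[of _ c]) (auto simp: V_def field_simps)
  have lower: "l \<le> u n / real n" if "1 \<le> n" for n
    unfolding l_def using that by (intro cInf_lower bdd) (auto simp: V_def)
  have mult: "u (q * m + r) \<le> real q * u m + \<bar>u r\<bar>" if "1 \<le> m" "1 \<le> q" for q m r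
  proof -
    have q: "u (q * m) \<le> real q * u m" using \<open>1 \<le> q\<close>
    proof (induction q rule: dec_induct)
      case (step q)
      have "1 * 1 \<le> q * m" using step(1) that(1) by (rule mult_le_mono)
      then have "u (q * m + m) \<le> u (q * m) + u m" using that(1) by (intro sub) auto
      then show ?case using step by (simp add: algebra_simps)
    qed simp
    show ?thesis
    proof (cases "r = 0")
      case False
      have "1 * 1 \<le> q * m" using that by (intro mult_le_mono)
      then have "u (q * m + r) \<le> u (q * m) + u r" using False by (intro sub) (auto simp: One_nat_def)
      then show ?thesis using q by linarith
    qed (use q in simp)
  qed
  have "(\<lambda>n. u n / real n) \<longlonglongrightarrow> l"
  proof (rule LIMSEQ_I)
    fix e :: real assume "0 < e"
    have "Inf V < l + e / 2" using \<open>0 < e\<close> by (simp add: l_def)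
    moreover have "V \<noteq> {}" by (auto simp: V_def)
    ultimately obtain m where m: "1 \<le> m" "u m / real m < l + e / 2"
      using cInf_less_iff[OF _ bdd, of "l + e / 2"] by (auto simp: V_def)
    \<comment> \<open>Absorbs the incomplete last block and the passage from \<open>q * m\<close> to
      n in the factor of \<open>u m / m\<close>.\<close>
    define M where "M = (\<Sum>r<m. \<bar>u r\<bar>) + \<bar>u m\<bar>"
    obtain N :: nat where N: "2 * M / e < real N" using reals_Archimedean2 by blast
    show "\<exists>N. \<forall>n\<ge>N. norm (u n / real n - l) < e"
    proof (intro exI allI impI)
      fix n assume n: "max N m \<le> n"
      define q r where "q = n div m" and "r = n mod m"
      have nqr: "n = q * m + r" "r < m" "1 \<le> q"
        using m(1) n by (auto simp: q_def r_def div_greater_zero_iff Suc_le_eq One_nat_def)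
      have "\<bar>u r\<bar> \<le> (\<Sum>r<m. \<bar>u r\<bar>)" using nqr(2) by (intro member_le_sum) auto
      then have 1: "u n \<le> real q * u m + (\<Sum>r<m. \<bar>u r\<bar>)"
        using mult[OF m(1) nqr(3), of r] nqr(1) by simp
      have "real q * u m = real q * real m * (u m / real m)" using m(1) by simp
      also have "\<dots> = real n * (u m / real m) - real r * (u m / real m)"
        using nqr(1) by (simp add: algebra_simps)
      finally have 2: "real q * u m = real n * (u m / real m) - real r * (u m / real m)" .
      have 3: "- (real r * (u m / real m)) \<le> \<bar>u m\<bar>"
      proof -
        have "- (real r * (u m / real m)) \<le> \<bar>real r * (u m / real m)\<bar>" by (rule abs_ge_minus_self)
        also have "\<dots> = (real r / real m) * \<bar>u m\<bar>" by (simp add: abs_mult)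
        also have "\<dots> \<le> 1 * \<bar>u m\<bar>" using nqr(2) by (intro mult_right_mono) auto
        finally show ?thesis by simp
      qed
      have "u n \<le> real n * (u m / real m) + M" using 1 2 3 unfolding M_def by linarith
      then have "u n / real n \<le> u m / real m + M / real n"
        using n m(1) by (simp add: field_simps)
      moreover have "M / real n < e / 2"
      proof -
        have "2 * M / e < real n" using N n by simp
        then have "2 * M < e * real n" using \<open>0 < e\<close> by (simp add: field_simps)
        then show ?thesis using n m(1) by (simp add: field_simps)
      qed
      moreover have "l \<le> u n / real n" using n m(1) by (intro lower) simp
      ultimately show "norm (u n / real n - l) < e" using m(2) unfolding real_norm_def by linarith
    qed
  qed
  then show ?thesis by (rule that)
qed

section \<open>Sums over words and over periodic points\<close>

lemma nn_integral_words_append: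
  fixes A :: "nat set" and f :: "nat list \<Rightarrow> ennreal"
  shows "(\<integral>\<^sup>+ w. f w \<partial>count_space (words A (m + n))) =
    (\<integral>\<^sup>+ u. (\<integral>\<^sup>+ v. f (u @ v) \<partial>count_space (words A n)) \<partial>count_space (words A m))"
proof -
  have bij: "bij_betw (\<lambda>(u, v). u @ v) (words A m \<times> words A n) (words A (m + n))"
  proof (rule bij_betw_byWitness[of _ "\<lambda>w. (take m w, drop m w)"])
    show "(\<lambda>w. (take m w, drop m w)) ` words A (m + n) \<subseteq> words A m \<times> words A n"
      by (auto simp: words_def dest: in_set_takeD in_set_dropD)
  qed (auto simp: words_def)
  interpret S: sigma_finite_measure "count_space (words A n)"
    by (rule sigma_finite_measure_count_space_countable) simp
  have pm: "count_space (words A m) \<Otimes>\<^sub>M count_space (words A n) = count_space (words A m \<times> words A n)"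
    by (rule pair_measure_countable) auto
  have "(\<integral>\<^sup>+ w. f w \<partial>count_space (words A (m + n))) =
     (\<integral>\<^sup>+ z. f (case z of (u, v) \<Rightarrow> u @ v) \<partial>(count_space (words A m) \<Otimes>\<^sub>M count_space (words A n)))"
    unfolding pm by (rule nn_integral_bij_count_space[OF bij, symmetric])
  also have "\<dots> = (\<integral>\<^sup>+ u. (\<integral>\<^sup>+ v. f (u @ v) \<partial>count_space (words A n)) \<partial>count_space (words A m))"
    by (subst S.nn_integral_fst[symmetric]) (auto simp: pm)
  finally show ?thesis .
qed

lemma nn_integral_words_1:
  fixes f :: "nat list \<Rightarrow> ennreal"
  shows "(\<integral>\<^sup>+ w. f w \<partial>count_space (words A 1)) = (\<integral>\<^sup>+ p. f [p] \<partial>count_space A)"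
proof -
  have "bij_betw (\<lambda>p. [p]) A (words A 1)"
    by (rule bij_betw_byWitness[of _ hd]) (auto simp: words_def length_Suc_conv One_nat_def)
  from nn_integral_bij_count_space[OF this, of f] show ?thesis by simp
qed

lemma nn_integral_words_prod:
  fixes A :: "nat set" and f :: "nat \<Rightarrow> ennreal"
  shows "(\<integral>\<^sup>+ w. (\<Prod>k<n. f (w ! k)) \<partial>count_space (words A n)) = (\<integral>\<^sup>+ p. f p \<partial>count_space A) ^ n"
proof (induction n)
  case 0
  have "words A 0 = {[]}" by (auto simp: words_def)
  then show ?case by (simp add: nn_integral_count_space_finite)
next
  case (Suc n)
  have "(\<integral>\<^sup>+ w. (\<Prod>k<Suc n. f (w ! k)) \<partial>count_space (words A (1 + n)))
     = (\<integral>\<^sup>+ p. (\<integral>\<^sup>+ v. (\<Prod>k<Suc n. f (([p] @ v) ! k)) \<partial>count_space (words A n)) \<partial>count_space A)"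
    unfolding nn_integral_words_append nn_integral_words_1 ..
  also have "\<dots> = (\<integral>\<^sup>+ p. (\<integral>\<^sup>+ v. f p * (\<Prod>k<n. f (v ! k)) \<partial>count_space (words A n)) \<partial>count_space A)"
    by (simp only: prod.lessThan_Suc_shift) simp
  also have "\<dots> = (\<integral>\<^sup>+ p. f p * (\<integral>\<^sup>+ p. f p \<partial>count_space A) ^ n \<partial>count_space A)"
    by (simp add: nn_integral_cmult Suc.IH)
  also have "\<dots> = (\<integral>\<^sup>+ p. f p \<partial>count_space A) ^ Suc n"
    by (simp add: nn_integral_multc)
  finally show ?case by (simp add: One_nat_def)
qed

definition per :: "nat list \<Rightarrow> nat \<Rightarrow> nat" where
  "per w k = w ! (k mod length w)"

lemma per_Xfull: "w \<in> words {1..} n \<Longrightarrow> 1 \<le> n \<Longrightarrow> per w \<in> Xfull"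
  by (auto simp: per_def words_def full_shift_def subset_iff)

lemma per_cyl: "w \<in> words {1..} n \<Longrightarrow> 1 \<le> n \<Longrightarrow> per w \<in> cyl w"
  using per_Xfull[of w n] by (auto simp: cylinder_def per_def words_def)

lemma periodic_pointsD:
  assumes "x \<in> periodic_points n"
  shows "x \<in> Xfull" "x (k + n) = x k"
proof -
  show "x \<in> Xfull" using assms by (simp add: periodic_points_def)
  have "(\<lambda>k. x (n + k)) = x" using assms by (simp add: periodic_points_def funpow_left_shift)
  then show "x (k + n) = x k" by (metis add.commute)
qed

lemma periodic_points_mod:
  assumes "x \<in> periodic_points n"
  shows "x k = x (k mod n)"
proof -
  have "x (r + q * n) = x r" for q r
  proof (induction q)
    case (Suc q)
    have "x (r + q * n + n) = x (r + q * n)" by (rule periodic_pointsD(2)[OF assms])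
    then show ?case using Suc by (simp add: algebra_simps)
  qed simp
  from this[of "k mod n" "k div n"] show ?thesis by simp
qed

lemma per_periodic:
  assumes "w \<in> words {1..} n" "1 \<le> n"
  shows "per w \<in> periodic_points n"
  using assms per_Xfull[OF assms]
  by (auto simp: periodic_points_def funpow_left_shift per_def words_def)

lemma bij_betw_per:
  assumes "1 \<le> n"
  shows "bij_betw per (words {1..} n) (periodic_points n)"
proof (rule bij_betw_byWitness[of _ "\<lambda>x. map x [0..<n]"])
  show "\<forall>w\<in>words {1..} n. map (per w) [0..<n] = w"
    by (auto simp: words_def per_def intro!: nth_equalityI)
  show "\<forall>x\<in>periodic_points n. per (map x [0..<n]) = x"
  proof (intro ballI ext)
    fix x k assume x: "x \<in> periodic_points n"
    show "per (map x [0..<n]) k = x k"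
      using assms periodic_points_mod[OF x, of k] by (simp add: per_def)
  qed
  show "per ` words {1..} n \<subseteq> periodic_points n"
    using per_periodic[OF _ assms] by auto
  show "(\<lambda>x. map x [0..<n]) ` periodic_points n \<subseteq> words {1..} n"
    using periodic_pointsD(1) by (fastforce simp: words_def full_shift_def)
qed

lemma nn_integral_periodic_points:
  assumes "1 \<le> n"
  shows "(\<integral>\<^sup>+ x. f x \<partial>count_space (periodic_points n)) = (\<integral>\<^sup>+ w. f (per w) \<partial>count_space (words {1..} n))"
  by (rule nn_integral_bij_count_space[OF bij_betw_per[OF assms], symmetric])

lemma left_shift_Xfull: "x \<in> Xfull \<Longrightarrow> (left_shift ^^ k) x \<in> Xfull"
  by (auto simp: funpow_left_shift full_shift_def)

lemma birkhoff_sum_add: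
  "birkhoff_sum \<phi> (m + n) x = birkhoff_sum \<phi> m x + birkhoff_sum \<phi> n ((left_shift ^^ m) x)"
proof -
  have "(\<Sum>k<m + n. \<phi> ((left_shift ^^ k) x)) =
    (\<Sum>k<m. \<phi> ((left_shift ^^ k) x)) + (\<Sum>k<n. \<phi> ((left_shift ^^ (m + k)) x))"
    by (induction n) auto
  moreover have "(left_shift ^^ (m + k)) x = (left_shift ^^ k) ((left_shift ^^ m) x)" for k
    by (simp add: funpow_left_shift add.assoc)
  ultimately show ?thesis by (simp add: birkhoff_sum_def)
qed

lemma acceptable_oscillation:
  assumes "acceptable {1..} \<phi>"
  obtains D where "0 \<le> D" "\<And>x y. x \<in> Xfull \<Longrightarrow> y \<in> Xfull \<Longrightarrow> x 0 = y 0 \<Longrightarrow> \<bar>\<phi> x - \<phi> y\<bar> \<le> D"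
proof -
  define s where "s = (SUP p\<in>{1::nat..}. (SUP x\<in>cyl [p]. ereal (\<phi> x)) - (INF x\<in>cyl [p]. ereal (\<phi> x)))"
  have s: "s < \<infinity>" using assms by (simp add: acceptable_def s_def)
  have le: "ereal (\<phi> x - \<phi> y) \<le> s" if "x \<in> Xfull" "y \<in> Xfull" "x 0 = y 0" for x y
  proof -
    have x: "x \<in> cyl [x 0]" "y \<in> cyl [x 0]" "x 0 \<in> {1..}"
      using that by (auto simp: cylinder_def full_shift_def)
    have "ereal (\<phi> x) - ereal (\<phi> y) \<le> (SUP x\<in>cyl [x 0]. ereal (\<phi> x)) - (INF x\<in>cyl [x 0]. ereal (\<phi> x))"
      using x by (intro ereal_minus_mono SUP_upper INF_lower)
    also have "\<dots> \<le> s" unfolding s_def using x(3) by (intro SUP_upper)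
    finally show ?thesis by simp
  qed
  show ?thesis
  proof (rule that[of "max 0 (real_of_ereal s)"])
    fix x y :: "nat \<Rightarrow> nat" assume xy: "x \<in> Xfull" "y \<in> Xfull" "x 0 = y 0"
    show "\<bar>\<phi> x - \<phi> y\<bar> \<le> max 0 (real_of_ereal s)"
      using le[OF xy] le[OF xy(2) xy(1) xy(3)[symmetric]] s by (cases s) (auto simp: max_def)
  qed simp
qed

lemma acceptable_uniform:
  assumes "acceptable {1..} \<phi>" "0 < e"
  obtains n where "\<And>x y. x \<in> Xfull \<Longrightarrow> y \<in> Xfull \<Longrightarrow> (\<And>k. k < n \<Longrightarrow> x k = y k) \<Longrightarrow> \<bar>\<phi> x - \<phi> y\<bar> < e"
proof -
  obtain d where d: "0 < d" "\<And>x y. x \<in> Xfull \<Longrightarrow> y \<in> Xfull \<Longrightarrow> seq_dist x y < d \<Longrightarrow> \<bar>\<phi> x - \<phi> y\<bar> < e"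
    using assms unfolding acceptable_def by blast
  obtain n :: nat where n: "- ln d < real n" using reals_Archimedean2 by blast
  show ?thesis
  proof (rule that[of n])
    fix x y :: "nat \<Rightarrow> nat" assume xy: "x \<in> Xfull" "y \<in> Xfull" "\<And>k. k < n \<Longrightarrow> x k = y k"
    have "seq_dist x y < d"
    proof (cases "x = y")
      case False
      then obtain k where "x k \<noteq> y k" by blast
      then have "x (LEAST k. x k \<noteq> y k) \<noteq> y (LEAST k. x k \<noteq> y k)" by (rule LeastI)
      then have "n \<le> (LEAST k. x k \<noteq> y k)" using xy(3) not_le by blast
      then have "- real (Suc (LEAST k. x k \<noteq> y k)) < ln d" using n by linarith
      then have "exp (- real (Suc (LEAST k. x k \<noteq> y k))) < exp (ln d)" by (simp only: exp_less_mono)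
      then show ?thesis using False d(1) by (simp add: seq_dist_def)
    qed (use d(1) in \<open>simp add: seq_dist_def\<close>)
    then show "\<bar>\<phi> x - \<phi> y\<bar> < e" using d(2) xy by blast
  qed
qed

section \<open>Birkhoff sums, letter weights and existence of the pressure\<close>

locale acceptable_potential =
  fixes \<phi> :: "(nat \<Rightarrow> nat) \<Rightarrow> real"
  assumes acceptable: "acceptable {1..} \<phi>" and pressure_finite: "pressure {1..} \<phi> < \<infinity>"
begin

abbreviation S :: "nat \<Rightarrow> (nat \<Rightarrow> nat) \<Rightarrow> real" where
  "S \<equiv> birkhoff_sum \<phi>"

definition osc :: real where
  "osc = (SOME D. 0 \<le> D \<and> (\<forall>x\<in>Xfull. \<forall>y\<in>Xfull. x 0 = y 0 \<longrightarrow> \<bar>\<phi> x - \<phi> y\<bar> \<le> D))"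

lemma osc: "0 \<le> osc" "x \<in> Xfull \<Longrightarrow> y \<in> Xfull \<Longrightarrow> x 0 = y 0 \<Longrightarrow> \<bar>\<phi> x - \<phi> y\<bar> \<le> osc"
proof -
  have "\<exists>D. 0 \<le> D \<and> (\<forall>x\<in>Xfull. \<forall>y\<in>Xfull. x 0 = y 0 \<longrightarrow> \<bar>\<phi> x - \<phi> y\<bar> \<le> D)"
    using acceptable_oscillation[OF acceptable] by metis
  from someI_ex[OF this] show "0 \<le> osc" "x \<in> Xfull \<Longrightarrow> y \<in> Xfull \<Longrightarrow> x 0 = y 0 \<Longrightarrow> \<bar>\<phi> x - \<phi> y\<bar> \<le> osc"
    unfolding osc_def by blast+
qed

lemma continuous_potential: "continuous_on Xfull \<phi>"
proof (rule prefix_continuous_on_Xfull)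
  fix x and e :: real assume x: "x \<in> Xfull" "0 < e"
  obtain n where "\<And>x y. x \<in> Xfull \<Longrightarrow> y \<in> Xfull \<Longrightarrow> (\<And>k. k < n \<Longrightarrow> x k = y k) \<Longrightarrow> \<bar>\<phi> x - \<phi> y\<bar> < e"
    using acceptable_uniform[OF acceptable x(2)] by metis
  then show "\<exists>n. \<forall>y\<in>Xfull. (\<forall>k<n. y k = x k) \<longrightarrow> \<bar>\<phi> y - \<phi> x\<bar> < e" using x(1) by blast
qed

text \<open>At time k the two orbits still share \<open>n - k\<close> coordinates. Uniform
  continuity keeps the difference below e per step except during the last \<open>K\<close> steps,
  which cost at most \<open>osc\<close> each; hence a constant plus \<open>e * n\<close> rather than
  a uniform bound.\<close>

lemma distortion:
  assumes "0 < e"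
  obtains C where "0 \<le> C"
    "\<And>n x y. x \<in> Xfull \<Longrightarrow> y \<in> Xfull \<Longrightarrow> (\<And>k. k < n \<Longrightarrow> x k = y k) \<Longrightarrow> \<bar>S n x - S n y\<bar> \<le> C + e * real n"
proof -
  obtain K where K: "\<And>x y. x \<in> Xfull \<Longrightarrow> y \<in> Xfull \<Longrightarrow> (\<And>k. k < K \<Longrightarrow> x k = y k) \<Longrightarrow> \<bar>\<phi> x - \<phi> y\<bar> < e"
    using acceptable_uniform[OF acceptable assms] by metis
  show ?thesis
  proof (rule that[of "osc * real K"])
    fix n x y assume x: "x \<in> Xfull" "y \<in> Xfull" "\<And>k. k < n \<Longrightarrow> x k = y k"
    have "\<bar>S n x - S n y\<bar> \<le> (\<Sum>k<n. \<bar>\<phi> ((left_shift ^^ k) x) - \<phi> ((left_shift ^^ k) y)\<bar>)"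
      unfolding birkhoff_sum_def sum_subtractf[symmetric] by (rule sum_abs)
    also have "\<dots> \<le> (\<Sum>k<n. e + osc * of_bool (n < k + K))"
    proof (rule sum_mono)
      fix k assume k: "k \<in> {..<n}"
      show "\<bar>\<phi> ((left_shift ^^ k) x) - \<phi> ((left_shift ^^ k) y)\<bar> \<le> e + osc * of_bool (n < k + K)"
      proof (cases "n < k + K")
        case True
        have "\<bar>\<phi> ((left_shift ^^ k) x) - \<phi> ((left_shift ^^ k) y)\<bar> \<le> osc"
          using x k by (intro osc left_shift_Xfull) (auto simp: funpow_left_shift)
        then show ?thesis using True assms by simp
      next
        case False
        then have "\<bar>\<phi> ((left_shift ^^ k) x) - \<phi> ((left_shift ^^ k) y)\<bar> < e"
          using x k by (intro K left_shift_Xfull) (auto simp: funpow_left_shift)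
        then show ?thesis using False by simp
      qed
    qed
    also have "\<dots> = e * real n + osc * real (card {k. k < n \<and> n < k + K})"
      by (simp add: sum.distrib sum_distrib_left[symmetric] sum_of_bool_eq Int_def)
    also have "card {k. k < n \<and> n < k + K} \<le> K"
    proof -
      have "card {k. k < n \<and> n < k + K} \<le> card {n - K..<n}" by (intro card_mono) auto
      then show ?thesis by simp
    qed
    then have "e * real n + osc * real (card {k. k < n \<and> n < k + K}) \<le> osc * real K + e * real n"
      using osc(1) by (simp add: mult_left_mono)
    finally show "\<bar>S n x - S n y\<bar> \<le> osc * real K + e * real n" .
  qed (use osc(1) in simp)
qed

text \<open>The value of \<open>exp \<phi>\<close> at the fixed point of the letter p. It agrees
  with all values on the cylinder of p up to the factor \<open>exp osc\<close>, so sums over words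
  reduce to powers of a sum over letters.\<close>

definition weight :: "nat \<Rightarrow> real" where "weight p = exp (\<phi> (\<lambda>_. p))"

lemma weight_pos: "0 < weight p" by (simp add: weight_def)

lemma potential_weight:
  assumes "x \<in> Xfull"
  shows "exp (\<phi> x) \<le> exp osc * weight (x 0)" "exp (- osc) * weight (x 0) \<le> exp (\<phi> x)"
proof -
  have "(\<lambda>_. x 0) \<in> Xfull" using assms by (simp add: full_shift_def)
  then have "\<bar>\<phi> x - \<phi> (\<lambda>_. x 0)\<bar> \<le> osc" using assms by (intro osc) auto
  then show "exp (\<phi> x) \<le> exp osc * weight (x 0)" "exp (- osc) * weight (x 0) \<le> exp (\<phi> x)"
    by (auto simp: weight_def simp flip: exp_add)
qed

lemma exp_S_prod: "exp (S n x) = (\<Prod>k<n. exp (\<phi> ((left_shift ^^ k) x)))"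
  by (simp add: birkhoff_sum_def exp_sum)

lemma exp_S_le:
  assumes "x \<in> Xfull"
  shows "exp (S n x) \<le> (\<Prod>k<n. exp osc * weight (x k))"
  unfolding exp_S_prod
proof (rule prod_mono)
  fix k
  show "0 \<le> exp (\<phi> ((left_shift ^^ k) x)) \<and> exp (\<phi> ((left_shift ^^ k) x)) \<le> exp osc * weight (x k)"
    using potential_weight(1)[OF left_shift_Xfull[OF assms, of k]] by (simp add: funpow_left_shift)
qed

lemma exp_S_ge:
  assumes "x \<in> Xfull"
  shows "(\<Prod>k<n. exp (- osc) * weight (x k)) \<le> exp (S n x)"
  unfolding exp_S_prod
proof (rule prod_mono)
  fix k
  show "0 \<le> exp (- osc) * weight (x k) \<and> exp (- osc) * weight (x k) \<le> exp (\<phi> ((left_shift ^^ k) x))"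
    using potential_weight(2)[OF left_shift_Xfull[OF assms, of k]] weight_pos[of "x k"] by (simp add: funpow_left_shift)
qed

abbreviation Z :: "nat \<Rightarrow> ennreal" where "Z \<equiv> partition_function \<phi>"

definition sup_sum :: "nat \<Rightarrow> ennreal" where
  "sup_sum n = (\<integral>\<^sup>+ w. (SUP x\<in>cyl w. ennreal (exp (S n x))) \<partial>count_space (words {1..} n))"

definition total_weight :: ennreal where "total_weight = (\<integral>\<^sup>+ p. ennreal (weight p) \<partial>count_space {1..})"

lemma Z_words: "1 \<le> n \<Longrightarrow> Z n = (\<integral>\<^sup>+ w. ennreal (exp (S n (per w))) \<partial>count_space (words {1..} n))"
  unfolding partition_function_def by (rule nn_integral_periodic_points)

lemma words_prod_weight:
  "0 \<le> c \<Longrightarrow> (\<integral>\<^sup>+ w. ennreal (\<Prod>k<n. c * weight ((w :: nat list) ! k)) \<partial>count_space (words {1..} n)) = (ennreal c * total_weight) ^ n"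
proof -
  assume c: "0 \<le> c"
  have "(\<integral>\<^sup>+ w. ennreal (\<Prod>k<n. c * weight ((w :: nat list) ! k)) \<partial>count_space (words {1..} n)) =
     (\<integral>\<^sup>+ w. (\<Prod>k<n. ennreal (c * weight ((w :: nat list) ! k))) \<partial>count_space (words {1..} n))"
    using c by (intro nn_integral_cong) (simp add: prod_ennreal weight_pos less_imp_le)
  also have "\<dots> = (\<integral>\<^sup>+ p. ennreal (c * weight p) \<partial>count_space {1..}) ^ n"
    by (rule nn_integral_words_prod)
  also have "(\<integral>\<^sup>+ p. ennreal (c * weight p) \<partial>count_space {1..}) = ennreal c * total_weight"
    using c unfolding total_weight_def by (subst nn_integral_cmult[symmetric]) (auto simp: ennreal_mult weight_pos less_imp_le)
  finally show ?thesis .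
qed

lemma Z_le_sup_sum: "1 \<le> n \<Longrightarrow> Z n \<le> sup_sum n"
  unfolding Z_words sup_sum_def by (intro nn_integral_mono SUP_upper) (auto intro: per_cyl)

lemma sup_sum_le: "sup_sum n \<le> (ennreal (exp osc) * total_weight) ^ n"
  unfolding words_prod_weight[OF exp_ge_zero, symmetric] sup_sum_def
proof (intro nn_integral_mono SUP_least)
  fix w :: "nat list" and x assume w: "w \<in> space (count_space (words {1..} n))" and x: "x \<in> cyl w"
  have "exp (S n x) \<le> (\<Prod>k<n. exp osc * weight (x k))" using x cyl_subset by (intro exp_S_le) auto
  also have "\<dots> = (\<Prod>k<n. exp osc * weight (w ! k))"
    using w x by (intro prod.cong) (auto simp: words_def cylinder_def)
  finally show "ennreal (exp (S n x)) \<le> ennreal (\<Prod>k<n. exp osc * weight (w ! k))" by (rule ennreal_leI)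
qed

lemma Z_ge: "1 \<le> n \<Longrightarrow> (ennreal (exp (- osc)) * total_weight) ^ n \<le> Z n"
proof -
  assume n: "1 \<le> n"
  show ?thesis
    unfolding words_prod_weight[OF exp_ge_zero, symmetric] Z_words[OF n]
  proof (intro nn_integral_mono)
    fix w :: "nat list" assume "w \<in> space (count_space (words {1..} n))"
    then have w: "w \<in> words {1..} n" by simp
    have "(\<Prod>k<n. exp (- osc) * weight (w ! k)) = (\<Prod>k<n. exp (- osc) * weight (per w k))"
      using w by (intro prod.cong) (auto simp: words_def per_def)
    also have "\<dots> \<le> exp (S n (per w))" using w n by (intro exp_S_ge per_Xfull)
    finally show "ennreal (\<Prod>k<n. exp (- osc) * weight (w ! k)) \<le> ennreal (exp (S n (per w)))" by (rule ennreal_leI)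
  qed
qed

lemma sup_sum_submult: "sup_sum (m + n) \<le> sup_sum m * sup_sum n"
proof -
  have "sup_sum (m + n) = (\<integral>\<^sup>+ u. \<integral>\<^sup>+ v. (SUP x\<in>cyl (u @ v). ennreal (exp (S (m + n) x)))
      \<partial>count_space (words {1..} n) \<partial>count_space (words {1..} m))"
    unfolding sup_sum_def by (rule nn_integral_words_append)
  also have "\<dots> \<le> (\<integral>\<^sup>+ u. \<integral>\<^sup>+ v. (SUP x\<in>cyl u. ennreal (exp (S m x))) * (SUP x\<in>cyl v. ennreal (exp (S n x)))
      \<partial>count_space (words {1..} n) \<partial>count_space (words {1..} m))"
  proof (intro nn_integral_mono SUP_least)
    fix u v :: "nat list" and x assume uv: "u \<in> space (count_space (words {1..} m))" "v \<in> space (count_space (words {1..} n))"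
      and x: "x \<in> cyl (u @ v)"
    have len: "length u = m" "length v = n" using uv by (auto simp: words_def)
    have "x \<in> cyl u" using x cyl_append by blast
    moreover have "(left_shift ^^ m) x \<in> cyl v"
      using x len left_shift_Xfull[of x m]
      by (auto simp: cylinder_def funpow_left_shift nth_append)
    moreover have "ennreal (exp (S (m + n) x)) = ennreal (exp (S m x)) * ennreal (exp (S n ((left_shift ^^ m) x)))"
      by (simp add: birkhoff_sum_add exp_add ennreal_mult)
    ultimately show "ennreal (exp (S (m + n) x)) \<le>
        (SUP x\<in>cyl u. ennreal (exp (S m x))) * (SUP x\<in>cyl v. ennreal (exp (S n x)))"
      by (auto intro!: mult_mono SUP_upper)
  qed
  also have "\<dots> = sup_sum m * sup_sum n"
    unfolding sup_sum_def by (simp add: nn_integral_cmult nn_integral_multc)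
  finally show ?thesis .
qed

lemma pressure_alt: "pressure {1..} \<phi> = lim (\<lambda>n. elog (sup_sum n) / ereal (real n))"
  by (simp add: pressure_def sup_sum_def)

text \<open>If the weights had infinite sum, every \<open>Z n\<close> and hence every
  \<open>sup_sum n\<close> with n at least 1 would be infinite, and so would be the
  pressure.\<close>

lemma total_weight_finite: "total_weight < \<infinity>"
proof (rule ccontr)
  assume "\<not> total_weight < \<infinity>"
  then have total_weight: "total_weight = \<infinity>" by (simp add: not_less top_unique)
  have a_inf: "sup_sum n = \<infinity>" if "1 \<le> n" for n
  proof -
    have "(ennreal (exp (- osc)) * total_weight) ^ n = \<infinity>"
      using that by (simp add: total_weight ennreal_mult_top power_eq_top_ennreal)
    then show ?thesis using order_trans[OF Z_ge[OF that] Z_le_sup_sum[OF that]] by (simp add: top_unique)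
  qed
  have "(\<lambda>n. elog (sup_sum n) / ereal (real n)) \<longlonglongrightarrow> \<infinity>"
  proof (rule tendsto_eventually)
    show "\<forall>\<^sub>F n in sequentially. elog (sup_sum n) / ereal (real n) = \<infinity>"
      using eventually_ge_at_top[of 1] by eventually_elim (simp add: a_inf elog_def)
  qed
  then have "pressure {1..} \<phi> = \<infinity>" unfolding pressure_alt by (rule limI)
  then show False using pressure_finite by simp
qed

lemma sup_sum_finite: "sup_sum n < \<infinity>"
proof -
  have "(ennreal (exp osc) * total_weight) ^ n < \<infinity>"
    using total_weight_finite by (simp add: power_less_top_ennreal ennreal_mult_less_top)
  with sup_sum_le[of n] show ?thesis by (rule le_less_trans)
qed

text \<open>The fixed point at the letter 1 is counted for every period. This keeps
  \<open>Z n\<close> positive and supplies the linear lower bound for \<open>fekete\<close>.\<close>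

lemma Z_lower: "1 \<le> n \<Longrightarrow> ennreal (exp (real n * \<phi> (\<lambda>_. 1))) \<le> Z n"
proof -
  assume n: "1 \<le> n"
  have one: "(\<lambda>_. 1) \<in> periodic_points n"
    by (simp add: periodic_points_def full_shift_def funpow_left_shift)
  have "S n (\<lambda>_. 1) = real n * \<phi> (\<lambda>_. 1)"
    by (simp add: birkhoff_sum_def funpow_left_shift)
  then have "ennreal (exp (real n * \<phi> (\<lambda>_. 1))) = (\<integral>\<^sup>+ x. ennreal (exp (S n x)) * indicator {\<lambda>_. 1} x \<partial>count_space (periodic_points n))"
    using one by (subst nn_integral_indicator_singleton) auto
  also have "\<dots> \<le> Z n"
    unfolding partition_function_def by (intro nn_integral_mono) (auto simp: indicator_def)
  finally show ?thesis .
qed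

definition z :: "nat \<Rightarrow> real" where "z n = enn2real (Z n)"

lemma Z_z: "1 \<le> n \<Longrightarrow> Z n = ennreal (z n)"
  using le_less_trans[OF Z_le_sup_sum sup_sum_finite, of n] by (simp add: z_def)

lemma z_lower: "1 \<le> n \<Longrightarrow> exp (real n * \<phi> (\<lambda>_. 1)) \<le> z n"
  using Z_lower[of n] Z_z[of n] by (metis ennreal_le_iff2 exp_gt_zero not_le)

lemma z_pos: "1 \<le> n \<Longrightarrow> 0 < z n"
  using z_lower[of n] exp_gt_zero less_le_trans by blast

lemma sup_sum_le_Z:
  assumes "0 < e"
  obtains C where "0 \<le> C" "\<And>n. 1 \<le> n \<Longrightarrow> sup_sum n \<le> ennreal (exp (C + e * real n)) * Z n"
proof -
  obtain C where C: "0 \<le> C"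
    "\<And>n x y. x \<in> Xfull \<Longrightarrow> y \<in> Xfull \<Longrightarrow> (\<And>k. k < n \<Longrightarrow> x k = y k) \<Longrightarrow> \<bar>S n x - S n y\<bar> \<le> C + e * real n"
    using distortion[OF assms] by metis
  show ?thesis
  proof (rule that[OF C(1)])
    fix n :: nat assume n: "1 \<le> n"
    have "sup_sum n \<le> (\<integral>\<^sup>+ w. ennreal (exp (C + e * real n)) * ennreal (exp (S n (per w))) \<partial>count_space (words {1..} n))"
      unfolding sup_sum_def
    proof (intro nn_integral_mono SUP_least)
      fix w :: "nat list" and x assume w: "w \<in> space (count_space (words {1..} n))" and x: "x \<in> cyl w"
      have "\<bar>S n x - S n (per w)\<bar> \<le> C + e * real n"
        using x w n per_cyl[of w n] cyl_subset by (intro C) (auto simp: cylinder_def words_def)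
      then have "exp (S n x) \<le> exp (C + e * real n) * exp (S n (per w))"
        by (simp flip: exp_add)
      then show "ennreal (exp (S n x)) \<le> ennreal (exp (C + e * real n)) * ennreal (exp (S n (per w)))"
        by (simp add: ennreal_leI flip: ennreal_mult)
    qed
    then show "sup_sum n \<le> ennreal (exp (C + e * real n)) * Z n"
      by (simp add: nn_integral_cmult Z_words[OF n])
  qed
qed

text \<open>Submultiplicativity is proved for \<open>sup_sum\<close>, so Fekete's lemma is applied
  there and the limit is carried over to \<open>z\<close> by \<open>sup_sum_le_Z\<close>. Its
  existence is what gives \<open>lim\<close> in the definition of the pressure a meaning.\<close>

lemma pressure_limit:
  obtains P where "pressure {1..} \<phi> = ereal P" "(\<lambda>n. ln (z n) / real n) \<longlonglongrightarrow> P"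
proof -
  define u where "u n = ln (enn2real (sup_sum n))" for n
  have a_real: "sup_sum n = ennreal (enn2real (sup_sum n))" for n using sup_sum_finite[of n] by simp
  have z_a: "z n \<le> enn2real (sup_sum n)" if "1 \<le> n" for n
    unfolding z_def using Z_le_sup_sum[OF that] sup_sum_finite[of n] by (intro enn2real_mono) auto
  have a_pos: "0 < enn2real (sup_sum n)" if "1 \<le> n" for n
    using z_a[OF that] z_pos[OF that] by linarith
  obtain P where P: "(\<lambda>n. u n / real n) \<longlonglongrightarrow> P"
  proof (rule fekete[of u "\<phi> (\<lambda>_. 1)"])
    fix m n :: nat assume mn: "1 \<le> m" "1 \<le> n"
    have "enn2real (sup_sum (m + n)) \<le> enn2real (sup_sum m) * enn2real (sup_sum n)"
      using sup_sum_submult[of m n] sup_sum_finite by (simp flip: enn2real_mult add: enn2real_mono ennreal_mult_less_top)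
    then have "u (m + n) \<le> ln (enn2real (sup_sum m) * enn2real (sup_sum n))"
      using a_pos mn by (simp add: u_def)
    then show "u (m + n) \<le> u m + u n"
      using a_pos[OF mn(1)] a_pos[OF mn(2)] by (simp add: u_def ln_mult)
  next
    fix n :: nat assume n: "1 \<le> n"
    have "exp (real n * \<phi> (\<lambda>_. 1)) \<le> enn2real (sup_sum n)" using z_lower[OF n] z_a[OF n] by linarith
    then have "ln (exp (real n * \<phi> (\<lambda>_. 1))) \<le> u n" unfolding u_def by (intro ln_mono) auto
    then show "\<phi> (\<lambda>_. 1) * real n \<le> u n" by (simp add: mult.commute)
  qed
  have "(\<lambda>n. elog (sup_sum n) / ereal (real n)) \<longlonglongrightarrow> ereal P"
  proof (rule Lim_transform_eventually[of "\<lambda>n. ereal (u n / real n)"])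
    show "(\<lambda>n. ereal (u n / real n)) \<longlonglongrightarrow> ereal P" using P by simp
    show "\<forall>\<^sub>F n in sequentially. ereal (u n / real n) = elog (sup_sum n) / ereal (real n)"
      using eventually_ge_at_top[of 1]
    proof eventually_elim
      case (elim n)
      then have "sup_sum n \<noteq> 0" "sup_sum n \<noteq> \<infinity>" using a_pos[of n] sup_sum_finite[of n] by auto
      then show ?case using elim by (simp add: elog_def u_def)
    qed
  qed
  then have 1: "pressure {1..} \<phi> = ereal P" unfolding pressure_alt by (rule limI)
  have "(\<lambda>n. ln (z n) / real n) \<longlonglongrightarrow> P"
  proof (rule LIMSEQ_I)
    fix r :: real assume r: "0 < r"
    obtain C where C: "0 \<le> C" "\<And>n. 1 \<le> n \<Longrightarrow> sup_sum n \<le> ennreal (exp (C + r / 4 * real n)) * Z n"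
      using sup_sum_le_Z[of "r / 4"] r by auto
    obtain N where N: "\<And>n. N \<le> n \<Longrightarrow> norm (u n / real n - P) < r / 4"
      using LIMSEQ_D[OF P, of "r / 4"] r by auto
    obtain N' :: nat where N': "4 * C / r < real N'" using reals_Archimedean2 by blast
    show "\<exists>no. \<forall>n\<ge>no. norm (ln (z n) / real n - P) < r"
    proof (intro exI[of _ "max 1 (max N N')"] allI impI)
      fix n assume n: "max 1 (max N N') \<le> n"
      then have n1: "1 \<le> n" by simp
      have "sup_sum n \<le> ennreal (exp (C + r / 4 * real n) * z n)"
        using C(2)[OF n1] by (simp add: Z_z[OF n1] z_pos[OF n1] less_imp_le ennreal_mult)
      then have "enn2real (sup_sum n) \<le> exp (C + r / 4 * real n) * z n"
        using z_pos[OF n1] by (intro enn2real_leI) (auto simp: less_imp_le)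
      then have "u n \<le> ln (exp (C + r / 4 * real n) * z n)"
        unfolding u_def using a_pos[OF n1] by (intro ln_mono) auto
      also have "\<dots> = C + r / 4 * real n + ln (z n)" using z_pos[OF n1] by (simp add: ln_mult)
      finally have "u n / real n \<le> C / real n + r / 4 + ln (z n) / real n"
        using n1 by (simp add: field_simps)
      moreover have "C / real n < r / 4"
      proof -
        have "4 * C / r < real n" using N' n by simp
        then show ?thesis using r n1 by (simp add: field_simps)
      qed
      moreover have "ln (z n) \<le> u n"
        unfolding u_def using z_pos[OF n1] z_a[OF n1] by (intro ln_mono) auto
      then have "ln (z n) / real n \<le> u n / real n" by (simp add: divide_right_mono)
      moreover have "\<bar>u n / real n - P\<bar> < r / 4" using N n by simp
      ultimately show "norm (ln (z n) / real n - P) < r" unfolding real_norm_def by linarith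
    qed
  qed
  with 1 show ?thesis by (rule that)
qed

end

section \<open>Exponential tightness\<close>

text \<open>With r the tails of the series, \<psi> is half the logarithm of
  \<open>r 0 / r p\<close>. Then \<open>b p * exp (\<psi> p)\<close> is proportional to
  \<open>b p / sqrt (r p)\<close>; as \<open>b p\<close> is the difference of consecutive tails,
  factoring it as a difference of squares gives a telescoping bound.\<close>

lemma summable_slowly_growing_weight:
  fixes b :: "nat \<Rightarrow> real"
  assumes pos: "\<And>p. 0 < b p" and summ: "summable b"
  obtains \<psi> where "\<And>p. 0 \<le> \<psi> p" "filterlim \<psi> at_top sequentially" "summable (\<lambda>p. b p * exp (\<psi> p))"
proof -
  define r where "r p = (\<Sum>q. b (q + p))" for p
  have r_alt: "r p = suminf b - (\<Sum>q<p. b q)" for p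
    unfolding r_def using suminf_split_initial_segment[OF summ, of p] by simp
  have r_Suc: "r (Suc p) = r p - b p" for p by (simp add: r_alt)
  have r_pos: "0 < r p" for p
    unfolding r_def using summ pos by (intro suminf_pos) (auto simp: summable_iff_shift)
  have r_le: "r p \<le> r 0" for p
    by (simp add: r_alt sum_nonneg pos less_imp_le)
  have r_lim: "r \<longlonglongrightarrow> 0"
  proof -
    have "(\<lambda>p. suminf b - (\<Sum>q<p. b q)) \<longlonglongrightarrow> suminf b - suminf b"
      by (intro tendsto_intros summable_LIMSEQ summ)
    then show ?thesis by (simp add: r_alt[abs_def])
  qed
  define \<psi> where "\<psi> p = (ln (r 0) - ln (r p)) / 2" for p
  have exp_psi: "exp (\<psi> p) = sqrt (r 0) / sqrt (r p)" for p
  proof -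
    have "\<psi> p = ln (sqrt (r 0)) - ln (sqrt (r p))"
      using r_pos[of 0] r_pos[of p] by (simp add: \<psi>_def ln_sqrt diff_divide_distrib)
    then show ?thesis using r_pos[of 0] r_pos[of p] by (simp add: exp_diff)
  qed
  show ?thesis
  proof (rule that[of \<psi>])
    show "0 \<le> \<psi> p" for p using r_le[of p] r_pos[of p] by (simp add: \<psi>_def)
    have "filterlim (\<lambda>p. r p) (at_right 0) sequentially"
      using r_lim r_pos by (simp add: filterlim_at less_imp_neq[symmetric] eventually_sequentiallyI[of 0])
    then have "filterlim (\<lambda>p. ln (r p)) at_bot sequentially"
      by (rule filterlim_compose[OF ln_at_0])
    then have 1: "filterlim (\<lambda>p. - ln (r p)) at_top sequentially"
      by (simp add: filterlim_uminus_at_bot)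
    then have "filterlim (\<lambda>p. (1 / 2) * (ln (r 0) + - ln (r p))) at_top sequentially"
      by (intro filterlim_tendsto_pos_mult_at_top[OF tendsto_const] filterlim_tendsto_add_at_top[OF tendsto_const]) auto
    then show "filterlim \<psi> at_top sequentially" by (simp add: \<psi>_def[abs_def])
    show "summable (\<lambda>p. b p * exp (\<psi> p))"
    proof (rule summableI_nonneg_bounded)
      show "0 \<le> b p * exp (\<psi> p)" for p using pos[of p] by simp
      fix Q
      have "b p * exp (\<psi> p) \<le> 2 * sqrt (r 0) * (sqrt (r p) - sqrt (r (Suc p)))" for p
      proof -
        have "b p = (sqrt (r p) - sqrt (r (Suc p))) * (sqrt (r p) + sqrt (r (Suc p)))"
          using r_Suc[of p] r_pos[of p] r_pos[of "Suc p"] by (simp add: algebra_simps)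
        also have "\<dots> \<le> (sqrt (r p) - sqrt (r (Suc p))) * (2 * sqrt (r p))"
          using r_Suc[of p] pos[of p] by (intro mult_left_mono) auto
        finally have "b p / sqrt (r p) \<le> 2 * (sqrt (r p) - sqrt (r (Suc p)))"
          using r_pos[of p] by (subst pos_divide_le_eq) (auto simp: algebra_simps)
        then have "sqrt (r 0) * (b p / sqrt (r p)) \<le> sqrt (r 0) * (2 * (sqrt (r p) - sqrt (r (Suc p))))"
          using r_pos[of 0] by (intro mult_left_mono) auto
        then show ?thesis by (simp add: exp_psi algebra_simps)
      qed
      then have "(\<Sum>p<Q. b p * exp (\<psi> p)) \<le> (\<Sum>p<Q. 2 * sqrt (r 0) * (sqrt (r p) - sqrt (r (Suc p))))"
        by (rule sum_mono)
      also have "\<dots> = 2 * sqrt (r 0) * (sqrt (r 0) - sqrt (r Q))"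
        unfolding sum_distrib_left[symmetric] by (induction Q) (auto simp: algebra_simps)
      also have "\<dots> \<le> 2 * sqrt (r 0) * sqrt (r 0)"
        using r_pos[of 0] r_pos[of Q] by (intro mult_left_mono) auto
      finally show "(\<Sum>p<Q. b p * exp (\<psi> p)) \<le> 2 * sqrt (r 0) * sqrt (r 0)" .
    qed
  qed
qed

lemma nn_integral_count_space_from_1:
  "(\<integral>\<^sup>+ p. f p \<partial>count_space {1::nat..}) = (\<Sum>p. f (Suc p))"
proof -
  have "bij_betw Suc UNIV {1..}"
    by (rule bij_betw_byWitness[of _ "\<lambda>p. p - 1"]) (auto simp: One_nat_def)
  from nn_integral_bij_count_space[OF this, of f] show ?thesis
    by (simp add: nn_integral_count_space_nat)
qed

section \<open>Empirical measures of periodic points\<close>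

lemma measure_empirical:
  assumes "1 \<le> n" "x \<in> Xfull"
  shows "measure (empirical_measure n x) (cyl w) = real (card {k. k < n \<and> (left_shift ^^ k) x \<in> cyl w}) / real n"
proof -
  have "emeasure (empirical_measure n x) (cyl w) =
      (\<integral>\<^sup>+ k. ennreal (1 / real n) * indicator (cyl w) ((left_shift ^^ k) x) \<partial>count_space {..<n})"
    unfolding empirical_measure_def
    using assms left_shift_Xfull by (intro emeasure_atomic_measure) auto
  also have "\<dots> = (\<Sum>k<n. ennreal (1 / real n) * indicator (cyl w) ((left_shift ^^ k) x))"
    by (rule nn_integral_count_space_finite) simp
  also have "\<dots> = (\<Sum>k\<in>{k. k < n \<and> (left_shift ^^ k) x \<in> cyl w}. ennreal (1 / real n))"
    by (intro sum.mono_neutral_cong_right) (auto simp: indicator_def)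
  also have "\<dots> = ennreal (real (card {k. k < n \<and> (left_shift ^^ k) x \<in> cyl w}) / real n)"
    by (simp add: ennreal_of_nat_eq_real_of_nat flip: ennreal_mult)
  finally show ?thesis by (simp add: measure_def)
qed

text \<open>Advancing the window by one trades its first position for the one n places later, where
  a point of period n has the same letter.\<close>

lemma card_periodic_shift:
  assumes "x \<in> periodic_points n"
  shows "card {l. l < n \<and> Q (x (l + j))} = card {l. l < n \<and> Q (x l)}"
proof (induction j)
  case (Suc j)
  define g where "g l = (if Q (x (l + j)) then 1 else 0 :: nat)" for l
  have card: "card {l. l < n \<and> Q (x (l + i))} = (\<Sum>l<n. if Q (x (l + i)) then 1 else 0)" for i
    using sum.inter_filter[of "{..<n}" "\<lambda>_. 1 :: nat" "\<lambda>l. Q (x (l + i))"] by simp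
  have "(\<Sum>l<n. g (Suc l)) + g 0 = (\<Sum>l<n. g l) + g n"
    using sum.lessThan_Suc_shift[of g n] sum.lessThan_Suc[of g n] by simp
  moreover have "g n = g 0"
    using periodic_pointsD(2)[OF assms, of j] by (simp add: g_def add.commute)
  ultimately have "(\<Sum>l<n. g (Suc l)) = (\<Sum>l<n. g l)" by simp
  then have "card {l. l < n \<and> Q (x (l + Suc j))} = card {l. l < n \<and> Q (x (l + j))}"
    unfolding card by (simp add: g_def)
  then show ?case using Suc by simp
qed simp

lemma closedin_tight:
  fixes b :: "nat \<Rightarrow> nat \<Rightarrow> nat"
  shows "closedin (weak_star Xfull) {\<mu> \<in> prob_measures Xfull.
    \<forall>k i. 1 - (1/2) ^ k \<le> (\<Sum>w\<in>bounded_words (b k) i. measure \<mu> (cyl w))}"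
proof -
  have "continuous_map (weak_star Xfull) euclidean (\<lambda>\<mu>. measure \<mu> (cyl w))" for w
    unfolding continuous_map_def by (auto simp: topspace_weak_star openin_weak_star_cyl)
  then have "continuous_map (weak_star Xfull) euclidean (\<lambda>\<mu>. \<Sum>w\<in>bounded_words (b k) i. measure \<mu> (cyl w))" for k i
    by (intro continuous_map_sum finite_bounded_words_fun)
  then have "closedin (weak_star Xfull) {\<mu> \<in> topspace (weak_star Xfull).
      (\<Sum>w\<in>bounded_words (b k) i. measure \<mu> (cyl w)) \<in> {1 - (1/2) ^ k..}}" for k i
    by (rule closedin_continuous_map_preimage) simp
  then have "closedin (weak_star Xfull) (\<Inter>k. \<Inter>i. {\<mu> \<in> topspace (weak_star Xfull).
      (\<Sum>w\<in>bounded_words (b k) i. measure \<mu> (cyl w)) \<in> {1 - (1/2) ^ k..}})"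
    by (intro closedin_INT) auto
  also have "(\<Inter>k. \<Inter>i. {\<mu> \<in> topspace (weak_star Xfull).
      (\<Sum>w\<in>bounded_words (b k) i. measure \<mu> (cyl w)) \<in> {1 - (1/2) ^ k..}}) = {\<mu> \<in> prob_measures Xfull.
    \<forall>k i. 1 - (1/2) ^ k \<le> (\<Sum>w\<in>bounded_words (b k) i. measure \<mu> (cyl w))}"
    by (auto simp: topspace_weak_star)
  finally show ?thesis .
qed

text \<open>By Markov's inequality at most the fraction \<open>(1/2) ^ (k + j + 1)\<close> of the
  positions carry a letter above \<open>b k j\<close>, and by periodicity the same holds when
  looking j places ahead. Summing over j leaves at most the fraction \<open>(1/2) ^ k\<close> of the
  starting positions outside the bounded words.\<close>

lemma empirical_tight:
  fixes b :: "nat \<Rightarrow> nat \<Rightarrow> nat" and \<psi> :: "nat \<Rightarrow> real"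
  assumes n: "1 \<le> n" and x: "x \<in> periodic_points n" and R: "0 < R"
    and psi: "\<And>p. 0 \<le> \<psi> p" "\<And>k j p. b k j < p \<Longrightarrow> R * 2 ^ (k + j + 1) \<le> \<psi> p"
    and le: "(\<Sum>l<n. \<psi> (x l)) \<le> R * real n"
  shows "1 - (1/2) ^ k \<le> (\<Sum>w\<in>bounded_words (b k) i. measure (empirical_measure n x) (cyl w))"
proof -
  note xX = periodic_pointsD(1)[OF x]
  define T where "T w = {l. l < n \<and> (left_shift ^^ l) x \<in> cyl w}" for w
  have bad: "real (card {l. l < n \<and> b k j < x l}) \<le> real n * (1/2) ^ (k + j + 1)" for j
  proof -
    have "real (card {l. l < n \<and> b k j < x l}) * (R * 2 ^ (k + j + 1)) = (\<Sum>l\<in>{l. l < n \<and> b k j < x l}. R * 2 ^ (k + j + 1))"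
      by simp
    also have "\<dots> \<le> (\<Sum>l\<in>{l. l < n \<and> b k j < x l}. \<psi> (x l))" using psi(2) by (intro sum_mono) auto
    also have "\<dots> \<le> (\<Sum>l<n. \<psi> (x l))" using psi(1) by (intro sum_mono2) auto
    also have "\<dots> \<le> R * real n" by (rule le)
    finally show ?thesis using R by (simp add: field_simps)
  qed
  have "n \<le> card (\<Union>w\<in>bounded_words (b k) i. T w) + (\<Sum>j<i. card {l. l < n \<and> b k j < x l})"
  proof -
    have "{..<n} \<subseteq> (\<Union>w\<in>bounded_words (b k) i. T w) \<union> (\<Union>j<i. {l. l < n \<and> b k j < x (l + j)})"
    proof
      fix l assume l: "l \<in> {..<n}"
      show "l \<in> (\<Union>w\<in>bounded_words (b k) i. T w) \<union> (\<Union>j<i. {l. l < n \<and> b k j < x (l + j)})"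
      proof (cases "\<exists>j<i. b k j < x (l + j)")
        case False
        define w where "w = map (\<lambda>j. x (l + j)) [0..<i]"
        have "w \<in> bounded_words (b k) i"
          using False xX by (auto simp: bounded_words_def w_def full_shift_def not_less dest: leD)
        moreover have "l \<in> T w"
          using l left_shift_Xfull[OF xX, of l] by (auto simp: T_def w_def cylinder_def funpow_left_shift)
        ultimately show ?thesis by blast
      qed (use l in auto)
    qed
    then have "card {..<n} \<le> card ((\<Union>w\<in>bounded_words (b k) i. T w) \<union> (\<Union>j<i. {l. l < n \<and> b k j < x (l + j)}))"
      by (intro card_mono finite_UnI finite_UN_I finite_bounded_words_fun) (auto simp: T_def)
    also have "\<dots> \<le> card (\<Union>w\<in>bounded_words (b k) i. T w) + card (\<Union>j<i. {l. l < n \<and> b k j < x (l + j)})"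
      by (rule card_Un_le)
    also have "card (\<Union>j<i. {l. l < n \<and> b k j < x (l + j)}) \<le> (\<Sum>j<i. card {l. l < n \<and> b k j < x (l + j)})"
      by (rule card_UN_le) simp
    also have "\<dots> = (\<Sum>j<i. card {l. l < n \<and> b k j < x l})"
      using card_periodic_shift[OF x, of "\<lambda>t. b k _ < t"] by (intro sum.cong) auto
    finally show ?thesis by simp
  qed
  moreover have "card (\<Union>w\<in>bounded_words (b k) i. T w) = (\<Sum>w\<in>bounded_words (b k) i. card (T w))"
  proof (rule card_UN_disjoint)
    show "\<forall>v\<in>bounded_words (b k) i. \<forall>w\<in>bounded_words (b k) i. v \<noteq> w \<longrightarrow> T v \<inter> T w = {}"
      using cyl_same_length_disjoint by (fastforce simp: T_def bounded_words_def)
  qed (auto simp: finite_bounded_words_fun T_def)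
  ultimately have "n \<le> (\<Sum>w\<in>bounded_words (b k) i. card (T w)) + (\<Sum>j<i. card {l. l < n \<and> b k j < x l})" by simp
  then have "real n \<le> real ((\<Sum>w\<in>bounded_words (b k) i. card (T w)) + (\<Sum>j<i. card {l. l < n \<and> b k j < x l}))"
    by (simp only: of_nat_le_iff)
  then have 1: "real n \<le> (\<Sum>w\<in>bounded_words (b k) i. real (card (T w))) + (\<Sum>j<i. real (card {l. l < n \<and> b k j < x l}))"
    by simp
  have "(\<Sum>j<i. real (card {l. l < n \<and> b k j < x l})) \<le> (\<Sum>j<i. real n * (1/2) ^ (k + j + 1))"
    by (rule sum_mono) (rule bad)
  also have "\<dots> = real n * (1/2) ^ (k + 1) * (\<Sum>j<i. (1/2) ^ j)"
    by (simp add: sum_distrib_left power_add algebra_simps)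
  also have "(\<Sum>j<i. (1/2::real) ^ j) \<le> 2" by (simp add: sum_gp_strict)
  then have "real n * (1/2) ^ (k + 1) * (\<Sum>j<i. (1/2) ^ j) \<le> real n * ((1/2) ^ (k + 1) * 2)"
    unfolding mult.assoc by (intro mult_left_mono) auto
  also have "(1/2::real) ^ (k + 1) * 2 = (1/2) ^ k" by (simp add: power_add)
  finally have "real n * (1 - (1/2) ^ k) \<le> (\<Sum>w\<in>bounded_words (b k) i. real (card (T w)))"
    using 1 by (simp add: algebra_simps flip: power_Suc)
  then have "1 - (1/2) ^ k \<le> (\<Sum>w\<in>bounded_words (b k) i. real (card (T w))) / real n"
    using n by (simp add: field_simps)
  also have "\<dots> = (\<Sum>w\<in>bounded_words (b k) i. measure (empirical_measure n x) (cyl w))"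
    by (simp add: sum_divide_distrib measure_empirical[OF n xX] T_def)
  finally show ?thesis .
qed

context acceptable_potential
begin

text \<open>The numerator of the mass that \<open>periodic_distribution \<phi> n\<close> gives to
  \<open>G\<close>. Estimates are made for it; the division by \<open>Z n\<close> happens in
  \<open>emeasure_periodic\<close>.\<close>

definition Zs :: "nat \<Rightarrow> (nat \<Rightarrow> nat) measure set \<Rightarrow> ennreal" where
  "Zs n G = (\<integral>\<^sup>+ x. ennreal (exp (S n x)) * indicator G (empirical_measure n x) \<partial>count_space (periodic_points n))"

lemma exponential_tightness:
  obtains K where "compactin (weak_star Xfull) K" "closedin (weak_star Xfull) K"
    "\<And>n. 1 \<le> n \<Longrightarrow> Zs n (topspace (weak_star Xfull) - K) \<le> ennreal (exp (- L * real n))"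
proof -
  have summ: "summable (\<lambda>p. weight (Suc p))"
    using total_weight_finite weight_pos unfolding total_weight_def nn_integral_count_space_from_1
    by (intro summable_suminf_not_top) (auto simp: less_imp_le)
  obtain \<psi>' where psi': "\<And>p. 0 \<le> \<psi>' p" "filterlim \<psi>' at_top sequentially"
    "summable (\<lambda>p. weight (Suc p) * exp (\<psi>' p))"
    using summable_slowly_growing_weight[of "\<lambda>p. weight (Suc p)"] summ weight_pos by metis
  \<comment> \<open>Letters start at 1, the summable family at 0.\<close>
  define \<psi> where "\<psi> p = \<psi>' (p - 1)" for p
  define \<beta> where "\<beta> = (\<Sum>p. weight (Suc p) * exp (\<psi>' p))"
  have beta: "0 < \<beta>"
    unfolding \<beta>_def by (intro suminf_pos psi'(3)) (simp add: weight_pos)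
  have B': "(\<integral>\<^sup>+ p. ennreal (weight p * exp (\<psi> p)) \<partial>count_space {1..}) = ennreal \<beta>"
    unfolding nn_integral_count_space_from_1 \<beta>_def \<psi>_def
    using psi'(3) weight_pos by (subst suminf_ennreal2) (auto simp: less_imp_le)
  \<comment> \<open>Makes \<open>exp (osc - R) * \<beta>\<close> at most \<open>exp (- L)\<close>;
    the maximum with 1 keeps \<open>R\<close> positive for Markov's inequality.\<close>
  define R where "R = max 1 (osc + ln \<beta> + L)"
  have R: "0 < R" by (simp add: R_def)
  have "\<exists>M. \<forall>p>M. R * 2 ^ (k + j + 1) \<le> \<psi> p" for k j
  proof -
    obtain M where M: "\<And>p. M \<le> p \<Longrightarrow> R * 2 ^ (k + j + 1) \<le> \<psi>' p"
      using psi'(2) unfolding filterlim_at_top eventually_sequentially by blast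
    then show ?thesis by (intro exI[of _ "Suc M"]) (auto simp: \<psi>_def)
  qed
  then obtain M where M: "\<And>k j p. M k j < p \<Longrightarrow> R * 2 ^ (k + j + 1) \<le> \<psi> p" by metis
  define K where "K = {\<mu> \<in> prob_measures Xfull.
    \<forall>k i. 1 - (1/2) ^ k \<le> (\<Sum>w\<in>bounded_words (M k) i. measure \<mu> (cyl w))}"
  show ?thesis
  proof (rule that[of K])
    show "compactin (weak_star Xfull) K" unfolding K_def by (rule compactin_tight)
    show "closedin (weak_star Xfull) K" unfolding K_def by (rule closedin_tight)
    fix n :: nat assume n: "1 \<le> n"
    have "Zs n (topspace (weak_star Xfull) - K) \<le>
       (\<integral>\<^sup>+ x. (\<Prod>k<n. ennreal (exp (osc - R) * (weight (x k) * exp (\<psi> (x k))))) \<partial>count_space (periodic_points n))"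
      unfolding Zs_def
    proof (rule nn_integral_mono)
      fix x assume "x \<in> space (count_space (periodic_points n))"
      then have x: "x \<in> periodic_points n" by simp
      note xX = periodic_pointsD(1)[OF x]
      show "ennreal (exp (S n x)) * indicator (topspace (weak_star Xfull) - K) (empirical_measure n x)
         \<le> (\<Prod>k<n. ennreal (exp (osc - R) * (weight (x k) * exp (\<psi> (x k)))))"
      proof (cases "empirical_measure n x \<in> topspace (weak_star Xfull) - K")
        case True
        \<comment> \<open>Contrapositive of \<open>empirical_tight\<close>: outside \<open>K\<close>
          the mean of \<psi> along the orbit exceeds \<open>R\<close>, so the Chernoff factor below
          is at least 1 and may be inserted.\<close>
        have "\<not> (\<Sum>l<n. \<psi> (x l)) \<le> R * real n"
        proof
          assume le: "(\<Sum>l<n. \<psi> (x l)) \<le> R * real n"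
          have "empirical_measure n x \<in> K"
            unfolding K_def
            using empirical_measure_in[OF n xX] empirical_tight[OF n x R _ M le] psi'(1)
            by (auto simp: \<psi>_def)
          then show False using True by simp
        qed
        then have "1 \<le> exp ((\<Sum>l<n. \<psi> (x l)) - R * real n)" by simp
        then have "exp (S n x) \<le> exp (S n x) * exp ((\<Sum>l<n. \<psi> (x l)) - R * real n)" by simp
        also have "\<dots> \<le> (\<Prod>k<n. exp osc * weight (x k)) * exp ((\<Sum>l<n. \<psi> (x l)) - R * real n)"
          by (intro mult_right_mono exp_S_le xX) simp
        also have "exp ((\<Sum>l<n. \<psi> (x l)) - R * real n) = (\<Prod>k<n. exp (\<psi> (x k) - R))"
          by (simp add: exp_sum[symmetric] sum_subtractf)
        also have "(\<Prod>k<n. exp osc * weight (x k)) * (\<Prod>k<n. exp (\<psi> (x k) - R)) =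
            (\<Prod>k<n. exp (osc - R) * (weight (x k) * exp (\<psi> (x k))))"
          by (subst prod.distrib[symmetric]) (intro prod.cong, auto simp: exp_diff)
        finally show ?thesis using True
          by (subst prod_ennreal) (auto simp: weight_pos less_imp_le intro!: ennreal_leI)
      qed simp
    qed
    also have "\<dots> = (\<integral>\<^sup>+ w. (\<Prod>k<n. ennreal (exp (osc - R) * (weight (per w k) * exp (\<psi> (per w k))))) \<partial>count_space (words {1..} n))"
      by (rule nn_integral_periodic_points[OF n])
    also have "\<dots> = (\<integral>\<^sup>+ w. (\<Prod>k<n. (\<lambda>p. ennreal (exp (osc - R) * (weight p * exp (\<psi> p)))) (w ! k)) \<partial>count_space (words {1..} n))"
      by (intro nn_integral_cong prod.cong) (auto simp: per_def words_def)
    also have "\<dots> = (\<integral>\<^sup>+ p. ennreal (exp (osc - R) * (weight p * exp (\<psi> p))) \<partial>count_space {1..}) ^ n"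
      by (rule nn_integral_words_prod)
    also have "(\<integral>\<^sup>+ p. ennreal (exp (osc - R) * (weight p * exp (\<psi> p))) \<partial>count_space {1..}) = ennreal (exp (osc - R) * \<beta>)"
      using beta by (subst ennreal_mult) (auto simp: B'[symmetric] weight_pos less_imp_le ennreal_mult nn_integral_cmult)
    also have "ennreal (exp (osc - R) * \<beta>) \<le> ennreal (exp (- L))"
    proof (rule ennreal_leI)
      have "exp (osc - R) * \<beta> = exp (osc - R + ln \<beta>)" using beta by (simp add: exp_add)
      also have "\<dots> \<le> exp (- L)" by (simp add: R_def)
      finally show "exp (osc - R) * \<beta> \<le> exp (- L)" .
    qed
    then have "ennreal (exp (osc - R) * \<beta>) ^ n \<le> ennreal (exp (- L)) ^ n" by (rule power_mono) simp
    also have "ennreal (exp (- L)) ^ n = ennreal (exp (- L * real n))"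
      by (simp add: ennreal_power exp_of_nat_mult[symmetric] mult.commute)
    finally show "Zs n (topspace (weak_star Xfull) - K) \<le> ennreal (exp (- L * real n))" .
  qed
qed

end

section \<open>Entropy\<close>

lemma words_0: "words A 0 = {[]}"
  by (auto simp: words_def)

lemma words_Suc: "words A (Suc n) = (\<lambda>(a, w). a # w) ` (A \<times> words A n)"
  by (force simp: words_def length_Suc_conv)

lemma finite_words: "finite A \<Longrightarrow> finite (words A n)"
  by (induction n) (auto simp: words_0 words_Suc)

lemma sum_words_Suc:
  assumes "finite A"
  shows "(\<Sum>w\<in>words A (Suc n). F w) = (\<Sum>a\<in>A. \<Sum>w\<in>words A n. F (a # w))"
  using assms unfolding words_Suc
  by (subst sum.reindex) (auto simp: inj_on_def sum.cartesian_product case_prod_beta finite_words)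

lemma sum_words_append:
  assumes "finite A"
  shows "(\<Sum>w\<in>words A (m + n). F w) = (\<Sum>u\<in>words A m. \<Sum>v\<in>words A n. F (u @ v))"
  using assms by (induction m arbitrary: F) (auto simp: words_0 sum_words_Suc)

text \<open>Here q plays the part of a conditional probability of i given j, with total at most 1.
  First components are summed out one position at a time.\<close>

lemma sum_words_weighted_le:
  fixes q :: "'i \<times> 'j \<Rightarrow> real"
  assumes "finite I" "finite J" and q: "\<And>c. 0 \<le> q c" "\<And>j. j \<in> J \<Longrightarrow> (\<Sum>i\<in>I. q (i, j)) \<le> 1"
    and R: "\<And>w. 0 \<le> R w"
  shows "(\<Sum>cs\<in>words (I \<times> J) n. R (map snd cs) * (\<Prod>k<n. q (cs ! k))) \<le> (\<Sum>bs\<in>words J n. R bs)"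
  using R
proof (induction n arbitrary: R)
  case 0
  then show ?case by (simp add: words_0)
next
  case (Suc n)
  have "(\<Sum>cs\<in>words (I \<times> J) (Suc n). R (map snd cs) * (\<Prod>k<Suc n. q (cs ! k))) =
      (\<Sum>c\<in>I \<times> J. \<Sum>cs\<in>words (I \<times> J) n. R (snd c # map snd cs) * (q c * (\<Prod>k<n. q (cs ! k))))"
    using assms by (subst sum_words_Suc) (simp_all only: prod.lessThan_Suc_shift, simp_all)
  also have "\<dots> = (\<Sum>c\<in>I \<times> J. q c * (\<Sum>cs\<in>words (I \<times> J) n. R (snd c # map snd cs) * (\<Prod>k<n. q (cs ! k))))"
    by (simp add: sum_distrib_left algebra_simps)
  also have "\<dots> \<le> (\<Sum>c\<in>I \<times> J. q c * (\<Sum>bs\<in>words J n. R (snd c # bs)))"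
    using q(1) Suc.prems by (intro sum_mono mult_left_mono Suc.IH[of "\<lambda>bs. R (snd _ # bs)"]) auto
  also have "\<dots> = (\<Sum>j\<in>J. (\<Sum>i\<in>I. q (i, j)) * (\<Sum>bs\<in>words J n. R (j # bs)))"
    by (simp add: sum.cartesian_product' sum_distrib_right sum.swap[of _ I J])
  also have "\<dots> \<le> (\<Sum>j\<in>J. 1 * (\<Sum>bs\<in>words J n. R (j # bs)))"
    using q(2) Suc.prems by (intro sum_mono mult_right_mono sum_nonneg) auto
  also have "\<dots> = (\<Sum>bs\<in>words J (Suc n). R bs)"
    using assms by (simp add: sum_words_Suc)
  finally show ?case .
qed

text \<open>This is \<open>ln t \<le> t - 1\<close> at \<open>q i / p i\<close>. The condition
  \<open>ac\<close> keeps the right-hand side away from the default value of \<open>ln\<close> at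
  0.\<close>

lemma gibbs_inequality:
  fixes p q :: "'i \<Rightarrow> real"
  assumes p: "\<And>i. i \<in> I \<Longrightarrow> 0 \<le> p i" and q: "\<And>i. i \<in> I \<Longrightarrow> 0 \<le> q i"
    and ac: "\<And>i. i \<in> I \<Longrightarrow> 0 < p i \<Longrightarrow> 0 < q i" and le: "sum q I \<le> sum p I"
  shows "(\<Sum>i\<in>I. - (p i * ln (p i))) \<le> (\<Sum>i\<in>I. - (p i * ln (q i)))"
proof -
  have "p i * ln (q i) - p i * ln (p i) \<le> q i - p i" if i: "i \<in> I" for i
  proof (cases "p i = 0")
    case False
    then have pos: "0 < p i" "0 < q i" using p[OF i] ac[OF i] by auto
    have "p i * ln (q i) - p i * ln (p i) = p i * ln (q i / p i)"
      using pos by (simp add: ln_div algebra_simps)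
    also have "\<dots> \<le> p i * (q i / p i - 1)"
      using pos by (intro mult_left_mono ln_le_minus_one) auto
    also have "\<dots> = q i - p i" using pos by (simp add: field_simps)
    finally show ?thesis .
  qed (use q[OF i] in simp)
  then have "(\<Sum>i\<in>I. p i * ln (q i) - p i * ln (p i)) \<le> (\<Sum>i\<in>I. q i - p i)" by (rule sum_mono)
  then show ?thesis using le by (simp add: sum_subtractf sum_negf)
qed

section \<open>Shannon entropy of finite-valued functions\<close>

context prob_space
begin

definition level_prob :: "('a \<Rightarrow> 'w) \<Rightarrow> 'w \<Rightarrow> real" where
  "level_prob u w = prob (u -` {w} \<inter> space M)"

text \<open>Shannon entropy of the partition into level sets. Functions in place of partitions turn
  joins into pairs or lists of values, and coarser partitions into compositions.\<close>

definition simple_entropy :: "('a \<Rightarrow> 'w) \<Rightarrow> real" where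
  "simple_entropy u = (\<Sum>w\<in>u ` space M. - (level_prob u w * ln (level_prob u w)))"

lemma level_prob_nonneg [simp]: "0 \<le> level_prob u w" by (simp add: level_prob_def)

lemma level_prob_outside: "w \<notin> u ` space M \<Longrightarrow> level_prob u w = 0"
proof -
  assume "w \<notin> u ` space M"
  then have "u -` {w} \<inter> space M = {}" by auto
  then show ?thesis by (simp add: level_prob_def)
qed

lemma simple_level: "simple_function M u \<Longrightarrow> u -` {w} \<inter> space M \<in> events"
proof (cases "w \<in> u ` space M")
  case False
  then have "u -` {w} \<inter> space M = {}" by auto
  then show ?thesis by simp
qed (auto simp: simple_function_def)

lemma simple_integral_real:
  fixes F :: "'w \<Rightarrow> real"
  assumes u: "simple_function M u"
  shows "(\<integral>x. F (u x) \<partial>M) = (\<Sum>w\<in>u ` space M. level_prob u w * F w)"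
proof -
  have fin: "finite (u ` space M)" using u by (simp add: simple_function_def)
  have "(\<integral>x. F (u x) \<partial>M) = (\<integral>x. (\<Sum>w\<in>u ` space M. F w * indicator (u -` {w} \<inter> space M) x) \<partial>M)"
  proof (rule Bochner_Integration.integral_cong)
    fix x assume x: "x \<in> space M"
    have "(\<Sum>w\<in>u ` space M. F w * indicator (u -` {w} \<inter> space M) x) =
        (\<Sum>w\<in>u ` space M. if w = u x then F w else 0)"
      using x by (intro sum.cong) (auto simp: indicator_def)
    then show "F (u x) = (\<Sum>w\<in>u ` space M. F w * indicator (u -` {w} \<inter> space M) x)"
      using fin x by simp
  qed simp
  also have "\<dots> = (\<Sum>w\<in>u ` space M. level_prob u w * F w)"
    using simple_level[OF u]
    by (subst Bochner_Integration.integral_sum)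
       (auto simp: level_prob_def mult.commute emeasure_eq_measure intro!: integrable_mult_right integrable_real_indicator sum.cong)
  finally show ?thesis .
qed

lemma sum_level_prob:
  assumes u: "simple_function M u"
  shows "(\<Sum>w\<in>u ` space M. level_prob u w) = 1"
  using simple_integral_real[OF u, of "\<lambda>_. 1"] by (simp add: prob_space)

lemma sum_level_prob_le:
  assumes u: "simple_function M u" and W: "finite W"
  shows "(\<Sum>w\<in>W. level_prob u w) \<le> 1"
proof -
  have "(\<Sum>w\<in>W. level_prob u w) = (\<Sum>w\<in>W \<inter> u ` space M. level_prob u w)"
    using W by (intro sum.mono_neutral_right) (auto simp: level_prob_outside)
  also have "\<dots> \<le> (\<Sum>w\<in>u ` space M. level_prob u w)"
    using u by (intro sum_mono2) (auto simp: simple_function_def)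
  finally show ?thesis using sum_level_prob[OF u] by simp
qed

lemma simple_entropy_nonneg: "0 \<le> simple_entropy u"
proof -
  have "level_prob u w * ln (level_prob u w) \<le> 0" for w
  proof (cases "level_prob u w = 0")
    case False
    then show ?thesis
      using level_prob_nonneg[of u w] prob_le_1[of "u -` {w} \<inter> space M"]
      by (intro mult_nonneg_nonpos) (auto simp: order_less_le level_prob_def)
  qed simp
  then show ?thesis unfolding simple_entropy_def by (intro sum_nonneg) simp
qed

text \<open>The Gibbs inequality against a product of factors, whose logarithm splits into a sum of
  integrals. Subadditivity of entropy and the comparison of two labels by conditional entropy are
  both instances, with different factors.\<close>

lemma gibbs_prod:
  assumes u: "simple_function M u" and J: "finite J"
    and q: "\<And>j w. 0 \<le> q j w" "\<And>j w. j \<in> J \<Longrightarrow> 0 < level_prob u w \<Longrightarrow> 0 < q j w"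
    and le: "(\<Sum>w\<in>u ` space M. \<Prod>j\<in>J. q j w) \<le> 1"
  shows "simple_entropy u \<le> (\<Sum>j\<in>J. \<integral>x. - ln (q j (u x)) \<partial>M)"
proof -
  have "simple_entropy u \<le> (\<Sum>w\<in>u ` space M. - (level_prob u w * ln (\<Prod>j\<in>J. q j w)))"
    unfolding simple_entropy_def using q le sum_level_prob[OF u]
    by (intro gibbs_inequality) (auto intro: prod_nonneg prod_pos)
  also have "\<dots> = (\<Sum>w\<in>u ` space M. \<Sum>j\<in>J. level_prob u w * (- ln (q j w)))"
  proof (rule sum.cong)
    fix w
    show "- (level_prob u w * ln (\<Prod>j\<in>J. q j w)) = (\<Sum>j\<in>J. level_prob u w * (- ln (q j w)))"
    proof (cases "level_prob u w = 0")
      case False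
      then have "ln (\<Prod>j\<in>J. q j w) = (\<Sum>j\<in>J. ln (q j w))"
        using q(2)[of _ w] J by (intro ln_prod) (auto simp: order_less_le)
      then show ?thesis by (simp add: sum_distrib_left sum_negf)
    qed simp
  qed simp
  also have "\<dots> = (\<Sum>j\<in>J. \<Sum>w\<in>u ` space M. level_prob u w * (- ln (q j w)))" by (rule sum.swap)
  also have "\<dots> = (\<Sum>j\<in>J. \<integral>x. - ln (q j (u x)) \<partial>M)"
    using simple_integral_real[OF u, of "\<lambda>w. - ln (q _ w)"] by simp
  finally show ?thesis .
qed

lemma simple_entropy_integral: "simple_function M u \<Longrightarrow> simple_entropy u = (\<integral>x. - ln (level_prob u (u x)) \<partial>M)"
  unfolding simple_entropy_def by (subst simple_integral_real[of u "\<lambda>w. - ln (level_prob u w)"]) auto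

text \<open>Merging level sets enlarges their probabilities, so \<open>- ln\<close> decreases at
  every value.\<close>

lemma simple_entropy_comp_le:
  assumes u: "simple_function M u"
  shows "simple_entropy (\<lambda>x. f (u x)) \<le> simple_entropy u"
proof -
  have fu: "simple_function M (\<lambda>x. f (u x))" by (rule simple_function_compose1[OF u])
  have "simple_entropy (\<lambda>x. f (u x)) = (\<Sum>w\<in>u ` space M. level_prob u w * (- ln (level_prob (\<lambda>x. f (u x)) (f w))))"
    unfolding simple_entropy_integral[OF fu] by (rule simple_integral_real[OF u, of "\<lambda>w. - ln (level_prob (\<lambda>x. f (u x)) (f w))"])
  also have "\<dots> \<le> (\<Sum>w\<in>u ` space M. - (level_prob u w * ln (level_prob u w)))"
  proof (rule sum_mono)
    fix w
    have "level_prob u w \<le> level_prob (\<lambda>x. f (u x)) (f w)"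
      unfolding level_prob_def using simple_level[OF fu] by (intro finite_measure_mono) auto
    then show "level_prob u w * (- ln (level_prob (\<lambda>x. f (u x)) (f w))) \<le> - (level_prob u w * ln (level_prob u w))"
      by (cases "level_prob u w = 0") (auto simp: order_less_le intro!: mult_left_mono ln_mono)
  qed
  finally show ?thesis by (simp add: simple_entropy_def)
qed

lemma simple_entropy_comp_inj:
  assumes u: "simple_function M u" and inj: "inj_on f (u ` space M)"
  shows "simple_entropy (\<lambda>x. f (u x)) = simple_entropy u"
proof (rule antisym)
  have fu: "simple_function M (\<lambda>x. f (u x))" by (rule simple_function_compose1[OF u])
  define v where "v x = the_inv_into (u ` space M) f (f (u x))" for x
  have v: "v x = u x" if "x \<in> space M" for x
    using that inj by (auto simp: v_def the_inv_into_f_f)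
  have "v -` {w} \<inter> space M = u -` {w} \<inter> space M" for w using v by auto
  moreover have "v ` space M = u ` space M" using v by auto
  ultimately have "simple_entropy v = simple_entropy u" by (simp add: simple_entropy_def level_prob_def)
  then show "simple_entropy u \<le> simple_entropy (\<lambda>x. f (u x))"
    using simple_entropy_comp_le[OF fu, of "the_inv_into (u ` space M) f"] by (simp add: v_def[abs_def])
qed (rule simple_entropy_comp_le[OF u])

end

section \<open>Kolmogorov-Sinai entropy through names\<close>

locale measure_preserving = prob_space M for M :: "'a measure" +
  fixes T :: "'a \<Rightarrow> 'a"
  assumes T_measurable: "T \<in> measurable M M"
    and T_preserves: "\<And>B. B \<in> sets M \<Longrightarrow> emeasure M (T -` B \<inter> space M) = emeasure M B"
begin

lemma T_space: "x \<in> space M \<Longrightarrow> (T ^^ k) x \<in> space M"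
  using measurable_space[OF T_measurable] by (induction k) auto

lemma funpow_measurable: "(T ^^ k) \<in> measurable M M"
proof (induction k)
  case (Suc k)
  then show ?case using measurable_comp[OF Suc T_measurable] by (simp add: comp_def)
qed (simp add: measurable_ident_sets[of M M, unfolded id_def] id_def)

lemma distr_funpow: "distr M M (T ^^ k) = M"
proof -
  have T: "distr M M T = M"
    by (rule measure_eqI) (simp_all add: emeasure_distr[OF T_measurable] T_preserves)
  show ?thesis
  proof (induction k)
    case (Suc k)
    have "distr M M (T ^^ Suc k) = distr (distr M M (T ^^ k)) M T"
      by (simp add: distr_distr[OF T_measurable funpow_measurable])
    then show ?case unfolding Suc T .
  qed (simp add: distr_id2)
qed

lemma integral_funpow:
  fixes F :: "'a \<Rightarrow> real"
  assumes "F \<in> borel_measurable M"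
  shows "(\<integral>x. F ((T ^^ k) x) \<partial>M) = (\<integral>x. F x \<partial>M)"
  using integral_distr[OF funpow_measurable assms, of k] by (simp add: distr_funpow)

text \<open>The itinerary of x under the labelling f; its level sets are the atoms of the iterated
  join.\<close>

definition names :: "('a \<Rightarrow> 'i) \<Rightarrow> nat \<Rightarrow> 'a \<Rightarrow> 'i list" where
  "names f n x = map (\<lambda>k. f ((T ^^ k) x)) [0..<n]"

lemma length_names [simp]: "length (names f n x) = n"
  by (simp add: names_def)

lemma nth_names: "k < n \<Longrightarrow> names f n x ! k = f ((T ^^ k) x)"
  by (simp add: names_def)

lemma names_eq_iff: "names f n x = w \<longleftrightarrow> length w = n \<and> (\<forall>k<n. f ((T ^^ k) x) = w ! k)"
  by (subst list_eq_iff_nth_eq) (auto simp: nth_names)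

lemma names_add: "names f (m + n) x = names f m x @ names f n ((T ^^ m) x)"
proof (rule nth_equalityI)
  fix k assume k: "k < length (names f (m + n) x)"
  have "(T ^^ k) x = (T ^^ (k - m)) ((T ^^ m) x)" if "m \<le> k"
    using that funpow_add[of "k - m" m T] by (metis comp_apply le_add_diff_inverse2)
  then show "names f (m + n) x ! k = (names f m x @ names f n ((T ^^ m) x)) ! k"
    using k by (auto simp: nth_append nth_names not_less)
qed simp

lemma simple_funpow:
  assumes "simple_function M f"
  shows "simple_function M (\<lambda>x. f ((T ^^ k) x))"
proof -
  have "(\<lambda>x. f ((T ^^ k) x)) ` space M \<subseteq> f ` space M" using T_space by auto
  moreover have "(\<lambda>x. f ((T ^^ k) x)) -` {y} \<inter> space M \<in> sets M" for y
  proof -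
    have "(\<lambda>x. f ((T ^^ k) x)) -` {y} \<inter> space M = (T ^^ k) -` (f -` {y} \<inter> space M) \<inter> space M"
      using T_space by auto
    also have "\<dots> \<in> sets M" by (rule measurable_sets[OF funpow_measurable simple_level[OF assms]])
    finally show ?thesis .
  qed
  ultimately show ?thesis
    using assms by (auto simp: simple_function_def intro: finite_subset)
qed

lemma simple_names:
  assumes "simple_function M f"
  shows "simple_function M (names f n)"
proof (induction n)
  case 0
  then show ?case by (simp add: names_def[abs_def])
next
  case (Suc n)
  have "names f (Suc n) = (\<lambda>x. names f n x @ [f ((T ^^ n) x)])"
    by (rule ext) (simp add: names_def)
  then show ?case
    using simple_function_compose2[OF Suc simple_funpow[OF assms, of n], of "\<lambda>w a. w @ [a]"] by simp
qed

lemma simple_borel: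
  "simple_function M u \<Longrightarrow> (\<lambda>x. F (u x) :: real) \<in> borel_measurable M"
  by (rule borel_measurable_simple_function[OF simple_function_compose1])

lemma names_words: "x \<in> space M \<Longrightarrow> names f n x \<in> words (f ` space M) n"
  using T_space by (auto simp: words_def names_def)

lemma simple_entropy_names_subadd:
  assumes f: "simple_function M f"
  shows "simple_entropy (names f (m + n)) \<le> simple_entropy (names f m) + simple_entropy (names f n)"
proof -
  \<comment> \<open>The two factors, indexed by a truth value, are the laws of the first m and of
    the last n labels; their product is a probability on words of length
    \<open>m + n\<close>.\<close>
  define q where "q j w = (if j then level_prob (names f m) (take m w) else level_prob (names f n) (drop m w))" for j w
  have s: "simple_function M (names f k)" for k by (rule simple_names[OF f])
  have "simple_entropy (names f (m + n)) \<le> (\<Sum>j\<in>{True, False}. \<integral>x. - ln (q j (names f (m + n) x)) \<partial>M)"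
  proof (rule gibbs_prod[OF s])
    show "0 < q j w" if "0 < level_prob (names f (m + n)) w" for j w
    proof (cases j)
      case True
      have "level_prob (names f (m + n)) w \<le> level_prob (names f m) (take m w)"
        unfolding level_prob_def using simple_level[OF s]
        by (intro finite_measure_mono) (auto simp: names_add)
      then show ?thesis using that True by (simp add: q_def)
    next
      case False
      have "level_prob (names f (m + n)) w \<le> prob ((T ^^ m) -` (names f n -` {drop m w} \<inter> space M) \<inter> space M)"
        unfolding level_prob_def using simple_level[OF s] T_space
        by (intro finite_measure_mono measurable_sets[OF funpow_measurable]) (auto simp: names_add)
      also have "\<dots> = level_prob (names f n) (drop m w)"
        unfolding level_prob_def using measure_distr[OF funpow_measurable simple_level[OF s], of m n "drop m w"]
        by (simp add: distr_funpow)
      finally show ?thesis using that False by (simp add: q_def)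
    qed
    have "(\<Sum>w\<in>names f (m + n) ` space M. \<Prod>j\<in>{True, False}. q j w)
       \<le> (\<Sum>w\<in>(\<lambda>(u, v). u @ v) ` (names f m ` space M \<times> names f n ` space M). \<Prod>j\<in>{True, False}. q j w)"
    proof (rule sum_mono2)
      show "names f (m + n) ` space M \<subseteq> (\<lambda>(u, v). u @ v) ` (names f m ` space M \<times> names f n ` space M)"
        using T_space by (force simp: names_add)
    qed (use s in \<open>auto simp: q_def simple_function_def\<close>)
    also have "\<dots> = (\<Sum>(u, v)\<in>names f m ` space M \<times> names f n ` space M. level_prob (names f m) u * level_prob (names f n) v)"
      by (subst sum.reindex) (auto simp: inj_on_def q_def intro!: sum.cong)
    also have "\<dots> = (\<Sum>u\<in>names f m ` space M. level_prob (names f m) u) * (\<Sum>v\<in>names f n ` space M. level_prob (names f n) v)"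
      by (simp add: sum_product sum.cartesian_product)
    also have "\<dots> = 1" using sum_level_prob[OF s] by simp
    finally show "(\<Sum>w\<in>names f (m + n) ` space M. \<Prod>j\<in>{True, False}. q j w) \<le> 1" .
  qed (auto simp: q_def)
  also have "\<dots> = (\<integral>x. - ln (level_prob (names f m) (names f m x)) \<partial>M) + (\<integral>x. - ln (level_prob (names f n) (names f n ((T ^^ m) x))) \<partial>M)"
    by (simp add: q_def names_add)
  also have "(\<integral>x. - ln (level_prob (names f n) (names f n ((T ^^ m) x))) \<partial>M) = (\<integral>x. - ln (level_prob (names f n) (names f n x)) \<partial>M)"
    by (rule integral_funpow) (rule simple_borel[OF s, of "\<lambda>w. - ln (level_prob (names f n) w)"])
  finally show ?thesis by (simp add: simple_entropy_integral[OF s])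
qed

lemma entropy_rate:
  assumes f: "simple_function M f"
  obtains l where "(\<lambda>n. simple_entropy (names f n) / real n) \<longlonglongrightarrow> l"
  by (rule fekete[of "\<lambda>n. simple_entropy (names f n)" 0]) (use simple_entropy_names_subadd[OF f] simple_entropy_nonneg in auto)

text \<open>The last term is the conditional entropy of \<open>f\<close> given \<open>g\<close>.\<close>

lemma simple_entropy_names_compare:
  fixes f :: "'a \<Rightarrow> 'i" and g :: "'a \<Rightarrow> 'j"
  assumes f: "simple_function M f" and g: "simple_function M g"
  shows "simple_entropy (names f n) \<le> simple_entropy (names g n) +
    real n * (\<integral>x. - ln (level_prob (\<lambda>x. (f x, g x)) (f x, g x) / level_prob g (g x)) \<partial>M)"
proof -
  define h where "h x = (f x, g x)" for x
  have h: "simple_function M h" unfolding h_def by (rule simple_function_compose2[OF f g, of Pair])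
  define q where "q c = level_prob h c / level_prob g (snd c)" for c
  \<comment> \<open>The reference weight has \<open>n + 1\<close> factors: at each position the
    conditional probability \<open>q\<close> of the f-label given the g-label, and as factor number
    n the law of the whole g-name.\<close>
  define Q where "Q j cs = (if j < n then q (cs ! j) else level_prob (names g n) (map snd cs))" for j cs
  have s: "simple_function M (names g n)" "simple_function M (names h n)"
    using simple_names g h by auto
  have fin: "finite (f ` space M)" "finite (g ` space M)"
    using f g by (auto simp: simple_function_def)
  have P_gh: "level_prob h c \<le> level_prob g (snd c)" for c
    unfolding level_prob_def using simple_level[OF g] by (intro finite_measure_mono) (auto simp: h_def)
  have sum_q: "(\<Sum>i\<in>f ` space M. q (i, j)) \<le> 1" for j
  proof -
    have "(\<Sum>i\<in>f ` space M. level_prob h (i, j)) = prob (\<Union>i\<in>f ` space M. h -` {(i, j)} \<inter> space M)"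
      unfolding level_prob_def using fin simple_level[OF h]
      by (intro finite_measure_finite_Union[symmetric]) (auto simp: disjoint_family_on_def)
    also have "\<dots> \<le> level_prob g j"
      unfolding level_prob_def using simple_level[OF g] by (intro finite_measure_mono) (auto simp: h_def)
    finally show ?thesis
      by (cases "level_prob g j = 0") (auto simp: q_def sum_divide_distrib[symmetric] order_less_le divide_le_eq)
  qed
  have "simple_entropy (names f n) = simple_entropy (\<lambda>x. map fst (names h n x))"
    by (rule arg_cong[of _ _ simple_entropy]) (auto simp: names_def h_def)
  also have "\<dots> \<le> simple_entropy (names h n)" by (rule simple_entropy_comp_le[OF s(2)])
  also have "\<dots> \<le> (\<Sum>j\<in>{..n}. \<integral>x. - ln (Q j (names h n x)) \<partial>M)"
  proof (rule gibbs_prod[OF s(2)])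
    show "0 < Q j cs" if "0 < level_prob (names h n) cs" for j cs
    proof (cases "j < n")
      case True
      have "level_prob (names h n) cs \<le> prob ((T ^^ j) -` (h -` {cs ! j} \<inter> space M) \<inter> space M)"
        unfolding level_prob_def using simple_level[OF h] T_space True
        by (intro finite_measure_mono measurable_sets[OF funpow_measurable]) (auto simp: nth_names)
      also have "\<dots> = level_prob h (cs ! j)"
        unfolding level_prob_def using measure_distr[OF funpow_measurable simple_level[OF h], of j "cs ! j"]
        by (simp add: distr_funpow)
      finally have "0 < level_prob h (cs ! j)" using that by simp
      moreover from this have "0 < level_prob g (snd (cs ! j))" using P_gh less_le_trans by blast
      ultimately show ?thesis using True by (simp add: Q_def q_def)
    next
      case False
      have "level_prob (names h n) cs \<le> level_prob (names g n) (map snd cs)"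
        unfolding level_prob_def using simple_level[OF s(1)]
        by (intro finite_measure_mono) (auto simp: names_def h_def comp_def)
      then show ?thesis using False that by (simp add: Q_def)
    qed
    have "(\<Sum>cs\<in>names h n ` space M. \<Prod>j\<le>n. Q j cs) = (\<Sum>cs\<in>names h n ` space M. level_prob (names g n) (map snd cs) * (\<Prod>k<n. q (cs ! k)))"
      by (intro sum.cong) (auto simp: Q_def lessThan_Suc_atMost[symmetric] mult.commute)
    also have "\<dots> \<le> (\<Sum>cs\<in>words (f ` space M \<times> g ` space M) n. level_prob (names g n) (map snd cs) * (\<Prod>k<n. q (cs ! k)))"
    proof (rule sum_mono2)
      show "names h n ` space M \<subseteq> words (f ` space M \<times> g ` space M) n"
        using T_space by (auto simp: words_def names_def h_def)
    qed (use fin in \<open>auto simp: finite_words q_def intro!: mult_nonneg_nonneg prod_nonneg\<close>)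
    also have "\<dots> \<le> (\<Sum>bs\<in>words (g ` space M) n. level_prob (names g n) bs)"
      using fin sum_q by (intro sum_words_weighted_le) (auto simp: q_def)
    also have "\<dots> \<le> 1" using fin by (intro sum_level_prob_le s finite_words)
    finally show "(\<Sum>cs\<in>names h n ` space M. \<Prod>j\<le>n. Q j cs) \<le> 1" .
  qed (auto simp: Q_def q_def)
  also have "\<dots> = (\<Sum>j<n. \<integral>x. - ln (q (h ((T ^^ j) x))) \<partial>M) + (\<integral>x. - ln (level_prob (names g n) (map snd (names h n x))) \<partial>M)"
    unfolding lessThan_Suc_atMost[symmetric] by (simp add: Q_def nth_names)
  also have "(\<lambda>x. map snd (names h n x)) = names g n"
    by (auto simp: names_def h_def)
  then have "(\<integral>x. - ln (level_prob (names g n) (map snd (names h n x))) \<partial>M) = simple_entropy (names g n)"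
    unfolding simple_entropy_integral[OF s(1)] by (metis (no_types, lifting))
  also have "(\<Sum>j<n. \<integral>x. - ln (q (h ((T ^^ j) x))) \<partial>M) = (\<Sum>j<n. \<integral>x. - ln (q (h x)) \<partial>M)"
    by (intro sum.cong refl integral_funpow simple_borel[OF h, of "\<lambda>c. - ln (q c)"])
  finally show ?thesis by (simp add: q_def h_def[abs_def])
qed

text \<open>For a pair with equal components, \<open>ln t \<le> t - 1\<close> bounds the term by the
  amount by which the mass of the g-label exceeds that of the pair, at most t. For unequal
  components the mass a of the pair is at most t and \<open>a * ln (1 / a) \<le> 2 * sqrt a\<close>.
  The square of \<open>card C\<close> counts the pairs crudely.\<close>

lemma conditional_entropy_bound:
  fixes f g :: "'a \<Rightarrow> 'i"
  assumes f: "simple_function M f" and g: "simple_function M g"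
    and C: "finite C" "f ` space M \<subseteq> C" "g ` space M \<subseteq> C"
    and t: "prob {x \<in> space M. f x \<noteq> g x} \<le> t"
  shows "(\<integral>x. - ln (level_prob (\<lambda>x. (f x, g x)) (f x, g x) / level_prob g (g x)) \<partial>M) \<le> real (card C) ^ 2 * (2 * sqrt t + t)"
proof -
  define h where "h x = (f x, g x)" for x
  have h: "simple_function M h" unfolding h_def by (rule simple_function_compose2[OF f g, of Pair])
  have t0: "0 \<le> t" using t measure_nonneg order_trans by blast
  have P_gh: "level_prob h c \<le> level_prob g (snd c)" for c
    unfolding level_prob_def using simple_level[OF g] by (intro finite_measure_mono) (auto simp: h_def)
  have ne: "{x \<in> space M. f x \<noteq> g x} \<in> events"
  proof -
    have "{x \<in> space M. f x \<noteq> g x} = (\<Union>c\<in>{c \<in> C \<times> C. fst c \<noteq> snd c}. h -` {c} \<inter> space M)"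
      using C(2,3) by (fastforce simp: h_def)
    also have "\<dots> \<in> events" using C simple_level[OF h] by (intro sets.finite_UN) auto
    finally show ?thesis .
  qed
  have term_le: "level_prob h c * - ln (level_prob h c / level_prob g (snd c)) \<le> 2 * sqrt t + t" for c
  proof (cases "level_prob h c = 0")
    case False
    have pos: "0 < level_prob h c" using False level_prob_nonneg[of h c] by linarith
    then have pos: "0 < level_prob h c" "0 < level_prob g (snd c)" using P_gh[of c] by linarith+
    have eq: "- ln (level_prob h c / level_prob g (snd c)) = ln (level_prob g (snd c) / level_prob h c)" using pos by (simp add: ln_div)
    show ?thesis
    proof (cases "fst c = snd c")
      case True
      have "level_prob h c * ln (level_prob g (snd c) / level_prob h c) \<le> level_prob h c * (level_prob g (snd c) / level_prob h c - 1)"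
        using pos by (intro mult_left_mono ln_le_minus_one) auto
      also have "\<dots> = level_prob g (snd c) - level_prob h c" using pos by (simp add: field_simps)
      also have "\<dots> \<le> t"
      proof -
        have "level_prob g (snd c) \<le> prob ((h -` {c} \<inter> space M) \<union> {x \<in> space M. f x \<noteq> g x})"
          unfolding level_prob_def using simple_level[OF h] ne True
          by (intro finite_measure_mono) (auto simp: h_def prod_eq_iff)
        also have "\<dots> \<le> level_prob h c + prob {x \<in> space M. f x \<noteq> g x}"
          unfolding level_prob_def using simple_level[OF h] ne by (intro measure_Un_le) auto
        finally show ?thesis using t by simp
      qed
      finally show ?thesis unfolding eq using t0 real_sqrt_ge_zero[OF t0] by linarith
    next
      case False
      have "level_prob h c \<le> prob {x \<in> space M. f x \<noteq> g x}"
        unfolding level_prob_def using ne False by (intro finite_measure_mono) (auto simp: h_def)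
      then have le: "level_prob h c \<le> t" using t by simp
      have "level_prob g (snd c) \<le> 1" unfolding level_prob_def by (rule prob_le_1)
      then have "ln (level_prob g (snd c) / level_prob h c) \<le> ln (1 / level_prob h c)"
        using pos by (intro ln_mono divide_right_mono) auto
      also have "\<dots> = 2 * ln (1 / sqrt (level_prob h c))" using pos by (simp add: ln_div ln_sqrt)
      also have "\<dots> \<le> 2 * (1 / sqrt (level_prob h c))"
        using ln_le_minus_one[of "1 / sqrt (level_prob h c)"] pos by simp
      finally have "level_prob h c * ln (level_prob g (snd c) / level_prob h c) \<le> level_prob h c * (2 * (1 / sqrt (level_prob h c)))"
        using pos by (intro mult_left_mono) auto
      also have "\<dots> = 2 * (level_prob h c / sqrt (level_prob h c))" by simp
      also have "\<dots> = 2 * sqrt (level_prob h c)" using pos by (simp add: real_div_sqrt)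
      also have "\<dots> \<le> 2 * sqrt t" using le by simp
      finally show ?thesis unfolding eq using t0 real_sqrt_ge_zero[OF t0] by linarith
    qed
  qed (use t0 in simp)
  have "(\<integral>x. - ln (level_prob h (h x) / level_prob g (snd (h x))) \<partial>M) = (\<Sum>c\<in>h ` space M. level_prob h c * - ln (level_prob h c / level_prob g (snd c)))"
    by (rule simple_integral_real[OF h])
  also have "\<dots> \<le> (\<Sum>c\<in>h ` space M. 2 * sqrt t + t)" by (rule sum_mono) (rule term_le)
  also have "\<dots> = real (card (h ` space M)) * (2 * sqrt t + t)" by simp
  also have "\<dots> \<le> real (card C) ^ 2 * (2 * sqrt t + t)"
  proof (rule mult_right_mono)
    have "card (h ` space M) \<le> card (C \<times> C)"
      using C by (intro card_mono) (auto simp: h_def)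
    then have "card (h ` space M) \<le> card C ^ 2" by (simp add: card_cartesian_product power2_eq_square)
    then show "real (card (h ` space M)) \<le> real (card C) ^ 2" by (simp flip: of_nat_power)
  qed (use t0 in simp)
  finally show ?thesis by (simp add: h_def[abs_def])
qed

text \<open>The atoms of the join, the empty set having been discarded, correspond one to one to the
  names that occur.\<close>

lemma partition_entropy_names:
  assumes C: "\<C> \<in> finite_partitions M" and l: "\<And>x. x \<in> space M \<Longrightarrow> l x \<in> \<C> \<and> x \<in> l x"
    and sl: "simple_function M l"
  shows "partition_entropy M (iterated_join M T \<C> n) = simple_entropy (names l n)"
proof -
  have "disjoint \<C>" using C unfolding finite_partitions_def partition_on_def by blast
  then have uniq: "x \<in> B \<longleftrightarrow> l x = B" if "x \<in> space M" "B \<in> \<C>" for x B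
    using l[OF that(1)] that(2) disjointD[of \<C> "l x" B] by auto
  have "iterated_join M T \<C> n = (\<lambda>w. names l n -` {w} \<inter> space M) ` (names l n ` space M)"
  proof (intro equalityI subsetI)
    fix D assume "D \<in> iterated_join M T \<C> n"
    then obtain f where f: "D = {x \<in> space M. \<forall>k<n. (T ^^ k) x \<in> f k}" "\<forall>k<n. f k \<in> \<C>" "D \<noteq> {}"
      unfolding iterated_join_def by blast
    have D: "x \<in> D \<longleftrightarrow> x \<in> space M \<and> names l n x = map f [0..<n]" for x
      using f(2) uniq[OF T_space, of x] by (auto simp: f(1) names_eq_iff)
    obtain x where "x \<in> D" using f(3) by blast
    then have "map f [0..<n] \<in> names l n ` space M" using D[of x] by (metis imageI)
    moreover have "D = names l n -` {map f [0..<n]} \<inter> space M" using D by (intro set_eqI) auto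
    ultimately show "D \<in> (\<lambda>w. names l n -` {w} \<inter> space M) ` (names l n ` space M)"
      by (rule rev_image_eqI)
  next
    fix D assume "D \<in> (\<lambda>w. names l n -` {w} \<inter> space M) ` (names l n ` space M)"
    then obtain y where y: "y \<in> space M" "D = names l n -` {names l n y} \<inter> space M" by blast
    have "D = {x \<in> space M. \<forall>k<n. (T ^^ k) x \<in> l ((T ^^ k) y)}"
      using uniq[OF T_space] l[OF T_space[OF y(1)]] by (auto simp: y(2) names_eq_iff nth_names)
    moreover have "y \<in> D" using y by simp
    ultimately show "D \<in> iterated_join M T \<C> n"
      unfolding iterated_join_def using l[OF T_space[OF y(1)]]
      by (intro DiffI CollectI exI[of _ "\<lambda>k. l ((T ^^ k) y)"]) auto
  qed
  then have "partition_entropy M (iterated_join M T \<C> n) =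
      - (\<Sum>B\<in>(\<lambda>w. names l n -` {w} \<inter> space M) ` (names l n ` space M). prob B * ln (prob B))"
    by (simp add: partition_entropy_def)
  also have "\<dots> = - (\<Sum>w\<in>names l n ` space M. level_prob (names l n) w * ln (level_prob (names l n) w))"
    by (subst sum.reindex) (auto simp: inj_on_def level_prob_def)
  finally show ?thesis by (simp add: simple_entropy_def sum_negf)
qed

lemma finite_partition_label:
  assumes C: "\<C> \<in> finite_partitions M"
  obtains l where "\<And>x. x \<in> space M \<Longrightarrow> l x \<in> \<C> \<and> x \<in> l x" "simple_function M l" "l ` space M \<subseteq> \<C>"
proof -
  have "\<forall>x\<in>space M. \<exists>B. B \<in> \<C> \<and> x \<in> B"
    using C unfolding finite_partitions_def partition_on_def by blast
  then obtain l where l: "\<And>x. x \<in> space M \<Longrightarrow> l x \<in> \<C> \<and> x \<in> l x" by metis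
  have sub: "B \<subseteq> space M" if "B \<in> \<C>" for B
    using that C unfolding finite_partitions_def partition_on_def by blast
  have uniq: "A = B" if "A \<in> \<C>" "B \<in> \<C>" "y \<in> A" "y \<in> B" for A B y
    using that C unfolding finite_partitions_def partition_on_def disjoint_def by blast
  have "l -` {l x} \<inter> space M = l x" if x: "x \<in> space M" for x
  proof (intro equalityI subsetI)
    show "y \<in> l x" if "y \<in> l -` {l x} \<inter> space M" for y
      using that l[of y] by auto
    show "y \<in> l -` {l x} \<inter> space M" if "y \<in> l x" for y
      using that l[OF x] sub uniq[of "l y" "l x" y] l[of y] by auto
  qed
  then have "simple_function M l"
    using l C by (auto simp: simple_function_def finite_partitions_def subset_iff intro: finite_subset[of _ \<C>])
  with l show ?thesis using that by blast
qed

lemma ks_entropy_ge: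
  assumes f: "simple_function M f" and lim: "(\<lambda>n. simple_entropy (names f n) / real n) \<longlonglongrightarrow> r"
  shows "ereal r \<le> ks_entropy M T"
proof -
  define \<C> where "\<C> = (\<lambda>i. f -` {i} \<inter> space M) ` (f ` space M)"
  have C: "\<C> \<in> finite_partitions M"
    using f by (auto simp: finite_partitions_def \<C>_def simple_function_def partition_on_def disjoint_def)
  define l where "l x = f -` {f x} \<inter> space M" for x
  have sl: "simple_function M l" unfolding l_def by (rule simple_function_compose1[OF f])
  have "simple_entropy (names l n) = simple_entropy (names f n)" for n
  proof -
    have "names l n = (\<lambda>x. map (\<lambda>i. f -` {i} \<inter> space M) (names f n x))"
      by (auto simp: names_def l_def)
    moreover have "inj_on (map (\<lambda>i. f -` {i} \<inter> space M)) (names f n ` space M)"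
    proof (rule inj_on_subset[of _ "words (f ` space M) n"])
      have "inj_on (\<lambda>i. f -` {i} \<inter> space M) (f ` space M)" by (auto simp: inj_on_def)
      then have "inj_on (map (\<lambda>i. f -` {i} \<inter> space M)) (lists (f ` space M))" by (rule inj_on_mapI[OF inj_on_subset]) auto
      then show "inj_on (map (\<lambda>i. f -` {i} \<inter> space M)) (words (f ` space M) n)"
        by (rule inj_on_subset) (auto simp: words_def)
    qed (use names_words in blast)
    ultimately show ?thesis by (simp add: simple_entropy_comp_inj[OF simple_names[OF f]])
  qed
  then have "partition_entropy M (iterated_join M T \<C> n) = simple_entropy (names f n)" for n
    using partition_entropy_names[OF C _ sl] by (auto simp: \<C>_def l_def)
  then have "lim (\<lambda>n. partition_entropy M (iterated_join M T \<C> n) / real n) = r"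
    using lim by (simp add: limI)
  then show ?thesis unfolding ks_entropy_def using C by (intro SUP_upper2[of \<C>]) auto
qed

end

section \<open>Invariant measures and finite block distributions\<close>

definition prefix_set :: "nat \<Rightarrow> nat list set \<Rightarrow> (nat \<Rightarrow> nat) set" where
  "prefix_set n W = {x \<in> Xfull. map x [0..<n] \<in> W}"

lemma prefix_set_UN: "prefix_set n W = (\<Union>w\<in>{w \<in> W. length w = n}. cyl w)"
proof (rule set_eqI)
  fix x
  show "x \<in> prefix_set n W \<longleftrightarrow> x \<in> (\<Union>w\<in>{w \<in> W. length w = n}. cyl w)"
  proof
    assume x: "x \<in> prefix_set n W"
    then have "x \<in> cyl (map x [0..<n])" by (auto simp: prefix_set_def cylinder_def)
    then show "x \<in> (\<Union>w\<in>{w \<in> W. length w = n}. cyl w)" using x by (auto simp: prefix_set_def)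
  next
    assume "x \<in> (\<Union>w\<in>{w \<in> W. length w = n}. cyl w)"
    then obtain w where w: "w \<in> W" "length w = n" "x \<in> cyl w" by blast
    then have "x \<in> Xfull" using cyl_subset by blast
    with w show "x \<in> prefix_set n W" using cyl_eq_prefix[of x w] by (simp add: prefix_set_def)
  qed
qed

lemma prefix_set_in_BX: "prefix_set n W \<in> sets BX"
  unfolding prefix_set_UN by (rule sets.countable_UN'') auto

text \<open>The approximable sets form a sigma-algebra containing the cylinders: complements carry
  over exactly, and a countable union is cut to a finite one before the approximants are brought to
  the common length \<open>L\<close>.\<close>

lemma borel_approx_prefix_set:
  assumes mu: "\<mu> \<in> prob_measures Xfull" and B: "A \<in> sets \<mu>" and d: "0 < d"
  shows "\<exists>n W. measure \<mu> ((A - prefix_set n W) \<union> (prefix_set n W - A)) < d"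
proof -
  interpret m: prob_space \<mu> by (rule prob_measuresD[OF mu])
  have sets: "sets \<mu> = sigma_sets Xfull (range cyl)" using prob_measuresD(1)[OF mu] sets_BX by simp
  have [measurable]: "prefix_set n W \<in> sets \<mu>" for n W
    using prefix_set_in_BX prob_measuresD(1)[OF mu] by simp
  have "A \<in> sigma_sets Xfull (range cyl)" using B sets by simp
  then show ?thesis using d
  proof (induction arbitrary: d)
    case (Basic a)
    then obtain w where "a = cyl w" by blast
    then have "a = prefix_set (length w) {w}" by (auto simp: prefix_set_UN)
    then show ?case using Basic by (intro exI[of _ "length w"] exI[of _ "{w}"]) simp
  next
    case Empty
    then show ?case by (intro exI[of _ 0] exI[of _ "{}"]) (simp add: prefix_set_def)
  next
    case (Compl a)
    obtain n W where nW: "measure \<mu> ((a - prefix_set n W) \<union> (prefix_set n W - a)) < d" using Compl by blast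
    have "a \<subseteq> Xfull" using Compl(1) sigma_sets_into_sp[of "range cyl" Xfull] cyl_subset by auto
    then have "((Xfull - a) - prefix_set n (- W)) \<union> (prefix_set n (- W) - (Xfull - a)) =
        (a - prefix_set n W) \<union> (prefix_set n W - a)"
      by (auto simp: prefix_set_def)
    then show ?case using nW by metis
  next
    case (Union a)
    have a [measurable]: "a i \<in> sets \<mu>" for i using Union(1) sets by auto
    have "(\<lambda>N. measure \<mu> (\<Union>i<N. a i)) \<longlonglongrightarrow> measure \<mu> (\<Union>N. \<Union>i<N. a i)"
      by (rule m.finite_Lim_measure_incseq) (auto intro!: incseq_SucI intro: less_SucI)
    also have "(\<Union>N. \<Union>i<N. a i) = (\<Union>i. a i)" by (auto intro: lessI)
    finally have "\<forall>\<^sub>F N in sequentially. measure \<mu> (\<Union>i. a i) - d / 2 < measure \<mu> (\<Union>i<N. a i)"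
      using Union.prems by (intro order_tendstoD(1)) auto
    then obtain N where N: "measure \<mu> (\<Union>i. a i) - d / 2 < measure \<mu> (\<Union>i<N. a i)"
      by (auto simp: eventually_sequentially)
    have "\<forall>i. \<exists>n W. measure \<mu> ((a i - prefix_set n W) \<union> (prefix_set n W - a i)) < d / (2 * (real N + 1))"
      using Union.IH Union.prems by simp
    then obtain n W where nW: "\<And>i. measure \<mu> ((a i - prefix_set (n i) (W i)) \<union> (prefix_set (n i) (W i) - a i)) < d / (2 * (real N + 1))"
      by metis
    define D where "D i = (a i - prefix_set (n i) (W i)) \<union> (prefix_set (n i) (W i) - a i)" for i
    have [measurable]: "D i \<in> sets \<mu>" for i by (simp add: D_def)
    define L where "L = Max (insert 0 (n ` {..<N}))"
    have L: "n i \<le> L" if "i < N" for i unfolding L_def using that by (intro Max_ge) auto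
    define V where "V = {w. \<exists>i<N. take (n i) w \<in> W i}"
    have V: "prefix_set L V = (\<Union>i<N. prefix_set (n i) (W i))"
      using L by (auto simp: prefix_set_def V_def take_map min_def)
    have "measure \<mu> (((\<Union>i. a i) - prefix_set L V) \<union> (prefix_set L V - (\<Union>i. a i)))
       \<le> measure \<mu> (((\<Union>i. a i) - (\<Union>i<N. a i)) \<union> (\<Union>i<N. D i))"
      unfolding V by (intro m.finite_measure_mono) (auto simp: D_def)
    also have "\<dots> \<le> measure \<mu> ((\<Union>i. a i) - (\<Union>i<N. a i)) + measure \<mu> (\<Union>i<N. D i)"
      by (intro measure_Un_le) auto
    also have "measure \<mu> ((\<Union>i. a i) - (\<Union>i<N. a i)) = measure \<mu> (\<Union>i. a i) - measure \<mu> (\<Union>i<N. a i)"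
      by (intro m.finite_measure_Diff) auto
    also have "measure \<mu> (\<Union>i<N. D i) \<le> (\<Sum>i<N. measure \<mu> (D i))"
      by (intro m.finite_measure_subadditive_finite) auto
    also have "\<dots> \<le> (\<Sum>i<N. d / (2 * (real N + 1)))" using nW by (intro sum_mono) (simp add: D_def less_imp_le)
    also have "\<dots> \<le> d / 2" using Union.prems by (simp add: field_simps)
    finally show ?case using N by (intro exI[of _ L] exI[of _ V]) linarith
  qed
qed

lemma cyl_Cons: "x \<in> cyl (p # w) \<longleftrightarrow> x \<in> Xfull \<and> x 0 = p \<and> left_shift x \<in> cyl w"
proof -
  have "x \<in> Xfull \<Longrightarrow> left_shift x \<in> Xfull" by (simp add: full_shift_def left_shift_def)
  then show ?thesis by (auto simp: cylinder_def All_less_Suc2 left_shift_def)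
qed

lemma invariant_measuresD:
  assumes "\<nu> \<in> invariant_measures"
  shows "\<nu> \<in> prob_measures Xfull" "measure_preserving \<nu> left_shift"
proof -
  show nu: "\<nu> \<in> prob_measures Xfull" using assms by (simp add: invariant_measures_def)
  interpret prob_space \<nu> by (rule prob_measuresD[OF nu])
  have "left_shift \<in> measurable BX BX"
  proof (rule measurable_BX)
    fix x assume "x \<in> space BX" then show "left_shift x \<in> Xfull" by (auto simp: full_shift_def left_shift_def)
  next
    fix w
    have "left_shift -` cyl w \<inter> space BX = (\<Union>p. cyl (p # w))"
      by (rule set_eqI) (simp add: cyl_Cons conj_commute)
    then show "left_shift -` cyl w \<inter> space BX \<in> sets BX" by simp
  qed
  moreover have "sets \<nu> = sets BX" by (rule prob_measuresD[OF nu])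
  ultimately have "left_shift \<in> measurable \<nu> \<nu>" by (simp cong: measurable_cong_sets)
  then show "measure_preserving \<nu> left_shift"
    using assms by unfold_locales (auto simp: invariant_measures_def)
qed

text \<open>The entropy of an arbitrary finite partition has to be read off words, so its atoms are
  approximated by sets depending on \<open>L\<close> coordinates; conditional entropy bounds the
  loss by e per step. The last conclusion makes the \<open>lim\<close> in \<open>ks_entropy\<close>
  a true limit.\<close>

lemma entropy_prefix_label:
  assumes nu: "\<nu> \<in> invariant_measures" and C: "\<C> \<in> finite_partitions \<nu>" and e: "0 < e"
  obtains L and G :: "nat list \<Rightarrow> (nat \<Rightarrow> nat) set" where
    "simple_function \<nu> (\<lambda>x. G (map x [0..<L]))"
    "\<And>n. partition_entropy \<nu> (iterated_join \<nu> left_shift \<C> n) \<le>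
      prob_space.simple_entropy \<nu> (measure_preserving.names left_shift (\<lambda>x. G (map x [0..<L])) n) + real n * e"
    "convergent (\<lambda>n. partition_entropy \<nu> (iterated_join \<nu> left_shift \<C> n) / real n)"
proof -
  note nu' = invariant_measuresD(1)[OF nu]
  interpret measure_preserving \<nu> left_shift by (rule invariant_measuresD(2)[OF nu])
  have sp: "space \<nu> = Xfull" by (rule prob_measuresD[OF nu'])
  have [measurable]: "prefix_set n W \<in> sets \<nu>" for n W
    using prefix_set_in_BX prob_measuresD(1)[OF nu'] by simp
  obtain l where l: "\<And>x. x \<in> space \<nu> \<Longrightarrow> l x \<in> \<C> \<and> x \<in> l x" "simple_function \<nu> l" "l ` space \<nu> \<subseteq> \<C>"
    using finite_partition_label[OF C] by metis
  have fin: "finite \<C>" and Csets: "\<C> \<subseteq> sets \<nu>" using C by (auto simp: finite_partitions_def)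
  have "disjoint \<C>" using C unfolding finite_partitions_def partition_on_def by blast
  then have uniq: "x \<in> B \<longleftrightarrow> l x = B" if "x \<in> space \<nu>" "B \<in> \<C>" for x B
    using l(1)[OF that(1)] that(2) disjointD[of \<C> "l x" B] by auto
  have Cne: "\<C> \<noteq> {}" using l(1) not_empty by blast
  define r where "r = real (card \<C>)"
  have r: "0 < r" using fin Cne by (simp add: r_def card_gt_0_iff)
  \<comment> \<open>With disagreement of mass at most \<open>s ^ 2\<close>,
    \<open>conditional_entropy_bound\<close> gives \<open>r ^ 2 * (2 * s + s ^ 2)\<close>, which is
    at most \<open>r ^ 2 * (3 * s)\<close> and so at most e.\<close>
  define s where "s = min 1 (e / (3 * r ^ 2))"
  have s: "0 < s" "s \<le> 1" "r ^ 2 * (3 * s) \<le> e"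
    using r e by (auto simp: s_def min_def field_simps)
  have "\<forall>B\<in>\<C>. \<exists>n W. prob ((B - prefix_set n W) \<union> (prefix_set n W - B)) < s ^ 2 / r"
    using Csets s(1) r by (intro ballI borel_approx_prefix_set[OF nu']) auto
  then obtain n W where nW: "\<And>B. B \<in> \<C> \<Longrightarrow> prob ((B - prefix_set (n B) (W B)) \<union> (prefix_set (n B) (W B) - B)) < s ^ 2 / r"
    by metis
  define L where "L = Max (n ` \<C>)"
  have L: "n B \<le> L" if "B \<in> \<C>" for B unfolding L_def using that fin by (intro Max_ge) auto
  define Q where "Q w B \<longleftrightarrow> B \<in> \<C> \<and> take (n B) w \<in> W B" for w B
  \<comment> \<open>The label of a word is the only atom whose approximant contains it, and an
    arbitrary atom if there is none or more than one; off the symmetric differences it agrees with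
    \<open>l\<close>.\<close>
  define G where "G w = (if \<exists>!B. Q w B then THE B. Q w B else SOME B. B \<in> \<C>)" for w
  have G_in: "G w \<in> \<C>" for w
    using theI'[of "Q w"] some_in_eq[of \<C>] Cne by (auto simp: G_def Q_def)
  define g where "g x = G (map x [0..<L])" for x :: "nat \<Rightarrow> nat"
  have g: "simple_function \<nu> g"
  proof -
    have "g -` {B} \<inter> space \<nu> = prefix_set L {w. G w = B}" for B
      by (rule set_eqI) (simp add: sp prefix_set_def g_def conj_commute)
    then have "g -` {B} \<inter> space \<nu> \<in> sets \<nu>" for B by simp
    moreover have "g ` space \<nu> \<subseteq> \<C>" by (rule image_subsetI) (simp add: g_def G_in)
    ultimately show ?thesis using finite_subset[OF _ fin] by (simp add: simple_function_def)
  qed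
  have "prob {x \<in> space \<nu>. l x \<noteq> g x} \<le> prob (\<Union>B\<in>\<C>. (B - prefix_set (n B) (W B)) \<union> (prefix_set (n B) (W B) - B))"
  proof (rule finite_measure_mono)
    show "{x \<in> space \<nu>. l x \<noteq> g x} \<subseteq> (\<Union>B\<in>\<C>. (B - prefix_set (n B) (W B)) \<union> (prefix_set (n B) (W B) - B))"
    proof (rule subsetI, rule ccontr)
      fix x assume x: "x \<in> {x \<in> space \<nu>. l x \<noteq> g x}"
        and nx: "x \<notin> (\<Union>B\<in>\<C>. (B - prefix_set (n B) (W B)) \<union> (prefix_set (n B) (W B) - B))"
      have "Q (map x [0..<L]) B \<longleftrightarrow> B = l x" for B
      proof (cases "B \<in> \<C>")
        case True
        have "take (n B) (map x [0..<L]) = map x [0..<n B]"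
          using L[OF True] by (simp add: take_map min_def)
        then have "Q (map x [0..<L]) B \<longleftrightarrow> x \<in> prefix_set (n B) (W B)"
          using True x sp by (simp add: Q_def prefix_set_def)
        also have "\<dots> \<longleftrightarrow> x \<in> B" using nx True by blast
        also have "\<dots> \<longleftrightarrow> B = l x" using uniq[of x B] True x by auto
        finally show ?thesis .
      qed (use l(1)[of x] x in \<open>auto simp: Q_def\<close>)
      then have "Q (map x [0..<L]) = (\<lambda>B. B = l x)" by (rule ext)
      then have "g x = l x" by (simp add: g_def G_def)
      then show False using x by simp
    qed
  next
    show "(\<Union>B\<in>\<C>. (B - prefix_set (n B) (W B)) \<union> (prefix_set (n B) (W B) - B)) \<in> sets \<nu>"
      using fin Csets by (intro sets.finite_UN sets.Un sets.Diff) auto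
  qed
  also have "\<dots> \<le> (\<Sum>B\<in>\<C>. prob ((B - prefix_set (n B) (W B)) \<union> (prefix_set (n B) (W B) - B)))"
    using fin Csets by (intro finite_measure_subadditive_finite) auto
  also have "\<dots> \<le> (\<Sum>B\<in>\<C>. s ^ 2 / r)" using nW by (intro sum_mono) (simp add: less_imp_le)
  also have "\<dots> = s ^ 2" using r by (simp add: r_def)
  finally have "(\<integral>x. - ln (level_prob (\<lambda>x. (l x, g x)) (l x, g x) / level_prob g (g x)) \<partial>\<nu>) \<le> real (card \<C>) ^ 2 * (2 * sqrt (s ^ 2) + s ^ 2)"
    using fin G_in l by (intro conditional_entropy_bound l(2) g) (auto simp: g_def)
  also have "\<dots> \<le> r ^ 2 * (3 * s)"
    unfolding r_def using s power_decreasing[of 1 2 s] by (intro mult_left_mono) (auto simp: One_nat_def)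
  also have "\<dots> \<le> e" by (rule s)
  finally have ce: "(\<integral>x. - ln (level_prob (\<lambda>x. (l x, g x)) (l x, g x) / level_prob g (g x)) \<partial>\<nu>) \<le> e" .
  have eq: "partition_entropy \<nu> (iterated_join \<nu> left_shift \<C> k) = simple_entropy (names l k)" for k
    by (rule partition_entropy_names[OF C l(1,2)])
  show ?thesis
  proof (rule that[of G L])
    show "simple_function \<nu> (\<lambda>x. G (map x [0..<L]))" using g by (simp add: g_def[abs_def])
    fix k
    have "simple_entropy (names l k) \<le> simple_entropy (names g k) + real k * e"
      using simple_entropy_names_compare[OF l(2) g, of k] mult_left_mono[OF ce, of "real k"] by simp
    then show "partition_entropy \<nu> (iterated_join \<nu> left_shift \<C> k) \<le>
      simple_entropy (names (\<lambda>x. G (map x [0..<L])) k) + real k * e"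
      by (simp add: eq g_def[abs_def])
  next
    show "convergent (\<lambda>n. partition_entropy \<nu> (iterated_join \<nu> left_shift \<C> n) / real n)"
      unfolding eq using entropy_rate[OF l(2)] by (metis convergentI)
  qed
qed

section \<open>Truncation to finitely many words\<close>

definition truncated_words :: "nat \<Rightarrow> nat \<Rightarrow> nat list set" where
  "truncated_words n m = {w. length w = n \<and> set w \<subseteq> {1..m}}"

lemma finite_truncated_words: "finite (truncated_words n m)"
  by (rule finite_subset[OF _ finite_bounded_words[of n m]]) (auto simp: truncated_words_def)

lemma truncated_words_length: "w \<in> truncated_words n m \<Longrightarrow> length w = n"
  by (simp add: truncated_words_def)

lemma prefix_set_truncated_incseq: "incseq (\<lambda>m. prefix_set n (truncated_words n m))"
  by (intro monoI) (auto simp: prefix_set_def truncated_words_def)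

lemma prefix_set_truncated_UN: "(\<Union>m. prefix_set n (truncated_words n m)) = Xfull"
proof (intro equalityI subsetI)
  fix x assume x: "x \<in> Xfull"
  have "x k \<le> Max (insert 0 (x ` {..<n}))" if "k < n" for k using that by (intro Max_ge) auto
  then have "x \<in> prefix_set n (truncated_words n (Max (insert 0 (x ` {..<n}))))"
    using x by (auto simp: prefix_set_def truncated_words_def full_shift_def)
  then show "x \<in> (\<Union>m. prefix_set n (truncated_words n m))" by blast
qed (auto simp: prefix_set_def)

text \<open>\<open>F\<close> may be unbounded, so the mass outside the truncated words is controlled
  by dominated convergence with majorant \<open>\<bar>F x\<bar>\<close>; the constant c pays for the
  single value \<open>h w\<close> on each cylinder.\<close>

lemma truncated_sum_approx:
  fixes F :: "(nat \<Rightarrow> nat) \<Rightarrow> real"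
  assumes nu: "\<nu> \<in> prob_measures Xfull" and F: "integrable \<nu> F" and e: "0 < e" and c: "0 \<le> c"
    and near: "\<And>w x. w \<in> words {1..} n \<Longrightarrow> x \<in> cyl w \<Longrightarrow> \<bar>F x - h w\<bar> \<le> c"
  shows "\<forall>\<^sub>F m in sequentially. \<bar>(\<Sum>w\<in>truncated_words n m. measure \<nu> (cyl w) * h w) - (\<integral>x. F x \<partial>\<nu>)\<bar> \<le> c + e"
proof -
  interpret prob_space \<nu> by (rule prob_measuresD[OF nu])
  have sp: "space \<nu> = Xfull" by (rule prob_measuresD[OF nu])
  have [measurable]: "prefix_set n W \<in> sets \<nu>" for n W
    using prefix_set_in_BX prob_measuresD(1)[OF nu] by simp
  have [measurable]: "F \<in> borel_measurable \<nu>" using F by simp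
  have [measurable]: "cyl w \<in> sets \<nu>" for w by (rule prob_measuresD[OF nu])
  have int_cyl [simp, intro]: "integrable \<nu> (indicat_real (cyl w))" for w
    by (rule integrable_real_indicator) (auto simp: emeasure_eq_measure)
  define U where "U m = prefix_set n (truncated_words n m)" for m
  have [measurable]: "U m \<in> sets \<nu>" for m by (simp add: U_def)
  have "(\<lambda>m. \<integral>x. indicator (U m) x * F x \<partial>\<nu>) \<longlonglongrightarrow> (\<integral>x. F x \<partial>\<nu>)"
  proof (rule integral_dominated_convergence[where w="\<lambda>x. \<bar>F x\<bar>"])
    show "AE x in \<nu>. (\<lambda>m. indicator (U m) x * F x) \<longlonglongrightarrow> F x"
    proof (rule AE_I2)
      fix x assume x: "x \<in> space \<nu>"
      then obtain m0 where "x \<in> U m0" using prefix_set_truncated_UN[of n] sp by (auto simp: U_def)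
      then have "x \<in> U m" if "m0 \<le> m" for m
        using prefix_set_truncated_incseq[of n] that by (auto simp: U_def incseq_def)
      then show "(\<lambda>m. indicator (U m) x * F x) \<longlonglongrightarrow> F x"
        by (intro tendsto_eventually eventually_sequentiallyI[of m0]) simp
    qed
  qed (use F in \<open>auto simp: indicator_def\<close>)
  then have "\<forall>\<^sub>F m in sequentially. dist (\<integral>x. indicator (U m) x * F x \<partial>\<nu>) (\<integral>x. F x \<partial>\<nu>) < e"
    using e by (rule tendstoD)
  then show ?thesis
  proof eventually_elim
    case (elim m)
    have sumeq: "(\<Sum>w\<in>truncated_words n m. h w * indicator (cyl w) x) = indicator (U m) x * h (map x [0..<n])" if "x \<in> Xfull" for x
      using sum_indicator_cyl[of "truncated_words n m" n x h] that
      by (simp add: finite_truncated_words truncated_words_length U_def prefix_set_def indicator_def)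
    have "(\<Sum>w\<in>truncated_words n m. measure \<nu> (cyl w) * h w) = (\<integral>x. (\<Sum>w\<in>truncated_words n m. h w * indicator (cyl w) x) \<partial>\<nu>)"
      by (subst Bochner_Integration.integral_sum)
         (auto simp: sp cyl_subset Int_absorb2 mult.commute intro!: sum.cong)
    then have "(\<Sum>w\<in>truncated_words n m. measure \<nu> (cyl w) * h w) - (\<integral>x. indicator (U m) x * F x \<partial>\<nu>)
       = (\<integral>x. (\<Sum>w\<in>truncated_words n m. h w * indicator (cyl w) x) - indicator (U m) x * F x \<partial>\<nu>)"
      using integrable_mult_indicator[OF _ F, of "U m"]
      by (subst Bochner_Integration.integral_diff) (auto intro!: Bochner_Integration.integrable_sum)
    also have "\<bar>\<dots>\<bar> \<le> (\<integral>x. \<bar>(\<Sum>w\<in>truncated_words n m. h w * indicator (cyl w) x) - indicator (U m) x * F x\<bar> \<partial>\<nu>)"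
      by (rule integral_abs_bound)
    also have "\<dots> \<le> (\<integral>x. c \<partial>\<nu>)"
    proof (rule integral_mono)
      show "integrable \<nu> (\<lambda>x. \<bar>(\<Sum>w\<in>truncated_words n m. h w * indicator (cyl w) x) - indicator (U m) x * F x\<bar>)"
        using integrable_mult_indicator[OF _ F, of "U m"]
        by (intro integrable_abs Bochner_Integration.integrable_diff Bochner_Integration.integrable_sum) auto
      fix x assume "x \<in> space \<nu>"
      then have x: "x \<in> Xfull" by (simp add: sp)
      have "x \<in> cyl (map x [0..<n])" using x by (auto simp: cylinder_def)
      moreover have "map x [0..<n] \<in> words {1..} n" using x by (auto simp: words_def full_shift_def)
      ultimately have "\<bar>F x - h (map x [0..<n])\<bar> \<le> c" by (rule near[rotated])
      then show "\<bar>(\<Sum>w\<in>truncated_words n m. h w * indicator (cyl w) x) - indicator (U m) x * F x\<bar> \<le> c"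
        unfolding sumeq[OF x] using c by (auto simp: indicator_def abs_minus_commute)
    qed simp
    also have "\<dots> = c" by (simp add: prob_space)
    finally show ?case using elim by (simp add: dist_real_def)
  qed
qed

lemma tendsto_xlnx:
  fixes f :: "'a \<Rightarrow> real"
  assumes "(f \<longlongrightarrow> l) F" "0 < l"
  shows "((\<lambda>x. - (f x * ln (f x))) \<longlongrightarrow> - (l * ln l)) F"
  using assms by (intro tendsto_intros) auto

text \<open>Words refine the label, so their sum of \<open>- (q * ln q)\<close> dominates the one
  over label masses, and the latter converges since the label takes finitely many values. The
  entropy of the words themselves may be infinite, hence a bound from below only.\<close>

lemma truncated_entropy:
  assumes nu: "\<nu> \<in> prob_measures Xfull" and u: "simple_function \<nu> (\<lambda>x. f (map x [0..<n]))" and e: "0 < e"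
  shows "\<forall>\<^sub>F m in sequentially. prob_space.simple_entropy \<nu> (\<lambda>x. f (map x [0..<n])) - e \<le>
    (\<Sum>w\<in>truncated_words n m. - (measure \<nu> (cyl w) * ln (measure \<nu> (cyl w))))"
proof -
  interpret prob_space \<nu> by (rule prob_measuresD[OF nu])
  have sp: "space \<nu> = Xfull" by (rule prob_measuresD[OF nu])
  have [measurable]: "prefix_set n W \<in> sets \<nu>" for n W
    using prefix_set_in_BX prob_measuresD(1)[OF nu] by simp
  define U where "U v m = prefix_set n {w \<in> truncated_words n m. f w = v}" for v m
  define I where "I = (\<lambda>x. f (map x [0..<n])) ` space \<nu>"
  have fin: "finite I" using u by (simp add: I_def simple_function_def)
  have U_lim: "(\<lambda>m. prob (U v m)) \<longlonglongrightarrow> level_prob (\<lambda>x. f (map x [0..<n])) v" for v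
  proof -
    have "(\<lambda>m. prob (U v m)) \<longlonglongrightarrow> prob (\<Union>m. U v m)"
    proof (rule finite_Lim_measure_incseq)
      show "range (U v) \<subseteq> events" by (auto simp: U_def)
      show "incseq (U v)" by (intro monoI) (auto simp: U_def prefix_set_def truncated_words_def)
    qed
    also have "(\<Union>m. U v m) = (\<lambda>x. f (map x [0..<n])) -` {v} \<inter> space \<nu>"
      using prefix_set_truncated_UN[of n] by (auto simp: U_def sp prefix_set_def)
    finally show ?thesis by (simp add: level_prob_def)
  qed
  have U_sum: "prob (U v m) = (\<Sum>w\<in>{w \<in> truncated_words n m. f w = v}. measure \<nu> (cyl w))" for v m
  proof -
    have "U v m = (\<Union>w\<in>{w \<in> truncated_words n m. f w = v}. cyl w)"
      unfolding U_def prefix_set_UN by (auto simp: truncated_words_length)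
    moreover have "prob (\<Union>w\<in>{w \<in> truncated_words n m. f w = v}. cyl w) =
        (\<Sum>w\<in>{w \<in> truncated_words n m. f w = v}. prob (cyl w))"
      by (rule measure_Union_cyl[OF nu, where n = n]) (use finite_truncated_words truncated_words_length in auto)
    ultimately show ?thesis by simp
  qed
  have eta: "(\<lambda>m. - (prob (U v m) * ln (prob (U v m)))) \<longlonglongrightarrow> - (level_prob (\<lambda>x. f (map x [0..<n])) v * ln (level_prob (\<lambda>x. f (map x [0..<n])) v))" for v
  \<comment> \<open>\<open>ln\<close> is not continuous at 0; a null label has null truncations, so
    that both sides vanish.\<close>
  proof (cases "level_prob (\<lambda>x. f (map x [0..<n])) v = 0")
    case True
    have "prob (U v m) \<le> level_prob (\<lambda>x. f (map x [0..<n])) v" for m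
      unfolding level_prob_def using simple_level[OF u] by (intro finite_measure_mono) (auto simp: U_def prefix_set_def sp)
    then have "prob (U v m) = 0" for m using True by (metis measure_le_0_iff)
    then show ?thesis using True by simp
  next
    case False
    then have "0 < level_prob (\<lambda>x. f (map x [0..<n])) v" using level_prob_nonneg[of "\<lambda>x. f (map x [0..<n])" v] by linarith
    then show ?thesis by (intro tendsto_xlnx U_lim)
  qed
  have "(\<lambda>m. \<Sum>v\<in>I. - (prob (U v m) * ln (prob (U v m)))) \<longlonglongrightarrow> simple_entropy (\<lambda>x. f (map x [0..<n]))"
    unfolding simple_entropy_def I_def[symmetric] by (intro tendsto_sum eta)
  then have "\<forall>\<^sub>F m in sequentially. simple_entropy (\<lambda>x. f (map x [0..<n])) - e < (\<Sum>v\<in>I. - (prob (U v m) * ln (prob (U v m))))"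
    using e by (intro order_tendstoD(1)) auto
  then show ?thesis
  proof eventually_elim
    case (elim m)
    define q where "q w = measure \<nu> (cyl w)" for w
    have "(\<Sum>v\<in>I. - (prob (U v m) * ln (prob (U v m)))) \<le> (\<Sum>v\<in>I. \<Sum>w\<in>{w \<in> truncated_words n m. f w = v}. - (q w * ln (q w)))"
    proof (rule sum_mono)
      fix v
      have "- (prob (U v m) * ln (prob (U v m))) = (\<Sum>w\<in>{w \<in> truncated_words n m. f w = v}. - (q w * ln (prob (U v m))))"
        by (simp add: U_sum q_def sum_negf sum_distrib_right)
      also have "\<dots> \<le> (\<Sum>w\<in>{w \<in> truncated_words n m. f w = v}. - (q w * ln (q w)))"
      proof (rule sum_mono)
        fix w assume w: "w \<in> {w \<in> truncated_words n m. f w = v}"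
        have "q w \<le> prob (U v m)"
          unfolding U_sum q_def using w finite_truncated_words[of n m] by (intro member_le_sum) auto
        moreover have "0 \<le> q w" by (simp add: q_def)
        ultimately show "- (q w * ln (prob (U v m))) \<le> - (q w * ln (q w))"
          by (cases "q w = 0") (auto simp: order_less_le intro!: mult_left_mono ln_mono)
      qed
      finally show "- (prob (U v m) * ln (prob (U v m))) \<le> (\<Sum>w\<in>{w \<in> truncated_words n m. f w = v}. - (q w * ln (q w)))" .
    qed
    also have "\<dots> = (\<Sum>w\<in>(\<Union>v\<in>I. {w \<in> truncated_words n m. f w = v}). - (q w * ln (q w)))"
      using fin finite_truncated_words[of n m] by (intro sum.UNION_disjoint[symmetric]) auto
    also have "\<dots> \<le> (\<Sum>w\<in>truncated_words n m. - (q w * ln (q w)))"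
    proof (rule sum_mono2[OF finite_truncated_words])
      fix w
      have "q w * ln (q w) \<le> 0"
        using prob_le_1[of "cyl w"] measure_nonneg[of \<nu> "cyl w"]
        by (cases "q w = 0") (auto simp: q_def order_less_le intro!: mult_nonneg_nonpos)
      then show "0 \<le> - (q w * ln (q w))" by simp
    qed auto
    finally show ?case using elim by (simp add: q_def)
  qed
qed

section \<open>Counting occurrences of words in blocks and along orbits\<close>

definition occurrences :: "nat list \<Rightarrow> nat list \<Rightarrow> nat" where
  "occurrences v w = card {j. j < length w \<and> j + length v \<le> length w \<and> take (length v) (drop j w) = v}"

definition visits :: "nat \<Rightarrow> nat list \<Rightarrow> (nat \<Rightarrow> nat) \<Rightarrow> nat" where
  "visits n v x = card {j. j < n \<and> (left_shift ^^ j) x \<in> cyl v}"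

text \<open>Only the last \<open>length v\<close> starting positions can look beyond the end of w.
  The bound \<open>j < length w\<close> in \<open>occurrences\<close> matters for the empty word,
  which would otherwise fit once more often than an orbit piece of that length visits it.\<close>

lemma occurrences_visits:
  assumes x: "x \<in> cyl w"
  shows "occurrences v w \<le> visits (length w) v x" "visits (length w) v x \<le> occurrences v w + length v"
proof -
  have xX: "x \<in> Xfull" using x cyl_subset by blast
  have iff: "(left_shift ^^ j) x \<in> cyl v \<longleftrightarrow> take (length v) (drop j w) = v" if "j + length v \<le> length w" for j
  proof -
    have "(left_shift ^^ j) x \<in> cyl v \<longleftrightarrow> (\<forall>k<length v. x (j + k) = v ! k)"
      using left_shift_Xfull[OF xX, of j] by (auto simp: cylinder_def funpow_left_shift)
    also have "\<dots> \<longleftrightarrow> (\<forall>k<length v. w ! (j + k) = v ! k)"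
      using x that by (auto simp: cylinder_def)
    also have "\<dots> \<longleftrightarrow> take (length v) (drop j w) = v"
      using that by (subst list_eq_iff_nth_eq) auto
    finally show ?thesis .
  qed
  show "occurrences v w \<le> visits (length w) v x"
    unfolding occurrences_def visits_def using iff by (intro card_mono) auto
  have "visits (length w) v x \<le> card ({j. j < length w \<and> j + length v \<le> length w \<and> take (length v) (drop j w) = v} \<union> {length w - length v..<length w})"
    unfolding visits_def
  proof (intro card_mono subsetI)
    fix j assume j: "j \<in> {j. j < length w \<and> (left_shift ^^ j) x \<in> cyl v}"
    then show "j \<in> {j. j < length w \<and> j + length v \<le> length w \<and> take (length v) (drop j w) = v} \<union> {length w - length v..<length w}"
      using iff[of j] by (cases "j + length v \<le> length w") auto
  qed auto
  also have "\<dots> \<le> occurrences v w + card {length w - length v..<length w}"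
    unfolding occurrences_def by (rule card_Un_le)
  also have "\<dots> \<le> occurrences v w + length v" by simp
  finally show "visits (length w) v x \<le> occurrences v w + length v" .
qed

lemma measure_empirical_visits:
  "1 \<le> n \<Longrightarrow> x \<in> Xfull \<Longrightarrow> measure (empirical_measure n x) (cyl v) = real (visits n v x) / real n"
  by (simp add: measure_empirical visits_def)

section \<open>The lower bound\<close>

lemma visits_birkhoff: "real (visits n v x) = birkhoff_sum (indicator (cyl v)) n x"
proof -
  have "(\<Sum>j<n. indicator (cyl v) ((left_shift ^^ j) x)) = (\<Sum>j\<in>{j. j < n \<and> (left_shift ^^ j) x \<in> cyl v}. 1 :: real)"
    by (intro sum.mono_neutral_cong_right) (auto simp: indicator_def)
  also have "\<dots> = real (visits n v x)" by (simp add: visits_def)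
  finally show ?thesis by (simp add: birkhoff_sum_def)
qed

lemma integral_birkhoff_sum:
  assumes nu: "\<nu> \<in> invariant_measures" and f: "integrable \<nu> f"
  shows "integrable \<nu> (birkhoff_sum f n)" "(\<integral>x. birkhoff_sum f n x \<partial>\<nu>) = real n * (\<integral>x. f x \<partial>\<nu>)"
proof -
  interpret measure_preserving \<nu> left_shift by (rule invariant_measuresD(2)[OF nu])
  have i: "integrable \<nu> (\<lambda>x. f ((left_shift ^^ k) x))" for k
    using integrable_distr[OF funpow_measurable, of k f] f by (simp add: distr_funpow)
  show "integrable \<nu> (birkhoff_sum f n)"
    unfolding birkhoff_sum_def[abs_def] by (intro Bochner_Integration.integrable_sum i)
  have "(\<integral>x. birkhoff_sum f n x \<partial>\<nu>) = (\<Sum>k<n. \<integral>x. f ((left_shift ^^ k) x) \<partial>\<nu>)"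
    unfolding birkhoff_sum_def[abs_def] by (intro Bochner_Integration.integral_sum i)
  also have "\<dots> = (\<Sum>k<n. \<integral>x. f x \<partial>\<nu>)"
    using f by (intro sum.cong refl integral_funpow) simp
  finally show "(\<integral>x. birkhoff_sum f n x \<partial>\<nu>) = real n * (\<integral>x. f x \<partial>\<nu>)" by simp
qed

lemma exists_nat_ge:
  fixes a b :: real
  assumes "0 < a"
  obtains k :: nat where "\<And>n. k \<le> n \<Longrightarrow> b \<le> a * real n"
proof -
  obtain k :: nat where k: "b / a \<le> real k" using real_arch_simple by blast
  show ?thesis
  proof (rule that[of k])
    fix n assume "k \<le> n"
    then have "b / a \<le> real n" using k by linarith
    then show "b \<le> a * real n" using assms by (simp add: pos_divide_le_eq mult.commute)
  qed
qed

text \<open>Everything about \<nu> that enters the construction of periodic points, as data of one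
  probability vector on finitely many words. Words of length \<open>N\<close> carry enough entropy
  because they determine a name of the approximating label; truncating and normalising their masses
  costs a bounded amount, absorbed in \<open>e * N\<close>.\<close>

lemma (in acceptable_potential) block_distribution:
  assumes nu: "\<nu> \<in> invariant_measures" and int: "integrable \<nu> \<phi>"
    and C: "\<C> \<in> finite_partitions \<nu>"
    and r: "(\<lambda>n. partition_entropy \<nu> (iterated_join \<nu> left_shift \<C> n) / real n) \<longlonglongrightarrow> r"
    and F: "finite F" and e: "0 < e"
  obtains N W p where "1 \<le> N" "finite W" "W \<subseteq> words {1..} N" "\<And>w. w \<in> W \<Longrightarrow> 0 < p w" "sum p W = 1"
    "\<And>w x. w \<in> W \<Longrightarrow> x \<in> cyl w \<Longrightarrow> \<bar>S N x - S N (per w)\<bar> \<le> e * real N"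
    "real N * (r + (\<integral>x. \<phi> x \<partial>\<nu>) - e) \<le> (\<Sum>w\<in>W. p w * (S N (per w) - ln (p w)))"
    "\<And>v. v \<in> F \<Longrightarrow> \<bar>(\<Sum>w\<in>W. p w * real (occurrences v w)) - real N * measure \<nu> (cyl v)\<bar> \<le> e * real N"
    "\<And>v. v \<in> F \<Longrightarrow> real (length v) \<le> e * real N"
proof -
  note nu' = invariant_measuresD(1)[OF nu]
  interpret measure_preserving \<nu> left_shift by (rule invariant_measuresD(2)[OF nu])
  have sp: "space \<nu> = Xfull" by (rule prob_measuresD[OF nu'])
  have [measurable]: "cyl w \<in> sets \<nu>" for w by (rule prob_measuresD[OF nu'])
  have int_cyl [simp, intro]: "integrable \<nu> (indicat_real (cyl w))" for w
    by (rule integrable_real_indicator) (auto simp: emeasure_eq_measure)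
  define I where "I = (\<integral>x. \<phi> x \<partial>\<nu>)"
  define PE where "PE n = partition_entropy \<nu> (iterated_join \<nu> left_shift \<C> n)" for n
  define e1 where "e1 = e / 8"
  have e1: "0 < e1" using e by (simp add: e1_def)
  obtain L and G :: "nat list \<Rightarrow> (nat \<Rightarrow> nat) set" where G: "simple_function \<nu> (\<lambda>x. G (map x [0..<L]))"
    "\<And>n. PE n \<le> simple_entropy (names (\<lambda>x. G (map x [0..<L])) n) + real n * e1"
    "convergent (\<lambda>n. PE n / real n)"
    unfolding PE_def
  proof (rule entropy_prefix_label[OF nu C e1], goal_cases)
    case (1 L G)
    show ?case by (rule 1(1)[OF 1(2-4)])
  qed
  obtain K where K: "0 \<le> K"
    "\<And>n x y. x \<in> Xfull \<Longrightarrow> y \<in> Xfull \<Longrightarrow> (\<And>k. k < n \<Longrightarrow> x k = y k) \<Longrightarrow> \<bar>S n x - S n y\<bar> \<le> K + e1 * real n"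
    using distortion[OF e1] by metis
  define lv where "lv = real (Max (insert 0 (length ` F)))"
  have lv: "real (length v) \<le> lv" "0 \<le> lv" if "v \<in> F" for v
    using that F by (auto simp: lv_def)
  have lv0: "0 \<le> lv" by (simp add: lv_def)
  have "\<forall>\<^sub>F n in sequentially. r - e1 < PE n / real n"
    using r e1 unfolding PE_def by (intro order_tendstoD(1)) auto
  then obtain N0 where N0: "\<And>n. N0 \<le> n \<Longrightarrow> r - e1 < PE n / real n"
    by (auto simp: eventually_sequentially)
  \<comment> \<open>Beyond k all errors that do not grow with the length fit into
    \<open>e1 * real n\<close>.\<close>
  obtain k where k: "\<And>n. k \<le> n \<Longrightarrow> K + 3 + (lv + 2) + real L * \<bar>r - 2 * e1\<bar> \<le> e1 * real n"
    using exists_nat_ge[OF e1] by metis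
  define n where "n = max 1 (max N0 k)"
  \<comment> \<open>The label at each of n consecutive positions looks at \<open>L\<close> letters,
    so \<open>L\<close> extra letters determine the whole name.\<close>
  define N where "N = n + L"
  have n1: "1 \<le> n" "n \<le> N" by (auto simp: n_def N_def)
  then have N1: "1 \<le> N" by simp
  have big: "K + 3 + (lv + 2) + real L * \<bar>r - 2 * e1\<bar> \<le> e1 * real N"
    using k[of N] by (simp add: n_def N_def)
  have LL: "0 \<le> real L * \<bar>r - 2 * e1\<bar>" by simp
  have PE_ge: "real n * (r - e1) \<le> PE n"
    using N0[of n] n1(1) by (simp add: n_def pos_less_divide_eq less_imp_le mult.commute)
  define g where "g x = G (map x [0..<L])" for x :: "nat \<Rightarrow> nat"
  define f where "f w = map (\<lambda>k. G (take L (drop k w))) [0..<n]" for w :: "nat list"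
  have f: "names g n x = f (map x [0..<N])" for x
  proof -
    have "map ((left_shift ^^ k) x) [0..<L] = take L (drop k (map x [0..<N]))" if "k < n" for k
      using that by (intro nth_equalityI) (auto simp: N_def funpow_left_shift)
    then show ?thesis by (auto simp: names_def f_def g_def)
  qed
  have g: "simple_function \<nu> g" using G(1) by (simp add: g_def[abs_def])
  have f': "names g n = (\<lambda>x. f (map x [0..<N]))" using f by (rule ext)
  have sf: "simple_function \<nu> (\<lambda>x. f (map x [0..<N]))"
    using simple_names[OF g, of n] by (simp add: f')
  define H where "H = simple_entropy (\<lambda>x. f (map x [0..<N]))"
  have H: "PE n - real n * e1 \<le> H"
    using G(2)[of n] by (simp add: H_def f'[symmetric] g_def[abs_def])
  define q where "q w = measure \<nu> (cyl w)" for w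
  define c where "c m = (\<Sum>w\<in>truncated_words N m. q w)" for m
  have c_lim: "c \<longlonglongrightarrow> 1"
  proof (rule tendstoI)
    fix d :: real assume d: "0 < d"
    have "\<forall>\<^sub>F m in sequentially. \<bar>(\<Sum>w\<in>truncated_words N m. measure \<nu> (cyl w) * 1) - (\<integral>x. 1 \<partial>\<nu>)\<bar> \<le> 0 + d / 2"
      using d by (intro truncated_sum_approx[OF nu']) auto
    then show "\<forall>\<^sub>F m in sequentially. dist (c m) 1 < d"
      by eventually_elim (use d in \<open>simp add: c_def q_def dist_real_def prob_space\<close>)
  qed
  \<comment> \<open>Lower bound for energy plus entropy of the truncated masses before the
    normalisation by \<open>c m\<close>, which tends to 1.\<close>
  define A where "A = real N * I - K - e1 * real N - 1 + (H - 1)"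
  have ev1: "\<forall>\<^sub>F m in sequentially. \<bar>(\<Sum>w\<in>truncated_words N m. measure \<nu> (cyl w) * S N (per w)) - (\<integral>x. S N x \<partial>\<nu>)\<bar> \<le> (K + e1 * real N) + 1"
  proof (rule truncated_sum_approx[OF nu' integral_birkhoff_sum(1)[OF nu int]])
    fix w x assume w: "w \<in> words {1..} N" and x: "x \<in> cyl w"
    show "\<bar>S N x - S N (per w)\<bar> \<le> K + e1 * real N"
      using x w N1 per_cyl[OF w N1] cyl_subset by (intro K) (auto simp: cylinder_def words_def)
  qed (use K e1 in auto)
  have ev2: "\<forall>\<^sub>F m in sequentially. \<forall>v\<in>F. \<bar>(\<Sum>w\<in>truncated_words N m. measure \<nu> (cyl w) * real (occurrences v w)) - real N * q v\<bar> \<le> real (length v) + 1"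
    unfolding eventually_ball_finite_distrib[OF F]
  proof
    fix v
    have i: "(\<integral>x. real (visits N v x) \<partial>\<nu>) = real N * q v"
      unfolding visits_birkhoff integral_birkhoff_sum(2)[OF nu int_cyl]
      by (simp add: q_def sp cyl_subset Int_absorb2)
    show "\<forall>\<^sub>F m in sequentially. \<bar>(\<Sum>w\<in>truncated_words N m. measure \<nu> (cyl w) * real (occurrences v w)) - real N * q v\<bar> \<le> real (length v) + 1"
      unfolding i[symmetric]
    proof (rule truncated_sum_approx[OF nu'])
      show "integrable \<nu> (\<lambda>x. real (visits N v x))"
        unfolding visits_birkhoff by (rule integral_birkhoff_sum(1)[OF nu int_cyl])
      fix w x assume "w \<in> words {1..} N" "x \<in> cyl w"
      then show "\<bar>real (visits N v x) - real (occurrences v w)\<bar> \<le> real (length v)"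
        using occurrences_visits[of x w v] by (simp add: words_def)
    qed auto
  qed
  have ev3: "\<forall>\<^sub>F m in sequentially. H - 1 \<le> (\<Sum>w\<in>truncated_words N m. - (q w * ln (q w)))"
    unfolding H_def q_def by (rule truncated_entropy[OF nu' sf]) simp
  have ev4: "\<forall>\<^sub>F m in sequentially. A - 1 < A / c m + ln (c m)"
  proof (rule order_tendstoD(1))
    show "(\<lambda>m. A / c m + ln (c m)) \<longlonglongrightarrow> A / 1 + ln 1" by (intro tendsto_intros c_lim) auto
  qed simp
  have ev5: "\<forall>\<^sub>F m in sequentially. \<forall>v\<in>F. (real N * q v + (real (length v) + 1)) / c m < real N * q v + (real (length v) + 2) \<and>
      real N * q v - (real (length v) + 2) < (real N * q v - (real (length v) + 1)) / c m"
    unfolding eventually_ball_finite_distrib[OF F]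
  proof (intro ballI eventually_conj)
    fix v
    have "(\<lambda>m. (real N * q v + (real (length v) + 1)) / c m) \<longlonglongrightarrow> (real N * q v + (real (length v) + 1)) / 1"
      by (intro tendsto_intros c_lim) auto
    then show "\<forall>\<^sub>F m in sequentially. (real N * q v + (real (length v) + 1)) / c m < real N * q v + (real (length v) + 2)"
      by (rule order_tendstoD(2)) simp
    have "(\<lambda>m. (real N * q v - (real (length v) + 1)) / c m) \<longlonglongrightarrow> (real N * q v - (real (length v) + 1)) / 1"
      by (intro tendsto_intros c_lim) auto
    then show "\<forall>\<^sub>F m in sequentially. real N * q v - (real (length v) + 2) < (real N * q v - (real (length v) + 1)) / c m"
      by (rule order_tendstoD(1)) simp
  qed
  have ev6: "\<forall>\<^sub>F m in sequentially. 0 < c m" by (rule order_tendstoD(1)[OF c_lim]) simp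
  obtain m where m:
    "\<bar>(\<Sum>w\<in>truncated_words N m. q w * S N (per w)) - real N * I\<bar> \<le> (K + e1 * real N) + 1"
    "\<And>v. v \<in> F \<Longrightarrow> \<bar>(\<Sum>w\<in>truncated_words N m. q w * real (occurrences v w)) - real N * q v\<bar> \<le> real (length v) + 1"
    "H - 1 \<le> (\<Sum>w\<in>truncated_words N m. - (q w * ln (q w)))" "A - 1 < A / c m + ln (c m)"
    "\<And>v. v \<in> F \<Longrightarrow> (real N * q v + (real (length v) + 1)) / c m < real N * q v + (real (length v) + 2)"
    "\<And>v. v \<in> F \<Longrightarrow> real N * q v - (real (length v) + 2) < (real N * q v - (real (length v) + 1)) / c m"
    "0 < c m"
    using eventually_happens[OF eventually_conj[OF ev1 eventually_conj[OF ev2 eventually_conj[OF ev3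
      eventually_conj[OF ev4 eventually_conj[OF ev5 ev6]]]]]]
    unfolding integral_birkhoff_sum(2)[OF nu int] I_def[symmetric] q_def[symmetric] by auto
  \<comment> \<open>Null words are dropped so that \<open>p\<close> is positive and
    \<open>ln (p w)\<close> is no default value.\<close>
  define W where "W = {w \<in> truncated_words N m. 0 < q w}"
  define p where "p w = q w / c m" for w
  have sumW: "(\<Sum>w\<in>W. q w * h w) = (\<Sum>w\<in>truncated_words N m. q w * h w)" for h
  proof (rule sum.mono_neutral_left[OF finite_truncated_words])
    show "\<forall>w\<in>truncated_words N m - W. q w * h w = 0"
      using measure_nonneg[of \<nu>] by (auto simp: W_def q_def order_less_le)
  qed (auto simp: W_def)
  have Wwords: "W \<subseteq> words {1..} N" by (auto simp: W_def truncated_words_def words_def)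
  show ?thesis
  proof (rule that[of N W p])
    show "finite W" unfolding W_def using finite_truncated_words by simp
    show "0 < p w" if "w \<in> W" for w using that m(7) by (simp add: W_def p_def)
    have "sum p W = (\<Sum>w\<in>W. q w * 1) / c m" by (simp add: p_def sum_divide_distrib)
    also have "\<dots> = 1" unfolding sumW using m(7) by (simp add: c_def)
    finally show sp1: "sum p W = 1" .
    show "\<bar>S N x - S N (per w)\<bar> \<le> e * real N" if "w \<in> W" "x \<in> cyl w" for w x
    proof -
      have w: "w \<in> words {1..} N" using that(1) Wwords by blast
      have "\<bar>S N x - S N (per w)\<bar> \<le> K + e1 * real N"
        using that(2) w N1 per_cyl[OF w N1] cyl_subset by (intro K) (auto simp: cylinder_def words_def)
      also have "\<dots> \<le> e1 * real N + e1 * real N" using big lv0 LL by linarith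
      also have "\<dots> \<le> e * real N" using e by (simp add: e1_def)
      finally show ?thesis .
    qed
    show "real N * (r + (\<integral>x. \<phi> x \<partial>\<nu>) - e) \<le> (\<Sum>w\<in>W. p w * (S N (per w) - ln (p w)))"
    proof -
      have "(\<Sum>w\<in>W. p w * (S N (per w) - ln (p w))) = (\<Sum>w\<in>W. q w * S N (per w) / c m + q w * (- ln (q w)) / c m + p w * ln (c m))"
      proof (rule sum.cong)
        fix w assume "w \<in> W"
        then have "ln (p w) = ln (q w) - ln (c m)" using m(7) by (simp add: W_def p_def ln_div)
        then show "p w * (S N (per w) - ln (p w)) = q w * S N (per w) / c m + q w * (- ln (q w)) / c m + p w * ln (c m)"
          unfolding \<open>ln (p w) = ln (q w) - ln (c m)\<close>
          by (simp add: p_def algebra_simps add_divide_distrib diff_divide_distrib)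
      qed simp
      also have "\<dots> = (\<Sum>w\<in>W. q w * S N (per w)) / c m + (\<Sum>w\<in>W. q w * (- ln (q w))) / c m + sum p W * ln (c m)"
        by (simp only: sum.distrib sum_divide_distrib sum_distrib_right)
      also have "\<dots> = ((\<Sum>w\<in>truncated_words N m. q w * S N (per w)) + (\<Sum>w\<in>truncated_words N m. - (q w * ln (q w)))) / c m + ln (c m)"
        unfolding sumW sp1 by (simp add: add_divide_distrib)
      also have "\<dots> \<ge> A / c m + ln (c m)"
        using m(1,3,7) by (intro add_mono divide_right_mono) (auto simp: A_def abs_le_iff)
      finally have "A - 1 \<le> (\<Sum>w\<in>W. p w * (S N (per w) - ln (p w)))" using m(4) by linarith
      moreover have "real n * (r - 2 * e1) = real N * (r - 2 * e1) - real L * (r - 2 * e1)"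
        by (simp add: N_def algebra_simps)
      moreover have "real L * (r - 2 * e1) \<le> real L * \<bar>r - 2 * e1\<bar>" by (intro mult_left_mono) auto
      moreover have "real n * (r - 2 * e1) \<le> H" using PE_ge H by (simp add: algebra_simps)
      ultimately have "real N * I - e1 * real N + real N * (r - 2 * e1) - (K + 3 + real L * \<bar>r - 2 * e1\<bar>)
          \<le> (\<Sum>w\<in>W. p w * (S N (per w) - ln (p w)))"
        unfolding A_def by linarith
      then have "real N * I - 2 * (e1 * real N) + real N * (r - 2 * e1) \<le> (\<Sum>w\<in>W. p w * (S N (per w) - ln (p w)))"
        using big lv0 by linarith
      moreover have "real N * (r + I - e) \<le> real N * I - 2 * (e1 * real N) + real N * (r - 2 * e1)"
        using e by (simp add: e1_def algebra_simps)
      ultimately show ?thesis unfolding I_def by linarith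
    qed
    fix v assume v: "v \<in> F"
    have len: "real (length v) + 2 \<le> e * real N"
    proof -
      have "real (length v) + 2 \<le> e1 * real N" using lv[OF v] big K(1) LL by linarith
      also have "\<dots> \<le> e * real N" using e by (simp add: e1_def)
      finally show ?thesis .
    qed
    then show "real (length v) \<le> e * real N" by simp
    have "(\<Sum>w\<in>W. p w * real (occurrences v w)) = (\<Sum>w\<in>W. q w * real (occurrences v w)) / c m"
      by (simp add: p_def sum_divide_distrib)
    also have "\<dots> = (\<Sum>w\<in>truncated_words N m. q w * real (occurrences v w)) / c m"
      unfolding sumW ..
    finally have eq: "(\<Sum>w\<in>W. p w * real (occurrences v w)) = (\<Sum>w\<in>truncated_words N m. q w * real (occurrences v w)) / c m" .
    have "(\<Sum>w\<in>truncated_words N m. q w * real (occurrences v w)) / c m \<le> (real N * q v + (real (length v) + 1)) / c m"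
      "(real N * q v - (real (length v) + 1)) / c m \<le> (\<Sum>w\<in>truncated_words N m. q w * real (occurrences v w)) / c m"
      using m(2)[OF v] m(7) by (auto intro!: divide_right_mono simp: abs_le_iff)
    then show "\<bar>(\<Sum>w\<in>W. p w * real (occurrences v w)) - real N * measure \<nu> (cyl v)\<bar> \<le> e * real N"
      using m(5,6)[OF v] len unfolding eq q_def[symmetric] abs_le_iff by linarith
  qed (use N1 Wwords in auto)
qed

section \<open>Weak law of large numbers for independent words\<close>

lemma sum_words_iid:
  fixes p g :: "'w \<Rightarrow> real"
  assumes W: "finite W" and p: "sum p W = 1" and g: "(\<Sum>w\<in>W. p w * g w) = 0"
  shows "(\<Sum>ws\<in>words W m. prod_list (map p ws)) = 1"
    and "(\<Sum>ws\<in>words W m. prod_list (map p ws) * sum_list (map g ws)) = 0"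
    and "(\<Sum>ws\<in>words W m. prod_list (map p ws) * (sum_list (map g ws))\<^sup>2) = real m * (\<Sum>w\<in>W. p w * (g w)\<^sup>2)"
proof -
  have "(\<Sum>ws\<in>words W m. prod_list (map p ws)) = 1 \<and>
    (\<Sum>ws\<in>words W m. prod_list (map p ws) * sum_list (map g ws)) = 0 \<and>
    (\<Sum>ws\<in>words W m. prod_list (map p ws) * (sum_list (map g ws))\<^sup>2) = real m * (\<Sum>w\<in>W. p w * (g w)\<^sup>2)"
  proof (induction m)
    case 0
    then show ?case by (simp add: words_0)
  next
    case (Suc m)
    define a where "a ws = prod_list (map p ws)" for ws
    define s where "s ws = sum_list (map g ws)" for ws
    have IH: "(\<Sum>ws\<in>words W m. a ws) = 1" "(\<Sum>ws\<in>words W m. a ws * s ws) = 0"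
      "(\<Sum>ws\<in>words W m. a ws * (s ws)\<^sup>2) = real m * (\<Sum>w\<in>W. p w * (g w)\<^sup>2)"
      using Suc by (auto simp: a_def s_def)
    have "(\<Sum>w\<in>W. \<Sum>ws\<in>words W m. p w * a ws) = 1"
      using p IH(1) by (simp flip: sum_product)
    moreover have "(\<Sum>w\<in>W. \<Sum>ws\<in>words W m. p w * a ws * (g w + s ws)) =
        (\<Sum>w\<in>W. p w * g w) * (\<Sum>ws\<in>words W m. a ws) + sum p W * (\<Sum>ws\<in>words W m. a ws * s ws)"
      unfolding sum_product sum.distrib[symmetric] by (intro sum.cong refl) (simp add: algebra_simps)
    moreover have "(\<Sum>w\<in>W. \<Sum>ws\<in>words W m. p w * a ws * (g w + s ws)\<^sup>2) =
        (\<Sum>w\<in>W. p w * (g w)\<^sup>2) * (\<Sum>ws\<in>words W m. a ws) + 2 * ((\<Sum>w\<in>W. p w * g w) * (\<Sum>ws\<in>words W m. a ws * s ws))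
        + sum p W * (\<Sum>ws\<in>words W m. a ws * (s ws)\<^sup>2)"
      unfolding sum_product unfolding sum_distrib_left sum.distrib[symmetric]
      by (intro sum.cong refl) (simp add: algebra_simps power2_sum)
    ultimately show ?case
      using IH p g W by (simp add: sum_words_Suc a_def s_def algebra_simps)
  qed
  then show "(\<Sum>ws\<in>words W m. prod_list (map p ws)) = 1"
    "(\<Sum>ws\<in>words W m. prod_list (map p ws) * sum_list (map g ws)) = 0"
    "(\<Sum>ws\<in>words W m. prod_list (map p ws) * (sum_list (map g ws))\<^sup>2) = real m * (\<Sum>w\<in>W. p w * (g w)\<^sup>2)"
    by auto
qed

lemma sum_Un_le:
  fixes f :: "'a \<Rightarrow> real"
  assumes "finite A" "finite B" "\<And>x. x \<in> A \<union> B \<Longrightarrow> 0 \<le> f x"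
  shows "sum f (A \<union> B) \<le> sum f A + sum f B"
  using assms sum_nonneg[of "A \<inter> B" f] by (simp add: sum_Un)

lemma sum_UN_le:
  fixes f :: "'a \<Rightarrow> real"
  assumes "finite J" "\<And>j. j \<in> J \<Longrightarrow> finite (B j)" "\<And>j x. j \<in> J \<Longrightarrow> x \<in> B j \<Longrightarrow> 0 \<le> f x"
  shows "sum f (\<Union>j\<in>J. B j) \<le> (\<Sum>j\<in>J. sum f (B j))"
  using assms
proof (induction J)
  case (insert j J)
  have "sum f (B j \<union> (\<Union>j\<in>J. B j)) \<le> sum f (B j) + sum f (\<Union>j\<in>J. B j)"
    using insert.hyps insert.prems by (intro sum_Un_le) auto
  then show ?case using insert by fastforce
qed simp

text \<open>Chebyshev's inequality for each of the finitely many centred functions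
  \<open>g' j\<close>, and a union bound; m is so large that the variances leave a total failure
  probability of at most 1/2.\<close>

lemma weak_law_words:
  fixes p :: "'w \<Rightarrow> real" and g :: "'j \<Rightarrow> 'w \<Rightarrow> real"
  assumes W: "finite W" and p: "\<And>w. w \<in> W \<Longrightarrow> 0 < p w" "sum p W = 1" and J: "finite J" and d: "0 < d"
  obtains m0 where "\<And>m. m0 \<le> m \<Longrightarrow> 1 / 2 \<le>
    (\<Sum>ws\<in>{ws \<in> words W m. \<forall>j\<in>J. \<bar>sum_list (map (g j) ws) - real m * (\<Sum>w\<in>W. p w * g j w)\<bar> \<le> d * real m}. prod_list (map p ws))"
proof -
  define g' where "g' j w = g j w - (\<Sum>w\<in>W. p w * g j w)" for j w
  have g'0: "(\<Sum>w\<in>W. p w * g' j w) = 0" for j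
    using p(2) by (simp add: g'_def right_diff_distrib sum_subtractf flip: sum_distrib_right)
  have sl: "sum_list (map (g' j) ws) = sum_list (map (g j) ws) - real (length ws) * (\<Sum>w\<in>W. p w * g j w)" for j ws
    by (induction ws) (auto simp: g'_def algebra_simps)
  define V where "V j = (\<Sum>w\<in>W. p w * (g' j w)\<^sup>2)" for j
  have V0: "0 \<le> V j" for j unfolding V_def using p(1) by (intro sum_nonneg) (auto simp: less_imp_le)
  obtain m1 where m1: "\<And>m. m1 \<le> m \<Longrightarrow> 2 * (\<Sum>j\<in>J. V j) \<le> d\<^sup>2 * real m"
    using exists_nat_ge[of "d\<^sup>2"] d by (metis zero_less_power)
  show ?thesis
  proof (rule that[of "max 1 m1"])
    fix m assume m: "max 1 m1 \<le> m"
    define a where "a ws = prod_list (map p ws)" for ws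
    have a0: "0 \<le> a ws" if "ws \<in> words W m" for ws
    proof -
      have "set ws \<subseteq> W" using that by (simp add: words_def)
      then show ?thesis unfolding a_def by (induction ws) (auto simp: p(1) less_imp_le)
    qed
    define bad where "bad j = {ws \<in> words W m. d * real m < \<bar>sum_list (map (g' j) ws)\<bar>}" for j
    define good where "good = {ws \<in> words W m. \<forall>j\<in>J. \<bar>sum_list (map (g j) ws) - real m * (\<Sum>w\<in>W. p w * g j w)\<bar> \<le> d * real m}"
    have fin: "finite (words W m)" by (rule finite_words[OF W])
    have cheb: "(\<Sum>ws\<in>bad j. a ws) * (d * real m)\<^sup>2 \<le> real m * V j" for j
    proof -
      have "(\<Sum>ws\<in>bad j. a ws) * (d * real m)\<^sup>2 = (\<Sum>ws\<in>bad j. a ws * (d * real m)\<^sup>2)" by (rule sum_distrib_right)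
      also have "\<dots> \<le> (\<Sum>ws\<in>bad j. a ws * (sum_list (map (g' j) ws))\<^sup>2)"
      proof (intro sum_mono mult_left_mono)
        fix ws assume ws: "ws \<in> bad j"
        have "(d * real m)\<^sup>2 \<le> \<bar>sum_list (map (g' j) ws)\<bar>\<^sup>2"
          using ws d by (intro power_mono) (auto simp: bad_def)
        then show "(d * real m)\<^sup>2 \<le> (sum_list (map (g' j) ws))\<^sup>2" by simp
        show "0 \<le> a ws" using ws a0 by (simp add: bad_def)
      qed
      also have "\<dots> \<le> (\<Sum>ws\<in>words W m. a ws * (sum_list (map (g' j) ws))\<^sup>2)"
        using fin a0 by (intro sum_mono2) (auto simp: bad_def)
      also have "\<dots> = real m * V j"
        unfolding a_def V_def by (rule sum_words_iid(3)[OF W p(2) g'0])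
      finally show ?thesis .
    qed
    have "(\<Sum>j\<in>J. \<Sum>ws\<in>bad j. a ws) * (d * real m)\<^sup>2 \<le> real m * (\<Sum>j\<in>J. V j)"
      using cheb by (simp add: sum_distrib_right sum_distrib_left sum_mono)
    also have "real m * (2 * (\<Sum>j\<in>J. V j)) \<le> real m * (d\<^sup>2 * real m)"
      using m m1 by (intro mult_left_mono) auto
    then have "real m * (\<Sum>j\<in>J. V j) \<le> 1 / 2 * (d * real m)\<^sup>2" by (simp add: power_mult_distrib power2_eq_square algebra_simps)
    finally have "(\<Sum>j\<in>J. \<Sum>ws\<in>bad j. a ws) * (d * real m)\<^sup>2 \<le> 1 / 2 * (d * real m)\<^sup>2" .
    then have half: "(\<Sum>j\<in>J. \<Sum>ws\<in>bad j. a ws) \<le> 1 / 2"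
      using d m by (subst (asm) mult_le_cancel_right_pos) auto
    have "1 = (\<Sum>ws\<in>words W m. a ws)"
      unfolding a_def by (rule sum_words_iid(1)[OF W p(2), of "\<lambda>_. 0", symmetric]) simp
    also have "\<dots> \<le> (\<Sum>ws\<in>good \<union> (\<Union>j\<in>J. bad j). a ws)"
    proof (rule sum_mono2)
      show "words W m \<subseteq> good \<union> (\<Union>j\<in>J. bad j)"
      proof
        fix ws assume ws: "ws \<in> words W m"
        then have "length ws = m" by (simp add: words_def)
        then show "ws \<in> good \<union> (\<Union>j\<in>J. bad j)"
          using ws by (auto simp: good_def bad_def sl not_less)
      qed
    qed (use fin J a0 in \<open>auto simp: good_def bad_def\<close>)
    also have "\<dots> \<le> (\<Sum>ws\<in>good. a ws) + (\<Sum>ws\<in>(\<Union>j\<in>J. bad j). a ws)"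
      using fin J a0 by (intro sum_Un_le) (auto simp: good_def bad_def)
    also have "(\<Sum>ws\<in>(\<Union>j\<in>J. bad j). a ws) \<le> (\<Sum>j\<in>J. \<Sum>ws\<in>bad j. a ws)"
      using fin J a0 by (intro sum_UN_le) (auto simp: bad_def)
    finally show "1 / 2 \<le> (\<Sum>ws\<in>{ws \<in> words W m. \<forall>j\<in>J. \<bar>sum_list (map (g j) ws) - real m * (\<Sum>w\<in>W. p w * g j w)\<bar> \<le> d * real m}. prod_list (map p ws))"
      using half unfolding good_def a_def by linarith
  qed
qed

lemma cyl_appendD:
  assumes "x \<in> cyl (u @ v)"
  shows "x \<in> cyl u" "(left_shift ^^ length u) x \<in> cyl v"
proof -
  show "x \<in> cyl u" using assms cyl_append by blast
  show "(left_shift ^^ length u) x \<in> cyl v"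
    using assms left_shift_Xfull[of x "length u"] by (auto simp: cylinder_def funpow_left_shift nth_append)
qed

text \<open>Used for \<phi> and for indicators of cylinders alike: energy and visits of a
  concatenation split over its blocks, at the cost c per block.\<close>

lemma birkhoff_sum_concat:
  fixes f :: "(nat \<Rightarrow> nat) \<Rightarrow> real"
  assumes near: "\<And>w x. w \<in> W \<Longrightarrow> x \<in> cyl w \<Longrightarrow> \<bar>birkhoff_sum f N x - h w\<bar> \<le> c"
    and len: "\<And>w. w \<in> W \<Longrightarrow> length w = N"
  shows "set ws \<subseteq> W \<Longrightarrow> x \<in> cyl (concat ws) \<Longrightarrow>
    \<bar>birkhoff_sum f (N * length ws) x - sum_list (map h ws)\<bar> \<le> c * real (length ws)"
proof (induction ws arbitrary: x)
  case Nil
  then show ?case by (simp add: birkhoff_sum_def)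
next
  case (Cons w ws)
  have w: "w \<in> W" "set ws \<subseteq> W" "length w = N" using Cons.prems len by auto
  have x: "x \<in> cyl w" "(left_shift ^^ N) x \<in> cyl (concat ws)"
    using Cons.prems(2) cyl_appendD[of x w "concat ws"] w(3) by auto
  have "birkhoff_sum f (N * length (w # ws)) x = birkhoff_sum f N x + birkhoff_sum f (N * length ws) ((left_shift ^^ N) x)"
    by (simp add: birkhoff_sum_add)
  moreover have "\<bar>birkhoff_sum f N x - h w\<bar> \<le> c" by (rule near[OF w(1) x(1)])
  moreover have "\<bar>birkhoff_sum f (N * length ws) ((left_shift ^^ N) x) - sum_list (map h ws)\<bar> \<le> c * real (length ws)"
    by (rule Cons.IH[OF w(2) x(2)])
  ultimately show ?case by (simp add: algebra_simps abs_le_iff)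
qed

text \<open>The product weights cancel against \<open>- ln p\<close>. This converts a lower bound on
  the probability of a set of concatenations into one on their sum of \<open>exp S\<close>.\<close>

lemma prod_list_exp:
  fixes p s :: "'w \<Rightarrow> real"
  assumes "\<And>w. w \<in> set ws \<Longrightarrow> 0 < p w"
  shows "prod_list (map p ws) * exp (sum_list (map (\<lambda>w. s w - ln (p w)) ws)) = exp (sum_list (map s ws))"
  using assms
proof (induction ws)
  case (Cons w ws)
  have "prod_list (map p (w # ws)) * exp (sum_list (map (\<lambda>w. s w - ln (p w)) (w # ws))) =
     (p w * exp (s w - ln (p w))) * (prod_list (map p ws) * exp (sum_list (map (\<lambda>w. s w - ln (p w)) ws)))"
    by (simp add: exp_add)
  also have "\<dots> = exp (s w) * exp (sum_list (map s ws))"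
  proof -
    have "0 < p w" using Cons.prems by simp
    then have "p w * exp (s w - ln (p w)) = exp (s w)" by (simp add: exp_diff)
    moreover have "prod_list (map p ws) * exp (sum_list (map (\<lambda>w. s w - ln (p w)) ws)) = exp (sum_list (map s ws))"
      using Cons by simp
    ultimately show ?thesis by simp
  qed
  finally show ?case by (simp add: exp_add)
qed simp

text \<open>Periods that are not multiples of the block length \<open>N\<close> are reached by
  padding with fewer than \<open>N\<close> letters 1, so that every large \<open>M\<close> is
  covered.\<close>

lemma (in acceptable_potential) lower_bound:
  assumes nu: "\<nu> \<in> invariant_measures" and int: "integrable \<nu> \<phi>"
    and C: "\<C> \<in> finite_partitions \<nu>"
    and r: "(\<lambda>n. partition_entropy \<nu> (iterated_join \<nu> left_shift \<C> n) / real n) \<longlonglongrightarrow> r"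
    and F: "finite F" and e: "0 < e"
  obtains M0 where "1 \<le> M0"
    "\<And>M. M0 \<le> M \<Longrightarrow> \<exists>A. finite A \<and> A \<subseteq> periodic_points M \<and>
      (\<forall>x\<in>A. \<forall>v\<in>F. \<bar>measure (empirical_measure M x) (cyl v) - measure \<nu> (cyl v)\<bar> \<le> e) \<and>
      exp (real M * (r + (\<integral>x. \<phi> x \<partial>\<nu>) - e)) \<le> (\<Sum>x\<in>A. exp (S M x))"
proof -
  note nu' = invariant_measuresD(1)[OF nu]
  interpret nu: prob_space \<nu> by (rule prob_measuresD[OF nu'])
  define e1 where "e1 = e / 8"
  have e1: "0 < e1" "e = 8 * e1" using e by (auto simp: e1_def)
  define I where "I = (\<integral>x. \<phi> x \<partial>\<nu>)"
  obtain N W p where N: "1 \<le> N" and W: "finite W" "W \<subseteq> words {1..} N"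
    and p: "\<And>w. w \<in> W \<Longrightarrow> 0 < p w" "sum p W = 1"
    and dist: "\<And>w x. w \<in> W \<Longrightarrow> x \<in> cyl w \<Longrightarrow> \<bar>S N x - S N (per w)\<bar> \<le> e1 * real N"
    and ent: "real N * (r + I - e1) \<le> (\<Sum>w\<in>W. p w * (S N (per w) - ln (p w)))"
    and occ: "\<And>v. v \<in> F \<Longrightarrow> \<bar>(\<Sum>w\<in>W. p w * real (occurrences v w)) - real N * measure \<nu> (cyl v)\<bar> \<le> e1 * real N"
      "\<And>v. v \<in> F \<Longrightarrow> real (length v) \<le> e1 * real N"
    unfolding I_def
  proof (rule block_distribution[OF nu int C r F e1(1)], goal_cases)
    case (1 N W p)
    show ?case by (rule 1(1)[OF 1(2-10)])
  qed
  \<comment> \<open>\<open>None\<close> stands for energy plus information of a block,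
    \<open>Some v\<close> for the occurrences of v; the weak law treats all of them
    simultaneously.\<close>
  define g where "g j w = (case j of None \<Rightarrow> S N (per w) - ln (p w) | Some v \<Rightarrow> real (occurrences v w))" for j w
  define J where "J = insert None (Some ` F)"
  obtain m0 where m0: "\<And>m. m0 \<le> m \<Longrightarrow> 1 / 2 \<le>
    (\<Sum>ws\<in>{ws \<in> words W m. \<forall>j\<in>J. \<bar>sum_list (map (g j) ws) - real m * (\<Sum>w\<in>W. p w * g j w)\<bar> \<le> e1 * real m}. prod_list (map p ws))"
    using weak_law_words[OF W(1) p, of J e1 g] F e1 by (auto simp: J_def)
  \<comment> \<open>Bounds the absolute value of \<phi> on the cylinder of the letter 1, hence along
    the padding.\<close>
  define A0 where "A0 = \<bar>\<phi> (\<lambda>_. 1)\<bar> + osc"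
  have A0: "0 \<le> A0" using osc(1) by (simp add: A0_def)
  \<comment> \<open>The exponent per letter after three losses of \<open>e1\<close>: in the block
    distribution, in the weak law and by distortion within blocks.\<close>
  define k where "k = r + I - 3 * e1"
  obtain M1 where M1: "\<And>M. M1 \<le> M \<Longrightarrow> real N * \<bar>k\<bar> + real N * A0 + ln 2 + 2 * real N \<le> e1 * real M"
    using exists_nat_ge[OF e1(1)] by metis
  have ln2: "0 \<le> ln (2::real)" by simp
  show ?thesis
  proof (rule that[of "max 1 (max M1 (N * m0))"])
    fix M assume M: "max 1 (max M1 (N * m0)) \<le> M"
    define m where "m = M div N"
    define q where "q = M mod N"
    have Mmq: "M = N * m + q" "q < N" using N by (auto simp: m_def q_def)
    have "m0 \<le> m" using M N unfolding m_def by (subst less_eq_div_iff_mult_less_eq) (auto simp: mult.commute)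
    define good where "good = {ws \<in> words W m. \<forall>j\<in>J. \<bar>sum_list (map (g j) ws) - real m * (\<Sum>w\<in>W. p w * g j w)\<bar> \<le> e1 * real m}"
    have half: "1 / 2 \<le> (\<Sum>ws\<in>good. prod_list (map p ws))" unfolding good_def by (rule m0[OF \<open>m0 \<le> m\<close>])
    have fin: "finite good" unfolding good_def using finite_words[OF W(1), of m] by simp
    have MM: "real M = real N * real m + real q" "real q < real N" using Mmq by (simp_all flip: of_nat_mult of_nat_add)
    have big: "real N * \<bar>k\<bar> + real N * A0 + ln 2 + 2 * real N \<le> e1 * real M" using M M1 by simp
    have len: "length w = N" if "w \<in> W" for w using that W(2) by (auto simp: words_def)
    have good: "length ws = m" "set ws \<subseteq> W" if "ws \<in> good" for ws
      using that by (auto simp: good_def words_def)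
    define y where "y ws = concat ws @ replicate q 1" for ws :: "nat list list"
    have len_concat: "length (concat ws) = N * length ws" if "set ws \<subseteq> W" for ws
      using that by (induction ws) (auto simp: len)
    have y: "y ws \<in> words {1..} M" if "ws \<in> good" for ws
      using good[OF that] len_concat[of ws] W(2) Mmq(1) by (auto simp: y_def words_def)
    have M1': "1 \<le> M" using M by simp
    define A where "A = (\<lambda>ws. per (y ws)) ` good"
    \<comment> \<open>\<open>per\<close> is injective on words of length \<open>M\<close>, and equal
      block lengths make the concatenation uniquely decodable.\<close>
    have inj: "inj_on (\<lambda>ws. per (y ws)) good"
    proof (rule inj_onI)
      fix us vs assume uv: "us \<in> good" "vs \<in> good" "per (y us) = per (y vs)"
      have "y us = y vs"
        using bij_betw_per[OF M1'] uv y unfolding bij_betw_def inj_on_def by blast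
      then have "concat us = concat vs" by (simp add: y_def)
      moreover have "length a = length b" if "(a, b) \<in> set (zip us vs)" for a b
        using set_zip_leftD[OF that] set_zip_rightD[OF that] good(2)[OF uv(1)] good(2)[OF uv(2)] len by blast
      ultimately show "us = vs"
        using good(1)[OF uv(1)] good(1)[OF uv(2)] by (intro concat_injective) auto
    qed
    have x: "per (y ws) \<in> Xfull" "per (y ws) \<in> cyl (concat ws)" "(left_shift ^^ (N * m)) (per (y ws)) \<in> cyl (replicate q 1)"
      if "ws \<in> good" for ws
    proof -
      show "per (y ws) \<in> Xfull" using y[OF that] M1' by (rule per_Xfull)
      have "per (y ws) \<in> cyl (concat ws @ replicate q 1)" using per_cyl[OF y[OF that] M1'] by (simp add: y_def)
      from cyl_appendD[OF this] show "per (y ws) \<in> cyl (concat ws)" "(left_shift ^^ (N * m)) (per (y ws)) \<in> cyl (replicate q 1)"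
        using len_concat good[OF that] by auto
    qed
    have tail: "\<bar>S q z\<bar> \<le> real N * A0" if z: "z \<in> cyl (replicate q 1)" for z
    proof -
      have zX: "z \<in> Xfull" using z cyl_subset by blast
      have "\<bar>S q z\<bar> \<le> (\<Sum>k<q. \<bar>\<phi> ((left_shift ^^ k) z)\<bar>)" unfolding birkhoff_sum_def by (rule sum_abs)
      also have "\<dots> \<le> (\<Sum>k<q. A0)"
      proof (rule sum_mono)
        fix k assume "k \<in> {..<q}"
        then have "(left_shift ^^ k) z 0 = 1" using z by (auto simp: cylinder_def funpow_left_shift)
        then have "\<bar>\<phi> ((left_shift ^^ k) z) - \<phi> (\<lambda>_. 1)\<bar> \<le> osc"
          using zX by (intro osc left_shift_Xfull) (auto simp: full_shift_def)
        then show "\<bar>\<phi> ((left_shift ^^ k) z)\<bar> \<le> A0" by (simp add: A0_def)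
      qed
      also have "\<dots> \<le> real N * A0" using MM(2) A0 by (simp add: mult_right_mono)
      finally show ?thesis .
    qed
    have S_ge: "sum_list (map (\<lambda>w. S N (per w)) ws) - e1 * real N * real m - real N * A0 \<le> S M (per (y ws))" if "ws \<in> good" for ws
    proof -
      have "\<bar>S (N * length ws) (per (y ws)) - sum_list (map (\<lambda>w. S N (per w)) ws)\<bar> \<le> e1 * real N * real (length ws)"
        by (rule birkhoff_sum_concat[OF dist len good(2)[OF that] x(2)[OF that]])
      moreover have "S M (per (y ws)) = S (N * m) (per (y ws)) + S q ((left_shift ^^ (N * m)) (per (y ws)))"
        unfolding Mmq(1) by (rule birkhoff_sum_add)
      ultimately show ?thesis using tail[OF x(3)[OF that]] good(1)[OF that] by simp
    qed
    have vis: "\<bar>measure (empirical_measure M (per (y ws))) (cyl v) - measure \<nu> (cyl v)\<bar> \<le> e"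
      if ws: "ws \<in> good" and v: "v \<in> F" for ws v
    proof -
      define t where "t = measure \<nu> (cyl v)"
      have t: "0 \<le> t" "t \<le> 1" using nu.prob_le_1 by (auto simp: t_def)
      have "\<bar>birkhoff_sum (indicator (cyl v)) (N * length ws) (per (y ws)) - sum_list (map (\<lambda>w. real (occurrences v w)) ws)\<bar> \<le> real (length v) * real (length ws)"
      proof (rule birkhoff_sum_concat[OF _ len good(2)[OF ws] x(2)[OF ws]])
        fix w x assume w: "w \<in> W" "x \<in> cyl w"
        show "\<bar>birkhoff_sum (indicator (cyl v)) N x - real (occurrences v w)\<bar> \<le> real (length v)"
          unfolding visits_birkhoff[symmetric] using occurrences_visits[OF w(2), of v] len[OF w(1)] by simp
      qed
      then have 1: "\<bar>birkhoff_sum (indicator (cyl v)) (N * m) (per (y ws)) - sum_list (map (\<lambda>w. real (occurrences v w)) ws)\<bar> \<le> real (length v) * real m"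
        using good(1)[OF ws] by simp
      also have "\<dots> \<le> e1 * real N * real m" using occ(2)[OF v] by (intro mult_right_mono) auto
      finally have 1: "\<bar>birkhoff_sum (indicator (cyl v)) (N * m) (per (y ws)) - sum_list (map (\<lambda>w. real (occurrences v w)) ws)\<bar> \<le> e1 * real N * real m" .
      define u where "u = real (visits q v ((left_shift ^^ (N * m)) (per (y ws))))"
      have u: "0 \<le> u" "u \<le> real N"
      proof -
        have "visits q v ((left_shift ^^ (N * m)) (per (y ws))) \<le> card {..<q}"
          unfolding visits_def by (intro card_mono) auto
        then show "u \<le> real N" using MM(2) by (simp add: u_def)
      qed (simp add: u_def)
      have 2: "real (visits M v (per (y ws))) = birkhoff_sum (indicator (cyl v)) (N * m) (per (y ws)) + u"
        unfolding u_def visits_birkhoff Mmq(1) by (rule birkhoff_sum_add)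
      have "\<bar>sum_list (map (g (Some v)) ws) - real m * (\<Sum>w\<in>W. p w * g (Some v) w)\<bar> \<le> e1 * real m"
        using ws v by (simp add: good_def J_def)
      then have 3: "\<bar>sum_list (map (\<lambda>w. real (occurrences v w)) ws) - real m * (\<Sum>w\<in>W. p w * real (occurrences v w))\<bar> \<le> e1 * real m"
        by (simp add: g_def[abs_def])
      have "\<bar>real m * (\<Sum>w\<in>W. p w * real (occurrences v w)) - real m * (real N * t)\<bar> = real m * \<bar>(\<Sum>w\<in>W. p w * real (occurrences v w)) - real N * t\<bar>"
        by (simp add: abs_mult flip: right_diff_distrib)
      also have "\<dots> \<le> real m * (e1 * real N)" using occ(1)[OF v] by (intro mult_left_mono) (auto simp: t_def)
      finally have 4: "\<bar>real m * (\<Sum>w\<in>W. p w * real (occurrences v w)) - real m * (real N * t)\<bar> \<le> real m * (e1 * real N)" .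
      have 5: "real M * t = real m * (real N * t) + real q * t" unfolding MM(1) by (simp add: algebra_simps)
      have 6: "0 \<le> real q * t" "real q * t \<le> real N"
        using t MM(2) mult_mono[of "real q" "real N" t 1] by auto
      have 7: "e1 * real m \<le> e1 * (real N * real m)"
        using N e1(1) mult_right_mono[of 1 "real N" "real m"] by (intro mult_left_mono) auto
      have 8: "e1 * (real N * real m) \<le> e1 * real M" using e1(1) unfolding MM(1) by (intro mult_left_mono) auto
      have 9: "2 * real N \<le> e1 * real M" using big A0 ln2 by (smt (verit) mult_nonneg_nonneg of_nat_0_le_iff abs_ge_zero)
      have c1: "e1 * real N * real m = e1 * (real N * real m)" "real m * (e1 * real N) = e1 * (real N * real m)" by simp_all
      have "\<bar>real (visits M v (per (y ws))) - real M * t\<bar> \<le> e * real M"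
        unfolding e1(2) using 1 2 3 4 5 6 7 8 9 u unfolding c1 by (simp add: abs_le_iff)
      then have "\<bar>(real (visits M v (per (y ws))) - real M * t) / real M\<bar> \<le> e"
        using M1' by (simp add: abs_divide pos_divide_le_eq)
      then show ?thesis
        using M1' measure_empirical_visits[OF M1' x(1)[OF ws], of v] by (simp add: t_def diff_divide_distrib)
    qed
    have exp_ge: "exp (real M * (r + I - e)) \<le> (\<Sum>x\<in>A. exp (S M x))"
    proof -
      define a where "a = real m * (\<Sum>w\<in>W. p w * g None w) - e1 * real m - e1 * real N * real m - real N * A0"
      have "exp (real M * (r + I - e)) \<le> 1 / 2 * exp a"
      proof -
        have "real m * (real N * (r + I - e1)) \<le> real m * (\<Sum>w\<in>W. p w * g None w)"
          using ent by (intro mult_left_mono) (auto simp: g_def)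
        moreover have "e1 * real m \<le> e1 * (real N * real m)"
          using N e1(1) mult_right_mono[of 1 "real N" "real m"] by (intro mult_left_mono) auto
        ultimately have "real m * real N * k - real N * A0 \<le> a"
          unfolding a_def k_def by (simp add: algebra_simps)
        moreover have "real M * k - real N * \<bar>k\<bar> \<le> real m * real N * k"
        proof -
          have "real q * k \<le> real q * \<bar>k\<bar>" by (intro mult_left_mono) auto
          also have "\<dots> \<le> real N * \<bar>k\<bar>" using MM(2) by (intro mult_right_mono) auto
          finally show ?thesis unfolding MM(1) by (simp add: algebra_simps)
        qed
        moreover have "real M * (r + I - e) = real M * k - 5 * (e1 * real M)"
          by (simp add: k_def e1(2) algebra_simps)
        moreover have "0 \<le> e1 * real M" using e1 by simp
        ultimately have "real M * (r + I - e) \<le> a - ln 2"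
          using big by simp
        then have "exp (real M * (r + I - e)) \<le> exp (a - ln 2)" by simp
        then show ?thesis by (simp add: exp_diff)
      qed
      also have "\<dots> \<le> (\<Sum>ws\<in>good. prod_list (map p ws)) * exp a"
        using half by (intro mult_right_mono) auto
      also have "\<dots> = (\<Sum>ws\<in>good. prod_list (map p ws) * exp a)" by (rule sum_distrib_right)
      also have "\<dots> \<le> (\<Sum>ws\<in>good. exp (S M (per (y ws))))"
      proof (rule sum_mono)
        fix ws assume ws: "ws \<in> good"
        have pos: "0 < p w" if "w \<in> set ws" for w using that good(2)[OF ws] p(1) by blast
        then have "0 \<le> prod_list (map p ws)" by (induction ws) (auto simp: less_imp_le)
        moreover have "a \<le> sum_list (map (g None) ws) - e1 * real N * real m - real N * A0"
          using ws by (auto simp: a_def good_def J_def abs_le_iff)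
        ultimately have "prod_list (map p ws) * exp a \<le>
            prod_list (map p ws) * exp (sum_list (map (g None) ws) - e1 * real N * real m - real N * A0)"
          by (intro mult_left_mono) auto
        also have "\<dots> = prod_list (map p ws) * exp (sum_list (map (\<lambda>w. S N (per w) - ln (p w)) ws)) * exp (- e1 * real N * real m - real N * A0)"
          by (simp add: g_def[abs_def] flip: exp_add)
        also have "\<dots> = exp (sum_list (map (\<lambda>w. S N (per w)) ws) - e1 * real N * real m - real N * A0)"
          by (subst prod_list_exp[OF pos]) (auto simp flip: exp_add)
        also have "\<dots> \<le> exp (S M (per (y ws)))" using S_ge[OF ws] by simp
        finally show "prod_list (map p ws) * exp a \<le> exp (S M (per (y ws)))" .
      qed
      also have "\<dots> = (\<Sum>x\<in>A. exp (S M x))" unfolding A_def by (subst sum.reindex[OF inj]) simp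
      finally show ?thesis .
    qed
    show "\<exists>A. finite A \<and> A \<subseteq> periodic_points M \<and>
      (\<forall>x\<in>A. \<forall>v\<in>F. \<bar>measure (empirical_measure M x) (cyl v) - measure \<nu> (cyl v)\<bar> \<le> e) \<and>
      exp (real M * (r + (\<integral>x. \<phi> x \<partial>\<nu>) - e)) \<le> (\<Sum>x\<in>A. exp (S M x))"
    proof (intro exI[of _ A] conjI)
      show "finite A" unfolding A_def using fin by simp
      show "A \<subseteq> periodic_points M" unfolding A_def using per_periodic[OF y M1'] by auto
      show "\<forall>x\<in>A. \<forall>v\<in>F. \<bar>measure (empirical_measure M x) (cyl v) - measure \<nu> (cyl v)\<bar> \<le> e"
        unfolding A_def using vis by auto
      show "exp (real M * (r + (\<integral>x. \<phi> x \<partial>\<nu>) - e)) \<le> (\<Sum>x\<in>A. exp (S M x))"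
        using exp_ge by (simp add: I_def)
    qed
  qed simp
qed

section \<open>Stationary block processes\<close>

text \<open>Concatenate independent blocks of length \<open>n\<close> with distribution \<open>p\<close>, and let \<open>g v s\<close> be the
  probability that the process reads \<open>v\<close> when \<open>s\<close> is the unread rest of the current block. Starting at
  a uniformly distributed position of the block makes the process stationary.\<close>

locale block_process =
  fixes n :: nat and A :: "nat list set" and p :: "nat list \<Rightarrow> real"
  assumes n: "1 \<le> n" and A: "finite A" "A \<subseteq> words {1..} n"
    and p: "\<And>w. w \<in> A \<Longrightarrow> 0 < p w" "sum p A = 1"
begin

primrec g :: "nat list \<Rightarrow> nat list \<Rightarrow> real" where
  "g [] = (\<lambda>s. 1)"
| "g (a # v) = (\<lambda>s. if hd s = a then if tl s = [] then \<Sum>w\<in>A. p w * g v w else g v (tl s) else 0)"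

text \<open>\<open>G\<close> is the law of the process read from the start of a block,
  \<open>E j\<close> the law read from position j of a block, and \<open>Q\<close> their average
  over the positions.\<close>

definition G :: "nat list \<Rightarrow> real" where "G v = (\<Sum>w\<in>A. p w * g v w)"

definition E :: "nat \<Rightarrow> nat list \<Rightarrow> real" where "E j v = (\<Sum>w\<in>A. p w * g v (drop j w))"

definition Q :: "nat list \<Rightarrow> real" where "Q v = (\<Sum>j<n. E j v) / real n"

definition letters :: "nat set" where "letters = (\<Union>w\<in>A. set w)"

lemma g_Cons: "g (a # v) s = (if hd s = a then if tl s = [] then G v else g v (tl s) else 0)"
  by (simp add: G_def)

lemma lenA: "w \<in> A \<Longrightarrow> length w = n"
  using A(2) by (auto simp: words_def)

lemma letters: "finite letters" "letters \<subseteq> {1..}" "w \<in> A \<Longrightarrow> set w \<subseteq> letters"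
  using A by (auto simp: letters_def words_def)

lemma drop_ne: "w \<in> A \<Longrightarrow> j < n \<Longrightarrow> drop j w \<noteq> [] \<and> set (drop j w) \<subseteq> letters"
  using letters(3)[of w] lenA[of w] set_drop_subset[of j w] by auto

lemma A_ne: "w \<in> A \<Longrightarrow> w \<noteq> [] \<and> set w \<subseteq> letters"
  using drop_ne[of w 0] n by simp

lemma g_range: "0 \<le> g v s \<and> g v s \<le> 1"
proof (induction v arbitrary: s)
  case (Cons a v)
  have "0 \<le> G v" unfolding G_def using Cons p by (intro sum_nonneg) (auto simp: less_imp_le)
  moreover have "G v \<le> sum p A"
    unfolding G_def using Cons p by (intro sum_mono) (auto simp: less_imp_le intro: mult_left_le)
  ultimately show ?case using Cons p(2) by (simp only: g_Cons) auto
qed simp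

lemma E_range: "0 \<le> E j v" "E j v \<le> 1"
proof -
  show "0 \<le> E j v" unfolding E_def using g_range p by (intro sum_nonneg) (auto simp: less_imp_le)
  have "E j v \<le> sum p A"
    unfolding E_def using g_range p by (intro sum_mono) (auto simp: less_imp_le intro: mult_left_le)
  then show "E j v \<le> 1" using p(2) by simp
qed

lemma G_range: "0 \<le> G v" "G v \<le> 1"
  using E_range[of 0 v] by (auto simp: E_def G_def)

lemma Q_nonneg: "0 \<le> Q v"
  unfolding Q_def by (intro divide_nonneg_nonneg sum_nonneg E_range) simp

lemma g_outside: "s \<noteq> [] \<and> set s \<subseteq> letters \<Longrightarrow> \<not> set v \<subseteq> letters \<Longrightarrow> g v s = 0"
proof (induction v arbitrary: s)
  case (Cons a v)
  show ?case
  proof (cases "hd s = a")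
    case True
    then have "a \<in> letters" using Cons.prems(1) by (cases s) auto
    then have v: "\<not> set v \<subseteq> letters" using Cons.prems(2) by simp
    then have "G v = 0" unfolding G_def using Cons.IH A_ne by (intro sum.neutral) simp
    moreover have "tl s \<noteq> [] \<Longrightarrow> g v (tl s) = 0"
      using Cons.prems(1) v by (intro Cons.IH) (auto dest: list.set_sel(2))
    ultimately show ?thesis by (simp add: g_Cons del: g.simps)
  qed simp
qed simp

lemma g_snoc: "s \<noteq> [] \<and> set s \<subseteq> letters \<Longrightarrow> (\<Sum>a\<in>letters. g (v @ [a]) s) = g v s"
proof (induction v arbitrary: s)
  case Nil
  have "hd s \<in> letters" using Nil by (cases s) auto
  then show ?case using letters(1) p(2) by simp
next
  case (Cons b v)
  have "(\<Sum>a\<in>letters. G (v @ [a])) = G v"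
  proof -
    have "(\<Sum>w\<in>A. p w * (\<Sum>a\<in>letters. g (v @ [a]) w)) = (\<Sum>w\<in>A. p w * g v w)"
      by (intro sum.cong) (auto simp: Cons.IH A_ne)
    then show ?thesis unfolding G_def by (subst sum.swap) (simp only: sum_distrib_left)
  qed
  moreover have "tl s \<noteq> [] \<Longrightarrow> (\<Sum>a\<in>letters. g (v @ [a]) (tl s)) = g v (tl s)"
    using Cons.prems by (intro Cons.IH) (auto dest: list.set_sel(2))
  ultimately show ?case by (simp add: g_Cons del: g.simps)
qed

lemma E_snoc: "j < n \<Longrightarrow> (\<Sum>a\<in>letters. E j (v @ [a])) = E j v"
proof -
  assume j: "j < n"
  have "(\<Sum>a\<in>letters. g (v @ [a]) (drop j w)) = g v (drop j w)" if "w \<in> A" for w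
    by (rule g_snoc[OF drop_ne[OF that j]])
  then have "(\<Sum>w\<in>A. p w * (\<Sum>a\<in>letters. g (v @ [a]) (drop j w))) = (\<Sum>w\<in>A. p w * g v (drop j w))"
    by (intro sum.cong) auto
  then show ?thesis unfolding E_def by (subst sum.swap) (simp only: sum_distrib_left)
qed

lemma E_outside: "j < n \<Longrightarrow> \<not> set v \<subseteq> letters \<Longrightarrow> E j v = 0"
  unfolding E_def using g_outside drop_ne by (intro sum.neutral) simp

lemma E_append: "j < n \<Longrightarrow> (\<Sum>t\<in>words letters k. E j (v @ t)) = E j v"
proof (induction k)
  case (Suc k)
  have "(\<Sum>t\<in>words letters (k + 1). E j (v @ t)) = (\<Sum>t\<in>words letters k. \<Sum>u\<in>words letters 1. E j ((v @ t) @ u))"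
    using letters(1) by (subst sum_words_append) auto
  also have "\<dots> = (\<Sum>t\<in>words letters k. E j (v @ t))"
  proof (rule sum.cong)
    fix t
    have "words letters 1 = (\<lambda>a. [a]) ` letters" by (auto simp: One_nat_def words_Suc words_0)
    then have "(\<Sum>u\<in>words letters 1. E j ((v @ t) @ u)) = (\<Sum>a\<in>letters. E j ((v @ t) @ [a]))"
      by (simp add: sum.reindex inj_on_def)
    then show "(\<Sum>u\<in>words letters 1. E j ((v @ t) @ u)) = E j (v @ t)"
      using E_snoc[OF Suc.prems, of "v @ t"] by simp
  qed simp
  finally show ?case using Suc by (simp add: One_nat_def)
qed (simp add: words_0)

lemma E_Nil: "E j [] = 1" by (simp add: E_def p)

lemma sum_E: "j < n \<Longrightarrow> (\<Sum>v\<in>words letters k. E j v) = 1"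
  using E_append[of j "[]" k] by (simp add: E_Nil)

text \<open>Forgetting the first letter moves the start from position j to \<open>j + 1\<close>, and
  from the last position to a fresh block.\<close>

lemma E_Cons:
  assumes "j < n"
  shows "(\<Sum>a\<in>letters. E j (a # v)) = (if Suc j < n then E (Suc j) v else G v)"
proof -
  have "(\<Sum>a\<in>letters. g (a # v) (drop j w)) = (if Suc j < n then g v (drop (Suc j) w) else G v)" if w: "w \<in> A" for w
  proof -
    have "hd (drop j w) \<in> letters" using drop_ne[OF w assms] by (cases "drop j w") auto
    moreover have "tl (drop j w) = drop (Suc j) w" by (simp add: drop_Suc tl_drop)
    ultimately show ?thesis using letters(1) lenA[OF w] assms
      by (auto simp: g_Cons simp del: g.simps)
  qed
  then have "(\<Sum>w\<in>A. p w * (\<Sum>a\<in>letters. g (a # v) (drop j w))) =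
      (\<Sum>w\<in>A. p w * (if Suc j < n then g v (drop (Suc j) w) else G v))"
    by (intro sum.cong) auto
  then have "(\<Sum>a\<in>letters. E j (a # v)) = (\<Sum>w\<in>A. p w * (if Suc j < n then g v (drop (Suc j) w) else G v))"
    unfolding E_def by (subst sum.swap) (simp only: sum_distrib_left)
  also have "\<dots> = (if Suc j < n then E (Suc j) v else G v)"
    using p(2) by (simp add: E_def flip: sum_distrib_right)
  finally show ?thesis .
qed

text \<open>The shift permutes the starting positions cyclically, \<open>G\<close> being
  \<open>E 0\<close>, so the average over them is unchanged.\<close>

lemma Q_Cons: "(\<Sum>a\<in>letters. Q (a # v)) = Q v"
proof -
  have "(\<Sum>a\<in>letters. \<Sum>j<n. E j (a # v)) = (\<Sum>j<n. if Suc j < n then E (Suc j) v else G v)"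
    by (subst sum.swap) (simp add: E_Cons)
  also obtain k where k: "n = Suc k" using n by (cases n) (auto simp: One_nat_def)
  have "(\<Sum>j<n. if Suc j < n then E (Suc j) v else G v) = (\<Sum>j<k. E (Suc j) v) + G v"
    unfolding k by simp
  also have "\<dots> = (\<Sum>j<n. E j v)"
    unfolding k sum.lessThan_Suc_shift by (simp add: E_def[of 0] G_def)
  finally show ?thesis by (simp add: Q_def flip: sum_divide_distrib)
qed

lemma Q_snoc: "(\<Sum>a\<in>letters. Q (v @ [a])) = Q v"
proof -
  have "(\<Sum>a\<in>letters. \<Sum>j<n. E j (v @ [a])) = (\<Sum>j<n. E j v)"
    by (subst sum.swap) (simp add: E_snoc)
  then show ?thesis by (simp add: Q_def flip: sum_divide_distrib)
qed

lemma Q_outside: "\<not> set v \<subseteq> letters \<Longrightarrow> Q v = 0"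
  unfolding Q_def using E_outside by simp

lemma sum_Q: "(\<Sum>v\<in>words letters k. Q v) = 1"
proof -
  have "(\<Sum>v\<in>words letters k. \<Sum>j<n. E j v) = (\<Sum>j<n. 1)"
    by (subst sum.swap) (simp add: sum_E)
  then show ?thesis using n by (simp add: Q_def flip: sum_divide_distrib)
qed

text \<open>\<open>Q_snoc\<close> provides the consistency that \<open>exists_measure_cyl\<close>
  requires, \<open>Q_Cons\<close> the invariance, checked on cylinders.\<close>

lemma exists_stationary:
  obtains \<nu> where "\<nu> \<in> invariant_measures" "\<And>v. measure \<nu> (cyl v) = Q v"
proof -
  have Q_nil: "Q [] = 1" using n by (simp add: Q_def E_Nil)
  have "(\<lambda>a. Q (v @ [a])) sums Q v" for v
    using sums_finite[OF letters(1), of "\<lambda>a. Q (v @ [a])"] by (simp add: Q_outside Q_snoc)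
  moreover have "Q v = 0" if "0 \<in> set v" for v using that letters(2) by (intro Q_outside) auto
  ultimately obtain \<nu> where nu: "\<nu> \<in> prob_measures Xfull" "\<And>v. measure \<nu> (cyl v) = Q v"
    using exists_measure_cyl[of Q] Q_nonneg Q_nil by metis
  interpret prob_space \<nu> by (rule prob_measuresD[OF nu(1)])
  have [measurable]: "cyl w \<in> sets \<nu>" for w by (rule prob_measuresD[OF nu(1)])
  have sp: "space \<nu> = Xfull" and sets: "sets \<nu> = sets BX" by (rule prob_measuresD[OF nu(1)])+
  have pre: "left_shift -` cyl w \<inter> Xfull = (\<Union>a. cyl (a # w))" for w
    by (rule set_eqI) (simp add: cyl_Cons conj_commute)
  have meas: "left_shift \<in> measurable \<nu> BX"
  proof (rule measurable_BX)
    fix x assume "x \<in> space \<nu>" then show "left_shift x \<in> Xfull" by (auto simp: sp full_shift_def left_shift_def)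
  qed (simp add: sp pre)
  define \<nu>' where "\<nu>' = distr \<nu> BX left_shift"
  have nu': "\<nu>' \<in> prob_measures Xfull"
    unfolding \<nu>'_def prob_measures_def using prob_space_distr[OF meas] by simp
  have "measure \<nu>' (cyl w) = measure \<nu> (cyl w)" for w
  proof -
    have "measure \<nu>' (cyl w) = prob (\<Union>a. cyl (a # w))"
      unfolding \<nu>'_def by (subst measure_distr[OF meas]) (auto simp: sp pre)
    moreover have "(\<lambda>a. prob (cyl (a # w))) sums prob (\<Union>a. cyl (a # w))"
      by (intro finite_measure_UNION) (auto simp: disjoint_family_on_def cyl_same_length_disjoint)
    moreover have "(\<lambda>a. prob (cyl (a # w))) sums Q w"
      using sums_finite[OF letters(1), of "\<lambda>a. Q (a # w)"] by (simp add: nu(2) Q_outside Q_Cons)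
    ultimately show ?thesis using nu(2) by (simp add: sums_iff)
  qed
  then have eq: "\<nu>' = \<nu>" by (rule measure_eqI_cyl[OF nu' nu(1)])
  have "emeasure \<nu> (left_shift -` B \<inter> space \<nu>) = emeasure \<nu> B" if "B \<in> sets \<nu>" for B
    using emeasure_distr[OF meas, of B] that unfolding \<nu>'_def[symmetric] eq sets by simp
  then have "\<nu> \<in> invariant_measures" using nu(1) by (simp add: invariant_measures_def)
  then show ?thesis using nu(2) by (rule that)
qed

lemma g_append: "length u = length s \<Longrightarrow> s \<noteq> [] \<Longrightarrow> g (u @ v) s = (if u = s then G v else 0)"
proof (induction u arbitrary: s)
  case (Cons a u)
  then obtain b s' where s: "s = b # s'" "length u = length s'" by (cases s) auto
  show ?case
  proof (cases "s' = []")
    case True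
    then show ?thesis using s by (auto simp: g_Cons simp del: g.simps)
  next
    case False
    then show ?thesis using s Cons.IH[OF s(2) False] by (auto simp: g_Cons simp del: g.simps)
  qed
qed simp

lemma g_short: "length v \<le> length s \<Longrightarrow> s \<noteq> [] \<Longrightarrow> g v s = (if take (length v) s = v then 1 else 0)"
proof -
  assume le: "length v \<le> length s" and s: "s \<noteq> []"
  have G1: "G [] = 1" using p(2) by (simp add: G_def)
  show ?thesis
    using le s
  proof (induction v arbitrary: s)
    case (Cons a v)
    then obtain b s' where s: "s = b # s'" "length v \<le> length s'" by (cases s) auto
    show ?case
    proof (cases "s' = []")
      case True
      then show ?thesis using s G1 by (auto simp: g_Cons simp del: g.simps)
    next
      case False
      then show ?thesis using s Cons.IH[OF s(2) False] by (auto simp: g_Cons simp del: g.simps)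
    qed
  qed simp
qed

lemma G_block: "length u = n \<Longrightarrow> G (u @ v) = (if u \<in> A then p u * G v else 0)"
proof -
  assume u: "length u = n"
  have "G (u @ v) = (\<Sum>w\<in>A. if w = u then p w * G v else 0)"
    unfolding G_def[of "u @ v"] using u lenA A_ne by (intro sum.cong) (auto simp: g_append)
  then show ?thesis using A(1) by simp
qed

text \<open>A word of length \<open>n - j\<close> read from position j fills exactly the rest of the
  block, after which an independent block begins.\<close>

lemma E_prefix:
  assumes "j < n" "length s = n - j"
  shows "E j (s @ v) = E j s * G v"
proof -
  have "G [] = 1" using p(2) by (simp add: G_def)
  then have "g (s @ v) (drop j w) = g s (drop j w) * G v" if "w \<in> A" for w
    using g_append[of s "drop j w" v] g_append[of s "drop j w" "[]"] lenA[OF that] drop_ne[OF that assms(1)] assms(2)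
    by simp
  then show ?thesis unfolding E_def sum_distrib_right by (intro sum.cong) auto
qed

lemma sum_E_prefix:
  assumes "j < n"
  shows "(\<Sum>s\<in>words letters (n - j). E j (s @ v)) = G v"
proof -
  have "(\<Sum>s\<in>words letters (n - j). E j (s @ v)) = (\<Sum>s\<in>words letters (n - j). E j s) * G v"
    unfolding sum_distrib_right using assms by (intro sum.cong E_prefix) (auto simp: words_def)
  then show ?thesis by (simp add: sum_E[OF assms])
qed

text \<open>The first \<open>n - j\<close> letters read from position j are the end of the current
  block. This turns averages over windows of the stationary process into averages over blocks, for
  the energy estimate in \<open>stationary_integral\<close>.\<close>

lemma E_sum_take:
  assumes j: "j < n" and k: "n - j \<le> k"
  shows "(\<Sum>v\<in>words letters k. E j v * h (take (n - j) v)) = (\<Sum>w\<in>A. p w * h (drop j w))"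
proof -
  have k': "k = (n - j) + (k - (n - j))" using k by simp
  have "(\<Sum>v\<in>words letters k. E j v * h (take (n - j) v)) =
      (\<Sum>s\<in>words letters (n - j). \<Sum>t\<in>words letters (k - (n - j)). E j (s @ t) * h (take (n - j) (s @ t)))"
    by (subst k', subst sum_words_append[OF letters(1)]) simp
  also have "\<dots> = (\<Sum>s\<in>words letters (n - j). (\<Sum>t\<in>words letters (k - (n - j)). E j (s @ t)) * h s)"
    unfolding sum_distrib_right by (intro sum.cong) (auto simp: words_def)
  also have "\<dots> = (\<Sum>s\<in>words letters (n - j). E j s * h s)" by (simp add: E_append[OF j])
  also have "\<dots> = (\<Sum>s\<in>words letters (n - j). \<Sum>w\<in>A. if s = drop j w then p w * h (drop j w) else 0)"
  proof (rule sum.cong)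
    fix s assume s: "s \<in> words letters (n - j)"
    have "p w * g s (drop j w) * h s = (if s = drop j w then p w * h (drop j w) else 0)" if w: "w \<in> A" for w
      using g_short[of s "drop j w"] lenA[OF w] drop_ne[OF w j] s by (auto simp: words_def)
    then show "E j s * h s = (\<Sum>w\<in>A. if s = drop j w then p w * h (drop j w) else 0)"
      unfolding E_def sum_distrib_right by (intro sum.cong) auto
  qed simp
  also have "\<dots> = (\<Sum>w\<in>A. \<Sum>s\<in>words letters (n - j). if s = drop j w then p w * h (drop j w) else 0)"
    by (rule sum.swap)
  also have "\<dots> = (\<Sum>w\<in>A. p w * h (drop j w))"
  proof (rule sum.cong)
    fix w assume w: "w \<in> A"
    have "drop j w \<in> words letters (n - j)" using drop_ne[OF w j] lenA[OF w] by (simp add: words_def)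
    then show "(\<Sum>s\<in>words letters (n - j). if s = drop j w then p w * h (drop j w) else 0) = p w * h (drop j w)"
      using finite_words[OF letters(1)] by simp
  qed simp
  finally show ?thesis .
qed

text \<open>\<open>n * Q v\<close> is a sum over starting positions. Those where v still fits into
  the block give the mean number of occurrences; at most \<open>length v\<close> positions remain,
  each contributing between 0 and 1.\<close>

lemma Q_occurrences: "\<bar>real n * Q v - (\<Sum>w\<in>A. p w * real (occurrences v w))\<bar> \<le> real (length v)"
proof -
  have "(\<Sum>w\<in>A. p w * real (occurrences v w)) = (\<Sum>w\<in>A. \<Sum>j\<in>{j. j < n \<and> j + length v \<le> n}. p w * g v (drop j w))"
  proof (rule sum.cong)
    fix w assume w: "w \<in> A"
    have "real (occurrences v w) = (\<Sum>j\<in>{j. j < n \<and> j + length v \<le> n \<and> take (length v) (drop j w) = v}. 1)"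
      by (simp add: occurrences_def lenA[OF w])
    also have "\<dots> = (\<Sum>j\<in>{j. j < n \<and> j + length v \<le> n}. g v (drop j w))"
    proof (rule sum.mono_neutral_cong_left)
      show "\<forall>j\<in>{j. j < n \<and> j + length v \<le> n} - {j. j < n \<and> j + length v \<le> n \<and> take (length v) (drop j w) = v}. g v (drop j w) = 0"
        using lenA[OF w] by (auto simp: g_short split: if_splits)
      show "1 = g v (drop j w)" if "j \<in> {j. j < n \<and> j + length v \<le> n \<and> take (length v) (drop j w) = v}" for j
        using that lenA[OF w] by (subst g_short) auto
    qed auto
    finally show "p w * real (occurrences v w) = (\<Sum>j\<in>{j. j < n \<and> j + length v \<le> n}. p w * g v (drop j w))"
      by (simp add: sum_distrib_left)
  qed simp
  also have "\<dots> = (\<Sum>j\<in>{j. j < n \<and> j + length v \<le> n}. E j v)"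
    unfolding E_def by (rule sum.swap)
  finally have occ: "(\<Sum>w\<in>A. p w * real (occurrences v w)) = (\<Sum>j\<in>{j. j < n \<and> j + length v \<le> n}. E j v)" .
  have "real n * Q v = (\<Sum>j<n. E j v)" using n by (simp add: Q_def)
  also have "\<dots> = (\<Sum>j\<in>{..<n} - {j. j < n \<and> j + length v \<le> n}. E j v) + (\<Sum>j\<in>{j. j < n \<and> j + length v \<le> n}. E j v)"
    by (rule sum.subset_diff) auto
  finally have eq: "real n * Q v - (\<Sum>w\<in>A. p w * real (occurrences v w)) = (\<Sum>j\<in>{..<n} - {j. j < n \<and> j + length v \<le> n}. E j v)"
    using occ by simp
  have "(\<Sum>j\<in>{..<n} - {j. j < n \<and> j + length v \<le> n}. E j v) \<le> (\<Sum>j\<in>{..<n} - {j. j < n \<and> j + length v \<le> n}. 1)"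
    by (intro sum_mono E_range)
  also have "\<dots> = real (card ({..<n} - {j. j < n \<and> j + length v \<le> n}))" by simp
  also have "card ({..<n} - {j. j < n \<and> j + length v \<le> n}) \<le> card {n - length v..<n}"
    by (intro card_mono) auto
  also have "\<dots> \<le> length v" by simp
  finally have "(\<Sum>j\<in>{..<n} - {j. j < n \<and> j + length v \<le> n}. E j v) \<le> real (length v)" by simp
  moreover have "0 \<le> (\<Sum>j\<in>{..<n} - {j. j < n \<and> j + length v \<le> n}. E j v)"
    by (intro sum_nonneg E_range)
  ultimately show ?thesis using eq by simp
qed

section \<open>Entropy of the block process\<close>

definition H :: real where "H = (\<Sum>w\<in>A. - (p w * ln (p w)))"

lemma sum_G: "(\<Sum>v\<in>words letters k. G v) = 1"
  using sum_E[of 0 k] n by (simp add: E_def G_def)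

text \<open>Read from the start of a block, a word of this length consists of m independent blocks,
  and their entropies add.\<close>

lemma entropy_G: "(\<Sum>v\<in>words letters (n * m). - (G v * ln (G v))) = real m * H"
proof (induction m)
  case 0
  then show ?case using p(2) by (simp add: words_0 G_def)
next
  case (Suc m)
  have "(\<Sum>v\<in>words letters (n * Suc m). - (G v * ln (G v))) =
      (\<Sum>u\<in>words letters n. \<Sum>v\<in>words letters (n * m). - (G (u @ v) * ln (G (u @ v))))"
    using sum_words_append[OF letters(1), where m = n and n = "n * m"] by simp
  also have "\<dots> = (\<Sum>u\<in>A. \<Sum>v\<in>words letters (n * m). - (G (u @ v) * ln (G (u @ v))))"
  proof (rule sum.mono_neutral_right)
    show "A \<subseteq> words letters n" using A_ne lenA by (auto simp: words_def)
    show "finite (words letters n)" by (rule finite_words[OF letters(1)])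
  qed (auto simp: G_block words_def intro!: sum.neutral)
  also have "\<dots> = (\<Sum>u\<in>A. \<Sum>v\<in>words letters (n * m). - (p u * ln (p u)) * G v + p u * (- (G v * ln (G v))))"
  proof (intro sum.cong refl)
    fix u v assume u: "u \<in> A"
    show "- (G (u @ v) * ln (G (u @ v))) = - (p u * ln (p u)) * G v + p u * (- (G v * ln (G v)))"
    proof (cases "G v = 0")
      case False
      then have "0 < G v" using G_range(1)[of v] by linarith
      then show ?thesis using u p(1)[OF u] lenA[OF u] by (simp add: G_block ln_mult algebra_simps)
    qed (use u lenA[OF u] in \<open>simp add: G_block\<close>)
  qed
  also have "\<dots> = (\<Sum>u\<in>A. - (p u * ln (p u))) * (\<Sum>v\<in>words letters (n * m). G v)
      + sum p A * (\<Sum>v\<in>words letters (n * m). - (G v * ln (G v)))"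
    unfolding sum_product sum.distrib ..
  finally show ?case using Suc p(2) by (simp add: sum_G H_def algebra_simps)
qed

text \<open>A window of length \<open>n * m + n\<close> from position j splits into the rest of a
  block, m whole blocks and j further letters. Its probability is at most that of the m whole
  blocks, so its \<open>- ln\<close> is at least as large.\<close>

lemma entropy_E:
  assumes j: "j < n"
  shows "real m * H \<le> (\<Sum>v\<in>words letters (n * m + n). - (E j v * ln (E j v)))"
proof -
  have len: "n * m + n = (n - j) + (n * m + j)" using j by simp
  have G_mono: "G (v @ t) \<le> G v" if "t \<in> words letters k" for v t k
  proof -
    have "G (v @ t) \<le> (\<Sum>t\<in>words letters k. G (v @ t))"
      using that finite_words[OF letters(1)] by (intro member_le_sum G_range) auto
    also have "\<dots> = G v" using E_append[of 0 v k] n by (simp add: E_def G_def)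
    finally show ?thesis .
  qed
  have "real m * H = (\<Sum>v\<in>words letters (n * m). - (G v * ln (G v)))" by (rule entropy_G[symmetric])
  also have "\<dots> = (\<Sum>v\<in>words letters (n * m). (\<Sum>s\<in>words letters (n - j). \<Sum>t\<in>words letters j. E j (s @ v @ t)) * (- ln (G v)))"
  proof (rule sum.cong)
    fix v
    have "(\<Sum>t\<in>words letters j. E j (s @ v @ t)) = E j (s @ v)" for s
      using E_append[OF j, of "s @ v" j] by simp
    then show "- (G v * ln (G v)) = (\<Sum>s\<in>words letters (n - j). \<Sum>t\<in>words letters j. E j (s @ v @ t)) * (- ln (G v))"
      by (simp add: sum_E_prefix[OF j])
  qed simp
  also have "\<dots> = (\<Sum>v\<in>words letters (n * m). \<Sum>s\<in>words letters (n - j). \<Sum>t\<in>words letters j. E j (s @ v @ t) * (- ln (G v)))"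
    by (simp only: sum_distrib_right)
  also have "\<dots> \<le> (\<Sum>v\<in>words letters (n * m). \<Sum>s\<in>words letters (n - j). \<Sum>t\<in>words letters j. - (E j (s @ v @ t) * ln (E j (s @ v @ t))))"
  proof (intro sum_mono)
    fix v s t assume vst: "v \<in> words letters (n * m)" "s \<in> words letters (n - j)" "t \<in> words letters j"
    have "E j (s @ v @ t) = E j s * G (v @ t)" using vst by (intro E_prefix[OF j]) (auto simp: words_def)
    also have "\<dots> \<le> 1 * G v" using vst E_range[of j s] G_range G_mono[OF vst(3)] by (intro mult_mono) auto
    finally have "E j (s @ v @ t) \<le> G v" by simp
    then show "E j (s @ v @ t) * (- ln (G v)) \<le> - (E j (s @ v @ t) * ln (E j (s @ v @ t)))"
      using E_range(1)[of j "s @ v @ t"]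
      by (cases "E j (s @ v @ t) = 0") (auto simp: order_less_le intro!: mult_left_mono ln_mono)
  qed
  also have "\<dots> = (\<Sum>s\<in>words letters (n - j). \<Sum>v\<in>words letters (n * m). \<Sum>t\<in>words letters j. - (E j (s @ v @ t) * ln (E j (s @ v @ t))))"
    by (rule sum.swap)
  also have "\<dots> = (\<Sum>v\<in>words letters (n * m + n). - (E j v * ln (E j v)))"
    unfolding len sum_words_append[OF letters(1), where m = "n - j"] sum_words_append[OF letters(1), where m = "n * m" and n = j] ..
  finally show ?thesis .
qed

text \<open>Concavity of entropy: each \<open>E j\<close> is compared with the mean \<open>Q\<close>
  by the Gibbs inequality, and summing over j turns the right-hand side into n times the entropy of
  \<open>Q\<close>.\<close>

lemma entropy_Q: "real m * H \<le> (\<Sum>v\<in>words letters (n * m + n). - (Q v * ln (Q v)))"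
proof -
  have "real n * (real m * H) = (\<Sum>j<n. real m * H)" by simp
  also have "\<dots> \<le> (\<Sum>j<n. \<Sum>v\<in>words letters (n * m + n). - (E j v * ln (E j v)))"
    by (intro sum_mono entropy_E) simp
  also have "\<dots> \<le> (\<Sum>j<n. \<Sum>v\<in>words letters (n * m + n). - (E j v * ln (Q v)))"
  proof (rule sum_mono, rule gibbs_inequality)
    fix j v assume j: "j \<in> {..<n}"
    show "0 < Q v" if "0 < E j v"
    proof -
      have "E j v \<le> (\<Sum>j<n. E j v)" using j by (intro member_le_sum E_range) auto
      then show ?thesis unfolding Q_def using that n by simp
    qed
  next
    fix j assume "j \<in> {..<n}"
    then show "sum Q (words letters (n * m + n)) \<le> sum (E j) (words letters (n * m + n))"
      by (simp add: sum_Q sum_E)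
  qed (auto simp: E_range Q_nonneg)
  also have "\<dots> = (\<Sum>v\<in>words letters (n * m + n). \<Sum>j<n. - (E j v * ln (Q v)))" by (rule sum.swap)
  also have "\<dots> = (\<Sum>v\<in>words letters (n * m + n). real n * - (Q v * ln (Q v)))"
    using n by (intro sum.cong) (auto simp: Q_def sum_negf simp flip: sum_distrib_right)
  also have "\<dots> = real n * (\<Sum>v\<in>words letters (n * m + n). - (Q v * ln (Q v)))"
    by (rule sum_distrib_left[symmetric])
  finally show ?thesis using n by simp
qed

lemma stationary_entropy:
  assumes nu: "\<nu> \<in> invariant_measures" and Q: "\<And>v. measure \<nu> (cyl v) = Q v"
  shows "ereal (H / real n) \<le> ks_entropy \<nu> left_shift"
proof -
  interpret measure_preserving \<nu> left_shift by (rule invariant_measuresD(2)[OF nu])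
  have sp: "space \<nu> = Xfull" by (rule prob_measuresD[OF invariant_measuresD(1)[OF nu]])
  have sets: "sets \<nu> = sets BX" by (rule prob_measuresD[OF invariant_measuresD(1)[OF nu]])
  \<comment> \<open>The first letter as a finite-valued label. The remaining letters, a null event,
    are sent to 0, which no word over \<open>letters\<close> contains.\<close>
  define f where "f x = (if x 0 \<in> letters then x 0 else 0)" for x :: "nat \<Rightarrow> nat"
  have f: "simple_function \<nu> f"
  proof -
    have "f -` {a} \<inter> space \<nu> = prefix_set 1 {w. (if hd w \<in> letters then hd w else 0) = a}" for a
    proof (rule set_eqI)
      fix x :: "nat \<Rightarrow> nat"
      have "hd (map x [0..<1]) = x 0" by (simp add: One_nat_def)
      then show "x \<in> f -` {a} \<inter> space \<nu> \<longleftrightarrow> x \<in> prefix_set 1 {w. (if hd w \<in> letters then hd w else 0) = a}"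
        unfolding prefix_set_def f_def sp Int_iff vimage_singleton_eq mem_Collect_eq
        by (metis (no_types, lifting))
    qed
    moreover have "f ` space \<nu> \<subseteq> insert 0 letters" by (rule image_subsetI) (simp add: f_def)
    then have "finite (f ` space \<nu>)" using letters(1) by (meson finite.insertI finite_subset)
    ultimately show ?thesis using prefix_set_in_BX sets by (simp add: simple_function_def)
  qed
  have name: "names f k -` {v} \<inter> space \<nu> = cyl v" if v: "v \<in> words letters k" for k v
  proof (rule set_eqI)
    fix x
    have v0: "v ! i \<in> letters \<and> v ! i \<noteq> 0" if "i < k" for i
    proof -
      have "v ! i \<in> letters" using v that by (auto simp: words_def)
      then show ?thesis using letters(2) by auto
    qed
    have "names f k x = v \<longleftrightarrow> (\<forall>i<k. f ((left_shift ^^ i) x) = v ! i)"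
      using v by (auto simp: names_eq_iff words_def)
    also have "\<dots> \<longleftrightarrow> (\<forall>i<k. x i = v ! i)"
    proof -
      have "f ((left_shift ^^ i) x) = v ! i \<longleftrightarrow> x i = v ! i" if "i < k" for i
        using v0[OF that] by (auto simp: f_def funpow_left_shift)
      then show ?thesis by auto
    qed
    finally show "x \<in> names f k -` {v} \<inter> space \<nu> \<longleftrightarrow> x \<in> cyl v"
      using v by (auto simp: cylinder_def sp words_def)
  qed
  have PQ: "level_prob (names f k) v = Q v" if "v \<in> words letters k" for k v
    unfolding level_prob_def name[OF that] Q ..
  have simple_entropy_ge: "real m * H \<le> simple_entropy (names f (n * m + n))" for m
  proof -
    let ?W = "words letters (n * m + n)" and ?u = "names f (n * m + n)"
    have nonneg: "0 \<le> - (level_prob ?u v * ln (level_prob ?u v))" for v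
    proof (cases "level_prob ?u v = 0")
      case False
      then have "0 < level_prob ?u v" "level_prob ?u v \<le> 1" using level_prob_nonneg[of ?u v] prob_le_1 by (linarith, simp add: level_prob_def)
      then show ?thesis by (simp add: mult_nonneg_nonpos)
    qed simp
    have "real m * H \<le> (\<Sum>v\<in>?W. - (level_prob ?u v * ln (level_prob ?u v)))"
      using entropy_Q[of m] by (simp add: PQ)
    also have "\<dots> = (\<Sum>v\<in>?W \<inter> ?u ` space \<nu>. - (level_prob ?u v * ln (level_prob ?u v)))"
      using finite_words[OF letters(1)] by (intro sum.mono_neutral_right) (auto simp: level_prob_outside)
    also have "\<dots> \<le> simple_entropy ?u"
      unfolding simple_entropy_def using simple_names[OF f] nonneg by (intro sum_mono2) (auto simp: simple_function_def)
    finally show ?thesis .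
  qed
  obtain l where l: "(\<lambda>k. simple_entropy (names f k) / real k) \<longlonglongrightarrow> l" using entropy_rate[OF f] by metis
  have "(\<lambda>m. simple_entropy (names f (n * m + n)) / real (n * m + n)) \<longlonglongrightarrow> l"
  proof -
    have "strict_mono (\<lambda>m. n * m + n)" using n by (intro strict_monoI) simp
    from LIMSEQ_subseq_LIMSEQ[OF l this] show ?thesis by (simp add: comp_def)
  qed
  \<comment> \<open>A window of length \<open>n * (m + 1)\<close> is only credited with m whole
    blocks; the lost block disappears in the limit.\<close>
  moreover have "(\<lambda>m. (H / real n) * (real m / real (Suc m))) \<longlonglongrightarrow> (H / real n) * 1"
    by (intro tendsto_intros LIMSEQ_n_over_Suc_n)
  moreover have "(H / real n) * (real m / real (Suc m)) \<le> simple_entropy (names f (n * m + n)) / real (n * m + n)" for m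
  proof -
    have "(H / real n) * (real m / real (Suc m)) = real m * H / real (n * m + n)"
      using n by (simp add: field_simps)
    also have "\<dots> \<le> simple_entropy (names f (n * m + n)) / real (n * m + n)"
      by (intro divide_right_mono simple_entropy_ge) simp
    finally show ?thesis .
  qed
  ultimately have "H / real n \<le> l"
    by (intro LIMSEQ_le[of "\<lambda>m. (H / real n) * (real m / real (Suc m))" _ "\<lambda>m. simple_entropy (names f (n * m + n)) / real (n * m + n)"]) auto
  moreover have "ereal l \<le> ks_entropy \<nu> left_shift" by (rule ks_entropy_ge[OF f l])
  ultimately show ?thesis using order_trans ereal_less_eq(3) by blast
qed

end

section \<open>The upper bound\<close>

context acceptable_potential
begin

text \<open>\<phi> is replaced from below by its infimum \<rho> over cylinders. These infima grow
  when the word is extended, so the rest of the current block alone already bounds the integral from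
  below, with the loss known from \<open>distortion\<close>.\<close>

lemma stationary_integral:
  assumes bp: "block_process n A p" and nu: "\<nu> \<in> invariant_measures"
    and Q: "\<And>v. measure \<nu> (cyl v) = block_process.Q n A p v"
    and e: "0 < e"
    and K: "\<And>x y. x \<in> Xfull \<Longrightarrow> y \<in> Xfull \<Longrightarrow> (\<And>k. k < K \<Longrightarrow> x k = y k) \<Longrightarrow> \<bar>\<phi> x - \<phi> y\<bar> < e"
  shows "integrable \<nu> \<phi>"
    and "(\<Sum>w\<in>A. p w * S n (per w)) - (osc * real K + e * real n) \<le> real n * (\<integral>x. \<phi> x \<partial>\<nu>)"
proof -
  interpret block_process n A p by (rule bp)
  note nu' = invariant_measuresD(1)[OF nu]
  interpret prob_space \<nu> by (rule prob_measuresD[OF nu'])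
  have sp: "space \<nu> = Xfull" and sets: "sets \<nu> = sets BX" by (rule prob_measuresD[OF nu'])+
  have [measurable]: "cyl w \<in> sets \<nu>" for w by (rule prob_measuresD[OF nu'])
  have [measurable]: "\<phi> \<in> borel_measurable \<nu>"
    using continuous_on_measurable_BX[OF continuous_potential] sets by (simp cong: measurable_cong_sets)
  have int_cyl [simp, intro]: "integrable \<nu> (indicat_real (cyl w))" for w
    by (rule integrable_real_indicator) (auto simp: emeasure_eq_measure)
  let ?W = "words letters n"
  have finW: "finite ?W" by (rule finite_words[OF letters(1)])
  have lenW: "length v = n" if "v \<in> ?W" for v using that by (simp add: words_def)
  have W1: "v \<in> words {1..} n" if "v \<in> ?W" for v using that letters(2) by (auto simp: words_def)
  have "prob (\<Union>v\<in>?W. cyl v) = 1"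
    using measure_Union_cyl[OF nu' finW lenW] by (simp add: Q sum_Q)
  then have "AE x in \<nu>. x \<in> (\<Union>v\<in>?W. cyl v)" using finW by (intro AE_prob_1) auto
  then have ae: "AE x in \<nu>. map x [0..<n] \<in> ?W \<and> x \<in> Xfull"
  proof (rule AE_mp, intro AE_I2 impI)
    fix x assume "x \<in> (\<Union>v\<in>?W. cyl v)"
    then obtain v where v: "v \<in> ?W" "x \<in> cyl v" by blast
    then have "x \<in> Xfull" using cyl_subset by blast
    with v show "map x [0..<n] \<in> ?W \<and> x \<in> Xfull" using cyl_eq_prefix[of x v] lenW[OF v(1)] by simp
  qed
  \<comment> \<open>A local name: an almost sure bound for the absolute value of \<phi>, different
    from the sum of the weights.\<close>
  define total_weight where "total_weight = (\<Sum>a\<in>letters. \<bar>\<phi> (\<lambda>_. a)\<bar>) + osc"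
  have "AE x in \<nu>. norm (\<phi> x) \<le> total_weight"
    using ae
  proof eventually_elim
    case (elim x)
    have x0: "x 0 \<in> letters" using elim n by (auto simp: words_def subset_iff)
    then have "(\<lambda>_. x 0) \<in> Xfull" using letters(2) by (auto simp: full_shift_def)
    then have "\<bar>\<phi> x - \<phi> (\<lambda>_. x 0)\<bar> \<le> osc" using elim by (intro osc) auto
    moreover have "\<bar>\<phi> (\<lambda>_. x 0)\<bar> \<le> (\<Sum>a\<in>letters. \<bar>\<phi> (\<lambda>_. a)\<bar>)"
      using x0 letters(1) by (intro member_le_sum) auto
    ultimately show ?case by (simp add: total_weight_def)
  qed
  then show int: "integrable \<nu> \<phi>" by (intro integrable_const_bound) auto
  define \<rho> where "\<rho> s = (INF x\<in>cyl s. \<phi> x)" for s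
  have ne: "per s \<in> cyl s" if "s \<noteq> []" "set s \<subseteq> {1..}" for s
    using that by (intro per_cyl[of s "length s"]) (auto simp: words_def Suc_le_eq One_nat_def)
  have rho_le: "\<rho> s \<le> \<phi> x" if s: "s \<noteq> []" and x: "x \<in> cyl s" for s x
    unfolding \<rho>_def
  proof (rule cINF_lower[OF _ x])
    show "bdd_below (\<phi> ` cyl s)"
    proof (rule bdd_belowI2)
      fix y assume y: "y \<in> cyl s"
      have "\<bar>\<phi> y - \<phi> x\<bar> \<le> osc"
        using x y s cyl_subset by (intro osc) (auto simp: cylinder_def)
      then show "\<phi> x - osc \<le> \<phi> y" by linarith
    qed
  qed
  have le_rho: "c \<le> \<rho> s" if "s \<noteq> []" "set s \<subseteq> {1..}" "\<And>x. x \<in> cyl s \<Longrightarrow> c \<le> \<phi> x" for c s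
    unfolding \<rho>_def using ne[OF that(1,2)] that(3) by (intro cINF_greatest) auto
  have "(\<Sum>v\<in>?W. \<rho> v * Q v) = (\<integral>x. (\<Sum>v\<in>?W. \<rho> v * indicator (cyl v) x) \<partial>\<nu>)"
    by (subst Bochner_Integration.integral_sum)
       (auto simp: sp cyl_subset Int_absorb2 Q[symmetric])
  also have "\<dots> \<le> (\<integral>x. \<phi> x \<partial>\<nu>)"
  proof (rule integral_mono_AE)
    show "integrable \<nu> (\<lambda>x. \<Sum>v\<in>?W. \<rho> v * indicator (cyl v) x)"
      by (intro Bochner_Integration.integrable_sum integrable_mult_right) auto
    show "AE x in \<nu>. (\<Sum>v\<in>?W. \<rho> v * indicator (cyl v) x) \<le> \<phi> x"
      using ae
    proof eventually_elim
      case (elim x)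
      have "x \<in> cyl (map x [0..<n])" using elim by (auto simp: cylinder_def)
      then have "\<rho> (map x [0..<n]) \<le> \<phi> x" using n by (intro rho_le) auto
      then show ?case using sum_indicator_cyl[OF finW lenW, of x \<rho>] elim by simp
    qed
  qed (rule int)
  finally have le1: "(\<Sum>v\<in>?W. \<rho> v * Q v) \<le> (\<integral>x. \<phi> x \<partial>\<nu>)" .
  \<comment> \<open>Loss at position j, where \<open>n - j\<close> letters of the block remain:
    uniform continuity applies if these are at least \<open>K\<close>, otherwise only the bound
    \<open>osc\<close>.\<close>
  define d where "d j = e + osc * of_bool (n < j + K)" for j
  have "(\<Sum>w\<in>A. p w * S n (per w)) - (osc * real K + e * real n) \<le> (\<Sum>w\<in>A. p w * (S n (per w) - (osc * real K + e * real n)))"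
    using p(2) by (simp add: right_diff_distrib sum_subtractf flip: sum_distrib_right)
  also have "\<dots> \<le> (\<Sum>w\<in>A. p w * (\<Sum>j<n. \<rho> (drop j w)))"
  proof (intro sum_mono mult_left_mono)
    fix w assume w: "w \<in> A"
    have ww: "w \<in> words {1..} n" using w A(2) by blast
    have "\<phi> ((left_shift ^^ j) (per w)) - d j \<le> \<rho> (drop j w)" if j: "j < n" for j
    proof (rule le_rho)
      show "drop j w \<noteq> []" using drop_ne[OF w j] by simp
      show "set (drop j w) \<subseteq> {1..}" using drop_ne[OF w j] letters(2) by blast
      fix x assume x: "x \<in> cyl (drop j w)"
      have xX: "x \<in> Xfull" using x cyl_subset by blast
      have px: "(left_shift ^^ j) (per w) \<in> Xfull" by (intro left_shift_Xfull per_Xfull[OF ww n])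
      have agree: "(left_shift ^^ j) (per w) k = x k" if "k < n - j" for k
        using x that lenA[OF w] by (auto simp: cylinder_def funpow_left_shift per_def)
      have "\<bar>\<phi> ((left_shift ^^ j) (per w)) - \<phi> x\<bar> \<le> d j"
      proof (cases "n < j + K")
        case True
        have "\<bar>\<phi> ((left_shift ^^ j) (per w)) - \<phi> x\<bar> \<le> osc" using agree j by (intro osc px xX) auto
        then show ?thesis using True e by (simp add: d_def)
      next
        case False
        have "\<bar>\<phi> ((left_shift ^^ j) (per w)) - \<phi> x\<bar> < e" using agree False by (intro K px xX) auto
        then show ?thesis using False by (simp add: d_def)
      qed
      then show "\<phi> ((left_shift ^^ j) (per w)) - d j \<le> \<phi> x" by linarith
    qed
    then have "(\<Sum>j<n. \<phi> ((left_shift ^^ j) (per w)) - d j) \<le> (\<Sum>j<n. \<rho> (drop j w))"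
      by (intro sum_mono) auto
    moreover have "(\<Sum>j<n. d j) \<le> osc * real K + e * real n"
    proof -
      have "(\<Sum>j<n. d j) = e * real n + osc * real (card {k. k < n \<and> n < k + K})"
        by (simp add: d_def sum.distrib sum_distrib_left[symmetric] sum_of_bool_eq Int_def)
      moreover have "card {k. k < n \<and> n < k + K} \<le> K"
      proof -
        have "card {k. k < n \<and> n < k + K} \<le> card {n - K..<n}" by (intro card_mono) auto
        then show ?thesis by simp
      qed
      then have "osc * real (card {k. k < n \<and> n < k + K}) \<le> osc * real K"
        using osc(1) by (intro mult_left_mono) auto
      ultimately show ?thesis by simp
    qed
    ultimately show "S n (per w) - (osc * real K + e * real n) \<le> (\<Sum>j<n. \<rho> (drop j w))"
      by (simp add: birkhoff_sum_def sum_subtractf)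
    show "0 \<le> p w" using p(1)[OF w] by simp
  qed
  also have "\<dots> = (\<Sum>j<n. \<Sum>w\<in>A. p w * \<rho> (drop j w))"
    unfolding sum_distrib_left by (rule sum.swap)
  also have "\<dots> = (\<Sum>j<n. \<Sum>v\<in>?W. E j v * \<rho> (take (n - j) v))"
    by (intro sum.cong refl E_sum_take[symmetric]) auto
  also have "\<dots> \<le> (\<Sum>j<n. \<Sum>v\<in>?W. E j v * \<rho> v)"
  proof (intro sum_mono mult_left_mono E_range)
    fix j v assume j: "j \<in> {..<n}" and v: "v \<in> ?W"
    show "\<rho> (take (n - j) v) \<le> \<rho> v"
    proof (rule le_rho)
      show "v \<noteq> []" using lenW[OF v] n by auto
      show "set v \<subseteq> {1..}" using W1[OF v] by (simp add: words_def)
      fix x assume "x \<in> cyl v"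
      then have "x \<in> cyl (take (n - j) v)"
        using cyl_append[of "take (n - j) v" "drop (n - j) v"] by auto
      then show "\<rho> (take (n - j) v) \<le> \<phi> x"
        using j lenW[OF v] by (intro rho_le) auto
    qed
  qed
  also have "\<dots> = (\<Sum>v\<in>?W. (\<Sum>j<n. E j v) * \<rho> v)"
    unfolding sum_distrib_right by (rule sum.swap)
  also have "\<dots> = real n * (\<Sum>v\<in>?W. \<rho> v * Q v)"
    unfolding sum_distrib_left using n by (intro sum.cong) (auto simp: Q_def)
  also have "\<dots> \<le> real n * (\<integral>x. \<phi> x \<partial>\<nu>)" using le1 by (intro mult_left_mono) auto
  finally show "(\<Sum>w\<in>A. p w * S n (per w)) - (osc * real K + e * real n) \<le> real n * (\<integral>x. \<phi> x \<partial>\<nu>)" .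
qed

text \<open>With weights proportional to \<open>exp S\<close> the value of \<open>S - ln p\<close>
  is the same on all blocks, so entropy plus energy of the block distribution is exactly the
  logarithm of the sum. Cylinder masses of the process are averages of those of the empirical
  measures up to boundary effects of order \<open>length v / n\<close>, which the factor 2 in
  \<open>2 * d\<close> absorbs.\<close>

lemma upper_bound:
  assumes F: "finite F" and d: "0 < d" and e: "0 < e"
  obtains N0 where "1 \<le> N0"
    "\<And>n A. N0 \<le> n \<Longrightarrow> finite A \<Longrightarrow> A \<noteq> {} \<Longrightarrow> A \<subseteq> periodic_points n \<Longrightarrow>
      (\<And>x v. x \<in> A \<Longrightarrow> v \<in> F \<Longrightarrow> \<bar>measure (empirical_measure n x) (cyl v) - c v\<bar> < d) \<Longrightarrow>
      \<exists>\<nu>\<in>invariant_measures. integrable \<nu> \<phi> \<and> (\<forall>v\<in>F. \<bar>measure \<nu> (cyl v) - c v\<bar> < 2 * d) \<and>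
        ereal (ln (\<Sum>x\<in>A. exp (S n x)) / real n - e) \<le> ks_entropy \<nu> left_shift + ereal (\<integral>x. \<phi> x \<partial>\<nu>)"
proof -
  have e2: "0 < e / 2" using e by simp
  obtain K where K: "\<And>x y. x \<in> Xfull \<Longrightarrow> y \<in> Xfull \<Longrightarrow> (\<And>k. k < K \<Longrightarrow> x k = y k) \<Longrightarrow> \<bar>\<phi> x - \<phi> y\<bar> < e / 2"
    using acceptable_uniform[OF acceptable e2] by metis
  define lv where "lv = real (Max (insert 0 (length ` F)))"
  have lv: "real (length v) \<le> lv" if "v \<in> F" for v
    using that F by (auto simp: lv_def)
  obtain k1 where k1: "\<And>n. k1 \<le> n \<Longrightarrow> osc * real K \<le> e / 2 * real n" using exists_nat_ge[OF e2] by metis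
  obtain k2 where k2: "\<And>n. k2 \<le> n \<Longrightarrow> 2 * lv + 1 \<le> d * real n" using exists_nat_ge[OF d] by metis
  show ?thesis
  proof (rule that[of "max 1 (max k1 k2)"])
    fix n A assume n: "max 1 (max k1 k2) \<le> n" and A: "finite A" "A \<noteq> {}" "A \<subseteq> periodic_points n"
      and near: "\<And>x v. x \<in> A \<Longrightarrow> v \<in> F \<Longrightarrow> \<bar>measure (empirical_measure n x) (cyl v) - c v\<bar> < d"
    have n1: "1 \<le> n" and nk: "k1 \<le> n" "k2 \<le> n" using n by auto
    define W where "W = {w \<in> words {1..} n. per w \<in> A}"
    have bij: "bij_betw per W A"
    proof -
      have inj: "inj_on per W"
        using bij_betw_per[OF n1] by (auto simp: bij_betw_def W_def inj_on_def)
      have "per ` W = A"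
      proof (intro equalityI subsetI)
        fix x assume x: "x \<in> A"
        then have "x \<in> per ` words {1..} n" using A(3) bij_betw_per[OF n1] by (auto simp: bij_betw_def)
        then show "x \<in> per ` W" using x by (auto simp: W_def)
      qed (auto simp: W_def)
      then show ?thesis using inj by (simp add: bij_betw_def)
    qed
    have W: "finite W" "W \<noteq> {}" "W \<subseteq> words {1..} n"
      using bij_betw_finite[OF bij] A bij by (auto simp: W_def bij_betw_def)
    define Zt where "Zt = (\<Sum>w\<in>W. exp (S n (per w)))"
    have Zt: "Zt = (\<Sum>x\<in>A. exp (S n x))"
      unfolding Zt_def by (rule sum.reindex_bij_betw[OF bij])
    have Zt0: "0 < Zt" unfolding Zt_def using W by (intro sum_pos) auto
    define p where "p w = exp (S n (per w)) / Zt" for w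
    have bp: "block_process n W p"
    proof
      show "sum p W = 1" using Zt0 by (simp add: p_def Zt_def flip: sum_divide_distrib)
    qed (use n1 W Zt0 in \<open>auto simp: p_def\<close>)
    interpret block_process n W p by (rule bp)
    obtain \<nu> where nu: "\<nu> \<in> invariant_measures" "\<And>v. measure \<nu> (cyl v) = Q v"
      using exists_stationary by metis
    have H: "H = ln Zt - (\<Sum>w\<in>W. p w * S n (per w))"
    proof -
      have "H = (\<Sum>w\<in>W. p w * ln Zt - p w * S n (per w))"
        unfolding H_def
      proof (rule sum.cong)
        fix w
        have "ln (p w) = S n (per w) - ln Zt" using Zt0 by (simp add: p_def ln_div)
        show "- (p w * ln (p w)) = p w * ln Zt - p w * S n (per w)"
          unfolding \<open>ln (p w) = S n (per w) - ln Zt\<close> by (simp add: algebra_simps)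
      qed simp
      also have "\<dots> = ln Zt - (\<Sum>w\<in>W. p w * S n (per w))"
        using p(2) by (simp add: sum_subtractf flip: sum_distrib_right)
      finally show ?thesis .
    qed
    have int: "integrable \<nu> \<phi>"
      and le: "(\<Sum>w\<in>W. p w * S n (per w)) - (osc * real K + e / 2 * real n) \<le> real n * (\<integral>x. \<phi> x \<partial>\<nu>)"
      by (rule stationary_integral[OF bp nu e2 K]; assumption)+
    show "\<exists>\<nu>\<in>invariant_measures. integrable \<nu> \<phi> \<and> (\<forall>v\<in>F. \<bar>measure \<nu> (cyl v) - c v\<bar> < 2 * d) \<and>
        ereal (ln (\<Sum>x\<in>A. exp (S n x)) / real n - e) \<le> ks_entropy \<nu> left_shift + ereal (\<integral>x. \<phi> x \<partial>\<nu>)"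
    proof (intro bexI conjI ballI)
      have "osc * real K \<le> e / 2 * real n" by (rule k1[OF nk(1)])
      then have "ln Zt - e * real n \<le> H + real n * (\<integral>x. \<phi> x \<partial>\<nu>)" using le H by simp
      then have "(ln Zt - e * real n) / real n \<le> (H + real n * (\<integral>x. \<phi> x \<partial>\<nu>)) / real n"
        by (intro divide_right_mono) auto
      then have "ln Zt / real n - e \<le> H / real n + (\<integral>x. \<phi> x \<partial>\<nu>)"
        using n1 by (simp add: diff_divide_distrib add_divide_distrib)
      then have "ereal (ln Zt / real n - e) \<le> ereal (H / real n) + ereal (\<integral>x. \<phi> x \<partial>\<nu>)" by simp
      also have "\<dots> \<le> ks_entropy \<nu> left_shift + ereal (\<integral>x. \<phi> x \<partial>\<nu>)"
        by (intro add_right_mono stationary_entropy nu)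
      finally show "ereal (ln (\<Sum>x\<in>A. exp (S n x)) / real n - e) \<le> ks_entropy \<nu> left_shift + ereal (\<integral>x. \<phi> x \<partial>\<nu>)"
        unfolding Zt .
    next
      fix v assume v: "v \<in> F"
      have "\<bar>(\<Sum>w\<in>W. p w * real (occurrences v w)) - real n * c v\<bar> = \<bar>\<Sum>w\<in>W. p w * (real (occurrences v w) - real n * c v)\<bar>"
        using p(2) by (simp add: right_diff_distrib sum_subtractf flip: sum_distrib_right)
      also have "\<dots> \<le> (\<Sum>w\<in>W. \<bar>p w * (real (occurrences v w) - real n * c v)\<bar>)" by (rule sum_abs)
      also have "\<dots> \<le> (\<Sum>w\<in>W. p w * (real (length v) + real n * d))"
      proof (rule sum_mono)
        fix w assume w: "w \<in> W"
        have ww: "w \<in> words {1..} n" "per w \<in> A" using w by (auto simp: W_def)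
        have m: "measure (empirical_measure n (per w)) (cyl v) = real (visits n v (per w)) / real n"
          by (rule measure_empirical_visits[OF n1 per_Xfull[OF ww(1) n1]])
        have "\<bar>real (visits n v (per w)) / real n - c v\<bar> < d" using near[OF ww(2) v] unfolding m .
        moreover have "real (visits n v (per w)) / real n - c v = (real (visits n v (per w)) - real n * c v) / real n"
          using n1 by (simp add: diff_divide_distrib)
        ultimately have "\<bar>real (visits n v (per w)) - real n * c v\<bar> < d * real n"
          using n1 by (simp add: abs_divide pos_divide_less_eq)
        moreover have "occurrences v w \<le> visits n v (per w)" "visits n v (per w) \<le> occurrences v w + length v"
          using occurrences_visits[OF per_cyl[OF ww(1) n1], of v] ww(1) by (auto simp: words_def)
        ultimately have "\<bar>real (occurrences v w) - real n * c v\<bar> \<le> real (length v) + real n * d"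
          by (simp add: abs_le_iff abs_less_iff algebra_simps)
        then show "\<bar>p w * (real (occurrences v w) - real n * c v)\<bar> \<le> p w * (real (length v) + real n * d)"
          using p(1)[OF w] by (simp add: abs_mult mult_left_mono)
      qed
      also have "\<dots> = real (length v) + real n * d" using p(2) by (simp flip: sum_distrib_right)
      finally have "\<bar>real n * Q v - real n * c v\<bar> \<le> 2 * real (length v) + real n * d"
        using Q_occurrences[of v] by simp
      moreover have "2 * real (length v) + 1 \<le> d * real n" using lv[OF v] k2[OF nk(2)] by simp
      moreover have "\<bar>real n * Q v - real n * c v\<bar> = real n * \<bar>Q v - c v\<bar>"
        by (simp add: abs_mult flip: right_diff_distrib)
      ultimately have "real n * \<bar>Q v - c v\<bar> < real n * (2 * d)"
        by (simp add: algebra_simps)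
      then show "\<bar>measure \<nu> (cyl v) - c v\<bar> < 2 * d" using nu(2) n1 by simp
    qed (use int nu in auto)
  qed simp
qed

lemma potential_bounded_above:
  obtains M where "\<And>x. x \<in> Xfull \<Longrightarrow> \<phi> x \<le> M"
proof (rule that[of "osc + ln (enn2real total_weight)"])
  fix x assume x: "x \<in> Xfull"
  have x0: "x 0 \<in> {1..}" using x by (simp add: full_shift_def)
  have "ennreal (weight (x 0)) = (\<integral>\<^sup>+ p. ennreal (weight p) * indicator {x 0} p \<partial>count_space {1..})"
    using x0 by (subst nn_integral_indicator_singleton) auto
  also have "\<dots> \<le> total_weight" unfolding total_weight_def by (intro nn_integral_mono) (auto simp: indicator_def)
  finally have "weight (x 0) \<le> enn2real total_weight"
    using total_weight_finite weight_pos[of "x 0"] by (metis enn2real_ennreal enn2real_mono infinity_ennreal_def less_imp_le)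
  then have "exp (\<phi> x) \<le> exp osc * enn2real total_weight"
    using potential_weight(1)[OF x] by (meson exp_ge_zero mult_left_mono order_trans)
  moreover have "0 < enn2real total_weight" using \<open>weight (x 0) \<le> enn2real total_weight\<close> weight_pos[of "x 0"] by linarith
  ultimately have "exp (\<phi> x) \<le> exp (osc + ln (enn2real total_weight))" by (simp add: exp_add)
  then show "\<phi> x \<le> osc + ln (enn2real total_weight)" by simp
qed

lemma ext_integral_integrable:
  assumes "integrable \<nu> \<phi>"
  shows "ext_integral \<nu> \<phi> = ereal (\<integral>x. \<phi> x \<partial>\<nu>)"
proof -
  have fin: "(\<integral>\<^sup>+ x. ennreal (\<phi> x) \<partial>\<nu>) \<noteq> \<infinity>" "(\<integral>\<^sup>+ x. ennreal (- \<phi> x) \<partial>\<nu>) \<noteq> \<infinity>"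
    using assms by (auto simp: real_integrable_def)
  then show ?thesis
    unfolding ext_integral_def real_lebesgue_integral_def[OF assms]
    by (cases "\<integral>\<^sup>+ x. ennreal (\<phi> x) \<partial>\<nu>" rule: ennreal_cases; cases "\<integral>\<^sup>+ x. ennreal (- \<phi> x) \<partial>\<nu>" rule: ennreal_cases)
       (auto simp: enn2ereal_ennreal)
qed

text \<open>\<phi> is bounded above, so its positive part has finite integral; an infinite negative
  part would then give exactly the excluded value.\<close>

lemma integrable_ext_integral:
  assumes nu: "\<nu> \<in> prob_measures Xfull" and ext: "- \<infinity> < ext_integral \<nu> \<phi>"
  shows "integrable \<nu> \<phi>"
proof -
  interpret prob_space \<nu> by (rule prob_measuresD[OF nu])
  have sp: "space \<nu> = Xfull" and sets: "sets \<nu> = sets BX" by (rule prob_measuresD[OF nu])+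
  have meas: "\<phi> \<in> borel_measurable \<nu>"
    using continuous_on_measurable_BX[OF continuous_potential] sets by (simp cong: measurable_cong_sets)
  obtain M where M: "\<And>x. x \<in> Xfull \<Longrightarrow> \<phi> x \<le> M" using potential_bounded_above by metis
  have "(\<integral>\<^sup>+ x. ennreal (\<phi> x) \<partial>\<nu>) \<le> (\<integral>\<^sup>+ x. ennreal M \<partial>\<nu>)"
    using M sp by (intro nn_integral_mono ennreal_leI) auto
  also have "\<dots> < \<infinity>" by (simp add: emeasure_space_1)
  finally have 1: "(\<integral>\<^sup>+ x. ennreal (\<phi> x) \<partial>\<nu>) < \<infinity>" .
  have "(\<integral>\<^sup>+ x. ennreal (- \<phi> x) \<partial>\<nu>) \<noteq> \<infinity>"
  proof
    assume "(\<integral>\<^sup>+ x. ennreal (- \<phi> x) \<partial>\<nu>) = \<infinity>"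
    then have "ext_integral \<nu> \<phi> = - \<infinity>"
      unfolding ext_integral_def using 1
      by (cases "\<integral>\<^sup>+ x. ennreal (\<phi> x) \<partial>\<nu>" rule: ennreal_cases) (auto simp: enn2ereal_ennreal)
    then show False using ext by simp
  qed
  then show ?thesis using 1 meas by (simp add: real_integrable_def)
qed

end

section \<open>The large deviation principle\<close>

lemma space_borel_on: "space (borel_on T) = topspace T"
  unfolding borel_on_def by (rule space_measure_of) (auto dest: openin_subset)

lemma openin_borel_on: "openin T U \<Longrightarrow> U \<in> sets (borel_on T)"
  unfolding borel_on_def using openin_subset by (subst sets_measure_of) auto

lemma closedin_borel_on: "closedin T C \<Longrightarrow> C \<in> sets (borel_on T)"
proof -
  assume C: "closedin T C"
  then have "topspace T - C \<in> sets (borel_on T)" by (intro openin_borel_on) (simp add: closedin_def)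
  then have "space (borel_on T) - (topspace T - C) \<in> sets (borel_on T)" by (rule sets.compl_sets)
  moreover have "space (borel_on T) - (topspace T - C) = C"
    using closedin_subset[OF C] by (auto simp: space_borel_on)
  ultimately show ?thesis by simp
qed

lemma elog_ennreal: "0 < r \<Longrightarrow> elog (ennreal r) = ereal (ln r)"
  by (simp add: elog_def)

lemma elog_mono: "s \<le> t \<Longrightarrow> elog s \<le> elog t"
  by (cases s rule: ennreal_cases; cases t rule: ennreal_cases)
     (auto simp: elog_def top_unique order_less_le)

context acceptable_potential
begin

abbreviation T :: "(nat \<Rightarrow> nat) measure topology" where "T \<equiv> weak_star Xfull"

abbreviation \<mu> :: "nat \<Rightarrow> (nat \<Rightarrow> nat) measure measure" where "\<mu> \<equiv> periodic_distribution \<phi>"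

definition P_real :: real where "P_real = real_of_ereal (pressure {1..} \<phi>)"

lemma P_real: "pressure {1..} \<phi> = ereal P_real" "(\<lambda>n. ln (z n) / real n) \<longlonglongrightarrow> P_real"
proof -
  obtain P where "pressure {1..} \<phi> = ereal P" "(\<lambda>n. ln (z n) / real n) \<longlonglongrightarrow> P"
    using pressure_limit by metis
  then show "pressure {1..} \<phi> = ereal P_real" "(\<lambda>n. ln (z n) / real n) \<longlonglongrightarrow> P_real"
    by (simp_all add: P_real_def)
qed

lemma emeasure_periodic:
  assumes n: "1 \<le> n" and U: "U \<in> sets (borel_on T)"
  shows "emeasure (\<mu> n) U = Zs n U / Z n"
proof -
  have "emeasure (\<mu> n) U = (\<integral>\<^sup>+ x. ennreal (exp (S n x)) / Z n * indicator U (empirical_measure n x) \<partial>count_space (periodic_points n))"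
    unfolding periodic_distribution_def
    using empirical_measure_in[OF n] periodic_pointsD(1) U
    by (intro emeasure_atomic_measure) (auto simp: space_borel_on topspace_weak_star)
  also have "\<dots> = (\<integral>\<^sup>+ x. (ennreal (exp (S n x)) * indicator U (empirical_measure n x)) * inverse (Z n) \<partial>count_space (periodic_points n))"
    by (intro nn_integral_cong) (simp add: divide_ennreal_def mult_ac)
  also have "\<dots> = Zs n U / Z n"
    unfolding Zs_def divide_ennreal_def by (rule nn_integral_multc) simp
  finally show ?thesis .
qed

lemma Zs_topspace: "1 \<le> n \<Longrightarrow> Zs n (topspace T) = Z n"
  unfolding Zs_def partition_function_def
  using empirical_measure_in periodic_pointsD(1)
  by (intro nn_integral_cong) (auto simp: topspace_weak_star)

lemma Zs_mono: "1 \<le> n \<Longrightarrow> U \<inter> topspace T \<subseteq> V \<Longrightarrow> Zs n U \<le> Zs n V"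
  unfolding Zs_def
proof (intro nn_integral_mono mult_left_mono)
  fix x assume n: "1 \<le> n" and UV: "U \<inter> topspace T \<subseteq> V" and "x \<in> space (count_space (periodic_points n))"
  then have "empirical_measure n x \<in> topspace T"
    using empirical_measure_in[OF n] periodic_pointsD(1) by (auto simp: topspace_weak_star)
  then show "indicator U (empirical_measure n x) \<le> (indicator V (empirical_measure n x) :: ennreal)"
    using UV by (auto simp: indicator_def)
qed simp

lemma Zs_Un_le: "Zs n (U \<union> V) \<le> Zs n U + Zs n V"
proof -
  have "Zs n (U \<union> V) \<le> (\<integral>\<^sup>+ x. ennreal (exp (S n x)) * indicator U (empirical_measure n x) +
      ennreal (exp (S n x)) * indicator V (empirical_measure n x) \<partial>count_space (periodic_points n))"
    unfolding Zs_def by (intro nn_integral_mono) (auto simp: indicator_def)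
  also have "\<dots> = Zs n U + Zs n V" unfolding Zs_def by (rule nn_integral_add) auto
  finally show ?thesis .
qed

lemma Zs_UN_le: "finite I \<Longrightarrow> Zs n (\<Union>i\<in>I. U i) \<le> (\<Sum>i\<in>I. Zs n (U i))"
proof (induction I rule: finite_induct)
  case empty
  then show ?case by (simp add: Zs_def)
next
  case (insert i I)
  have "Zs n (\<Union>i\<in>insert i I. U i) \<le> Zs n (U i) + Zs n (\<Union>i\<in>I. U i)"
    using Zs_Un_le[of n "U i" "\<Union>i\<in>I. U i"] by simp
  also have "\<dots> \<le> Zs n (U i) + (\<Sum>i\<in>I. Zs n (U i))" using insert by (intro add_left_mono)
  finally show ?case using insert by simp
qed

lemma Zs_ge_sum:
  assumes A: "finite A" "A \<subseteq> periodic_points n" "\<And>x. x \<in> A \<Longrightarrow> empirical_measure n x \<in> U"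
  shows "ennreal (\<Sum>x\<in>A. exp (S n x)) \<le> Zs n U"
proof -
  have "ennreal (\<Sum>x\<in>A. exp (S n x)) = (\<Sum>x\<in>A. ennreal (exp (S n x)))" by (subst sum_ennreal) auto
  also have "\<dots> = (\<integral>\<^sup>+ x. ennreal (exp (S n x)) * indicator A x \<partial>count_space (periodic_points n))"
  proof (subst nn_integral_indicator_finite[OF A(1)])
    show "(\<Sum>x\<in>A. ennreal (exp (S n x))) = (\<Sum>x\<in>A. ennreal (exp (S n x)) * emeasure (count_space (periodic_points n)) {x})"
      using A(2) by (intro sum.cong) auto
  qed (use A(2) in auto)
  also have "\<dots> \<le> Zs n U"
    unfolding Zs_def using A(3) by (intro nn_integral_mono) (auto simp: indicator_def)
  finally show ?thesis .
qed

text \<open>\<open>upper_bound\<close> speaks of finite sets. The periodic points with letters at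
  most m are finite in number and exhaust all of them, and monotone convergence passes to the full
  sum.\<close>

lemma Zs_le:
  assumes n: "1 \<le> n"
    and le: "\<And>A. finite A \<Longrightarrow> A \<subseteq> periodic_points n \<Longrightarrow> (\<And>x. x \<in> A \<Longrightarrow> empirical_measure n x \<in> U) \<Longrightarrow>
      (\<Sum>x\<in>A. exp (S n x)) \<le> c"
  shows "Zs n U \<le> ennreal c"
proof -
  define f where "f x = ennreal (exp (S n x)) * indicator U (empirical_measure n x)" for x
  define D where "D m = per ` truncated_words n m" for m
  have D: "finite (D m)" "D m \<subseteq> periodic_points n" for m
  proof -
    have "truncated_words n m \<subseteq> words {1..} n" by (auto simp: truncated_words_def words_def)
    then show "finite (D m)" "D m \<subseteq> periodic_points n"
      using finite_truncated_words per_periodic[OF _ n] by (auto simp: D_def)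
  qed
  have "(\<integral>\<^sup>+ x. f x \<partial>count_space (periodic_points n)) = (\<integral>\<^sup>+ x. (SUP m. f x * indicator (D m) x) \<partial>count_space (periodic_points n))"
  proof (rule nn_integral_cong)
    fix x assume "x \<in> space (count_space (periodic_points n))"
    then have x: "x \<in> periodic_points n" by simp
    then obtain w where w: "w \<in> words {1..} n" "x = per w" using bij_betw_per[OF n] by (auto simp: bij_betw_def)
    have "w \<in> truncated_words n (Max (insert 0 (set w)))"
      using w(1) by (auto simp: truncated_words_def words_def)
    then have "x \<in> D (Max (insert 0 (set w)))" using w(2) by (simp add: D_def)
    then have "f x \<le> (SUP m. f x * indicator (D m) x)"
      by (intro SUP_upper2[of "Max (insert 0 (set w))"]) auto
    moreover have "(SUP m. f x * indicator (D m) x) \<le> f x" by (intro SUP_least) (auto simp: indicator_def)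
    ultimately show "f x = (SUP m. f x * indicator (D m) x)" by (rule antisym)
  qed
  also have "\<dots> = (SUP m. \<integral>\<^sup>+ x. f x * indicator (D m) x \<partial>count_space (periodic_points n))"
  proof (rule nn_integral_monotone_convergence_SUP)
    show "incseq (\<lambda>m x. f x * indicator (D m) x)"
    proof (intro monoI le_funI mult_left_mono)
      fix m m' :: nat and x assume "m \<le> m'"
      then have "D m \<subseteq> D m'" unfolding D_def by (intro image_mono) (auto simp: truncated_words_def)
      then show "indicator (D m) x \<le> (indicator (D m') x :: ennreal)" by (auto simp: indicator_def)
    qed simp
  qed simp
  also have "\<dots> \<le> ennreal c"
  proof (rule SUP_least)
    fix m
    define A where "A = {x \<in> D m. empirical_measure n x \<in> U}"
    have A: "finite A" "A \<subseteq> periodic_points n" using D by (auto simp: A_def)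
    have "(\<integral>\<^sup>+ x. f x * indicator (D m) x \<partial>count_space (periodic_points n)) =
        (\<integral>\<^sup>+ x. ennreal (exp (S n x)) * indicator A x \<partial>count_space (periodic_points n))"
      by (intro nn_integral_cong) (auto simp: f_def A_def indicator_def)
    also have "\<dots> = (\<Sum>x\<in>A. ennreal (exp (S n x)))"
    proof (subst nn_integral_indicator_finite[OF A(1)])
      show "(\<Sum>x\<in>A. ennreal (exp (S n x)) * emeasure (count_space (periodic_points n)) {x}) = (\<Sum>x\<in>A. ennreal (exp (S n x)))"
        using A(2) by (intro sum.cong) auto
    qed (use A(2) in auto)
    also have "\<dots> = ennreal (\<Sum>x\<in>A. exp (S n x))" by (subst sum_ennreal) auto
    also have "\<dots> \<le> ennreal c" using A by (intro ennreal_leI le) (auto simp: A_def)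
    finally show "(\<integral>\<^sup>+ x. f x * indicator (D m) x \<partial>count_space (periodic_points n)) \<le> ennreal c" .
  qed
  finally show ?thesis by (simp add: Zs_def f_def)
qed

lemma growth_rate_limit: "(\<lambda>n. ereal (k - ln (z n) / real n)) \<longlonglongrightarrow> ereal (k - P_real)"
  using tendsto_diff[OF tendsto_const P_real(2), of k] by simp

lemma elog_quotient:
  assumes n: "1 \<le> n"
  shows "elog (ennreal (exp (real n * k)) / Z n) / ereal (real n) = ereal (k - ln (z n) / real n)"
proof -
  have "ennreal (exp (real n * k)) / Z n = ennreal (exp (real n * k) / z n)"
    unfolding Z_z[OF n] using z_pos[OF n] by (subst divide_ennreal) auto
  then have "elog (ennreal (exp (real n * k)) / Z n) = ereal (real n * k - ln (z n))"
    using z_pos[OF n] by (simp add: elog_ennreal ln_div)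
  then show ?thesis using n by (simp add: diff_divide_distrib)
qed

text \<open>Since \<open>ln (z n) / n\<close> tends to the pressure, division by \<open>Z n\<close>
  turns a growth rate k of \<open>Zs\<close> into the rate \<open>k - P_real\<close>.\<close>

lemma growth_upper:
  assumes U: "U \<in> sets (borel_on T)" and le: "\<forall>\<^sub>F n in sequentially. Zs n U \<le> ennreal (exp (real n * k))"
  shows "limsup (\<lambda>n. elog (emeasure (\<mu> n) U) / ereal (real n)) \<le> ereal (k - P_real)"
proof -
  have "limsup (\<lambda>n. elog (emeasure (\<mu> n) U) / ereal (real n)) \<le> limsup (\<lambda>n. ereal (k - ln (z n) / real n))"
  proof (rule Limsup_mono)
    show "\<forall>\<^sub>F n in sequentially. elog (emeasure (\<mu> n) U) / ereal (real n) \<le> ereal (k - ln (z n) / real n)"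
      using le eventually_ge_at_top[of 1]
    proof eventually_elim
      case (elim n)
      have "elog (emeasure (\<mu> n) U) \<le> elog (ennreal (exp (real n * k)) / Z n)"
        unfolding emeasure_periodic[OF elim(2) U] using elim(1)
        by (intro elog_mono divide_right_mono_ennreal)
      then have "elog (emeasure (\<mu> n) U) / ereal (real n) \<le> elog (ennreal (exp (real n * k)) / Z n) / ereal (real n)"
        using elim(2) by (intro ereal_divide_right_mono) auto
      then show ?case by (simp add: elog_quotient[OF elim(2)])
    qed
  qed
  also have "\<dots> = ereal (k - P_real)" by (rule lim_imp_Limsup[OF _ growth_rate_limit]) simp
  finally show ?thesis .
qed

lemma growth_lower:
  assumes U: "U \<in> sets (borel_on T)" and le: "\<forall>\<^sub>F n in sequentially. ennreal (exp (real n * k)) \<le> Zs n U"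
  shows "ereal (k - P_real) \<le> liminf (\<lambda>n. elog (emeasure (\<mu> n) U) / ereal (real n))"
proof -
  have "ereal (k - P_real) = liminf (\<lambda>n. ereal (k - ln (z n) / real n))"
    by (rule lim_imp_Liminf[OF _ growth_rate_limit, symmetric]) simp
  also have "\<dots> \<le> liminf (\<lambda>n. elog (emeasure (\<mu> n) U) / ereal (real n))"
  proof (rule Liminf_mono)
    show "\<forall>\<^sub>F n in sequentially. ereal (k - ln (z n) / real n) \<le> elog (emeasure (\<mu> n) U) / ereal (real n)"
      using le eventually_ge_at_top[of 1]
    proof eventually_elim
      case (elim n)
      have "elog (ennreal (exp (real n * k)) / Z n) \<le> elog (emeasure (\<mu> n) U)"
        unfolding emeasure_periodic[OF elim(2) U] using elim(1)
        by (intro elog_mono divide_right_mono_ennreal)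
      then have "elog (ennreal (exp (real n * k)) / Z n) / ereal (real n) \<le> elog (emeasure (\<mu> n) U) / ereal (real n)"
        using elim(2) by (intro ereal_divide_right_mono) auto
      then show ?case by (simp add: elog_quotient[OF elim(2)])
    qed
  qed
  finally show ?thesis .
qed

lemma periodic_borel_prob: "1 \<le> n \<Longrightarrow> borel_prob_on T (\<mu> n)"
proof -
  assume n: "1 \<le> n"
  have sets: "sets (\<mu> n) = sets (borel_on T)"
    by (simp add: periodic_distribution_def atomic_measure_def)
  have sp: "space (\<mu> n) = topspace T" using sets_eq_imp_space_eq[OF sets] by (simp add: space_borel_on)
  have "emeasure (\<mu> n) (space (\<mu> n)) = Z n / Z n"
    unfolding sp by (simp add: emeasure_periodic[OF n openin_borel_on] Zs_topspace[OF n])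
  also have "\<dots> = 1" unfolding Z_z[OF n] using z_pos[OF n] by (subst divide_ennreal) auto
  finally show ?thesis by (simp add: borel_prob_on_def sets prob_spaceI)
qed

lemma exponential_tightness_limsup:
  obtains K where "compactin T K" "closedin T K"
    "limsup (\<lambda>n. elog (emeasure (\<mu> n) (topspace T - K)) / ereal (real n)) \<le> ereal (- L)"
proof -
  obtain K where K: "compactin T K" "closedin T K"
    "\<And>n. 1 \<le> n \<Longrightarrow> Zs n (topspace T - K) \<le> ennreal (exp (- (L - P_real) * real n))"
    using exponential_tightness[of "L - P_real"] by metis
  have "limsup (\<lambda>n. elog (emeasure (\<mu> n) (topspace T - K)) / ereal (real n)) \<le> ereal (- (L - P_real) - P_real)"
  proof (rule growth_upper)
    show "topspace T - K \<in> sets (borel_on T)" using K(2) by (intro openin_borel_on) (simp add: closedin_def)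
    show "\<forall>\<^sub>F n in sequentially. Zs n (topspace T - K) \<le> ennreal (exp (real n * - (L - P_real)))"
      using eventually_ge_at_top[of 1] by eventually_elim (use K(3) in \<open>simp add: mult.commute\<close>)
  qed
  then show ?thesis using K by (intro that[of K]) auto
qed

text \<open>Each finite partition is treated separately and the supremum over partitions is taken
  last, which also covers infinite entropy.\<close>

lemma free_energy_le_liminf:
  assumes G: "openin T G" and nu: "\<nu> \<in> G"
  shows "free_energy \<phi> \<nu> \<le> liminf (\<lambda>n. elog (emeasure (\<mu> n) G) / ereal (real n))" (is "_ \<le> ?L")
proof (cases "\<nu> \<in> invariant_measures \<and> ext_integral \<nu> \<phi> > - \<infinity>")
  case True
  then have inv: "\<nu> \<in> invariant_measures" and nu': "\<nu> \<in> prob_measures Xfull"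
    using invariant_measuresD(1) by auto
  have int: "integrable \<nu> \<phi>" using integrable_ext_integral[OF nu'] True by blast
  define I where "I = (\<integral>x. \<phi> x \<partial>\<nu>)"
  have "ks_entropy \<nu> left_shift \<le> ?L - ereal (I - P_real)"
    unfolding ks_entropy_def
  proof (rule SUP_least)
    fix \<C> assume C: "\<C> \<in> finite_partitions \<nu>"
    have "convergent (\<lambda>n. partition_entropy \<nu> (iterated_join \<nu> left_shift \<C> n) / real n)"
      by (rule entropy_prefix_label[OF inv C zero_less_one])
    then obtain l where r: "(\<lambda>n. partition_entropy \<nu> (iterated_join \<nu> left_shift \<C> n) / real n) \<longlonglongrightarrow> l"
      unfolding convergent_def by (elim exE)
    have "ereal (l + (I - P_real)) \<le> ?L"
    proof (rule ereal_le_epsilon2)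
      fix e :: real assume e: "0 < e"
      obtain F d where F: "finite F" "0 < d"
        "\<And>\<nu>'. \<nu>' \<in> prob_measures Xfull \<Longrightarrow> (\<And>w. w \<in> F \<Longrightarrow> \<bar>measure \<nu>' (cyl w) - measure \<nu> (cyl w)\<bar> < d) \<Longrightarrow> \<nu>' \<in> G"
        using weak_star_nhd[OF G nu] by metis
      \<comment> \<open>One number for two purposes: it bounds the loss in the exponent by e and
        keeps the empirical measures in the neighbourhood of radius \<open>d\<close>.\<close>
      define e' where "e' = min e (d / 2)"
      have e': "0 < e'" "e' \<le> e" "e' < d" using e F(2) by (auto simp: e'_def)
      obtain M0 where M0: "1 \<le> M0" "\<And>M. M0 \<le> M \<Longrightarrow> \<exists>A. finite A \<and> A \<subseteq> periodic_points M \<and>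
        (\<forall>x\<in>A. \<forall>v\<in>F. \<bar>measure (empirical_measure M x) (cyl v) - measure \<nu> (cyl v)\<bar> \<le> e') \<and>
        exp (real M * (l + (\<integral>x. \<phi> x \<partial>\<nu>) - e')) \<le> (\<Sum>x\<in>A. exp (S M x))"
      proof (rule lower_bound[OF inv int C r F(1) e'(1)], goal_cases)
        case (1 M0)
        show ?case by (rule 1(1)[OF 1(2)]) (rule 1(3))
      qed
      have "ereal ((l + I - e') - P_real) \<le> ?L"
      proof (rule growth_lower[OF openin_borel_on[OF G]])
        show "\<forall>\<^sub>F n in sequentially. ennreal (exp (real n * (l + I - e'))) \<le> Zs n G"
          using eventually_ge_at_top[of M0]
        proof eventually_elim
          case (elim n)
          then have n: "1 \<le> n" using M0(1) by simp
          obtain A where A: "finite A" "A \<subseteq> periodic_points n"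
            "\<forall>x\<in>A. \<forall>v\<in>F. \<bar>measure (empirical_measure n x) (cyl v) - measure \<nu> (cyl v)\<bar> \<le> e'"
            "exp (real n * (l + I - e')) \<le> (\<Sum>x\<in>A. exp (S n x))"
            using M0(2)[OF elim] unfolding I_def by blast
          have "empirical_measure n x \<in> G" if x: "x \<in> A" for x
          proof (rule F(3))
            show "empirical_measure n x \<in> prob_measures Xfull"
              using empirical_measure_in[OF n] periodic_pointsD(1) A(2) x by blast
            show "\<bar>measure (empirical_measure n x) (cyl w) - measure \<nu> (cyl w)\<bar> < d" if "w \<in> F" for w
              using A(3) x that e'(3) by (meson le_less_trans)
          qed
          then have "ennreal (\<Sum>x\<in>A. exp (S n x)) \<le> Zs n G" by (rule Zs_ge_sum[OF A(1,2)])
          then show ?case using ennreal_leI[OF A(4)] order_trans by blast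
        qed
      qed
      moreover have "ereal (l + (I - P_real)) \<le> ereal ((l + I - e') - P_real) + ereal e" using e'(2) by simp
      ultimately show "ereal (l + (I - P_real)) \<le> ?L + ereal e" by (meson add_right_mono order_trans)
    qed
    then show "ereal (lim (\<lambda>n. partition_entropy \<nu> (iterated_join \<nu> left_shift \<C> n) / real n)) \<le> ?L - ereal (I - P_real)"
      unfolding limI[OF r] by (cases ?L) auto
  qed
  then have "ks_entropy \<nu> left_shift + ereal I - ereal P_real \<le> ?L"
    by (cases ?L; cases "ks_entropy \<nu> left_shift") auto
  then show ?thesis using True by (simp add: free_energy_def ext_integral_integrable[OF int] I_def P_real(1))
next
  case False
  then have "free_energy \<phi> \<nu> = - \<infinity>" unfolding free_energy_def by (rule if_not_P)
  then show ?thesis by simp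
qed

lemma rate_function_le:
  assumes "openin T G" "\<nu> \<in> G"
  shows "- rate_function \<phi> \<nu> \<le> (SUP \<nu>\<in>G. free_energy \<phi> \<nu>)"
  using assms by (auto simp: rate_function_def intro!: INF_lower)

lemma rate_function_less:
  assumes "r < rate_function \<phi> \<nu>"
  obtains G where "openin T G" "\<nu> \<in> G" "(SUP \<nu>\<in>G. free_energy \<phi> \<nu>) < - r"
proof -
  have "(INF G\<in>{G. openin T G \<and> \<nu> \<in> G}. SUP \<nu>\<in>G. free_energy \<phi> \<nu>) < - r"
    using assms by (simp add: rate_function_def ereal_less_uminus_reorder)
  then show ?thesis using that by (auto simp: INF_less_iff)
qed

lemma ldp_lower:
  assumes G: "openin T G"
  shows "- (INF x\<in>G. rate_function \<phi> x) \<le> liminf (\<lambda>n. elog (emeasure (\<mu> n) G) / ereal (real n))" (is "_ \<le> ?L")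
proof -
  have "(SUP \<nu>\<in>G. free_energy \<phi> \<nu>) \<le> ?L" by (rule SUP_least) (rule free_energy_le_liminf[OF G])
  then have "- rate_function \<phi> x \<le> ?L" if "x \<in> G" for x using rate_function_le[OF G that] by simp
  then have "- ?L \<le> rate_function \<phi> x" if "x \<in> G" for x using that by (simp add: ereal_uminus_le_reorder)
  then have "- ?L \<le> (INF x\<in>G. rate_function \<phi> x)" by (rule INF_greatest)
  then show ?thesis by (simp add: ereal_uminus_le_reorder)
qed

text \<open>The variational inequality as a by-product: the whole space is open and has mass 1, so
  the lower bound for it leaves no room for positive free energy.\<close>

lemma free_energy_nonpos: "\<nu> \<in> topspace T \<Longrightarrow> free_energy \<phi> \<nu> \<le> 0"
proof -
  assume nu: "\<nu> \<in> topspace T"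
  have "free_energy \<phi> \<nu> \<le> liminf (\<lambda>n. elog (emeasure (\<mu> n) (topspace T)) / ereal (real n))"
    using nu by (intro free_energy_le_liminf) auto
  also have "\<dots> = 0"
  proof (rule lim_imp_Liminf)
    show "(\<lambda>n. elog (emeasure (\<mu> n) (topspace T)) / ereal (real n)) \<longlonglongrightarrow> 0"
    proof (rule tendsto_eventually)
      show "\<forall>\<^sub>F n in sequentially. elog (emeasure (\<mu> n) (topspace T)) / ereal (real n) = 0"
        using eventually_ge_at_top[of 1]
      proof eventually_elim
        case (elim n)
        have "prob_space (\<mu> n)" "space (\<mu> n) = topspace T"
          using periodic_borel_prob[OF elim] sets_eq_imp_space_eq[of "\<mu> n" "borel_on T"]
          by (auto simp: borel_prob_on_def space_borel_on)
        then have "emeasure (\<mu> n) (topspace T) = 1" using prob_space.emeasure_space_1 by metis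
        then show ?case using elog_ennreal[of 1] by simp
      qed
    qed
  qed simp
  finally show ?thesis .
qed

lemma rate_function_nonneg: "\<nu> \<in> topspace T \<Longrightarrow> 0 \<le> rate_function \<phi> \<nu>"
proof -
  assume nu: "\<nu> \<in> topspace T"
  have "- rate_function \<phi> \<nu> \<le> (SUP \<nu>\<in>topspace T. free_energy \<phi> \<nu>)" using nu by (intro rate_function_le) auto
  also have "\<dots> \<le> 0" by (intro SUP_least free_energy_nonpos)
  finally show ?thesis by (simp add: ereal_uminus_le_reorder)
qed

lemma rate_function_lsc: "closedin T {x \<in> topspace T. rate_function \<phi> x \<le> r}"
proof -
  have "openin T {x \<in> topspace T. r < rate_function \<phi> x}"
  proof (subst openin_subopen, intro ballI)
    fix x assume x: "x \<in> {x \<in> topspace T. r < rate_function \<phi> x}"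
    then obtain G where G: "openin T G" "x \<in> G" "(SUP \<nu>\<in>G. free_energy \<phi> \<nu>) < - r"
      using rate_function_less by blast
    have "r < rate_function \<phi> y" if "y \<in> G" for y
    proof -
      have "- rate_function \<phi> y < - r" using rate_function_le[OF G(1) that] G(3) by (rule le_less_trans)
      then show ?thesis by simp
    qed
    then show "\<exists>G. openin T G \<and> x \<in> G \<and> G \<subseteq> {x \<in> topspace T. r < rate_function \<phi> x}"
      using G openin_subset by blast
  qed
  moreover have "topspace T - {x \<in> topspace T. rate_function \<phi> x \<le> r} = {x \<in> topspace T. r < rate_function \<phi> x}"
    by (auto simp: not_le)
  ultimately show ?thesis by (auto simp: closedin_def)
qed

text \<open>By definition of the rate function there is a neighbourhood \<open>G\<close> of x on
  which the free energy stays below k. \<open>U\<close> has half its radius, so that the invariant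
  measure which \<open>upper_bound\<close> builds from points with empirical measure in
  \<open>U\<close> still lies in \<open>G\<close>.\<close>

lemma local_upper_bound:
  assumes x: "x \<in> topspace T" and k: "ereal (- k) < rate_function \<phi> x" and e: "0 < e"
  obtains U where "openin T U" "x \<in> U" "\<forall>\<^sub>F n in sequentially. Zs n U \<le> ennreal (exp (real n * (k + P_real + e)))"
proof -
  obtain G where G: "openin T G" "x \<in> G" "(SUP \<nu>\<in>G. free_energy \<phi> \<nu>) < - ereal (- k)"
    using rate_function_less[OF k] by metis
  obtain F d where F: "finite F" "0 < d"
    "\<And>\<nu>. \<nu> \<in> prob_measures Xfull \<Longrightarrow> (\<And>w. w \<in> F \<Longrightarrow> \<bar>measure \<nu> (cyl w) - measure x (cyl w)\<bar> < d) \<Longrightarrow> \<nu> \<in> G"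
    using weak_star_nhd[OF G(1,2)] by metis
  define U where "U = {\<nu> \<in> prob_measures Xfull. \<forall>w\<in>F. \<bar>measure \<nu> (cyl w) - measure x (cyl w)\<bar> < d / 2}"
  have d2: "0 < d / 2" using F(2) by simp
  obtain N0 where N0: "1 \<le> N0" "\<And>n A. N0 \<le> n \<Longrightarrow> finite A \<Longrightarrow> A \<noteq> {} \<Longrightarrow> A \<subseteq> periodic_points n \<Longrightarrow>
      (\<And>y v. y \<in> A \<Longrightarrow> v \<in> F \<Longrightarrow> \<bar>measure (empirical_measure n y) (cyl v) - measure x (cyl v)\<bar> < d / 2) \<Longrightarrow>
      \<exists>\<nu>\<in>invariant_measures. integrable \<nu> \<phi> \<and> (\<forall>v\<in>F. \<bar>measure \<nu> (cyl v) - measure x (cyl v)\<bar> < 2 * (d / 2)) \<and>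
        ereal (ln (\<Sum>x\<in>A. exp (S n x)) / real n - e) \<le> ks_entropy \<nu> left_shift + ereal (\<integral>x. \<phi> x \<partial>\<nu>)"
  proof (rule upper_bound[OF F(1) d2 e, of "\<lambda>v. measure x (cyl v)"], goal_cases)
    case (1 N0)
    show ?case by (rule 1(1)[OF 1(2)]) (rule 1(3))
  qed
  show ?thesis
  proof (rule that[of U])
    show "openin T U" unfolding U_def by (rule openin_weak_star_nhd[OF F(1) d2])
    show "x \<in> U" using x d2 by (simp add: U_def topspace_weak_star)
    show "\<forall>\<^sub>F n in sequentially. Zs n U \<le> ennreal (exp (real n * (k + P_real + e)))"
      using eventually_ge_at_top[of N0]
    proof eventually_elim
      case (elim n)
      then have n: "1 \<le> n" using N0(1) by simp
      show ?case
      proof (rule Zs_le[OF n])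
        fix A assume A: "finite A" "A \<subseteq> periodic_points n" "\<And>y. y \<in> A \<Longrightarrow> empirical_measure n y \<in> U"
        show "(\<Sum>x\<in>A. exp (S n x)) \<le> exp (real n * (k + P_real + e))"
        proof (cases "A = {}")
          case False
          obtain \<nu> where nu: "\<nu> \<in> invariant_measures" "integrable \<nu> \<phi>"
            "\<forall>v\<in>F. \<bar>measure \<nu> (cyl v) - measure x (cyl v)\<bar> < 2 * (d / 2)"
            "ereal (ln (\<Sum>x\<in>A. exp (S n x)) / real n - e) \<le> ks_entropy \<nu> left_shift + ereal (\<integral>x. \<phi> x \<partial>\<nu>)"
          proof (rule bexE[OF N0(2)[OF elim A(1) False A(2)]], goal_cases)
            case (1 y v)
            then show ?case using A(3)[OF 1(2)] by (simp add: U_def)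
          next
            case (2 \<nu>)
            from 2(2,3) show ?case by (elim conjE) (rule 2(1))
          qed
          have "\<nu> \<in> G" using nu(3) invariant_measuresD(1)[OF nu(1)] by (intro F(3)) auto
          then have "free_energy \<phi> \<nu> \<le> (SUP \<nu>\<in>G. free_energy \<phi> \<nu>)" by (rule SUP_upper)
          also have "\<dots> < ereal k" using G(3) by simp
          finally have "ks_entropy \<nu> left_shift + ereal (\<integral>x. \<phi> x \<partial>\<nu>) - ereal P_real < ereal k"
            using nu(1) by (simp add: free_energy_def ext_integral_integrable[OF nu(2)] P_real(1))
          then have "ks_entropy \<nu> left_shift + ereal (\<integral>x. \<phi> x \<partial>\<nu>) < ereal (k + P_real)"
            by (cases "ks_entropy \<nu> left_shift") auto
          then have "ereal (ln (\<Sum>x\<in>A. exp (S n x)) / real n - e) < ereal (k + P_real)" using nu(4) by (rule le_less_trans[rotated])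
          then have "ln (\<Sum>x\<in>A. exp (S n x)) < real n * (k + P_real + e)"
            using n by (simp add: field_simps)
          then have "exp (ln (\<Sum>x\<in>A. exp (S n x))) \<le> exp (real n * (k + P_real + e))" by simp
          moreover have "0 < (\<Sum>x\<in>A. exp (S n x))" using A(1) False by (intro sum_pos) auto
          ultimately show ?thesis by simp
        qed simp
      qed
    qed
  qed
qed

text \<open>Exponential tightness cuts the closed set down to a compact one, which finitely many of
  the neighbourhoods of \<open>local_upper_bound\<close> cover.\<close>

lemma ldp_upper:
  assumes C: "closedin T C"
  shows "limsup (\<lambda>n. elog (emeasure (\<mu> n) C) / ereal (real n)) \<le> - (INF x\<in>C. rate_function \<phi> x)" (is "?L \<le> _")
proof (rule dense_ge)
  fix y assume y: "- (INF x\<in>C. rate_function \<phi> x) < y"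
  show "?L \<le> y"
  proof (cases y)
    case (real k)
    show ?thesis
      unfolding real
    proof (rule ereal_le_epsilon2)
      fix e :: real assume e: "0 < e"
      have e2: "0 < e / 2" using e by simp
      have rate: "ereal (- k) < rate_function \<phi> x" if "x \<in> C" for x
      proof -
        have "- ereal k < (INF x\<in>C. rate_function \<phi> x)" using y real by (simp add: ereal_uminus_less_reorder)
        also have "\<dots> \<le> rate_function \<phi> x" using that by (rule INF_lower)
        finally show ?thesis by simp
      qed
      \<comment> \<open>The level is chosen so that the part outside \<open>K\<close> grows no
        faster than the neighbourhoods do.\<close>
      obtain K where K: "compactin T K" "closedin T K"
        "\<And>n. 1 \<le> n \<Longrightarrow> Zs n (topspace T - K) \<le> ennreal (exp (- (- (k + P_real)) * real n))"
        using exponential_tightness[of "- (k + P_real)"] by metis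
      have "\<forall>x\<in>C. \<exists>U. openin T U \<and> x \<in> U \<and> (\<forall>\<^sub>F n in sequentially. Zs n U \<le> ennreal (exp (real n * (k + P_real + e / 2))))"
      proof
        fix x assume x: "x \<in> C"
        then have "x \<in> topspace T" using closedin_subset[OF C] by blast
        from local_upper_bound[OF this rate[OF x] e2]
        show "\<exists>U. openin T U \<and> x \<in> U \<and> (\<forall>\<^sub>F n in sequentially. Zs n U \<le> ennreal (exp (real n * (k + P_real + e / 2))))"
          by metis
      qed
      from bchoice[OF this] obtain U where "\<forall>x\<in>C. openin T (U x) \<and> x \<in> U x \<and>
          (\<forall>\<^sub>F n in sequentially. Zs n (U x) \<le> ennreal (exp (real n * (k + P_real + e / 2))))" ..
      then have U: "\<And>x. x \<in> C \<Longrightarrow> openin T (U x)" "\<And>x. x \<in> C \<Longrightarrow> x \<in> U x"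
        "\<And>x. x \<in> C \<Longrightarrow> \<forall>\<^sub>F n in sequentially. Zs n (U x) \<le> ennreal (exp (real n * (k + P_real + e / 2)))"
        by auto
      have "compactin T (C \<inter> K)" by (rule closed_Int_compactin[OF C K(1)])
      moreover have "C \<inter> K \<subseteq> \<Union>(U ` (C \<inter> K))" using U(2) by blast
      moreover have "openin T V" if "V \<in> U ` (C \<inter> K)" for V using that U(1) by auto
      ultimately have "\<exists>\<F>. finite \<F> \<and> \<F> \<subseteq> U ` (C \<inter> K) \<and> C \<inter> K \<subseteq> \<Union>\<F>"
        by (intro compactinD)
      then obtain \<F> where F: "finite \<F>" "\<F> \<subseteq> U ` (C \<inter> K)" "C \<inter> K \<subseteq> \<Union>\<F>" by (elim exE conjE)
      obtain X where X: "X \<subseteq> C \<inter> K" "finite X" "\<F> = U ` X"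
        using finite_subset_image[OF F(1,2)] by blast
      define c where "c = k + P_real + e / 2"
      have ev: "\<forall>\<^sub>F n in sequentially. \<forall>x\<in>X. Zs n (U x) \<le> ennreal (exp (real n * c))"
        unfolding eventually_ball_finite_distrib[OF X(2)] c_def using U(3) X(1) by blast
      \<comment> \<open>One term for each point of \<open>X\<close> and one for the complement of
        \<open>K\<close>; their number is absorbed by half of e.\<close>
      obtain N :: nat where N: "\<And>n. N \<le> n \<Longrightarrow> ln (real (card X + 1)) \<le> e / 2 * real n"
        using exists_nat_ge[OF e2] by metis
      have "?L \<le> ereal ((c + e / 2) - P_real)"
      proof (rule growth_upper[OF closedin_borel_on[OF C]])
        show "\<forall>\<^sub>F n in sequentially. Zs n C \<le> ennreal (exp (real n * (c + e / 2)))"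
          using ev eventually_ge_at_top[of "max 1 N"]
        proof eventually_elim
          case (elim n)
          then have n: "1 \<le> n" "N \<le> n" by auto
          have "Zs n C \<le> Zs n ((\<Union>x\<in>X. U x) \<union> (topspace T - K))"
            using F(3) X(3) by (intro Zs_mono[OF n(1)]) auto
          also have "\<dots> \<le> Zs n (\<Union>x\<in>X. U x) + Zs n (topspace T - K)" by (rule Zs_Un_le)
          also have "\<dots> \<le> (\<Sum>x\<in>X. Zs n (U x)) + ennreal (exp (real n * c))"
          proof (intro add_mono Zs_UN_le X(2))
            have "Zs n (topspace T - K) \<le> ennreal (exp (- (- (k + P_real)) * real n))" by (rule K(3)[OF n(1)])
            also have "\<dots> \<le> ennreal (exp (real n * c))"
              using e n by (intro ennreal_leI) (simp add: c_def algebra_simps)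
            finally show "Zs n (topspace T - K) \<le> ennreal (exp (real n * c))" .
          qed
          also have "\<dots> \<le> (\<Sum>x\<in>X. ennreal (exp (real n * c))) + ennreal (exp (real n * c))"
            using elim(1) by (intro add_right_mono sum_mono) auto
          also have "\<dots> = ennreal (real (card X + 1) * exp (real n * c))"
            by (simp add: ennreal_of_nat_eq_real_of_nat distrib_right ennreal_mult[symmetric] flip: ennreal_plus)
          also have "\<dots> \<le> ennreal (exp (real n * (c + e / 2)))"
          proof (rule ennreal_leI)
            have "real (card X + 1) = exp (ln (real (card X + 1)))" by simp
            also have "\<dots> \<le> exp (e / 2 * real n)" using N[OF n(2)] by (simp only: exp_le_cancel_iff)
            finally have "real (card X + 1) * exp (real n * c) \<le> exp (e / 2 * real n) * exp (real n * c)"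
              by (intro mult_right_mono) auto
            also have "\<dots> = exp (real n * (c + e / 2))" by (simp add: algebra_simps flip: exp_add)
            finally show "real (card X + 1) * exp (real n * c) \<le> exp (real n * (c + e / 2))" .
          qed
          finally show ?case .
        qed
      qed
      then show "?L \<le> ereal k + ereal e" by (simp add: c_def add.commute)
    qed
  qed (use y in auto)
qed

text \<open>For the open complement of a set \<open>K\<close> from exponential tightness, the lower
  bound forces the rate to be at least \<open>\<alpha> + 1\<close>; the closed sublevel set
  therefore lies in the compact set \<open>K\<close>.\<close>

lemma rate_function_good: "good_rate T (rate_function \<phi>)"
  unfolding good_rate_def
proof (intro allI impI)
  fix \<alpha> :: real assume "0 < \<alpha>"
  obtain K where K: "compactin T K" "closedin T K"
    "limsup (\<lambda>n. elog (emeasure (\<mu> n) (topspace T - K)) / ereal (real n)) \<le> ereal (- (\<alpha> + 1))"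
    by (rule exponential_tightness_limsup)
  have op: "openin T (topspace T - K)" using K(2) by (simp add: closedin_def)
  have "- (INF x\<in>topspace T - K. rate_function \<phi> x) \<le> ereal (- (\<alpha> + 1))"
    using ldp_lower[OF op] K(3) Liminf_le_Limsup[OF sequentially_bot, of "\<lambda>n. elog (emeasure (\<mu> n) (topspace T - K)) / ereal (real n)"]
    by (meson order_trans)
  then have inf: "ereal (\<alpha> + 1) \<le> (INF x\<in>topspace T - K. rate_function \<phi> x)"
    by (simp add: ereal_uminus_le_reorder add.commute)
  have "{x \<in> topspace T. rate_function \<phi> x \<le> ereal \<alpha>} \<subseteq> K"
  proof (rule subsetI, rule ccontr)
    fix x assume x: "x \<in> {x \<in> topspace T. rate_function \<phi> x \<le> ereal \<alpha>}" "x \<notin> K"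
    then have "(INF x\<in>topspace T - K. rate_function \<phi> x) \<le> rate_function \<phi> x" by (intro INF_lower) auto
    then have "ereal (\<alpha> + 1) \<le> rate_function \<phi> x" using inf by (rule order_trans[rotated])
    also have "\<dots> \<le> ereal \<alpha>" using x by simp
    finally show False by simp
  qed
  then show "compactin T {x \<in> topspace T. rate_function \<phi> x \<le> ereal \<alpha>}"
    by (rule closed_compactin[OF K(1) _ rate_function_lsc])
qed

lemma large_deviations:
  "(\<forall>n\<ge>1. borel_prob_on T (\<mu> n)) \<and> exponentially_tight T \<mu> \<and> ldp T \<mu> (rate_function \<phi>) \<and> good_rate T (rate_function \<phi>)"
proof (intro conjI allI impI)
  show "borel_prob_on T (\<mu> n)" if "1 \<le> n" for n using that by (rule periodic_borel_prob)
  show "exponentially_tight T \<mu>"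
    unfolding exponentially_tight_def
  proof (intro allI impI)
    fix L :: real
    obtain K where "compactin T K" "closedin T K"
      "limsup (\<lambda>n. elog (emeasure (\<mu> n) (topspace T - K)) / ereal (real n)) \<le> ereal (- L)"
      by (rule exponential_tightness_limsup)
    then show "\<exists>K. compactin T K \<and> K \<in> sets (borel_on T) \<and>
      limsup (\<lambda>n. elog (emeasure (\<mu> n) (topspace T - K)) / ereal (real n)) \<le> ereal (- L)"
      using closedin_borel_on by blast
  qed
  show "ldp T \<mu> (rate_function \<phi>)"
    unfolding ldp_def using rate_function_nonneg rate_function_lsc ldp_lower ldp_upper by blast
qed (rule rate_function_good)

end

theorem theoremA:
  fixes \<phi> :: "(nat \<Rightarrow> nat) \<Rightarrow> real"
  assumes "acceptable {1..} \<phi>"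
    and "pressure {1..} \<phi> < \<infinity>"
    and "\<exists>pstar\<ge>2.
      (\<forall>\<gamma>. locally_hoelder (induced_alphabet pstar) (induced_potential \<phi> pstar \<gamma> \<circ> coding pstar)) \<and>
      (\<exists>\<gamma>\<^sub>0. pressure (induced_alphabet pstar) (induced_potential \<phi> pstar \<gamma>\<^sub>0 \<circ> coding pstar) = 0)"
  shows "(\<forall>n\<ge>1. borel_prob_on (weak_star Xfull) (periodic_distribution \<phi> n)) \<and>
    exponentially_tight (weak_star Xfull) (periodic_distribution \<phi>) \<and>
    ldp (weak_star Xfull) (periodic_distribution \<phi>) (rate_function \<phi>) \<and>
    good_rate (weak_star Xfull) (rate_function \<phi>)"
proof -
  interpret acceptable_potential \<phi> by unfold_locales (rule assms)+
  show ?thesis by (rule large_deviations)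
qed

end
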